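(* Let $X=(X_t)_{t\geq0}$ be a scalar symmetric $\alpha$-stable Lévy process, $0<\alpha\leq2$, with $X_0=0$ and $\mathbb{E}[e^{iuX_t}]=e^{-|u|^{\alpha}t}$. Let $T>0$, $\Delta_n=T/n$, $t_k=k\Delta_n$, and let $\mathcal{G}_n=\sigma(X_{t_1},\dots,X_{t_n})$. For $y\in\mathbb{R}$ and $t>0$ put $\mathcal{O}_t(y)=\int_0^t\mathbf{1}(X_s\geq y)\,ds$. (i) If $1<\alpha\leq 2$ and $y\in\mathbb{R}$, then \[ \lim_{n\to\infty}\Delta_n^{-1-1/\alpha}\bigl\|\mathbb{E}[\mathcal{O}_T(y)\mid\mathcal{G}_n]-\mathcal{O}_T(y)\bigr\|^2_{L^2(\mathbb{P})}=2\,\mathbb{E}[L_T(y)]\int_0^\infty\mathbb{E}\bigl[\operatorname{Var}(\mathcal{O}_1(x)\mid X_1)\bigr]dx, \] where $L_T(y)$ is the local time of $X$ at $y$ up to time $T$. (ii) If $0<\alpha<1$, then \[ \lim_{n\to\infty}\Delta_n^{-2}(\log n)^{-1}\bigl\|\mathbb{E}[\mathcal{O}_T(0)\mid\mathcal{G}_n]-\mathcal{O}_T(0)\bigr\|^2_{L^2(\mathbb{P})}=\frac{\Gamma(\alpha)\sin(\frac{\pi\alpha}{2})}{12\pi}\mathbb{E}[|X_1|^{-\alpha}]. \] (iii) If $\alpha=1$, then \[ \lim_{n\to\infty}\Delta_n^{-2}(\log n)^{-2}\bigl\|\mathbb{E}[\mathcal{O}_T(0)\mid\mathcal{G}_n]-\mathcal{O}_T(0)\bigr\|^2_{L^2(\mathbb{P})}=\frac{1}{12\pi^2}.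 \]
   Context: For $1<\alpha\leq2$ the local time $L_T(y)$ exists and is the Lebesgue density of the occupation measure $A\mapsto\int_0^T\mathbf{1}_A(X_t)dt$. *)

theory Defs
  imports "HOL-Probability.Probability"
begin

definition gen_sigma :: "'a measure \<Rightarrow> ('a \<Rightarrow> real) set \<Rightarrow> 'a measure" where
  "gen_sigma M fs = sigma (space M) {f -` B \<inter> space M | f B. f \<in> fs \<and> B \<in> sets borel}"

definition sym_stable_levy :: "'a measure \<Rightarrow> real \<Rightarrow> (real \<Rightarrow> 'a \<Rightarrow> real) \<Rightarrow> bool" where
  "sym_stable_levy M \<alpha> X \<longleftrightarrow>
     (\<forall>t\<ge>0. X t \<in> borel_measurable M) \<and>
     (\<forall>\<omega>\<in>space M. X 0 \<omega> = 0) \<and>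
     (\<forall>\<omega>\<in>space M. (\<forall>t\<ge>0. continuous (at_right t) (\<lambda>s. X s \<omega>)) \<and>
                   (\<forall>t>0. \<exists>l. ((\<lambda>s. X s \<omega>) \<longlongrightarrow> l) (at_left t))) \<and>
     (\<forall>(ts :: nat \<Rightarrow> real) n. 0 \<le> ts 0 \<longrightarrow> (\<forall>i<n. ts i < ts (Suc i)) \<longrightarrow>
         prob_space.indep_vars M (\<lambda>_. borel) (\<lambda>i \<omega>. X (ts (Suc i)) \<omega> - X (ts i) \<omega>) {..<n}) \<and>
     (\<forall>s t. 0 \<le> s \<longrightarrow> s \<le> t \<longrightarrow>
         char (distr M borel (\<lambda>\<omega>. X t \<omega> - X s \<omega>)) =
           (\<lambda>u. complex_of_real (exp (- (\<bar>u\<bar> powr \<alpha>) * (t - s)))))"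

definition occ :: "(real \<Rightarrow> 'a \<Rightarrow> real) \<Rightarrow> real \<Rightarrow> real \<Rightarrow> 'a \<Rightarrow> real" where
  "occ X t y \<omega> = set_lebesgue_integral lborel {0..t} (\<lambda>s. indicator {s. y \<le> X s \<omega>} s :: real)"

definition obs_sigma :: "'a measure \<Rightarrow> (real \<Rightarrow> 'a \<Rightarrow> real) \<Rightarrow> real \<Rightarrow> nat \<Rightarrow> 'a measure" where
  "obs_sigma M X T n = gen_sigma M {X (real k * (T / real n)) | k. k \<in> {1..n}}"

definition approx_err :: "'a measure \<Rightarrow> (real \<Rightarrow> 'a \<Rightarrow> real) \<Rightarrow> real \<Rightarrow> real \<Rightarrow> nat \<Rightarrow> real" where
  "approx_err M X T y n =
     integral\<^sup>L M (\<lambda>\<omega>. (real_cond_exp M (obs_sigma M X T n) (occ X T y) \<omega> - occ X T y \<omega>)\<^sup>2)"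

definition cond_var :: "'a measure \<Rightarrow> 'a measure \<Rightarrow> ('a \<Rightarrow> real) \<Rightarrow> 'a \<Rightarrow> real" where
  "cond_var M F Y = real_cond_exp M F (\<lambda>\<omega>. (Y \<omega> - real_cond_exp M F Y \<omega>)\<^sup>2)"

definition is_local_time :: "'a measure \<Rightarrow> (real \<Rightarrow> 'a \<Rightarrow> real) \<Rightarrow> real \<Rightarrow> (real \<Rightarrow> 'a \<Rightarrow> real) \<Rightarrow> bool" where
  "is_local_time M X T L \<longleftrightarrow>
     (\<forall>y. L y \<in> borel_measurable M) \<and>
     (AE \<omega> in M. continuous_on UNIV (\<lambda>y. L y \<omega>) \<and> (\<forall>y. 0 \<le> L y \<omega>) \<and>
        (\<forall>A\<in>sets borel. (\<integral>\<^sup>+ y. ennreal (L y \<omega>) * indicator A y \<partial>lborel) =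
                         emeasure lborel {s\<in>{0..T}. X s \<omega> \<in> A}))"

end

(*
Given the observations, the path on different blocks consists of independent bridges, so the squared
error is the sum over k < n of E[V(D, y - X_{kD})], where D = T/n and V(D, x) = E[Var(O_D(x) | X_D)].
By self-similarity V(D, x) = D^2 V(1, D^(-1/alpha) x).

If alpha > 1, then V(1, .) is integrable, and the sum is a Riemann sum for the integral of V(1, .) times
int_0^T p_s(y) ds. The latter is E[L_T(y)]: the averages of the local time over shrinking windows are
bounded in L^2 and converge almost surely, hence their expectations converge.

If alpha <= 1, the tail P(X_1 >= x) ~ c x^(-alpha) yields V(1, x) ~ c |x|^(-alpha) / 12: a high level is
passed by a single jump at a uniform time U, and Var U = 1/12. As X_k has the law of k^(1/alpha) X_1, the
k-th term behaves like 1/k for alpha < 1, where |X_1|^(-alpha) is integrable, and like (ln k)/k for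
alpha = 1; the Stolz-Cesaro theorem sums these. The constant c comes from the weak convergence of the law
of X_1/x, tilted by 1 - exp(-z^2/2), which is proved through characteristic functions that only involve
exp(-|u|^alpha) and Gaussian averages of it.
*)
theory Submission
  imports Defs
begin

subsection \<open>Densities by Fourier inversion\<close>

text \<open>The process is given through characteristic functions only, so densities are built
  first. They make bridge probabilities explicit quotients, and conditional expectations are
  verified by test functions instead of a disintegration of path space. For \<alpha> > 1 the density
  bound has the singularity t^(-1/\<alpha>) at time 0. It is integrable, and it dominates the
  Riemann sums as well as the second moments behind the local time. For \<alpha> <= 1 the obstacle
  is E[G^2], where G is the conditional expectation given X_1 of the occupation time O: the bridge
  has no formula to insert. It is squeezed between a completed square and a bound from time
  reversal, both asymptotic to c/4 x^(-\<alpha>). As E[O^2] behaves like c/3 x^(-\<alpha>), the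
  difference gives 1/12. The laws of X_1/x collapse to 0; multiplied by x^\<alpha> they approach the
  Levy measure, which is infinite near 0. The tilt 1 - exp(-z^2/2) vanishes to second order at 0, so
  the limit becomes finite, and it is Gaussian because its effect on characteristic functions is
  then a Gaussian average.\<close>

lemma (in pair_sigma_finite) integrable_times:
  fixes f :: "_ \<Rightarrow> real" and g :: "_ \<Rightarrow> real"
  assumes f: "integrable M1 f" and g: "integrable M2 g"
  shows "integrable (M1 \<Otimes>\<^sub>M M2) (\<lambda>(x, y). f x * g y)"
proof (rule integrableI_bounded)
  have [measurable]: "f \<in> borel_measurable M1" "g \<in> borel_measurable M2" using f g by auto
  show "(\<lambda>(x, y). f x * g y) \<in> borel_measurable (M1 \<Otimes>\<^sub>M M2)" by measurable
  have "(\<integral>\<^sup>+z. ennreal (norm (case z of (x, y) \<Rightarrow> f x * g y)) \<partial>(M1 \<Otimes>\<^sub>M M2))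
      = (\<integral>\<^sup>+x. (\<integral>\<^sup>+y. ennreal \<bar>f x\<bar> * ennreal \<bar>g y\<bar> \<partial>M2) \<partial>M1)"
    by (subst M2.nn_integral_fst[symmetric]) (auto simp: abs_mult ennreal_mult)
  also have "\<dots> = (\<integral>\<^sup>+x. ennreal \<bar>f x\<bar> \<partial>M1) * (\<integral>\<^sup>+y. ennreal \<bar>g y\<bar> \<partial>M2)"
    by (simp add: nn_integral_cmult nn_integral_multc)
  also have "\<dots> < \<infinity>"
    using f g by (auto simp: integrable_iff_bounded ennreal_mult_less_top)
  finally show "(\<integral>\<^sup>+z. ennreal (norm (case z of (x, y) \<Rightarrow> f x * g y)) \<partial>(M1 \<Otimes>\<^sub>M M2)) < \<infinity>" .
qed

lemma integral_cos_interval: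
  fixes a b t :: real
  assumes "a \<le> b" "t \<noteq> 0"
  shows "set_integrable lborel {a..b} (\<lambda>x. cos (t * x))"
    and "(LINT x:{a..b}|lborel. cos (t * x)) = (sin (t * b) - sin (t * a)) / t"
proof -
  show "set_integrable lborel {a..b} (\<lambda>x. cos (t * x))"
    by (intro borel_integrable_atLeastAtMost' continuous_intros)
  have "has_bochner_integral lborel (\<lambda>x. cos (t * x) * indicator {a..b} x) (sin (t * b) / t - sin (t * a) / t)"
    using assms by (intro has_bochner_integral_FTC_Icc_real) (auto intro!: derivative_eq_intros)
  then show "(LINT x:{a..b}|lborel. cos (t * x)) = (sin (t * b) - sin (t * a)) / t"
    unfolding set_lebesgue_integral_def
    by (auto simp: has_bochner_integral_iff mult.commute diff_divide_distrib)
qed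

text \<open>Fourier inversion in cosine form: a real characteristic function is even, so the sine
  part integrates to 0.\<close>

definition inv_dens :: "(real \<Rightarrow> real) \<Rightarrow> real \<Rightarrow> real" where
  "inv_dens f x = (LINT u|lborel. cos (u * x) * f u) / (2 * pi)"

lemma inv_dens_integrable:
  fixes f :: "real \<Rightarrow> real"
  assumes "integrable lborel f"
  shows "integrable lborel (\<lambda>u. cos (u * x) * f u)"
  by (rule Bochner_Integration.integrable_bound[OF assms])
     (use assms in \<open>auto simp: abs_mult intro!: mult_left_le_one_le\<close>)

lemma inv_dens_le:
  fixes f :: "real \<Rightarrow> real"
  assumes "integrable lborel f"
  shows "\<bar>inv_dens f x\<bar> \<le> (LINT u|lborel. \<bar>f u\<bar>) / (2 * pi)"
proof -
  have "\<bar>LINT u|lborel. cos (u * x) * f u\<bar> \<le> (LINT u|lborel. \<bar>f u\<bar>)"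
    by (rule integral_abs_bound_integral)
       (use inv_dens_integrable[OF assms] assms in \<open>auto intro!: mult_left_le_one_le simp: abs_mult\<close>)
  then show ?thesis by (simp add: inv_dens_def divide_right_mono)
qed

lemma continuous_inv_dens:
  fixes f :: "real \<Rightarrow> real"
  assumes "integrable lborel f"
  shows "continuous_on UNIV (inv_dens f)"
proof -
  have "isCont (\<lambda>x. LINT u|lborel. cos (u * x) * f u) x" for x
    unfolding continuous_at_sequentially comp_def
  proof (intro allI impI)
    fix X assume X: "X \<longlonglongrightarrow> x"
    show "(\<lambda>n. LINT u|lborel. cos (u * X n) * f u) \<longlonglongrightarrow> (LINT u|lborel. cos (u * x) * f u)"
    proof (rule integral_dominated_convergence[where w="\<lambda>u. \<bar>f u\<bar>"])
      show "AE u in lborel. (\<lambda>n. cos (u * X n) * f u) \<longlonglongrightarrow> cos (u * x) * f u"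
        by (auto intro!: tendsto_intros X)
    qed (use assms in \<open>auto simp: abs_mult intro!: mult_left_le_one_le\<close>)
  qed
  then have "isCont (inv_dens f) x" for x
    unfolding inv_dens_def[abs_def] by (intro continuous_intros) auto
  then show ?thesis by (simp add: continuous_on_eq_continuous_at)
qed

text \<open>Levy inversion gives the mass as a limit of truncated integrals. Its kernel is bounded
  by b - a, so integrability of \<open>f\<close> allows the truncation to be removed. The real part
  of the kernel is the integral of cos(t x) over [a, b], and Fubini then produces
  \<open>inv_dens\<close>.\<close>

lemma (in real_distribution) inversion_interval:
  fixes f :: "real \<Rightarrow> real"
  assumes f: "integrable lborel f" and ch: "char M = (\<lambda>u. complex_of_real (f u))"
    and ab: "a \<le> b" "measure M {a} = 0" "measure M {b} = 0"
  shows "measure M {a<..b} = (LINT x:{a..b}|lborel. inv_dens f x)"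
proof -
  define F :: "real \<Rightarrow> complex" where "F t = (iexp (-(t * a)) - iexp (-(t * b))) / (\<i> * t) * f t" for t
  have [measurable]: "F \<in> borel_measurable borel" "f \<in> borel_measurable borel"
    using f by (auto simp: F_def[abs_def])
  have Fb: "cmod (F t) \<le> (b - a) * \<bar>f t\<bar>" if "t \<noteq> 0" for t
  proof -
    have "cmod ((iexp (t * (-a)) - iexp (t * (-b))) / (\<i> * t)) \<le> -a - (-b)"
      using that ab by (intro Levy_Inversion_aux2) auto
    from mult_right_mono[OF this abs_ge_zero[of "f t"]] show ?thesis
      by (simp add: F_def norm_mult norm_divide)
  qed
  have AE0: "AE t in lborel. t \<noteq> (0::real)" by (intro AE_lborel_singleton)
  have Fint: "integrable lborel F"
  proof (rule Bochner_Integration.integrable_bound)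
    show "AE t in lborel. norm (F t) \<le> norm ((b - a) * \<bar>f t\<bar>)"
      using AE0 by eventually_elim (use Fb ab in \<open>auto simp: abs_mult\<close>)
  qed (use f in auto)
  have lim1: "(\<lambda>n::nat. LINT t|lborel. indicator {- real n<..<real n} t *\<^sub>R F t) \<longlonglongrightarrow> (LINT t|lborel. F t)"
  proof (rule integral_dominated_convergence[where w="\<lambda>t. cmod (F t)"])
    show "AE t in lborel. (\<lambda>n. indicator {- real n<..<real n} t *\<^sub>R F t) \<longlonglongrightarrow> F t"
    proof (intro AE_I2 tendsto_eventually)
      fix t :: real
      have "eventually (\<lambda>n. real n > \<bar>t\<bar>) sequentially"
        using filterlim_at_top_dense filterlim_real_sequentially by blast
      then show "eventually (\<lambda>n. indicator {- real n<..<real n} t *\<^sub>R F t = F t) sequentially"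
        by eventually_elim (auto simp: indicator_def abs_if split: if_splits)
    qed
  qed (use Fint in \<open>auto simp: indicator_def\<close>)
  have "(\<lambda>T. 1 / (2 * pi) * (CLBINT t=-T..T. (iexp (-(t * a)) - iexp (-(t * b))) / (\<i> * t) * char M t))
    \<longlonglongrightarrow> complex_of_real (measure M {a<..b})"
    by (rule Levy_Inversion[OF ab])
  also have "(\<lambda>T::nat. 1 / (2 * pi) * (CLBINT t=-T..T. (iexp (-(t * a)) - iexp (-(t * b))) / (\<i> * t) * char M t))
     = (\<lambda>n. 1 / (2 * pi) * (LINT t|lborel. indicator {- real n<..<real n} t *\<^sub>R F t))"
    unfolding ch
    by (auto simp: F_def fun_eq_iff interval_lebesgue_integral_def set_lebesgue_integral_def)
  finally have "complex_of_real (measure M {a<..b}) = 1 / (2 * pi) * (LINT t|lborel. F t)"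
    using lim1 by (intro LIMSEQ_unique[OF _ tendsto_mult[OF tendsto_const lim1]])
  then have 1: "measure M {a<..b} = (LINT t|lborel. Re (F t)) / (2 * pi)"
    by (subst integral_Re[OF Fint]) (simp add: complex_eq_iff)
  have ReF: "Re (F t) = (sin (t * b) - sin (t * a)) / t * f t" if "t \<noteq> 0" for t
    using that by (simp add: F_def Re_divide Im_divide Re_exp Im_exp power2_eq_square field_simps)
  have "(LINT t|lborel. Re (F t)) = (LINT t|lborel. (LINT x|lborel. indicator {a..b} x * (cos (t * x) * f t)))"
  proof (rule integral_cong_AE)
    show "AE t in lborel. Re (F t) = (LINT x|lborel. indicator {a..b} x * (cos (t * x) * f t))"
      using AE0
    proof eventually_elim
      case (elim t)
      show ?case
        using integral_cos_interval(2)[OF ab(1) elim] unfolding ReF[OF elim] set_lebesgue_integral_def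
        by (simp add: mult.assoc[symmetric])
    qed
  qed measurable
  also have "\<dots> = (LINT x|lborel. (LINT t|lborel. indicator {a..b} x * (cos (t * x) * f t)))"
  proof (rule lborel_pair.Fubini_integral)
    have "integrable lborel (indicator {a..b} :: real \<Rightarrow> real)"
      by (intro integrable_real_indicator) (auto simp: emeasure_lborel_Icc_eq)
    then have "integrable (lborel \<Otimes>\<^sub>M lborel) (\<lambda>(x, t). indicator {a..b} x * f t)"
      using lborel_pair.integrable_times[OF _ f, of "indicator {a..b}"] by blast
    then show "integrable (lborel \<Otimes>\<^sub>M lborel) (\<lambda>(x, t). indicator {a..b} x * (cos (t * x) * f t))"
      by (rule Bochner_Integration.integrable_bound)
        (auto simp: abs_mult split_beta indicator_def intro!: mult_left_le_one_le)
  qed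
  also have "\<dots> = 2 * pi * (LINT x:{a..b}|lborel. inv_dens f x)"
    by (simp add: set_lebesgue_integral_def inv_dens_def)
  finally show ?thesis using 1 by simp
qed


text \<open>The interval formula needs endpoints that carry no mass. Atoms are countable, so such
  endpoints exist arbitrarily close to x on both sides, and the bounded density leaves too little
  mass in between for an atom at x.\<close>

lemma (in real_distribution) no_atoms_of_integrable_char:
  fixes f :: "real \<Rightarrow> real"
  assumes f: "integrable lborel f" and ch: "char M = (\<lambda>u. complex_of_real (f u))"
  shows "measure M {x} = 0"
proof (rule ccontr)
  assume nz: "measure M {x} \<noteq> 0"
  define K where "K = (LINT u|lborel. \<bar>f u\<bar>) / (2 * pi)"
  have K: "\<bar>inv_dens f y\<bar> \<le> K" for y unfolding K_def by (rule inv_dens_le[OF f])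
  have K0: "0 \<le> K" using K[of 0] by linarith
  have cnt: "countable {x. measure M {x} \<noteq> 0}" by (rule countable_support)
  \<comment> \<open>With this width the interval has mass at most 2 e K, which is less than half of
    the supposed atom.\<close>
  define e where "e = measure M {x} / (4 * (K + 1))"
  have e: "0 < e" using nz K0 by (simp add: e_def zero_less_measure_iff)
  obtain a where a: "a \<in> {x - e<..<x}" "measure M {a} = 0"
    using open_minus_countable[OF cnt, of "{x - e<..<x}"] e by auto
  obtain b where b: "b \<in> {x<..<x+e}" "measure M {b} = 0"
    using open_minus_countable[OF cnt, of "{x<..<x+e}"] e by auto
  have "measure M {x} \<le> measure M {a<..b}" using a b by (intro finite_measure_mono) auto
  also have "\<dots> = (LINT x:{a..b}|lborel. inv_dens f x)"
    using a b by (intro inversion_interval[OF f ch]) auto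
  also have "\<dots> \<le> (LINT x:{a..b}|lborel. K)"
    using K by (intro set_integral_mono borel_integrable_atLeastAtMost' continuous_intros
        continuous_on_subset[OF continuous_inv_dens[OF f]]) (auto simp: abs_le_iff)
  also have "\<dots> = (b - a) * K" using a b by (simp add: set_lebesgue_integral_def)
  also have "\<dots> \<le> (2 * e) * K" using a b K0 by (intro mult_right_mono) auto
  also have "\<dots> < measure M {x}" using nz K0
    by (simp add: e_def zero_less_measure_iff divide_simps add_pos_nonneg)
  finally show False by simp
qed

text \<open>By continuity a negative value would persist on a short interval, which would then have
  negative probability.\<close>

lemma (in real_distribution) inv_dens_nonneg:
  fixes f :: "real \<Rightarrow> real"
  assumes f: "integrable lborel f" and ch: "char M = (\<lambda>u. complex_of_real (f u))"
  shows "0 \<le> inv_dens f x"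
proof (rule ccontr)
  assume "\<not> 0 \<le> inv_dens f x"
  then have neg: "inv_dens f x < 0" by simp
  have "isCont (inv_dens f) x" using continuous_inv_dens[OF f] by (simp add: continuous_on_eq_continuous_at)
  from this neg have "eventually (\<lambda>y. inv_dens f y < inv_dens f x / 2) (at x)"
    unfolding isCont_def by (intro order_tendstoD) auto
  then obtain d where d: "0 < d" "\<And>y. y \<noteq> x \<Longrightarrow> dist y x < d \<Longrightarrow> inv_dens f y < inv_dens f x / 2"
    unfolding eventually_at by auto
  have le: "inv_dens f y \<le> inv_dens f x / 2" if "y \<in> {x..x + d/2}" for y
    using d(2)[of y] that d(1) neg by (cases "y = x") (auto simp: dist_real_def)
  have "0 \<le> measure M {x<..x+d/2}" by simp
  also have "\<dots> = (LINT x:{x..x+d/2}|lborel. inv_dens f x)"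
    using d by (intro inversion_interval[OF f ch] no_atoms_of_integrable_char[OF f ch]) auto
  also have "\<dots> \<le> (LINT y:{x..x+d/2}|lborel. inv_dens f x / 2)"
    using le by (intro set_integral_mono borel_integrable_atLeastAtMost' continuous_intros
        continuous_on_subset[OF continuous_inv_dens[OF f]]) auto
  also have "\<dots> = d / 2 * (inv_dens f x / 2)" using d by (simp add: set_lebesgue_integral_def)
  also have "\<dots> < 0" using d neg by (simp add: mult_pos_neg)
  finally show False by simp
qed

text \<open>Half-open intervals form an intersection-stable generator, and on them the two measures
  agree by the interval formula.\<close>

lemma (in real_distribution) density_inv_dens:
  fixes f :: "real \<Rightarrow> real"
  assumes f: "integrable lborel f" and ch: "char M = (\<lambda>u. complex_of_real (f u))"
  shows "M = density lborel (\<lambda>x. ennreal (inv_dens f x))"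
proof -
  have [measurable]: "inv_dens f \<in> borel_measurable borel"
    using continuous_inv_dens[OF f] by (rule borel_measurable_continuous_onI)
  have eq: "emeasure M {a<..b} = emeasure (density lborel (\<lambda>x. ennreal (inv_dens f x))) {a<..b}" for a b
  proof (cases "a \<le> b")
    case True
    have int: "set_integrable lborel {a..b} (inv_dens f)"
      by (intro borel_integrable_atLeastAtMost' continuous_on_subset[OF continuous_inv_dens[OF f]]) auto
    have "emeasure (density lborel (\<lambda>x. ennreal (inv_dens f x))) {a<..b}
        = (\<integral>\<^sup>+x. ennreal (inv_dens f x) * indicator {a<..b} x \<partial>lborel)"
      by (simp add: emeasure_density)
    also have "\<dots> = (\<integral>\<^sup>+x. ennreal (indicator {a..b} x *\<^sub>R inv_dens f x) \<partial>lborel)"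
      by (intro nn_integral_cong_AE eventually_mono[OF AE_lborel_singleton[of a]])
        (auto simp: indicator_def)
    also have "\<dots> = ennreal (LINT x:{a..b}|lborel. inv_dens f x)"
      using int unfolding set_lebesgue_integral_def set_integrable_def
      by (intro nn_integral_eq_integral) (auto simp: inv_dens_nonneg[OF f ch] indicator_def)
    also have "\<dots> = ennreal (measure M {a<..b})"
      by (subst inversion_interval[OF f ch True]) (auto simp: no_atoms_of_integrable_char[OF f ch])
    finally show ?thesis by (simp add: emeasure_eq_measure)
  qed auto
  show ?thesis
  proof (rule measure_eqI_generator_eq[where E="range (\<lambda>(a, b). {a <.. b::real})" and \<Omega>=UNIV
      and A="\<lambda>n::nat. {- real n<..real n}"])
    show "Int_stable (range (\<lambda>(a, b). {a <.. b::real}))"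
      by (auto simp: Int_stable_def intro!: image_eqI[where f="\<lambda>(a, b). {a <.. b::real}"])
    show "sets M = sigma_sets UNIV (range (\<lambda>(a, b). {a<..b}))"
      unfolding events_eq_borel by (subst borel_sigma_sets_Ioc) simp
    then show "sets (density lborel (\<lambda>x. ennreal (inv_dens f x))) = sigma_sets UNIV (range (\<lambda>(a, b). {a<..b}))"
      by simp
    show "(\<Union>n::nat. {- real n<..real n}) = UNIV"
      by (auto, metis reals_Archimedean2 abs_le_iff abs_less_iff less_eq_real_def minus_less_iff)
  qed (auto simp: eq[symmetric] less_top[symmetric])
qed

section \<open>Densities of the symmetric stable laws\<close>

lemma exp_neg_le_inverse_power:
  fixes z :: real
  assumes "0 < z"
  shows "exp (- z) \<le> fact m / z ^ m"
proof -
  have "(\<Sum>n\<in>{m}. z ^ n / fact n) \<le> (\<Sum>n. z ^ n / fact n)"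
    using assms summable_exp[of z] by (intro sum_le_suminf) (auto simp: field_simps)
  then have "z ^ m / fact m \<le> exp z"
    by (simp add: exp_def divide_inverse mult.commute)
  then have "1 / exp z \<le> 1 / (z ^ m / fact m)"
    using assms by (intro divide_left_mono) auto
  then show ?thesis using assms by (simp add: exp_minus inverse_eq_divide)
qed

lemma integrable_inverse_1_plus_square': "integrable lborel (\<lambda>x::real. inverse (1 + x\<^sup>2))"
  using integrable_inverse_1_plus_square by (simp add: set_integrable_def)

lemma integrable_exp_neg_powr:
  fixes \<alpha> t :: real
  assumes "0 < \<alpha>" "0 < t"
  shows "integrable lborel (\<lambda>u. exp (- (\<bar>u\<bar> powr \<alpha>) * t))"
proof -
  \<comment> \<open>For this m, the m-th term of the exponential series at |u|^\<alpha> t grows at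
    least like u^2, which yields a majorant C / (1 + u^2).\<close>
  obtain m :: nat where m: "2 / \<alpha> \<le> real m" using real_arch_simple by blast
  have m2: "2 \<le> \<alpha> * m" using m assms by (simp add: field_simps)
  define C where "C = 2 * (1 + fact m / t ^ m)"
  show ?thesis
  proof (rule Bochner_Integration.integrable_bound)
    show "integrable lborel (\<lambda>u::real. C * inverse (1 + u\<^sup>2))"
      by (intro integrable_mult_right integrable_inverse_1_plus_square')
    show "AE u in lborel. norm (exp (- (\<bar>u\<bar> powr \<alpha>) * t)) \<le> norm (C * inverse (1 + u\<^sup>2))"
    proof (intro AE_I2)
      fix u :: real
      have C0: "0 < C" using assms by (auto simp: C_def intro!: add_pos_pos)
      have pos: "0 < 1 + u\<^sup>2" by (simp add: add_pos_nonneg)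
      have "exp (- (\<bar>u\<bar> powr \<alpha>) * t) * (1 + u\<^sup>2) \<le> C"
      proof (cases "\<bar>u\<bar> \<le> 1")
        case True
        then have "u\<^sup>2 \<le> 1" by (simp add: abs_square_le_1)
        moreover have "exp (- (\<bar>u\<bar> powr \<alpha>) * t) \<le> 1" using assms by simp
        ultimately have "exp (- (\<bar>u\<bar> powr \<alpha>) * t) * (1 + u\<^sup>2) \<le> 1 * 2"
          by (intro mult_mono) auto
        also have "\<dots> \<le> C" using assms by (simp add: C_def)
        finally show ?thesis .
      next
        case False
        then have u1: "1 \<le> \<bar>u\<bar>" by simp
        have le2: "1 + u\<^sup>2 \<le> 2 * u\<^sup>2"
          using abs_le_square_iff[of 1 u] u1 by simp
        have "exp (- (\<bar>u\<bar> powr \<alpha> * t)) \<le> fact m / (\<bar>u\<bar> powr \<alpha> * t) ^ m"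
          using assms u1 by (intro exp_neg_le_inverse_power) auto
        also have "\<dots> = fact m / t ^ m / \<bar>u\<bar> powr (\<alpha> * m)"
          using u1 by (simp add: power_mult_distrib powr_power mult.commute)
        also have "\<dots> \<le> fact m / t ^ m / u\<^sup>2"
        proof (intro divide_left_mono)
          have "u\<^sup>2 = \<bar>u\<bar> powr 2" using u1 by (simp add: powr_numeral)
          also have "\<dots> \<le> \<bar>u\<bar> powr (\<alpha> * m)" using u1 m2 by (intro powr_mono) auto
          finally show "u\<^sup>2 \<le> \<bar>u\<bar> powr (\<alpha> * m)" .
        qed (use assms u1 in auto)
        finally have "exp (- (\<bar>u\<bar> powr \<alpha>) * t) * (1 + u\<^sup>2) \<le> (fact m / t ^ m / u\<^sup>2) * (2 * u\<^sup>2)"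
          using le2 assms by (intro mult_mono) auto
        also have "\<dots> = 2 * (fact m / t ^ m)" using u1 by auto
        also have "\<dots> \<le> C" by (simp add: C_def)
        finally show ?thesis .
      qed
      then show "norm (exp (- (\<bar>u\<bar> powr \<alpha>) * t)) \<le> norm (C * inverse (1 + u\<^sup>2))"
        using C0 pos by (simp add: divide_simps abs_mult)
    qed
  qed simp
qed

text \<open>Written through the density at time 1, so that self-similarity and joint continuity in
  time and space are built in. \<open>stable_dens_eq_inv_dens\<close> identifies it with the inverse
  transform at time t.\<close>

definition stable_dens :: "real \<Rightarrow> real \<Rightarrow> real \<Rightarrow> real" where
  "stable_dens \<alpha> t x = t powr (- 1 / \<alpha>) * inv_dens (\<lambda>u. exp (- (\<bar>u\<bar> powr \<alpha>))) (x * t powr (- 1 / \<alpha>))"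

text \<open>The density at time 1 in the point 0, where it is largest.\<close>

definition stable_dens_sup :: "real \<Rightarrow> real" where
  "stable_dens_sup \<alpha> = (LINT u|lborel. exp (- (\<bar>u\<bar> powr \<alpha>))) / (2 * pi)"

text \<open>The substitution u -> t^(-1/\<alpha>) u turns |u|^\<alpha> t into |u|^\<alpha>.\<close>

lemma stable_dens_eq_inv_dens:
  assumes "0 < \<alpha>" "0 < t"
  shows "stable_dens \<alpha> t x = inv_dens (\<lambda>u. exp (- (\<bar>u\<bar> powr \<alpha>) * t)) x"
proof -
  define k where "k = t powr (- 1 / \<alpha>)"
  have k: "0 < k" using assms by (simp add: k_def)
  have kt: "\<bar>k * u\<bar> powr \<alpha> * t = \<bar>u\<bar> powr \<alpha>" for u
    using assms by (simp add: k_def abs_mult powr_mult powr_divide powr_powr powr_minus_divide)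
  have "(LINT u|lborel. cos (u * x) * exp (- (\<bar>u\<bar> powr \<alpha>) * t))
    = \<bar>k\<bar> *\<^sub>R (LINT u|lborel. cos ((0 + k * u) * x) * exp (- (\<bar>0 + k * u\<bar> powr \<alpha>) * t))"
    using k by (intro lborel_integral_real_affine) auto
  also have "\<dots> = k * (LINT u|lborel. cos (u * (x * k)) * exp (- (\<bar>u\<bar> powr \<alpha>)))"
    using k kt by (simp add: ac_simps)
  finally show ?thesis
    by (simp add: stable_dens_def inv_dens_def k_def)
qed

context
  fixes \<alpha> :: real
  assumes \<alpha>: "0 < \<alpha>"
begin

lemma integrable_exp_neg_powr_1: "integrable lborel (\<lambda>u::real. exp (- (\<bar>u\<bar> powr \<alpha>)))"
  using integrable_exp_neg_powr[OF \<alpha>, of 1] by simp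

lemma borel_measurable_stable_dens[measurable]:
  assumes [measurable]: "f \<in> borel_measurable N" "g \<in> borel_measurable N"
  shows "(\<lambda>x. stable_dens \<alpha> (f x) (g x)) \<in> borel_measurable N"
proof -
  have [measurable]: "inv_dens (\<lambda>u::real. exp (- (\<bar>u\<bar> powr \<alpha>))) \<in> borel_measurable borel"
    by (rule borel_measurable_continuous_onI continuous_inv_dens integrable_exp_neg_powr_1)+
  show ?thesis unfolding stable_dens_def by measurable
qed

lemma tendsto_stable_dens:
  assumes "(f \<longlongrightarrow> t) F" "(g \<longlongrightarrow> x) F" "0 < t"
  shows "((\<lambda>z. stable_dens \<alpha> (f z) (g z)) \<longlongrightarrow> stable_dens \<alpha> t x) F"
proof -
  have "isCont (inv_dens (\<lambda>u::real. exp (- (\<bar>u\<bar> powr \<alpha>)))) y" for y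
    using continuous_inv_dens[OF integrable_exp_neg_powr_1] by (simp add: continuous_on_eq_continuous_at)
  then show ?thesis unfolding stable_dens_def using assms
    by (intro tendsto_mult isCont_tendsto_compose[where g="inv_dens (\<lambda>u::real. exp (- (\<bar>u\<bar> powr \<alpha>)))"]
        tendsto_powr tendsto_const) auto
qed

lemma stable_dens_le: "stable_dens \<alpha> t x \<le> stable_dens_sup \<alpha> * t powr (- 1 / \<alpha>)"
  using mult_right_mono[OF order_trans[OF abs_ge_self inv_dens_le[OF integrable_exp_neg_powr_1]],
      of "t powr (- 1 / \<alpha>)" "x * t powr (- 1 / \<alpha>)"]
  by (simp add: stable_dens_def stable_dens_sup_def mult.commute)

lemma stable_dens_sup_nonneg: "0 \<le> stable_dens_sup \<alpha>"
  by (simp add: stable_dens_sup_def)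

lemma stable_dens_scale:
  assumes "0 < t" "0 < c"
  shows "stable_dens \<alpha> (c * t) (c powr (1 / \<alpha>) * x) = c powr (- 1 / \<alpha>) * stable_dens \<alpha> t x"
proof -
  have "(c * t) powr (- 1 / \<alpha>) = c powr (- 1 / \<alpha>) * t powr (- 1 / \<alpha>)"
    using assms by (simp add: powr_mult)
  moreover have "c powr (1 / \<alpha>) * x * (c powr (- 1 / \<alpha>) * t powr (- 1 / \<alpha>)) = x * t powr (- 1 / \<alpha>)"
    using assms by (simp add: powr_minus)
  ultimately show ?thesis
    by (simp only: stable_dens_def)
qed

lemma stable_dens_minus: "stable_dens \<alpha> t (- x) = stable_dens \<alpha> t x"
  by (simp add: stable_dens_def inv_dens_def)

end

subsection \<open>Symmetric stable processes\<close>

locale stable_process = prob_space M for M :: "'a measure" +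
  fixes \<alpha> :: real and X :: "real \<Rightarrow> 'a \<Rightarrow> real"
  assumes levy: "sym_stable_levy M \<alpha> X" and \<alpha>_pos: "0 < \<alpha>"
begin

abbreviation "p \<equiv> stable_dens \<alpha>"

lemmas p_measurable[measurable] = borel_measurable_stable_dens[OF \<alpha>_pos]

lemma X_measurable[measurable]: "0 \<le> t \<Longrightarrow> X t \<in> borel_measurable M"
  using levy by (auto simp: sym_stable_levy_def)

lemma X_0: "\<omega> \<in> space M \<Longrightarrow> X 0 \<omega> = 0"
  using levy by (auto simp: sym_stable_levy_def)

lemma char_increment:
  "0 \<le> s \<Longrightarrow> s \<le> t \<Longrightarrow> char (distr M borel (\<lambda>\<omega>. X t \<omega> - X s \<omega>)) =
     (\<lambda>u. complex_of_real (exp (- (\<bar>u\<bar> powr \<alpha>) * (t - s))))"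
  using levy unfolding sym_stable_levy_def by blast

lemma indep_increments:
  fixes ts :: "nat \<Rightarrow> real"
  assumes "0 \<le> ts 0" "\<And>i. i < n \<Longrightarrow> ts i < ts (Suc i)"
  shows "indep_vars (\<lambda>_. borel) (\<lambda>i \<omega>. X (ts (Suc i)) \<omega> - X (ts i) \<omega>) {..<n}"
  using levy assms unfolding sym_stable_levy_def by blast

lemma real_distribution_increment:
  "0 \<le> s \<Longrightarrow> 0 \<le> t \<Longrightarrow> real_distribution (distr M borel (\<lambda>\<omega>. X t \<omega> - X s \<omega>))"
  by (intro real_distribution_distr) auto

lemma distr_increment:
  assumes "0 \<le> s" "s < t"
  shows "distr M borel (\<lambda>\<omega>. X t \<omega> - X s \<omega>) = density lborel (\<lambda>x. ennreal (p (t - s) x))"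
proof -
  interpret D: real_distribution "distr M borel (\<lambda>\<omega>. X t \<omega> - X s \<omega>)"
    using assms by (intro real_distribution_increment) auto
  show ?thesis
    using assms D.density_inv_dens[OF integrable_exp_neg_powr[OF \<alpha>_pos] char_increment]
    by (simp add: stable_dens_eq_inv_dens[OF \<alpha>_pos])
qed

lemma p_nonneg: "0 < t \<Longrightarrow> 0 \<le> p t x"
proof -
  assume t: "0 < t"
  interpret D: real_distribution "distr M borel (\<lambda>\<omega>. X t \<omega> - X 0 \<omega>)"
    using t by (intro real_distribution_increment) auto
  show ?thesis
    using t D.inv_dens_nonneg[OF integrable_exp_neg_powr[OF \<alpha>_pos], of t x] char_increment[of 0 t]
    by (simp add: stable_dens_eq_inv_dens[OF \<alpha>_pos])
qed

lemma distributed_increment: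
  assumes "0 \<le> s" "s < t"
  shows "distributed M lborel (\<lambda>\<omega>. X t \<omega> - X s \<omega>) (\<lambda>x. ennreal (p (t - s) x))"
  using distr_increment[OF assms] assms
  by (auto simp: distributed_def intro!: measure_eqI cong: distr_cong)

lemma distributed_X:
  assumes "0 < t"
  shows "distributed M lborel (X t) (\<lambda>x. ennreal (p t x))"
proof -
  have "distr M borel (X t) = distr M borel (\<lambda>\<omega>. X t \<omega> - X 0 \<omega>)"
    by (intro distr_cong) (auto simp: X_0)
  then show ?thesis
    using distr_increment[of 0 t] assms by (auto simp: distributed_def cong: distr_cong)
qed

lemma nn_integral_p: "0 < t \<Longrightarrow> (\<integral>\<^sup>+x. ennreal (p t x) \<partial>lborel) = 1"
  using distributed_nn_integral[OF distributed_X, of t "\<lambda>_. 1"] by (simp add: emeasure_space_1)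

lemma integrable_p: "0 < t \<Longrightarrow> integrable lborel (p t)"
  by (intro integrableI_nonneg) (auto simp: nn_integral_p p_nonneg)

lemma expectation_increment:
  assumes "0 \<le> s" "s < t" and [measurable]: "g \<in> borel_measurable borel"
  shows "(\<integral>\<omega>. g (X t \<omega> - X s \<omega>) \<partial>M) = (LINT x|lborel. p (t - s) x * g x)"
  using distributed_integral[OF distributed_increment[OF assms(1,2)], of g] assms p_nonneg
  by simp

lemma expectation_X:
  assumes "0 < t" and [measurable]: "g \<in> borel_measurable borel"
  shows "(\<integral>\<omega>. g (X t \<omega>) \<partial>M) = (LINT x|lborel. p t x * g x)"
  using distributed_integral[OF distributed_X[OF assms(1)], of g] assms p_nonneg
  by simp

end

subsection \<open>Independence and bridges\<close>

text \<open>The library's \<open>indep_var\<close> forces both random variables to take values in the same type.\<close>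

definition (in prob_space) indep_pair ::
    "'b measure \<Rightarrow> ('a \<Rightarrow> 'b) \<Rightarrow> 'c measure \<Rightarrow> ('a \<Rightarrow> 'c) \<Rightarrow> bool" where
  "indep_pair N R L Y \<longleftrightarrow> R \<in> measurable M N \<and> Y \<in> measurable M L \<and>
     distr M (N \<Otimes>\<^sub>M L) (\<lambda>\<omega>. (R \<omega>, Y \<omega>)) = distr M N R \<Otimes>\<^sub>M distr M L Y"

lemma (in prob_space) indep_var_imp_indep_pair: "indep_var N R L Y \<Longrightarrow> indep_pair N R L Y"
  by (simp add: indep_var_distribution_eq indep_pair_def)

lemma (in prob_space) indep_pair_compose:
  assumes ind: "indep_pair N R L Y" and [measurable]: "f \<in> measurable N N'" "g \<in> measurable L L'"
  shows "indep_pair N' (\<lambda>\<omega>. f (R \<omega>)) L' (\<lambda>\<omega>. g (Y \<omega>))"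
proof -
  have [measurable]: "R \<in> measurable M N" "Y \<in> measurable M L"
    using ind by (auto simp: indep_pair_def)
  interpret DY: prob_space "distr (distr M L Y) L' g"
    by (intro prob_space.prob_space_distr prob_space_distr) auto
  have "distr M N' (\<lambda>\<omega>. f (R \<omega>)) \<Otimes>\<^sub>M distr M L' (\<lambda>\<omega>. g (Y \<omega>))
      = distr (distr M N R) N' f \<Otimes>\<^sub>M distr (distr M L Y) L' g"
    by (simp add: distr_distr comp_def)
  also have "\<dots> = distr (distr M N R \<Otimes>\<^sub>M distr M L Y) (N' \<Otimes>\<^sub>M L') (\<lambda>(x, y). (f x, g y))"
    by (intro pair_measure_distr DY.sigma_finite_measure_axioms) auto
  also have "distr M N R \<Otimes>\<^sub>M distr M L Y = distr M (N \<Otimes>\<^sub>M L) (\<lambda>\<omega>. (R \<omega>, Y \<omega>))"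
    using ind by (simp add: indep_pair_def)
  also have "distr \<dots> (N' \<Otimes>\<^sub>M L') (\<lambda>(x, y). (f x, g y)) = distr M (N' \<Otimes>\<^sub>M L') (\<lambda>\<omega>. (f (R \<omega>), g (Y \<omega>)))"
    by (simp add: distr_distr comp_def)
  finally show ?thesis by (simp add: indep_pair_def)
qed

text \<open>Stands in for conditioning: under independence, the second component may be drawn from a
  separate copy of the space while the first one is frozen.\<close>

lemma (in prob_space) integral_indep_pair:
  fixes f :: "'b \<times> 'c \<Rightarrow> real"
  assumes ind: "indep_pair N R L Y" and f[measurable]: "f \<in> borel_measurable (N \<Otimes>\<^sub>M L)"
    and B: "\<And>x. \<bar>f x\<bar> \<le> B"
  shows "(\<integral>\<omega>. f (R \<omega>, Y \<omega>) \<partial>M) = (\<integral>\<omega>. (\<integral>\<omega>'. f (R \<omega>, Y \<omega>') \<partial>M) \<partial>M)"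
proof -
  have R[measurable]: "R \<in> measurable M N" and Y[measurable]: "Y \<in> measurable M L"
    using ind by (auto simp: indep_pair_def)
  interpret DR: prob_space "distr M N R" by (rule prob_space_distr[OF R])
  interpret DY: prob_space "distr M L Y" by (rule prob_space_distr[OF Y])
  interpret P: pair_prob_space "distr M N R" "distr M L Y" ..
  have "(\<integral>\<omega>. f (R \<omega>, Y \<omega>) \<partial>M) = (\<integral>z. f z \<partial>distr M (N \<Otimes>\<^sub>M L) (\<lambda>\<omega>. (R \<omega>, Y \<omega>)))"
    by (subst integral_distr) auto
  also have "distr M (N \<Otimes>\<^sub>M L) (\<lambda>\<omega>. (R \<omega>, Y \<omega>)) = distr M N R \<Otimes>\<^sub>M distr M L Y"
    using ind by (simp add: indep_pair_def)
  also have "(\<integral>z. f z \<partial>(distr M N R \<Otimes>\<^sub>M distr M L Y)) = (\<integral>x. (\<integral>y. f (x, y) \<partial>distr M L Y) \<partial>distr M N R)"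
    using B by (intro P.integral_fst'[symmetric] P.P.integrable_const_bound[where B=B]) auto
  also have "\<dots> = (\<integral>x. (\<integral>\<omega>'. f (x, Y \<omega>') \<partial>M) \<partial>distr M N R)"
    by (intro Bochner_Integration.integral_cong refl) (auto simp: integral_distr)
  also have "\<dots> = (\<integral>\<omega>. (\<integral>\<omega>'. f (R \<omega>, Y \<omega>') \<partial>M) \<partial>M)"
    by (subst integral_distr) auto
  finally show ?thesis .
qed

context stable_process
begin

text \<open>The Markov property across the block from c to d, for any finite set of other times. The
  past is recorded by values and the future by increments after d, so that nothing recorded involves
  the two increments inside the block.\<close>

lemma indep_gap:
  assumes c: "0 \<le> c" and ct: "c < t" and td: "t < d"
    and S: "finite S" "S \<subseteq> {0..}" "S \<inter> {c<..<d} = {}"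
  shows "indep_pair (PiM S (\<lambda>_. borel)) (\<lambda>\<omega>. \<lambda>r\<in>S. if r \<le> c then X r \<omega> - X 0 \<omega> else X r \<omega> - X d \<omega>)
    (borel \<Otimes>\<^sub>M borel) (\<lambda>\<omega>. (X t \<omega> - X c \<omega>, X d \<omega> - X t \<omega>))"
proof -
  \<comment> \<open>All times, together with 0 as the origin of the past, are sorted into one
    increasing grid, so that a single use of \<open>indep_increments\<close> covers them.\<close>
  define G where "G = insert 0 (insert c (insert t (insert d S)))"
  have finG: "finite G" using S by (simp add: G_def)
  have G0: "0 \<in> G" "\<And>g. g \<in> G \<Longrightarrow> 0 \<le> g" using S c ct td by (auto simp: G_def)
  define xs where "xs = sorted_list_of_set G"
  define ts where "ts i = xs ! i" for i
  define m where "m = card G - 1"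
  have "0 < card G" using finG G0(1) card_gt_0_iff by blast
  then have len: "length xs = Suc m" using finG by (simp add: xs_def m_def)
  have set_xs: "set xs = G" using finG by (simp add: xs_def)
  have sxs: "sorted_wrt (<) xs" unfolding xs_def by (rule strict_sorted_list_of_set)
  have mono: "ts i < ts j" if "i < j" "j \<le> m" for i j
    using sxs that len by (auto simp: ts_def sorted_wrt_iff_nth_less)
  have tsG: "ts i \<in> G" if "i \<le> m" for i
    using that len set_xs by (auto simp: ts_def intro!: nth_mem[of i xs, simplified set_xs])
  have "\<forall>g\<in>G. \<exists>i\<le>m. ts i = g"
    using set_xs len by (auto simp: ts_def in_set_conv_nth less_Suc_eq_le)
  then obtain idx where idx: "\<And>g. g \<in> G \<Longrightarrow> idx g \<le> m" "\<And>g. g \<in> G \<Longrightarrow> ts (idx g) = g"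
    by metis
  have idx_less: "idx g < idx h" if "g \<in> G" "h \<in> G" "g < h" for g h
  proof (rule ccontr)
    assume "\<not> idx g < idx h"
    then have "ts (idx h) \<le> ts (idx g)"
      using mono[of "idx h" "idx g"] idx(1)[OF that(1)] by (cases "idx h = idx g") auto
    then show False using idx(2)[OF that(1)] idx(2)[OF that(2)] that(3) by simp
  qed
  have idx_le: "idx g \<le> idx h" if "g \<in> G" "h \<in> G" "g \<le> h" for g h
    using idx_less[of g h] that by (cases "g = h") auto
  have succ: "idx h = Suc (idx g)" if gh: "g \<in> G" "h \<in> G" "g < h" "G \<inter> {g<..<h} = {}" for g h
  proof (rule ccontr)
    assume "idx h \<noteq> Suc (idx g)"
    then have "Suc (idx g) < idx h" using idx_less[OF gh(1-3)] by simp
    then have "ts (idx g) < ts (Suc (idx g))" "ts (Suc (idx g)) < ts (idx h)" "ts (Suc (idx g)) \<in> G"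
      using idx(1)[OF gh(2)] by (auto intro!: mono tsG)
    then show False using gh idx by auto
  qed
  have cG: "c \<in> G" and tG: "t \<in> G" and dG: "d \<in> G" and SG: "S \<subseteq> G" by (auto simp: G_def)
  \<comment> \<open>No point of \<open>S\<close> lies strictly between c and d, so c, t and d are
    consecutive grid points.\<close>
  have it: "idx t = Suc (idx c)" using cG tG ct td S c by (intro succ) (auto simp: G_def)
  have id: "idx d = Suc (idx t)" using dG tG ct td S c by (intro succ) (auto simp: G_def)
  have i0: "idx 0 = 0"
  proof (rule ccontr)
    assume "idx 0 \<noteq> 0"
    then have "ts 0 < ts (idx 0)" using idx(1)[OF G0(1)] by (intro mono) auto
    then show False using G0(2)[OF tsG[of 0]] idx(2)[OF G0(1)] by simp
  qed
  define Y where "Y i \<omega> = X (ts (Suc i)) \<omega> - X (ts i) \<omega>" for i \<omega>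
  have ind: "indep_vars (\<lambda>_. borel) Y {..<m}"
    unfolding Y_def[abs_def] using G0(2)[OF tsG[of 0]] by (intro indep_increments mono) auto
  have tele: "(\<Sum>i\<in>{i..<j}. Y i \<omega>) = X (ts j) \<omega> - X (ts i) \<omega>" if "i \<le> j" for i j \<omega>
    unfolding Y_def using that by (rule sum_Suc_diff')
  define K where "K = {..<m} - {idx c, Suc (idx c)}"
  \<comment> \<open>Recovers the recorded quantities by telescoping grid increments, starting from 0
    in the past and from d in the future. Neither range contains the two increments removed in
    \<open>K\<close>.\<close>
  define \<phi> where "\<phi> y = (\<lambda>r\<in>S. if r \<le> c then \<Sum>i\<in>{0..<idx r}. y i else \<Sum>i\<in>{idx d..<idx r}. y i)" for y :: "nat \<Rightarrow> real"
  have dm: "idx d \<le> m" using idx(1)[OF dG] .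
  have sub1: "{0..<idx r} \<subseteq> K" if "r \<in> S" "r \<le> c" for r
    using idx_le[of r c] that SG cG dm it id by (auto simp: K_def)
  have sub2: "{idx d..<idx r} \<subseteq> K" if "r \<in> S" for r
    using idx(1)[of r] that SG it id by (auto simp: K_def)
  have sm: "(\<lambda>y. \<Sum>i\<in>J. y i) \<in> borel_measurable (PiM K (\<lambda>_. borel :: real measure))" if "J \<subseteq> K" for J
    using that by (intro borel_measurable_sum[where f="\<lambda>i y. y i"] measurable_component_singleton) auto
  have [measurable]: "\<phi> \<in> measurable (PiM K (\<lambda>_. borel)) (PiM S (\<lambda>_. borel))"
    unfolding \<phi>_def
  proof (rule measurable_restrict)
    fix r assume r: "r \<in> S"
    show "(\<lambda>y::nat \<Rightarrow> real. if r \<le> c then \<Sum>i\<in>{0..<idx r}. y i else \<Sum>i\<in>{idx d..<idx r}. y i) \<in> borel_measurable (PiM K (\<lambda>_. borel))"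
    proof (cases "r \<le> c")
      case True
      then show ?thesis using sm[OF sub1[OF r True]] by simp
    next
      case False
      then show ?thesis using sm[OF sub2[OF r]] by simp
    qed
  qed
  have i1: "indep_var (PiM K (\<lambda>_. borel)) (\<lambda>\<omega>. restrict (\<lambda>i. Y i \<omega>) K)
     (PiM {idx c, Suc (idx c)} (\<lambda>_. borel)) (\<lambda>\<omega>. restrict (\<lambda>i. Y i \<omega>) {idx c, Suc (idx c)})"
    using dm it id by (intro indep_var_restrict[OF ind]) (auto simp: K_def)
  have "indep_pair (PiM S (\<lambda>_. borel)) (\<lambda>\<omega>. \<phi> (restrict (\<lambda>i. Y i \<omega>) K))
     (borel \<Otimes>\<^sub>M borel) (\<lambda>\<omega>. (\<lambda>y. (y (idx c), y (Suc (idx c)))) (restrict (\<lambda>i. Y i \<omega>) {idx c, Suc (idx c)}))"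
    by (rule indep_pair_compose[OF indep_var_imp_indep_pair[OF i1]]) measurable
  also have "(\<lambda>\<omega>. (\<lambda>y. (y (idx c), y (Suc (idx c)))) (restrict (\<lambda>i. Y i \<omega>) {idx c, Suc (idx c)}))
     = (\<lambda>\<omega>. (X t \<omega> - X c \<omega>, X d \<omega> - X t \<omega>))"
    using it id idx(2)[OF cG] idx(2)[OF tG] idx(2)[OF dG] by (auto simp: fun_eq_iff Y_def)
  also have "(\<lambda>\<omega>. \<phi> (restrict (\<lambda>i. Y i \<omega>) K)) =
     (\<lambda>\<omega>. \<lambda>r\<in>S. if r \<le> c then X r \<omega> - X 0 \<omega> else X r \<omega> - X d \<omega>)"
  proof
    fix \<omega>
    have "(\<Sum>i\<in>{0..<idx r}. restrict (\<lambda>i. Y i \<omega>) K i) = X r \<omega> - X 0 \<omega>" if "r \<in> S" "r \<le> c" for r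
    proof -
      have "(\<Sum>i\<in>{0..<idx r}. restrict (\<lambda>i. Y i \<omega>) K i) = (\<Sum>i\<in>{0..<idx r}. Y i \<omega>)"
        using sub1[OF that] by (intro sum.cong) auto
      also have "\<dots> = X r \<omega> - X 0 \<omega>"
        using tele[of 0 "idx r"] idx(2)[of r] idx(2)[OF G0(1)] that SG by (auto simp: i0)
      finally show ?thesis .
    qed
    moreover have "(\<Sum>i\<in>{idx d..<idx r}. restrict (\<lambda>i. Y i \<omega>) K i) = X r \<omega> - X d \<omega>" if "r \<in> S" "\<not> r \<le> c" for r
    proof -
      have "d \<le> r" using that S(3) by auto
      then have le: "idx d \<le> idx r" using that SG dG by (intro idx_le) auto
      have "(\<Sum>i\<in>{idx d..<idx r}. restrict (\<lambda>i. Y i \<omega>) K i) = (\<Sum>i\<in>{idx d..<idx r}. Y i \<omega>)"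
        using sub2[OF that(1)] by (intro sum.cong) auto
      also have "\<dots> = X r \<omega> - X d \<omega>"
        using tele[OF le] idx(2)[of r] idx(2)[OF dG] that SG by auto
      finally show ?thesis .
    qed
    ultimately show "\<phi> (restrict (\<lambda>i. Y i \<omega>) K) =
     (\<lambda>r\<in>S. if r \<le> c then X r \<omega> - X 0 \<omega> else X r \<omega> - X d \<omega>)"
      by (auto simp: \<phi>_def)
  qed
  finally show ?thesis .
qed

lemma indep_two_increments:
  assumes c: "0 \<le> c" and ct: "c < t" and td: "t < d"
  shows "indep_var borel (\<lambda>\<omega>. X t \<omega> - X c \<omega>) borel (\<lambda>\<omega>. X d \<omega> - X t \<omega>)"
proof -
  define ts where "ts i = (if i = 0 then c else if i = Suc 0 then t else d)" for i :: nat
  have "indep_vars (\<lambda>_. borel) (\<lambda>i \<omega>. X (ts (Suc i)) \<omega> - X (ts i) \<omega>) {..<2}"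
    using assms by (intro indep_increments) (auto simp: ts_def)
  then have "indep_var (PiM {0} (\<lambda>_. borel)) (\<lambda>\<omega>. restrict (\<lambda>i. X (ts (Suc i)) \<omega> - X (ts i) \<omega>) {0})
    (PiM {Suc 0} (\<lambda>_. borel)) (\<lambda>\<omega>. restrict (\<lambda>i. X (ts (Suc i)) \<omega> - X (ts i) \<omega>) {Suc 0})"
    by (rule indep_var_restrict) auto
  then have "indep_var borel ((\<lambda>y. y 0) \<circ> (\<lambda>\<omega>. restrict (\<lambda>i. X (ts (Suc i)) \<omega> - X (ts i) \<omega>) {0}))
    borel ((\<lambda>y. y (Suc 0)) \<circ> (\<lambda>\<omega>. restrict (\<lambda>i. X (ts (Suc i)) \<omega> - X (ts i) \<omega>) {Suc 0}))"
    by (rule indep_var_compose) auto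
  then show ?thesis by (simp add: ts_def comp_def)
qed

lemma distributed_two_increments:
  assumes "0 \<le> c" "c < t" "t < d"
  shows "distributed M (lborel \<Otimes>\<^sub>M lborel) (\<lambda>\<omega>. (X t \<omega> - X c \<omega>, X d \<omega> - X t \<omega>))
    (\<lambda>(x, y). ennreal (p (t - c) x) * ennreal (p (d - t) y))"
proof -
  have "indep_var lborel (\<lambda>\<omega>. X t \<omega> - X c \<omega>) lborel (\<lambda>\<omega>. X d \<omega> - X t \<omega>)"
    using indep_two_increments[OF assms] by (simp add: indep_var_eq)
  then show ?thesis
    using assms
    by (intro distributed_joint_indep distributed_increment sigma_finite_lborel) auto
qed

text \<open>Both sides are densities of the increment over [0, a + b], and a density is determined
  only almost everywhere.\<close>

lemma convolution_p:
  assumes "0 < a" "0 < b"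
  shows "AE z in lborel. (\<integral>\<^sup>+v. ennreal (p a (z - v)) * ennreal (p b v) \<partial>lborel) = ennreal (p (a + b) z)"
proof -
  have A: "distributed M lborel (\<lambda>\<omega>. X a \<omega> - X 0 \<omega>) (\<lambda>x. ennreal (p a x))"
    using distributed_increment[of 0 a] assms by simp
  have B: "distributed M lborel (\<lambda>\<omega>. X (a + b) \<omega> - X a \<omega>) (\<lambda>x. ennreal (p b x))"
    using distributed_increment[of a "a + b"] assms by simp
  have "distributed M lborel (\<lambda>\<omega>. (X a \<omega> - X 0 \<omega>) + (X (a + b) \<omega> - X a \<omega>))
     (\<lambda>x. \<integral>\<^sup>+y. ennreal (p a (x - y)) * ennreal (p b y) \<partial>lborel)"
    using assms by (intro distributed_convolution[OF _ A B] indep_two_increments) auto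
  moreover have "distributed M lborel (\<lambda>\<omega>. (X a \<omega> - X 0 \<omega>) + (X (a + b) \<omega> - X a \<omega>)) (\<lambda>x. ennreal (p (a + b) x))"
    using distributed_increment[of 0 "a + b"] assms by simp
  ultimately show ?thesis
    by (intro distributed_unique) auto
qed

end

text \<open>The density at z of X at time a + b, restricted to the event that X at time a is at
  least x; v is the increment over the last stretch of length b. Extended values make it meaningful
  for every z.\<close>

definition bridge_num :: "real \<Rightarrow> real \<Rightarrow> real \<Rightarrow> real \<Rightarrow> real \<Rightarrow> ennreal" where
  "bridge_num \<alpha> a b x z = (\<integral>\<^sup>+v. (if x \<le> z - v then 1 else 0) *
     (ennreal (stable_dens \<alpha> a (z - v)) * ennreal (stable_dens \<alpha> b v)) \<partial>lborel)"

text \<open>The probability that \<open>X\<^sub>a \<ge> x\<close> given \<open>X\<^sub>a\<^sub>+\<^sub>b = z\<close>; the minimum only matters on a null set of \<open>z\<close>.\<close>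

definition bridge :: "real \<Rightarrow> real \<Rightarrow> real \<Rightarrow> real \<Rightarrow> real \<Rightarrow> real" where
  "bridge \<alpha> a b x z = enn2real (min 1 (bridge_num \<alpha> a b x z / ennreal (stable_dens \<alpha> (a + b) z)))"

lemma bridge_nonneg: "0 \<le> bridge \<alpha> a b x z"
  by (simp add: bridge_def)

lemma bridge_le_1: "bridge \<alpha> a b x z \<le> 1"
  unfolding bridge_def by (rule enn2real_leI) auto

lemma borel_measurable_bridge_num:
  assumes \<alpha>: "0 < \<alpha>"
    and [measurable]: "f \<in> borel_measurable N" "g \<in> borel_measurable N" "h \<in> borel_measurable N" "k \<in> borel_measurable N"
  shows "(\<lambda>w. bridge_num \<alpha> (f w) (g w) (h w) (k w)) \<in> borel_measurable N"
proof -
  note [measurable] = borel_measurable_stable_dens[OF \<alpha>]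
  show ?thesis unfolding bridge_num_def by measurable
qed

lemma borel_measurable_bridge:
  assumes \<alpha>: "0 < \<alpha>"
    and [measurable]: "f \<in> borel_measurable N" "g \<in> borel_measurable N" "h \<in> borel_measurable N" "k \<in> borel_measurable N"
  shows "(\<lambda>w. bridge \<alpha> (f w) (g w) (h w) (k w)) \<in> borel_measurable N"
proof -
  note [measurable] = borel_measurable_stable_dens[OF \<alpha>] borel_measurable_bridge_num[OF \<alpha>]
  show ?thesis unfolding bridge_def by measurable
qed

context stable_process
begin

lemmas bridge_num_measurable[measurable] = borel_measurable_bridge_num[OF \<alpha>_pos]
lemmas bridge_measurable[measurable] = borel_measurable_bridge[OF \<alpha>_pos]

text \<open>The numerator is at most the full convolution, which is the density itself. So the
  quotient is at most 1, the truncation by the minimum is inactive, and a zero of the density is a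
  zero of the numerator.\<close>

lemma bridge_times_density:
  assumes "0 < a" "0 < b"
  shows "AE z in lborel. ennreal (bridge \<alpha> a b x z) * ennreal (p (a + b) z) = bridge_num \<alpha> a b x z"
  using convolution_p[OF assms]
proof eventually_elim
  case (elim z)
  let ?N = "bridge_num \<alpha> a b x z" and ?p = "ennreal (p (a + b) z)"
  have le: "?N \<le> ?p"
    unfolding elim[symmetric] bridge_num_def by (intro nn_integral_mono) auto
  show ?case
  proof (cases "?p = 0")
    case True
    then show ?thesis using le by simp
  next
    case False
    have "?N / ?p \<le> 1" using le False by (simp add: divide_le_posI_ennreal zero_less_iff_neq_zero)
    moreover have "?N / ?p * ?p = ?N"
      using False by (simp add: ennreal_divide_times ennreal_times_divide mult.commute[of ?N] 
          ennreal_mult_divide_eq)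
    ultimately show ?thesis
      by (simp add: bridge_def min_absorb2 order_le_less_trans)
  qed
qed

text \<open>Conditional probability, tested against functions \<open>F\<close> of the endpoint. In
  the joint density of the two increments the shift u = z - v and Fubini isolate the integral over
  v, which is \<open>bridge_num\<close>.\<close>

lemma nn_integral_bridge:
  assumes "0 \<le> c" "c < t" "t < d" and F[measurable]: "F \<in> borel_measurable borel"
  shows "(\<integral>\<^sup>+\<omega>. (if \<xi> \<le> X t \<omega> - X c \<omega> then 1 else 0) * F (X d \<omega> - X c \<omega>) \<partial>M)
    = (\<integral>\<^sup>+\<omega>. ennreal (bridge \<alpha> (t - c) (d - t) \<xi> (X d \<omega> - X c \<omega>)) * F (X d \<omega> - X c \<omega>) \<partial>M)"
    (is "?L = ?R")
proof -
  define a b where "a = t - c" and "b = d - t"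
  have ab: "0 < a" "0 < b" "a + b = d - c" using assms by (auto simp: a_def b_def)
  have "?L = (\<integral>\<^sup>+\<omega>. (\<lambda>(u, v). (if \<xi> \<le> u then 1 else 0) * F (u + v)) (X t \<omega> - X c \<omega>, X d \<omega> - X t \<omega>) \<partial>M)"
    by simp
  also have "\<dots> = (\<integral>\<^sup>+z. (\<lambda>(x, y). ennreal (p a x) * ennreal (p b y)) z *
      (\<lambda>(u, v). (if \<xi> \<le> u then 1 else 0) * F (u + v)) z \<partial>(lborel \<Otimes>\<^sub>M lborel))"
    unfolding a_def b_def
    by (intro distributed_nn_integral[symmetric] distributed_two_increments assms) measurable
  also have "\<dots> = (\<integral>\<^sup>+v. (\<integral>\<^sup>+u. ennreal (p a u) * ennreal (p b v) * ((if \<xi> \<le> u then 1 else 0) * F (u + v)) \<partial>lborel) \<partial>lborel)"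
    by (subst lborel_pair.nn_integral_snd[symmetric]) (auto simp: split_beta)
  also have "\<dots> = (\<integral>\<^sup>+v. (\<integral>\<^sup>+z. ennreal (p a (z - v)) * ennreal (p b v) * ((if \<xi> \<le> z - v then 1 else 0) * F z) \<partial>lborel) \<partial>lborel)"
  proof (rule nn_integral_cong)
    fix v :: real
    show "(\<integral>\<^sup>+u. ennreal (p a u) * ennreal (p b v) * ((if \<xi> \<le> u then 1 else 0) * F (u + v)) \<partial>lborel)
      = (\<integral>\<^sup>+z. ennreal (p a (z - v)) * ennreal (p b v) * ((if \<xi> \<le> z - v then 1 else 0) * F z) \<partial>lborel)"
      by (subst nn_integral_real_affine[where c=1 and t="-v"]) auto
  qed
  also have "\<dots> = (\<integral>\<^sup>+z. (\<integral>\<^sup>+v. ennreal (p a (z - v)) * ennreal (p b v) * ((if \<xi> \<le> z - v then 1 else 0) * F z) \<partial>lborel) \<partial>lborel)"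
    by (intro lborel_pair.Fubini') measurable
  also have "\<dots> = (\<integral>\<^sup>+z. bridge_num \<alpha> a b \<xi> z * F z \<partial>lborel)"
    unfolding bridge_num_def
    by (rule nn_integral_cong, subst nn_integral_multc[symmetric]) (auto simp: ac_simps)
  also have "\<dots> = (\<integral>\<^sup>+z. ennreal (p (d - c) z) * (ennreal (bridge \<alpha> a b \<xi> z) * F z) \<partial>lborel)"
    using bridge_times_density[OF ab(1,2), of \<xi>] unfolding ab(3)
    by (intro nn_integral_cong_AE) (auto elim!: eventually_mono simp: ac_simps)
  also have "\<dots> = ?R"
    unfolding a_def b_def using assms by (intro distributed_nn_integral distributed_increment) auto
  finally show ?thesis .
qed

lemma expectation_bridge:
  assumes t: "0 \<le> c" "c < t" "t < d"
    and F[measurable]: "F \<in> borel_measurable borel" and B: "\<And>x. \<bar>F x\<bar> \<le> B"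
  shows "(\<integral>\<omega>. (if \<xi> \<le> X t \<omega> - X c \<omega> then 1 else 0) * F (X d \<omega> - X c \<omega>) \<partial>M)
    = (\<integral>\<omega>. bridge \<alpha> (t - c) (d - t) \<xi> (X d \<omega> - X c \<omega>) * F (X d \<omega> - X c \<omega>) \<partial>M)"
proof -
  have [measurable]: "X t \<in> borel_measurable M" "X c \<in> borel_measurable M" "X d \<in> borel_measurable M"
    using t by auto
  let ?I = "\<lambda>\<omega>. if \<xi> \<le> X t \<omega> - X c \<omega> then 1 else 0 :: real"
  let ?b = "\<lambda>\<omega>. bridge \<alpha> (t - c) (d - t) \<xi> (X d \<omega> - X c \<omega>)"
  have nn: "(\<integral>\<omega>. ?I \<omega> * G (X d \<omega> - X c \<omega>) \<partial>M) = (\<integral>\<omega>. ?b \<omega> * G (X d \<omega> - X c \<omega>) \<partial>M)"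
    if [measurable]: "G \<in> borel_measurable borel" and G: "\<And>x. 0 \<le> G x" for G
  proof -
    have if_mult: "ennreal ((if b then 1 else 0) * x) = (if b then 1 else 0) * ennreal x" for b and x :: real
      by simp
    have "(\<integral>\<^sup>+\<omega>. ennreal (?I \<omega> * G (X d \<omega> - X c \<omega>)) \<partial>M) = (\<integral>\<^sup>+\<omega>. ennreal (?b \<omega> * G (X d \<omega> - X c \<omega>)) \<partial>M)"
      using nn_integral_bridge[OF t, of "\<lambda>x. ennreal (G x)" \<xi>] G
      by (simp add: if_mult ennreal_mult bridge_nonneg del: mult_if_delta)
    then show ?thesis
      using G by (subst (1 2) integral_eq_nn_integral) (auto simp: bridge_nonneg)
  qed
  have B0: "0 \<le> B" using B[of 0] by linarith
  have bI: "integrable M (\<lambda>\<omega>. ?I \<omega> * G (X d \<omega> - X c \<omega>))"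
    and bb: "integrable M (\<lambda>\<omega>. ?b \<omega> * G (X d \<omega> - X c \<omega>))"
    if [measurable]: "G \<in> borel_measurable borel" and G: "\<And>x. \<bar>G x\<bar> \<le> K" for G K
  proof -
    have K0: "0 \<le> K" using G[of 0] by linarith
    show "integrable M (\<lambda>\<omega>. ?I \<omega> * G (X d \<omega> - X c \<omega>))"
      using G K0 by (intro integrable_const_bound[where B=K]) auto
    have "\<bar>?b \<omega>\<bar> * \<bar>G (X d \<omega> - X c \<omega>)\<bar> \<le> 1 * K" for \<omega>
      using G by (intro mult_mono) (auto simp: bridge_nonneg bridge_le_1)
    then show "integrable M (\<lambda>\<omega>. ?b \<omega> * G (X d \<omega> - X c \<omega>))"
      by (intro integrable_const_bound[where B=K]) (auto simp: abs_mult)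
  qed
  \<comment> \<open>Adding B makes a signed test function nonnegative, and the constant B is a
    nonnegative test function itself.\<close>
  have FB: "0 \<le> F x + B" "\<bar>F x + B\<bar> \<le> 2 * B" for x using B[of x] by (auto simp: abs_le_iff)
  have "(\<integral>\<omega>. ?I \<omega> * F (X d \<omega> - X c \<omega>) \<partial>M)
      = (\<integral>\<omega>. ?I \<omega> * (F (X d \<omega> - X c \<omega>) + B) - ?I \<omega> * B \<partial>M)" by (simp add: algebra_simps)
  also have "\<dots> = (\<integral>\<omega>. ?I \<omega> * (F (X d \<omega> - X c \<omega>) + B) \<partial>M) - (\<integral>\<omega>. ?I \<omega> * B \<partial>M)"
    using bI[of "\<lambda>x. F x + B" "2*B"] bI[of "\<lambda>x. B" "B"] FB B0
    by (intro Bochner_Integration.integral_diff) auto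
  also have "\<dots> = (\<integral>\<omega>. ?b \<omega> * (F (X d \<omega> - X c \<omega>) + B) \<partial>M) - (\<integral>\<omega>. ?b \<omega> * B \<partial>M)"
    using nn[of "\<lambda>x. F x + B"] nn[of "\<lambda>x. B"] FB B0 by simp
  also have "\<dots> = (\<integral>\<omega>. ?b \<omega> * (F (X d \<omega> - X c \<omega>) + B) - ?b \<omega> * B \<partial>M)"
    using bb[of "\<lambda>x. F x + B" "2*B"] bb[of "\<lambda>x. B" "B"] FB B0
    by (intro Bochner_Integration.integral_diff[symmetric]) auto
  also have "\<dots> = (\<integral>\<omega>. ?b \<omega> * F (X d \<omega> - X c \<omega>) \<partial>M)" by (simp add: algebra_simps)
  finally show ?thesis .
qed

text \<open>Given all values at times outside the open block, the prediction at t involves only the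
  endpoints of the block, because the increments inside are independent of the rest. The test
  function may depend on all of \<open>S\<close>, which is what a conditional expectation
  requires.\<close>

lemma expectation_bridge_gap:
  assumes t: "0 \<le> c" "c < t" "t < d"
    and S: "finite S" "S \<subseteq> {0..}" "S \<inter> {c<..<d} = {}" "c \<in> S" "d \<in> S"
    and \<Phi>[measurable]: "\<Phi> \<in> borel_measurable (PiM S (\<lambda>_. borel))" and B: "\<And>v. \<bar>\<Phi> v\<bar> \<le> B"
  shows "(\<integral>\<omega>. (if y \<le> X t \<omega> then 1 else 0) * \<Phi> (\<lambda>r\<in>S. X r \<omega>) \<partial>M)
    = (\<integral>\<omega>. bridge \<alpha> (t - c) (d - t) (y - X c \<omega>) (X d \<omega> - X c \<omega>) * \<Phi> (\<lambda>r\<in>S. X r \<omega>) \<partial>M)"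
proof -
  have [measurable]: "X t \<in> borel_measurable M" "X c \<in> borel_measurable M" "X d \<in> borel_measurable M"
    using t by auto
  define V where "V \<omega> = (\<lambda>r\<in>S. if r \<le> c then X r \<omega> - X 0 \<omega> else X r \<omega> - X d \<omega>)" for \<omega>
  \<comment> \<open>\<open>V\<close> is independent of the block and, together with the block
    increment \<open>\<delta>\<close>, it restores every observed value: a future value is
    \<open>v c + \<delta>\<close> plus the increment after d.\<close>
  define rec where "rec v \<delta> = (\<lambda>r\<in>S. if r \<le> c then v r else v c + \<delta> + v r)" for v and \<delta> :: real
  have rec_V: "rec (V \<omega>) (X d \<omega> - X c \<omega>) = (\<lambda>r\<in>S. X r \<omega>)" if "\<omega> \<in> space M" for \<omega>
    using S X_0[OF that] by (auto simp: rec_def V_def)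
  have Vc: "V \<omega> c = X c \<omega>" if "\<omega> \<in> space M" for \<omega>
    using S X_0[OF that] by (auto simp: V_def)
  have ind: "indep_pair (PiM S (\<lambda>_. borel)) V (borel \<Otimes>\<^sub>M borel) (\<lambda>\<omega>. (X t \<omega> - X c \<omega>, X d \<omega> - X t \<omega>))"
    unfolding V_def[abs_def] by (rule indep_gap) (use t S in auto)
  have [measurable]: "(\<lambda>x. (fst x) r) \<in> borel_measurable (PiM S (\<lambda>_. borel :: real measure) \<Otimes>\<^sub>M N)" if "r \<in> S" for r and N :: "'x measure"
    using measurable_compose[OF measurable_fst measurable_component_singleton[OF that]] .
  have rec_meas[measurable]: "(\<lambda>x. rec (fst x) (f x)) \<in> measurable (PiM S (\<lambda>_. borel) \<Otimes>\<^sub>M N) (PiM S (\<lambda>_. borel))"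
    if [measurable]: "f \<in> borel_measurable (PiM S (\<lambda>_. borel) \<Otimes>\<^sub>M N)" for f and N :: "'x measure"
    unfolding rec_def using S by (intro measurable_restrict) auto
  have Phi_rec: "(\<lambda>\<delta>. \<Phi> (rec v \<delta>)) \<in> borel_measurable borel" if "v \<in> space (PiM S (\<lambda>_. borel))" for v
  proof -
    have "(\<lambda>\<delta>. rec v \<delta>) \<in> measurable borel (PiM S (\<lambda>_. borel))"
      unfolding rec_def using S by (intro measurable_restrict) auto
    then show ?thesis by measurable
  qed
  have V_space: "V \<omega> \<in> space (PiM S (\<lambda>_. borel))" for \<omega>
    by (auto simp: V_def space_PiM)
  have cS[measurable]: "c \<in> S" by fact
  have B0: "0 \<le> B" using B[of "\<lambda>_. undefined"] by linarith
  have "(\<integral>\<omega>. (if y \<le> X t \<omega> then 1 else 0) * \<Phi> (\<lambda>r\<in>S. X r \<omega>) \<partial>M)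
    = (\<integral>\<omega>. (\<lambda>(v, a, b). (if y - v c \<le> a then 1 else 0) * \<Phi> (rec v (a + b))) (V \<omega>, (X t \<omega> - X c \<omega>, X d \<omega> - X t \<omega>)) \<partial>M)"
    by (intro Bochner_Integration.integral_cong) (auto simp: rec_V Vc algebra_simps)
  also have "\<dots> = (\<integral>\<omega>. (\<integral>\<omega>'. (\<lambda>(v, a, b). (if y - v c \<le> a then 1 else 0) * \<Phi> (rec v (a + b))) (V \<omega>, (X t \<omega>' - X c \<omega>', X d \<omega>' - X t \<omega>')) \<partial>M) \<partial>M)"
  proof (rule integral_indep_pair[OF ind])
    show "\<bar>case x of (v, a, b) \<Rightarrow> (if y - v c \<le> a then 1 else 0) * \<Phi> (rec v (a + b))\<bar> \<le> B" for x
      using B B0 by (auto split: prod.split)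
  qed (simp add: split_beta; measurable)
  \<comment> \<open>With \<open>V\<close> frozen, the test function depends on the block increment
    alone, so the one-block statement applies.\<close>
  also have "\<dots> = (\<integral>\<omega>. (\<integral>\<omega>'. (\<lambda>(v, a, b). bridge \<alpha> (t - c) (d - t) (y - v c) (a + b) * \<Phi> (rec v (a + b))) (V \<omega>, (X t \<omega>' - X c \<omega>', X d \<omega>' - X t \<omega>')) \<partial>M) \<partial>M)"
    using expectation_bridge[OF t Phi_rec[OF V_space] B]
    by (intro Bochner_Integration.integral_cong[OF refl, of M "\<lambda>\<omega>. integral\<^sup>L M (f \<omega>)" for f]) simp
  also have "\<dots> = (\<integral>\<omega>. (\<lambda>(v, a, b). bridge \<alpha> (t - c) (d - t) (y - v c) (a + b) * \<Phi> (rec v (a + b))) (V \<omega>, (X t \<omega> - X c \<omega>, X d \<omega> - X t \<omega>)) \<partial>M)"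
  proof (rule integral_indep_pair[OF ind, symmetric])
    show "\<bar>case x of (v, a, b) \<Rightarrow> bridge \<alpha> (t - c) (d - t) (y - v c) (a + b) * \<Phi> (rec v (a + b))\<bar> \<le> 1 * B" for x
      unfolding split_beta abs_mult using B by (intro mult_mono) (auto simp: bridge_nonneg bridge_le_1)
  qed (simp add: split_beta; measurable)
  also have "\<dots> = (\<integral>\<omega>. bridge \<alpha> (t - c) (d - t) (y - X c \<omega>) (X d \<omega> - X c \<omega>) * \<Phi> (\<lambda>r\<in>S. X r \<omega>) \<partial>M)"
    by (intro Bochner_Integration.integral_cong) (auto simp: rec_V Vc)
  finally show ?thesis .
qed

lemma indep_past_increments:
  assumes "0 \<le> c" "c < t" "t < d"
  shows "indep_pair borel (\<lambda>\<omega>. X c \<omega> - X 0 \<omega>) (borel \<Otimes>\<^sub>M borel) (\<lambda>\<omega>. (X t \<omega> - X c \<omega>, X d \<omega> - X t \<omega>))"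
  using indep_pair_compose[OF indep_gap[OF assms, of "{c}"], of "\<lambda>v. v c" borel "\<lambda>x. x" "borel \<Otimes>\<^sub>M borel"] assms
  by simp

text \<open>Right-continuity makes the path a pointwise limit of functions that are piecewise
  constant in time on countably many pieces. \<open>max 0 s\<close> freezes the path at negative
  times, about which nothing is assumed.\<close>

lemma X_joint_measurable: "(\<lambda>(s :: real, \<omega>). X (max 0 s) \<omega>) \<in> borel_measurable (borel \<Otimes>\<^sub>M M)"
proof (rule borel_measurable_LIMSEQ_metric)
  fix i :: nat
  have "(\<lambda>z. (\<lambda>k::int. \<lambda>(s :: real, \<omega>). X (max 0 ((real_of_int k + 1) / (real i + 1))) \<omega>) \<lfloor>fst z * (real i + 1)\<rfloor> z) \<in> borel_measurable (borel \<Otimes>\<^sub>M M)"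
    by (rule measurable_compose_countable) (auto intro!: measurable_compose[OF measurable_snd] simp: split_beta)
  then show "(\<lambda>(s :: real, \<omega>). X (max 0 ((real_of_int \<lfloor>s * (real i + 1)\<rfloor> + 1) / (real i + 1))) \<omega>) \<in> borel_measurable (borel \<Otimes>\<^sub>M M)"
    by (simp add: split_beta)
next
  fix z :: "real \<times> 'a" assume z: "z \<in> space (borel \<Otimes>\<^sub>M M)"
  obtain s \<omega> where [simp]: "z = (s, \<omega>)" by (cases z)
  have \<omega>: "\<omega> \<in> space M" using z by (auto simp: space_pair_measure)
  \<comment> \<open>The grid point strictly to the right of s; the strictness permits the use of the
    right-hand limit at s.\<close>
  define u where "u i = (real_of_int \<lfloor>s * (real i + 1)\<rfloor> + 1) / (real i + 1)" for i :: nat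
  have u1: "s < u i" for i
  proof -
    have "s * (real i + 1) < real_of_int \<lfloor>s * (real i + 1)\<rfloor> + 1" by linarith
    then show ?thesis by (simp add: u_def field_simps)
  qed
  have u2: "u i \<le> s + 1 / (real i + 1)" for i
  proof -
    have "u i \<le> (s * (real i + 1) + 1) / (real i + 1)"
      unfolding u_def by (rule divide_right_mono) linarith+
    also have "\<dots> = s + 1 / (real i + 1)" by (simp add: add_divide_distrib)
    finally show ?thesis .
  qed
  have lim_u: "u \<longlonglongrightarrow> s"
  proof (rule tendsto_sandwich[of "\<lambda>_. s" _ _ "\<lambda>i. s + 1 / (real i + 1)"])
    show "(\<lambda>i. s + 1 / (real i + 1)) \<longlonglongrightarrow> s"
      using tendsto_add[OF tendsto_const[of s] LIMSEQ_inverse_real_of_nat] by (simp add: inverse_eq_divide add.commute)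
  qed (use u1 u2 in \<open>auto intro!: always_eventually less_imp_le\<close>)
  have "(\<lambda>i. X (max 0 (u i)) \<omega>) \<longlonglongrightarrow> X (max 0 s) \<omega>"
  proof (cases "0 \<le> s")
    case True
    have "continuous (at_right s) (\<lambda>s. X s \<omega>)"
      using levy \<omega> True by (auto simp: sym_stable_levy_def)
    then have "((\<lambda>s. X s \<omega>) \<longlongrightarrow> X s \<omega>) (at_right s)"
      by (simp add: continuous_within)
    moreover have "filterlim u (at_right s) sequentially"
      using lim_u u1 by (auto simp: filterlim_at intro!: always_eventually)
    ultimately have "(\<lambda>i. X (u i) \<omega>) \<longlonglongrightarrow> X s \<omega>"
      by (rule filterlim_compose)
    moreover have "max 0 (u i) = u i" for i using u1[of i] True by simp
    ultimately show ?thesis using True by simp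
  next
    case False
    then have "eventually (\<lambda>i. u i < 0) sequentially"
      using lim_u by (intro order_tendstoD(2)) auto
    then have "eventually (\<lambda>i. X (max 0 (u i)) \<omega> = X (max 0 s) \<omega>) sequentially"
      using False by (auto elim!: eventually_mono)
    then show ?thesis by (rule tendsto_eventually)
  qed
  then show "(\<lambda>i. (\<lambda>(s :: real, \<omega>). X (max 0 ((real_of_int \<lfloor>s * (real i + 1)\<rfloor> + 1) / (real i + 1))) \<omega>) z) \<longlonglongrightarrow> (\<lambda>(s, \<omega>). X (max 0 s) \<omega>) z"
    by (simp add: u_def)
qed

end

subsection \<open>Occupation times on blocks\<close>

lemma Fubini_bounded:
  fixes f :: "'a \<Rightarrow> 'b \<Rightarrow> real"
  assumes "finite_measure P" "finite_measure M"
    and [measurable]: "(\<lambda>(x, y). f x y) \<in> borel_measurable (P \<Otimes>\<^sub>M M)"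
    and B: "\<And>x y. x \<in> space P \<Longrightarrow> y \<in> space M \<Longrightarrow> \<bar>f x y\<bar> \<le> B"
  shows "(\<integral>y. (\<integral>x. f x y \<partial>P) \<partial>M) = (\<integral>x. (\<integral>y. f x y \<partial>M) \<partial>P)"
proof -
  interpret P: finite_measure P by fact
  interpret M: finite_measure M by fact
  interpret PM: pair_sigma_finite P M ..
  interpret PP: finite_measure "P \<Otimes>\<^sub>M M" by (intro finite_measure_pair_measure) fact+
  show ?thesis
    by (intro PM.Fubini_integral PP.integrable_const_bound[where B=B] AE_I2)
       (auto simp: space_pair_measure B)
qed

text \<open>The open interval keeps s and D - s positive, so that both increments of a bridge have
  densities. Being finite, the measure suits Fubini for bounded integrands.\<close>

definition timed :: "real \<Rightarrow> real measure" where
  "timed D = restrict_space lborel {0<..<D}"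

lemma space_timed[simp]: "space (timed D) = {0<..<D}"
  by (simp add: timed_def space_restrict_space)

lemma finite_measure_timed: "finite_measure (timed D)"
  by (rule finite_measureI, cases "0 \<le> D") (simp_all add: timed_def emeasure_restrict_space)

lemma measure_timed[simp]: "0 \<le> D \<Longrightarrow> measure (timed D) {0<..<D} = D"
  by (simp add: timed_def measure_restrict_space)

lemma measurable_timed: "f \<in> measurable borel N \<Longrightarrow> f \<in> measurable (timed D) N"
  unfolding timed_def by (rule measurable_restrict_space1) simp

lemma timed_ident_measurable[measurable]: "(\<lambda>s. s) \<in> borel_measurable (timed D)"
  by (simp add: measurable_timed)

lemma integral_timed:
  fixes f :: "real \<Rightarrow> real"
  shows "(\<integral>s. f s \<partial>timed D) = (LINT s|lborel. indicator {0<..<D} s * f s)"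
  unfolding timed_def by (subst integral_restrict_space) auto

lemma integral_block:
  fixes f :: "real \<Rightarrow> real"
  assumes [measurable]: "f \<in> borel_measurable borel"
  shows "(LINT s:{a..a+D}|lborel. f s) = (\<integral>s. f (a + s) \<partial>timed D)"
proof -
  have "(LINT s:{a..a+D}|lborel. f s) = (LINT s|lborel. indicator {a<..<a+D} s * f s)"
    unfolding set_lebesgue_integral_def
    by (intro integral_cong_AE eventually_mono[OF eventually_conj[OF AE_lborel_singleton[of a] AE_lborel_singleton[of "a+D"]]])
       (auto simp: indicator_def)
  also have "\<dots> = \<bar>1\<bar> *\<^sub>R (LINT s|lborel. indicator {a<..<a+D} (a + 1 * s) * f (a + 1 * s))"
    by (intro lborel_integral_real_affine) auto
  also have "\<dots> = (\<integral>s. f (a + s) \<partial>timed D)"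
    unfolding integral_timed by (auto intro!: Bochner_Integration.integral_cong simp: indicator_def)
  finally show ?thesis .
qed

lemma set_integrable_bounded_Icc:
  fixes f :: "real \<Rightarrow> real"
  assumes [measurable]: "f \<in> borel_measurable borel" and "\<And>x. \<bar>f x\<bar> \<le> B"
  shows "set_integrable lborel {a..b} f"
  unfolding set_integrable_def
  by (rule integrableI_bounded_set_indicator[where B=B]) (use assms in \<open>auto simp: emeasure_lborel_Icc_eq\<close>)

lemma integral_blocks:
  fixes f :: "real \<Rightarrow> real"
  assumes [measurable]: "f \<in> borel_measurable borel" and B: "\<And>x. \<bar>f x\<bar> \<le> B" and D: "0 \<le> D"
  shows "(LINT s:{0..real n * D}|lborel. f s) = (\<Sum>k<n. \<integral>s. f (real k * D + s) \<partial>timed D)"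
proof (induction n)
  case 0
  have "(LINT s:{0..0}|lborel. f s) = (\<integral>s. f (0 + s) \<partial>timed 0)"
    using integral_block[of f 0 0] by simp
  then show ?case by (simp add: integral_timed)
next
  case (Suc n)
  have D': "0 \<le> real n * D" "real (Suc n) * D = real n * D + D" using D by (auto simp: algebra_simps)
  then have "{0..real (Suc n) * D} = {0..real n * D} \<union> {real n * D..real n * D + D}"
    using D order_trans[OF D'(1)] by (simp only: D'(2)) auto
  then have "(LINT s:{0..real (Suc n) * D}|lborel. f s)
      = (LINT s:{0..real n * D} \<union> {real n * D..real n * D + D}|lborel. f s)"
    by simp
  also have "\<dots> = (LINT s:{0..real n * D}|lborel. f s) + (LINT s:{real n * D..real n * D + D}|lborel. f s)"
    by (intro set_integral_Un_AE set_integrable_bounded_Icc[where B=B] eventually_mono[OF AE_lborel_singleton[of "real n * D"]])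
       (auto simp: B)
  finally show ?case using Suc by (simp add: integral_block)
qed

definition hv :: "real \<Rightarrow> real \<Rightarrow> real" where
  "hv y x = (if y \<le> x then 1 else 0)"

lemma hv_measurable[measurable (raw)]:
  assumes [measurable]: "f \<in> borel_measurable N" "g \<in> borel_measurable N"
  shows "(\<lambda>w. hv (f w) (g w)) \<in> borel_measurable N"
  unfolding hv_def by measurable

lemma hv_bounds: "0 \<le> hv y x" "hv y x \<le> 1" "\<bar>hv y x\<bar> \<le> 1"
  by (auto simp: hv_def)

lemma subalgebra_gen_sigma:
  assumes "\<And>f. f \<in> fs \<Longrightarrow> f \<in> borel_measurable M"
  shows "subalgebra M (gen_sigma M fs)"
proof -
  let ?G = "{f -` B \<inter> space M |f B. f \<in> fs \<and> B \<in> sets borel}"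
  have G: "?G \<subseteq> sets M" using assms by (auto intro: measurable_sets)
  have "sets (gen_sigma M fs) = sigma_sets (space M) ?G"
    unfolding gen_sigma_def by (rule sets_measure_of) auto
  also have "\<dots> \<subseteq> sets M" by (rule sets.sigma_sets_subset[OF G])
  finally show ?thesis by (simp add: subalgebra_def gen_sigma_def space_measure_of_conv)
qed

lemma measurable_gen_sigma:
  assumes "f \<in> fs" "\<And>f. f \<in> fs \<Longrightarrow> f \<in> borel_measurable M"
  shows "f \<in> borel_measurable (gen_sigma M fs)"
proof (rule measurableI)
  fix A :: "real set" assume "A \<in> sets borel"
  moreover have "space (gen_sigma M fs) = space M" by (auto simp: gen_sigma_def space_measure_of_conv)
  ultimately show "f -` A \<inter> space (gen_sigma M fs) \<in> sets (gen_sigma M fs)"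
    using assms(1) by (auto simp: gen_sigma_def sets_measure_of_conv)
qed simp

context stable_process
begin

lemma X_comp_measurable:
  assumes [measurable]: "f \<in> borel_measurable N" "g \<in> measurable N M" and pos: "\<And>w. w \<in> space N \<Longrightarrow> 0 \<le> f w"
  shows "(\<lambda>w. X (f w) (g w)) \<in> borel_measurable N"
proof -
  have "(\<lambda>w. (\<lambda>(s, \<omega>). X (max 0 s) \<omega>) (f w, g w)) \<in> borel_measurable N"
    using X_joint_measurable by measurable
  then show ?thesis
    by (rule measurable_cong[THEN iffD1, rotated]) (simp add: pos)
qed

lemma path_measurable: "\<omega> \<in> space M \<Longrightarrow> (\<lambda>s. X (max 0 s) \<omega>) \<in> borel_measurable borel"
  by (rule X_comp_measurable) auto

lemma occ_eq_blocks:
  assumes "\<omega> \<in> space M" "0 \<le> D"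
  shows "occ X (real n * D) y \<omega> = (\<Sum>k<n. \<integral>s. hv y (X (real k * D + s) \<omega>) \<partial>timed D)"
proof -
  note [measurable] = path_measurable[OF assms(1)]
  have "occ X (real n * D) y \<omega> = (LINT s:{0..real n * D}|lborel. hv y (X (max 0 s) \<omega>))"
    unfolding occ_def set_lebesgue_integral_def
    by (intro Bochner_Integration.integral_cong) (auto simp: indicator_def hv_def)
  also have "\<dots> = (\<Sum>k<n. \<integral>s. hv y (X (max 0 (real k * D + s)) \<omega>) \<partial>timed D)"
    by (intro integral_blocks[where B=1]) (auto simp: hv_bounds assms)
  also have "\<dots> = (\<Sum>k<n. \<integral>s. hv y (X (real k * D + s) \<omega>) \<partial>timed D)"
    using assms by (intro sum.cong Bochner_Integration.integral_cong refl) (auto simp: max_def add_nonneg_nonneg)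
  finally show ?thesis .
qed

text \<open>\<open>eta\<close> is the error at time \<open>s\<close> of the prediction on the \<open>k\<close>-th block from the two endpoints of that block.\<close>

definition eta :: "real \<Rightarrow> real \<Rightarrow> nat \<Rightarrow> real \<Rightarrow> 'a \<Rightarrow> real" where
  "eta D y k s \<omega> = hv y (X (real k * D + s) \<omega>) -
     bridge \<alpha> s (D - s) (y - X (real k * D) \<omega>) (X (real (Suc k) * D) \<omega> - X (real k * D) \<omega>)"

text \<open>The conditional expectation of \<open>occ X D x\<close> given that X at time D equals
  z.\<close>

definition bint :: "real \<Rightarrow> real \<Rightarrow> real \<Rightarrow> real" where
  "bint D x z = (\<integral>s. bridge \<alpha> s (D - s) x z \<partial>timed D)"

lemma eta_bound: "\<bar>eta D y k s \<omega>\<bar> \<le> 1"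
  using hv_bounds[of y "X (real k * D + s) \<omega>"]
    bridge_nonneg[of \<alpha> s "D - s" "y - X (real k * D) \<omega>" "X (real (Suc k) * D) \<omega> - X (real k * D) \<omega>"]
    bridge_le_1[of \<alpha> s "D - s" "y - X (real k * D) \<omega>" "X (real (Suc k) * D) \<omega> - X (real k * D) \<omega>"]
  by (simp add: eta_def abs_le_iff)

lemma bint_measurable[measurable]:
  assumes [measurable]: "f \<in> borel_measurable N" "g \<in> borel_measurable N"
  shows "(\<lambda>w. bint D (f w) (g w)) \<in> borel_measurable N"
proof -
  interpret T: finite_measure "timed D" by (rule finite_measure_timed)
  show ?thesis unfolding bint_def by measurable
qed

lemma eta_measurable:
  assumes D: "0 < D"
    and [measurable]: "f \<in> borel_measurable N" "g \<in> measurable N M" and f: "\<And>w. w \<in> space N \<Longrightarrow> 0 < f w"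
  shows "(\<lambda>w. eta D y k (f w) (g w)) \<in> borel_measurable N"
proof -
  have [measurable]: "(\<lambda>w. X (real k * D + f w) (g w)) \<in> borel_measurable N"
    using D f by (intro X_comp_measurable add_nonneg_nonneg) (auto simp: less_imp_le)
  have [measurable]: "X (real k * D) \<in> borel_measurable M" "X (real (Suc k) * D) \<in> borel_measurable M"
    using D by auto
  show ?thesis unfolding eta_def by measurable
qed

text \<open>The prediction error at an interior time is orthogonal to every bounded function of
  finitely many values outside the open block. Both the form of the conditional expectation and the
  orthogonality of the blocks rest on this.\<close>

lemma expectation_eta:
  assumes D: "0 < D" and s: "s \<in> {0<..<D}"
    and S: "finite S" "S \<subseteq> {0..}" "S \<inter> {real k * D<..<real (Suc k) * D} = {}" "real k * D \<in> S" "real (Suc k) * D \<in> S"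
    and \<Phi>[measurable]: "\<Phi> \<in> borel_measurable (PiM S (\<lambda>_. borel))" and B: "\<And>v. \<bar>\<Phi> v\<bar> \<le> B"
  shows "(\<integral>\<omega>. eta D y k s \<omega> * \<Phi> (\<lambda>r\<in>S. X r \<omega>) \<partial>M) = 0"
proof -
  let ?c = "real k * D" and ?d = "real (Suc k) * D"
  have t: "0 \<le> ?c" "?c < ?c + s" "?c + s < ?d" using D s by (auto simp: algebra_simps)
  have e: "(?c + s) - ?c = s" "?d - (?c + s) = D - s" by (auto simp: algebra_simps)
  have [measurable]: "X (?c + s) \<in> borel_measurable M" "X ?c \<in> borel_measurable M" "X ?d \<in> borel_measurable M"
    using t by auto
  have [measurable]: "(\<lambda>\<omega>. \<lambda>r\<in>S. X r \<omega>) \<in> measurable M (PiM S (\<lambda>_. borel))"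
    using S by (intro measurable_restrict X_measurable) auto
  let ?b = "\<lambda>\<omega>. bridge \<alpha> s (D - s) (y - X ?c \<omega>) (X ?d \<omega> - X ?c \<omega>)"
  have B0: "0 \<le> B" using B[of "\<lambda>_. undefined"] by linarith
  have "\<bar>hv y (X (?c + s) \<omega>)\<bar> * \<bar>\<Phi> (\<lambda>r\<in>S. X r \<omega>)\<bar> \<le> 1 * B" for \<omega>
    using B by (intro mult_mono) (auto simp: hv_bounds)
  then have i1: "integrable M (\<lambda>\<omega>. hv y (X (?c + s) \<omega>) * \<Phi> (\<lambda>r\<in>S. X r \<omega>))"
    by (intro integrable_const_bound[where B=B]) (auto simp: abs_mult)
  have "\<bar>?b \<omega>\<bar> * \<bar>\<Phi> (\<lambda>r\<in>S. X r \<omega>)\<bar> \<le> 1 * B" for \<omega>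
    using B by (intro mult_mono) (auto simp: bridge_nonneg bridge_le_1)
  then have i2: "integrable M (\<lambda>\<omega>. ?b \<omega> * \<Phi> (\<lambda>r\<in>S. X r \<omega>))"
    by (intro integrable_const_bound[where B=B]) (auto simp: abs_mult simp del: of_nat_Suc)
  have "(\<integral>\<omega>. eta D y k s \<omega> * \<Phi> (\<lambda>r\<in>S. X r \<omega>) \<partial>M)
      = (\<integral>\<omega>. hv y (X (?c + s) \<omega>) * \<Phi> (\<lambda>r\<in>S. X r \<omega>) \<partial>M) - (\<integral>\<omega>. ?b \<omega> * \<Phi> (\<lambda>r\<in>S. X r \<omega>) \<partial>M)"
    unfolding eta_def left_diff_distrib by (intro Bochner_Integration.integral_diff i1 i2)
  also have "(\<integral>\<omega>. hv y (X (?c + s) \<omega>) * \<Phi> (\<lambda>r\<in>S. X r \<omega>) \<partial>M)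
      = (\<integral>\<omega>. bridge \<alpha> ((?c + s) - ?c) (?d - (?c + s)) (y - X ?c \<omega>) (X ?d \<omega> - X ?c \<omega>) * \<Phi> (\<lambda>r\<in>S. X r \<omega>) \<partial>M)"
    unfolding hv_def by (rule expectation_bridge_gap[OF t S \<Phi> B])
  finally show ?thesis by (simp only: e diff_self)
qed

lemma obs_sigma_subalgebra: "0 \<le> T \<Longrightarrow> subalgebra M (obs_sigma M X T n)"
  unfolding obs_sigma_def by (rule subalgebra_gen_sigma) auto

text \<open>The events of this form are a sigma-algebra that contains the generators.
  \<open>S\<close> starts at 0, although the observations start at the first grid point, so that the
  first block has its left endpoint in \<open>S\<close> too.\<close>

lemma obs_sigma_sets:
  assumes T: "0 \<le> T" and A: "A \<in> sets (obs_sigma M X T n)" and S: "S = (\<lambda>k. real k * (T / real n)) ` {..n}"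
  shows "\<exists>B \<in> sets (PiM S (\<lambda>_. borel)). A = {\<omega> \<in> space M. (\<lambda>r\<in>S. X r \<omega>) \<in> B}"
proof -
  define W where "W \<omega> = (\<lambda>r\<in>S. X r \<omega>)" for \<omega>
  have sp: "W \<omega> \<in> space (PiM S (\<lambda>_. borel))" for \<omega>
    by (auto simp: space_PiM W_def)
  let ?G = "{f -` B \<inter> space M |f B. f \<in> {X (real k * (T / real n)) | k. k \<in> {1..n}} \<and> B \<in> sets borel}"
  have "A \<in> sigma_sets (space M) ?G"
    using A unfolding obs_sigma_def gen_sigma_def by (subst (asm) sets_measure_of) auto
  then have "\<exists>B \<in> sets (PiM S (\<lambda>_. borel)). A = {\<omega> \<in> space M. W \<omega> \<in> B}"
  proof induction
    case (Basic a)
    then obtain k B where k: "k \<in> {1..n}" and B: "B \<in> sets borel" and a: "a = X (real k * (T / real n)) -` B \<inter> space M"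
      by blast
    define r where "r = real k * (T / real n)"
    have rS: "r \<in> S" using k S by (auto simp: r_def)
    have "{v \<in> space (PiM S (\<lambda>_. borel)). v r \<in> B} \<in> sets (PiM S (\<lambda>_. borel))"
      using B rS by measurable
    moreover have "a = {\<omega> \<in> space M. W \<omega> \<in> {v \<in> space (PiM S (\<lambda>_. borel)). v r \<in> B}}"
      unfolding a r_def[symmetric] using rS sp by (auto simp: W_def)
    ultimately show ?case by blast
  next
    case Empty
    show ?case by (rule bexI[of _ "{}"]) auto
  next
    case (Compl a)
    then obtain B where B: "B \<in> sets (PiM S (\<lambda>_. borel))" "a = {\<omega> \<in> space M. W \<omega> \<in> B}" by blast
    have "space M - a = {\<omega> \<in> space M. W \<omega> \<in> space (PiM S (\<lambda>_. borel)) - B}"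
      unfolding B(2) using sp by blast
    then show ?case using B(1) by blast
  next
    case (Union a)
    then obtain B where B: "\<And>i. B i \<in> sets (PiM S (\<lambda>_. borel))" "\<And>i. a i = {\<omega> \<in> space M. W \<omega> \<in> B i}"
      by metis
    have "(\<Union>i. a i) = {\<omega> \<in> space M. W \<omega> \<in> (\<Union>i. B i)}"
      unfolding B(2) by blast
    moreover have "(\<Union>i. B i) \<in> sets (PiM S (\<lambda>_. borel))" using B(1) by blast
    ultimately show ?case by blast
  qed
  then show ?thesis by (simp add: W_def)
qed

lemma xi_eq:
  assumes D: "0 < D" and \<omega>: "\<omega> \<in> space M"
  shows "(\<integral>s. eta D y k s \<omega> \<partial>timed D) = (\<integral>s. hv y (X (real k * D + s) \<omega>) \<partial>timed D)
     - bint D (y - X (real k * D) \<omega>) (X (real (Suc k) * D) \<omega> - X (real k * D) \<omega>)"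
proof -
  interpret T: finite_measure "timed D" by (rule finite_measure_timed)
  have [measurable]: "(\<lambda>s. X (real k * D + s) \<omega>) \<in> borel_measurable (timed D)"
    using D \<omega> by (intro X_comp_measurable add_nonneg_nonneg) (auto simp: less_imp_le)
  show ?thesis unfolding eta_def bint_def
    by (intro Bochner_Integration.integral_diff T.integrable_const_bound[where B=1])
       (auto simp: hv_bounds bridge_nonneg bridge_le_1)
qed

section \<open>Second moments of the block errors\<close>

definition joint_exc :: "real \<Rightarrow> real \<Rightarrow> real \<Rightarrow> real" where
  "joint_exc s t x = (\<integral>\<omega>. hv x (X s \<omega>) * hv x (X t \<omega>) \<partial>M)"

definition bridge_exc :: "real \<Rightarrow> real \<Rightarrow> real \<Rightarrow> real \<Rightarrow> real" where
  "bridge_exc D s t x = (\<integral>\<omega>. bridge \<alpha> s (D - s) x (X D \<omega>) * bridge \<alpha> t (D - t) x (X D \<omega>) \<partial>M)"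

text \<open>\<open>V D x\<close> is the expectation of the conditional variance of \<open>occ X D x\<close> given \<open>X D\<close>.\<close>

definition V :: "real \<Rightarrow> real \<Rightarrow> real" where
  "V D x = (\<integral>s. (\<integral>t. joint_exc s t x - bridge_exc D s t x \<partial>timed D) \<partial>timed D)"

text \<open>The share of block k in the occupation time minus its prediction, see
  \<open>occ_minus_proj\<close>.\<close>

definition xi :: "real \<Rightarrow> real \<Rightarrow> nat \<Rightarrow> 'a \<Rightarrow> real" where
  "xi D y k \<omega> = (\<integral>s. eta D y k s \<omega> \<partial>timed D)"

lemma joint_exc_measurable:
  assumes [measurable]: "f \<in> borel_measurable N" "g \<in> borel_measurable N" "h \<in> borel_measurable N"
    and "\<And>w. w \<in> space N \<Longrightarrow> 0 < f w" "\<And>w. w \<in> space N \<Longrightarrow> 0 < g w"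
  shows "(\<lambda>w. joint_exc (f w) (g w) (h w)) \<in> borel_measurable N"
proof -
  have [measurable]: "(\<lambda>z. X (f (fst z)) (snd z)) \<in> borel_measurable (N \<Otimes>\<^sub>M M)"
    "(\<lambda>z. X (g (fst z)) (snd z)) \<in> borel_measurable (N \<Otimes>\<^sub>M M)"
    using assms by (auto intro!: X_comp_measurable less_imp_le simp: space_pair_measure)
  show ?thesis unfolding joint_exc_def by measurable
qed

lemma bridge_exc_measurable:
  assumes [measurable]: "f \<in> borel_measurable N" "g \<in> borel_measurable N" "h \<in> borel_measurable N"
    and D: "0 < D"
  shows "(\<lambda>w. bridge_exc D (f w) (g w) (h w)) \<in> borel_measurable N"
proof -
  have [measurable]: "X D \<in> borel_measurable M" using D by auto
  show ?thesis unfolding bridge_exc_def by measurable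
qed

lemma joint_exc_bounds: "0 \<le> joint_exc s t x" "0 \<le> s \<Longrightarrow> 0 \<le> t \<Longrightarrow> joint_exc s t x \<le> 1"
proof -
  show "0 \<le> joint_exc s t x" unfolding joint_exc_def by (intro Bochner_Integration.integral_nonneg) (auto simp: hv_bounds)
  assume [simp]: "0 \<le> s" "0 \<le> t"
  have "joint_exc s t x \<le> (\<integral>\<omega>. 1 \<partial>M)" unfolding joint_exc_def
    by (intro integral_mono integrable_const_bound[where B=1]) (auto simp: hv_def)
  then show "joint_exc s t x \<le> 1" by (simp add: prob_space)
qed

lemma bridge_exc_bounds: "0 \<le> bridge_exc D s t x" "0 < D \<Longrightarrow> bridge_exc D s t x \<le> 1"
proof -
  show "0 \<le> bridge_exc D s t x" unfolding bridge_exc_def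
    by (intro Bochner_Integration.integral_nonneg) (auto simp: bridge_nonneg)
  assume D: "0 < D"
  then have [measurable]: "X D \<in> borel_measurable M" by auto
  have le: "bridge \<alpha> s (D - s) x z * bridge \<alpha> t (D - t) x z \<le> 1" for z
    by (intro mult_le_one) (auto simp: bridge_nonneg bridge_le_1)
  then have "bridge_exc D s t x \<le> (\<integral>\<omega>. 1 \<partial>M)" unfolding bridge_exc_def
    by (intro integral_mono integrable_const_bound[where B=1]) (auto simp: bridge_nonneg)
  then show "bridge_exc D s t x \<le> 1" by (simp add: prob_space)
qed

lemma exc_diff_bound: "0 < D \<Longrightarrow> 0 \<le> s \<Longrightarrow> 0 \<le> t \<Longrightarrow> \<bar>joint_exc s t x - bridge_exc D s t x\<bar> \<le> 1"
  using joint_exc_bounds[of s t x] bridge_exc_bounds[of D s t x] by (simp add: abs_le_iff)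

lemma sigma_finite_timed: "sigma_finite_measure (timed D)"
  by (intro finite_measure.sigma_finite_measure finite_measure_timed)

lemma timed_integral_bound:
  assumes "0 \<le> D" "\<And>s. s \<in> {0<..<D} \<Longrightarrow> \<bar>f s\<bar> \<le> B" and "0 \<le> B"
  shows "\<bar>\<integral>s. f s \<partial>timed D\<bar> \<le> D * B"
\<comment> \<open>A non-integrable \<open>f\<close> has integral 0 by convention, and then the bound
  is trivial.\<close>
proof (cases "integrable (timed D) f")
  case True
  interpret T: finite_measure "timed D" by (rule finite_measure_timed)
  have "\<bar>\<integral>s. f s \<partial>timed D\<bar> \<le> (\<integral>s. B \<partial>timed D)"
    using True assms by (intro integral_abs_bound_integral) auto
  then show ?thesis using assms by simp
qed (use assms in \<open>simp add: not_integrable_integral_eq\<close>)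

lemma V_measurable[measurable]: assumes D: "0 < D" shows "V D \<in> borel_measurable borel"
proof -
  interpret T: sigma_finite_measure "timed D" by (rule sigma_finite_timed)
  have m2: "(\<lambda>z. snd z) \<in> borel_measurable (N \<Otimes>\<^sub>M timed D)" for N :: "'x measure"
    by (rule measurable_compose[OF measurable_snd timed_ident_measurable])
  have m: "(\<lambda>z. snd (fst z)) \<in> borel_measurable ((borel \<Otimes>\<^sub>M timed D) \<Otimes>\<^sub>M timed D)"
    by (rule measurable_compose[OF measurable_fst m2])
  have "(\<lambda>z. joint_exc (snd (fst z)) (snd z) (fst (fst z)) - bridge_exc D (snd (fst z)) (snd z) (fst (fst z)))
      \<in> borel_measurable ((borel \<Otimes>\<^sub>M timed D) \<Otimes>\<^sub>M timed D)"
    by (rule borel_measurable_diff; rule joint_exc_measurable bridge_exc_measurable)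
       (auto simp: space_pair_measure D intro: m m2 measurable_compose[OF measurable_fst measurable_fst])
  then have "(\<lambda>z. \<integral>t. joint_exc (snd z) t (fst z) - bridge_exc D (snd z) t (fst z) \<partial>timed D) \<in> borel_measurable (borel \<Otimes>\<^sub>M timed D)"
    by (intro T.borel_measurable_lebesgue_integral) (simp add: case_prod_unfold)
  then have "(\<lambda>x. \<integral>s. (\<integral>t. joint_exc s t x - bridge_exc D s t x \<partial>timed D) \<partial>timed D) \<in> borel_measurable borel"
    by (intro T.borel_measurable_lebesgue_integral) (simp add: case_prod_unfold)
  then show ?thesis by (simp add: V_def[abs_def])
qed

lemma V_bound: "0 < D \<Longrightarrow> \<bar>V D x\<bar> \<le> D * (D * 1)"
  unfolding V_def by (intro timed_integral_bound) (auto simp: exc_diff_bound)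

lemma eta_joint_measurable: "0 < D \<Longrightarrow> (\<lambda>(s, \<omega>). eta D y k s \<omega>) \<in> borel_measurable (timed D \<Otimes>\<^sub>M M)"
  unfolding split_beta by (rule eta_measurable) (auto simp: space_pair_measure)

lemma xi_measurable[measurable]: assumes D: "0 < D" shows "xi D y k \<in> borel_measurable M"
proof -
  interpret T: sigma_finite_measure "timed D" by (rule sigma_finite_timed)
  have "(\<lambda>(\<omega>, s). eta D y k s \<omega>) \<in> borel_measurable (M \<Otimes>\<^sub>M timed D)"
    using measurable_compose[OF measurable_pair_swap' eta_joint_measurable[OF D]] by (simp add: split_beta)
  then show ?thesis unfolding xi_def[abs_def] by (rule T.borel_measurable_lebesgue_integral)
qed

lemma xi_bound: "0 < D \<Longrightarrow> \<bar>xi D y k \<omega>\<bar> \<le> D"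
  using timed_integral_bound[of D "\<lambda>s. eta D y k s \<omega>" 1] by (simp add: xi_def eta_bound)

lemma expectation_xi:
  assumes D: "0 < D" and [measurable]: "g \<in> borel_measurable M" and B: "\<And>\<omega>. \<omega> \<in> space M \<Longrightarrow> \<bar>g \<omega>\<bar> \<le> B"
  shows "(\<integral>\<omega>. xi D y k \<omega> * g \<omega> \<partial>M) = (\<integral>s. (\<integral>\<omega>. eta D y k s \<omega> * g \<omega> \<partial>M) \<partial>timed D)"
proof -
  note [measurable] = eta_joint_measurable[OF D]
  have "(\<integral>\<omega>. xi D y k \<omega> * g \<omega> \<partial>M) = (\<integral>\<omega>. (\<integral>s. eta D y k s \<omega> * g \<omega> \<partial>timed D) \<partial>M)"
    by (simp add: xi_def)
  also have "\<dots> = (\<integral>s. (\<integral>\<omega>. eta D y k s \<omega> * g \<omega> \<partial>M) \<partial>timed D)"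
  proof (rule Fubini_bounded[where B="1 * B"])
    show "finite_measure (timed D)" by (rule finite_measure_timed)
    show "finite_measure M" by unfold_locales
    show "\<bar>eta D y k s \<omega> * g \<omega>\<bar> \<le> 1 * B" if "\<omega> \<in> space M" for s \<omega>
      unfolding abs_mult using B[OF that] by (intro mult_mono eta_bound) auto
  qed measurable
  finally show ?thesis .
qed

lemma expectation_xi_xi:
  assumes D: "0 < D"
  shows "(\<integral>\<omega>. xi D y j \<omega> * xi D y k \<omega> \<partial>M) = (\<integral>s. (\<integral>t. (\<integral>\<omega>. eta D y j s \<omega> * eta D y k t \<omega> \<partial>M) \<partial>timed D) \<partial>timed D)"
proof -
  have "(\<integral>\<omega>. xi D y j \<omega> * xi D y k \<omega> \<partial>M) = (\<integral>s. (\<integral>\<omega>. eta D y j s \<omega> * xi D y k \<omega> \<partial>M) \<partial>timed D)"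
    using D by (intro expectation_xi[where B=D] xi_bound) auto
  also have "\<dots> = (\<integral>s. (\<integral>t. (\<integral>\<omega>. eta D y j s \<omega> * eta D y k t \<omega> \<partial>M) \<partial>timed D) \<partial>timed D)"
  proof (rule Bochner_Integration.integral_cong[OF refl])
    fix s assume "s \<in> space (timed D)"
    then have [measurable]: "eta D y j s \<in> borel_measurable M"
      using D by (intro eta_measurable) auto
    show "(\<integral>\<omega>. eta D y j s \<omega> * xi D y k \<omega> \<partial>M) = (\<integral>t. (\<integral>\<omega>. eta D y j s \<omega> * eta D y k t \<omega> \<partial>M) \<partial>timed D)"
      using expectation_xi[OF D, of "eta D y j s" 1 y k] by (simp add: eta_bound mult.commute)
  qed
  finally show ?thesis .
qed

text \<open>The error in block j is a bounded function of values at times outside the open block k,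
  so it serves as a test function in \<open>expectation_eta\<close> for block k.\<close>

lemma expectation_eta_eta_neq:
  assumes D: "0 < D" and jk: "j \<noteq> k" and s: "s \<in> {0<..<D}" and t: "t \<in> {0<..<D}"
  shows "(\<integral>\<omega>. eta D y j s \<omega> * eta D y k t \<omega> \<partial>M) = 0"
proof -
  \<comment> \<open>Besides the endpoints of both blocks, the interior time of block j counts as
    observed.\<close>
  define S where "S = {real j * D + s, real j * D, real (Suc j) * D, real k * D, real (Suc k) * D}"
  define \<Phi> where "\<Phi> v = hv y (v (real j * D + s)) - bridge \<alpha> s (D - s) (y - v (real j * D)) (v (real (Suc j) * D) - v (real j * D))" for v :: "real \<Rightarrow> real"
  have mem: "real j * D + s \<in> S" "real j * D \<in> S" "real (Suc j) * D \<in> S" by (auto simp: S_def)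
  have P: "\<Phi> (\<lambda>r\<in>S. X r \<omega>) = eta D y j s \<omega>" for \<omega>
    using mem by (simp add: \<Phi>_def eta_def)
  have [measurable]: "\<Phi> \<in> borel_measurable (PiM S (\<lambda>_. borel))"
    unfolding \<Phi>_def using mem by measurable
  have Pb: "\<bar>\<Phi> v\<bar> \<le> 1" for v
    using hv_bounds[of y "v (real j * D + s)"]
      bridge_nonneg[of \<alpha> s "D - s" "y - v (real j * D)" "v (real (Suc j) * D) - v (real j * D)"]
      bridge_le_1[of \<alpha> s "D - s" "y - v (real j * D)" "v (real (Suc j) * D) - v (real j * D)"]
    by (simp add: \<Phi>_def abs_le_iff)
  have grid: "real i * D \<notin> {real k * D<..<real (Suc k) * D}" for i
  proof
    assume "real i * D \<in> {real k * D<..<real (Suc k) * D}"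
    then have "real k < real i" "real i < real (Suc k)" using D by (auto simp: mult_less_cancel_right simp del: of_nat_Suc)
    then show False by simp
  qed
  have ns: "real j * D + s \<notin> {real k * D<..<real (Suc k) * D}"
  proof (cases "j < k")
    case True
    then have "real (Suc j) * D \<le> real k * D" using D by (intro mult_right_mono) auto
    then show ?thesis using s by (auto simp: algebra_simps)
  next
    case False
    then have "real (Suc k) * D \<le> real j * D" using D jk by (intro mult_right_mono) auto
    then show ?thesis using s by (auto simp: algebra_simps)
  qed
  have "(\<integral>\<omega>. eta D y k t \<omega> * \<Phi> (\<lambda>r\<in>S. X r \<omega>) \<partial>M) = 0"
  proof (rule expectation_eta[OF D t, where B=1])
    show "S \<inter> {real k * D<..<real (Suc k) * D} = {}" using grid[of j] grid[of "Suc j"] grid[of k] grid[of "Suc k"] ns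
      unfolding S_def by blast
    show "S \<subseteq> {0..}" using D s by (auto simp: S_def)
    show "finite S" "real k * D \<in> S" "real (Suc k) * D \<in> S" by (auto simp: S_def)
    show "\<Phi> \<in> borel_measurable (PiM S (\<lambda>_. borel))" by fact
  qed (rule Pb)
  then show ?thesis by (simp add: P mult.commute)
qed

text \<open>Stationarity: the joint density of the two increments depends only on the lengths of the
  two intervals.\<close>

lemma distr_two_increments_shift:
  assumes "0 \<le> c" "0 < s" "s < t"
  shows "distr M (borel \<Otimes>\<^sub>M borel) (\<lambda>\<omega>. (X (c + s) \<omega> - X c \<omega>, X (c + t) \<omega> - X (c + s) \<omega>))
    = distr M (borel \<Otimes>\<^sub>M borel) (\<lambda>\<omega>. (X s \<omega> - X 0 \<omega>, X t \<omega> - X s \<omega>))"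
proof -
  have "distr M (lborel \<Otimes>\<^sub>M lborel) (\<lambda>\<omega>. (X (c + s) \<omega> - X c \<omega>, X (c + t) \<omega> - X (c + s) \<omega>))
    = distr M (lborel \<Otimes>\<^sub>M lborel) (\<lambda>\<omega>. (X s \<omega> - X 0 \<omega>, X t \<omega> - X s \<omega>))"
    using distributed_distr_eq_density[OF distributed_two_increments[of c "c + s" "c + t"]]
      distributed_distr_eq_density[OF distributed_two_increments[of 0 s t]] assms by simp
  moreover have "sets (lborel \<Otimes>\<^sub>M lborel) = sets (borel \<Otimes>\<^sub>M borel :: (real \<times> real) measure)"
    by (intro sets_pair_measure_cong) auto
  ultimately show ?thesis
    by (simp cong: distr_cong)
qed

text \<open>The Markov property at time c: the two later increments are independent of X at time c
  and are distributed as if started at time 0.\<close>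

lemma expectation_shift:
  fixes f :: "real \<Rightarrow> real \<times> real \<Rightarrow> real"
  assumes c: "0 \<le> c" "0 < s" "s < t"
    and [measurable]: "(\<lambda>(z, w). f z w) \<in> borel_measurable (borel \<Otimes>\<^sub>M (borel \<Otimes>\<^sub>M borel))" and B: "\<And>z w. \<bar>f z w\<bar> \<le> B"
  shows "(\<integral>\<omega>. f (X c \<omega>) (X (c + s) \<omega> - X c \<omega>, X (c + t) \<omega> - X (c + s) \<omega>) \<partial>M)
    = (\<integral>\<omega>. (\<integral>\<omega>'. f (X c \<omega>) (X s \<omega>', X t \<omega>' - X s \<omega>') \<partial>M) \<partial>M)"
proof -
  have [measurable]: "X c \<in> borel_measurable M" "X s \<in> borel_measurable M" "X t \<in> borel_measurable M"
    "X (c + s) \<in> borel_measurable M" "X (c + t) \<in> borel_measurable M" "X 0 \<in> borel_measurable M"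
    using c by auto
  have "(\<integral>\<omega>. f (X c \<omega>) (X (c + s) \<omega> - X c \<omega>, X (c + t) \<omega> - X (c + s) \<omega>) \<partial>M)
      = (\<integral>\<omega>. (\<lambda>(z, w). f z w) (X c \<omega> - X 0 \<omega>, (X (c + s) \<omega> - X c \<omega>, X (c + t) \<omega> - X (c + s) \<omega>)) \<partial>M)"
    by (intro Bochner_Integration.integral_cong) (auto simp: X_0)
  also have "\<dots> = (\<integral>\<omega>. (\<integral>\<omega>'. (\<lambda>(z, w). f z w) (X c \<omega> - X 0 \<omega>, (X (c + s) \<omega>' - X c \<omega>', X (c + t) \<omega>' - X (c + s) \<omega>')) \<partial>M) \<partial>M)"
  proof (rule integral_indep_pair[where B=B])
    show "indep_pair borel (\<lambda>\<omega>. X c \<omega> - X 0 \<omega>) (borel \<Otimes>\<^sub>M borel) (\<lambda>\<omega>. (X (c + s) \<omega> - X c \<omega>, X (c + t) \<omega> - X (c + s) \<omega>))"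
      by (rule indep_past_increments) (use c in auto)
    show "(\<lambda>(z, w). f z w) \<in> borel_measurable (borel \<Otimes>\<^sub>M (borel \<Otimes>\<^sub>M borel))" by fact
    show "\<bar>case x of (z, w) \<Rightarrow> f z w\<bar> \<le> B" for x using B by (cases x) auto
  qed
  also have "\<dots> = (\<integral>\<omega>. (\<integral>\<omega>'. f (X c \<omega>) (X s \<omega>', X t \<omega>' - X s \<omega>') \<partial>M) \<partial>M)"
  proof (rule Bochner_Integration.integral_cong[OF refl])
    fix \<omega> assume \<omega>: "\<omega> \<in> space M"
    have [measurable]: "f z \<in> borel_measurable (borel \<Otimes>\<^sub>M borel)" for z
      using measurable_compose[OF measurable_Pair1' assms(4), of z] by simp
    have "(\<integral>\<omega>'. f (X c \<omega>) (X (c + s) \<omega>' - X c \<omega>', X (c + t) \<omega>' - X (c + s) \<omega>') \<partial>M)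
       = (\<integral>w. f (X c \<omega>) w \<partial>distr M (borel \<Otimes>\<^sub>M borel) (\<lambda>\<omega>. (X (c + s) \<omega> - X c \<omega>, X (c + t) \<omega> - X (c + s) \<omega>)))"
      by (subst integral_distr) auto
    also have "\<dots> = (\<integral>w. f (X c \<omega>) w \<partial>distr M (borel \<Otimes>\<^sub>M borel) (\<lambda>\<omega>. (X s \<omega> - X 0 \<omega>, X t \<omega> - X s \<omega>)))"
      by (simp only: distr_two_increments_shift[OF c])
    also have "\<dots> = (\<integral>\<omega>'. f (X c \<omega>) (X s \<omega>' - X 0 \<omega>', X t \<omega>' - X s \<omega>') \<partial>M)"
      by (subst integral_distr) auto
    also have "\<dots> = (\<integral>\<omega>'. f (X c \<omega>) (X s \<omega>', X t \<omega>' - X s \<omega>') \<partial>M)"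
      by (intro Bochner_Integration.integral_cong) (auto simp: X_0)
    finally show "(\<integral>\<omega>'. (\<lambda>(z, w). f z w) (X c \<omega> - X 0 \<omega>, (X (c + s) \<omega>' - X c \<omega>', X (c + t) \<omega>' - X (c + s) \<omega>')) \<partial>M)
      = (\<integral>\<omega>'. f (X c \<omega>) (X s \<omega>', X t \<omega>' - X s \<omega>') \<partial>M)"
      using \<omega> by (simp add: X_0)
  qed
  finally show ?thesis .
qed

lemma expectation_hv_hv:
  assumes c: "0 \<le> c" and s: "0 < s" and t: "0 < t"
  shows "(\<integral>\<omega>. hv y (X (c + s) \<omega>) * hv y (X (c + t) \<omega>) \<partial>M) = (\<integral>\<omega>. joint_exc s t (y - X c \<omega>) \<partial>M)"
proof -
  have hv_shift: "hv (y - z) (x - z) = hv y x" for y x z by (simp add: hv_def)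
  have less: "(\<integral>\<omega>. hv y (X (c + s) \<omega>) * hv y (X (c + t) \<omega>) \<partial>M) = (\<integral>\<omega>. joint_exc s t (y - X c \<omega>) \<partial>M)"
    if "0 < s" "s < t" for s t
  proof -
    have "(\<integral>\<omega>. (\<lambda>z (a, b). hv (y - z) a * hv (y - z) (a + b)) (X c \<omega>) (X (c + s) \<omega> - X c \<omega>, X (c + t) \<omega> - X (c + s) \<omega>) \<partial>M)
      = (\<integral>\<omega>. (\<integral>\<omega>'. (\<lambda>z (a, b). hv (y - z) a * hv (y - z) (a + b)) (X c \<omega>) (X s \<omega>', X t \<omega>' - X s \<omega>') \<partial>M) \<partial>M)"
      by (rule expectation_shift[OF c that, where B=1]) (auto simp: hv_def)
    then show ?thesis by (simp add: joint_exc_def hv_shift)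
  qed
  consider "s < t" | "t < s" | "s = t" by linarith
  then show ?thesis
  proof cases
    case 1 then show ?thesis using less s by blast
  next
    case 2 then show ?thesis using less[of t s] t by (simp add: joint_exc_def mult.commute)
  next
    case 3
    \<comment> \<open>\<open>expectation_shift\<close> wants two distinct times; s + 1 is a dummy
      second time.\<close>
    have "(\<integral>\<omega>. (\<lambda>z (a, b). hv (y - z) a * hv (y - z) a) (X c \<omega>) (X (c + s) \<omega> - X c \<omega>, X (c + (s + 1)) \<omega> - X (c + s) \<omega>) \<partial>M)
      = (\<integral>\<omega>. (\<integral>\<omega>'. (\<lambda>z (a, b). hv (y - z) a * hv (y - z) a) (X c \<omega>) (X s \<omega>', X (s + 1) \<omega>' - X s \<omega>') \<partial>M) \<partial>M)"
      by (rule expectation_shift[OF c s, where B=1]) (auto simp: hv_def)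
    then show ?thesis using 3 by (simp add: joint_exc_def hv_shift)
  qed
qed

lemma bridge_mult_bound: "\<bar>bridge \<alpha> a b x z * bridge \<alpha> a' b' x' z'\<bar> \<le> 1"
  unfolding abs_mult by (intro mult_le_one) (auto simp: bridge_nonneg bridge_le_1)

lemma expectation_bridge_bridge:
  assumes c: "0 \<le> c" and D: "0 < D"
  shows "(\<integral>\<omega>. bridge \<alpha> s (D - s) (y - X c \<omega>) (X (c + D) \<omega> - X c \<omega>) * bridge \<alpha> t (D - t) (y - X c \<omega>) (X (c + D) \<omega> - X c \<omega>) \<partial>M)
    = (\<integral>\<omega>. bridge_exc D s t (y - X c \<omega>) \<partial>M)"
proof -
  \<comment> \<open>The midpoint is auxiliary: only the sum a + b of the two increments
    enters.\<close>
  have "(\<integral>\<omega>. (\<lambda>z (a, b). bridge \<alpha> s (D - s) (y - z) (a + b) * bridge \<alpha> t (D - t) (y - z) (a + b)) (X c \<omega>) (X (c + D / 2) \<omega> - X c \<omega>, X (c + D) \<omega> - X (c + D / 2) \<omega>) \<partial>M)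
      = (\<integral>\<omega>. (\<integral>\<omega>'. (\<lambda>z (a, b). bridge \<alpha> s (D - s) (y - z) (a + b) * bridge \<alpha> t (D - t) (y - z) (a + b)) (X c \<omega>) (X (D / 2) \<omega>', X D \<omega>' - X (D / 2) \<omega>') \<partial>M) \<partial>M)"
  proof (rule expectation_shift[OF c, where B=1])
    show "(\<lambda>(z, w). case w of (a, b) \<Rightarrow> bridge \<alpha> s (D - s) (y - z) (a + b) * bridge \<alpha> t (D - t) (y - z) (a + b)) \<in> borel_measurable (borel \<Otimes>\<^sub>M (borel \<Otimes>\<^sub>M borel))"
      by measurable
  qed (use D in \<open>auto simp: bridge_mult_bound split: prod.split\<close>)
  then show ?thesis by (simp add: bridge_exc_def)
qed

lemma expectation_eta_eta:
  assumes D: "0 < D" and s: "s \<in> {0<..<D}" and t: "t \<in> {0<..<D}"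
  shows "(\<integral>\<omega>. eta D y k s \<omega> * eta D y k t \<omega> \<partial>M)
    = (\<integral>\<omega>. joint_exc s t (y - X (real k * D) \<omega>) - bridge_exc D s t (y - X (real k * D) \<omega>) \<partial>M)"
proof -
  define c where "c = real k * D"
  have c0: "0 \<le> c" using D by (simp add: c_def)
  have cd: "real (Suc k) * D = c + D" by (simp add: c_def algebra_simps)
  define b where "b s \<omega> = bridge \<alpha> s (D - s) (y - X c \<omega>) (X (c + D) \<omega> - X c \<omega>)" for s \<omega>
  have Xm[measurable]: "X c \<in> borel_measurable M" "X (c + D) \<in> borel_measurable M" using c0 D by auto
  have Xs[measurable]: "X (c + s) \<in> borel_measurable M" "X (c + t) \<in> borel_measurable M" using c0 s t by auto
  have bm[measurable]: "b s \<in> borel_measurable M" for s unfolding b_def by measurable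
  have [measurable]: "eta D y k s \<in> borel_measurable M" "eta D y k t \<in> borel_measurable M"
    using D s t by (auto intro!: eta_measurable)
  have b1: "\<bar>b s \<omega>\<bar> \<le> 1" for s \<omega> by (simp add: b_def bridge_nonneg bridge_le_1)
  have zero: "(\<integral>\<omega>. eta D y k s \<omega> * b t \<omega> \<partial>M) = 0" if "s \<in> {0<..<D}" for s t
  proof -
    have "(\<integral>\<omega>. eta D y k s \<omega> * (\<lambda>v. bridge \<alpha> t (D - t) (y - v c) (v (c + D) - v c)) (\<lambda>r\<in>{c, c + D}. X r \<omega>) \<partial>M) = 0"
      by (rule expectation_eta[OF D that, where B=1])
         (use c0 D in \<open>auto simp: cd c_def[symmetric] bridge_nonneg bridge_le_1 simp del: of_nat_Suc\<close>)
    then show ?thesis by (simp add: b_def)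
  qed
  have eta: "eta D y k s \<omega> = hv y (X (c + s) \<omega>) - b s \<omega>" for s \<omega>
    unfolding eta_def b_def cd by (simp add: c_def)
  have I: "integrable M (\<lambda>\<omega>. f \<omega> * g \<omega>)" if [measurable]: "f \<in> borel_measurable M" "g \<in> borel_measurable M"
    and "\<And>\<omega>. \<bar>f \<omega>\<bar> \<le> 1" "\<And>\<omega>. \<bar>g \<omega>\<bar> \<le> 1" for f g :: "'a \<Rightarrow> real"
    using that by (intro integrable_const_bound[where B=1]) (auto simp: abs_mult intro!: mult_le_one)
  note I1 = I[OF _ _ eta_bound eta_bound] and I2 = I[OF _ _ eta_bound b1] and I3 = I[OF _ _ hv_bounds(3) hv_bounds(3)] and I4 = I[OF _ _ b1 b1]
  \<comment> \<open>The two added terms have mean 0 by orthogonality. With them, the product of the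
    errors becomes the product of the indicators minus the product of the predictions, free of mixed
    terms.\<close>
  have "(\<integral>\<omega>. eta D y k s \<omega> * eta D y k t \<omega> \<partial>M)
      = (\<integral>\<omega>. eta D y k s \<omega> * eta D y k t \<omega> + eta D y k s \<omega> * b t \<omega> + eta D y k t \<omega> * b s \<omega> \<partial>M)"
  proof -
    have i: "integrable M (\<lambda>\<omega>. eta D y k s \<omega> * eta D y k t \<omega>)" "integrable M (\<lambda>\<omega>. eta D y k s \<omega> * b t \<omega>)"
      "integrable M (\<lambda>\<omega>. eta D y k t \<omega> * b s \<omega>)"
      by (auto intro!: I1 I2)
    show ?thesis
      unfolding Bochner_Integration.integral_add[OF Bochner_Integration.integrable_add[OF i(1,2)] i(3)]
        Bochner_Integration.integral_add[OF i(1,2)] by (simp add: zero[OF s] zero[OF t])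
  qed
  also have "\<dots> = (\<integral>\<omega>. hv y (X (c + s) \<omega>) * hv y (X (c + t) \<omega>) - b s \<omega> * b t \<omega> \<partial>M)"
    by (intro Bochner_Integration.integral_cong) (auto simp: eta algebra_simps)
  also have "\<dots> = (\<integral>\<omega>. hv y (X (c + s) \<omega>) * hv y (X (c + t) \<omega>) \<partial>M) - (\<integral>\<omega>. b s \<omega> * b t \<omega> \<partial>M)"
    by (intro Bochner_Integration.integral_diff I3 I4) auto
  also have "\<dots> = (\<integral>\<omega>. joint_exc s t (y - X c \<omega>) \<partial>M) - (\<integral>\<omega>. bridge_exc D s t (y - X c \<omega>) \<partial>M)"
    unfolding b_def using c0 D s t by (simp add: expectation_hv_hv expectation_bridge_bridge)
  also have "\<dots> = (\<integral>\<omega>. joint_exc s t (y - X c \<omega>) - bridge_exc D s t (y - X c \<omega>) \<partial>M)"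
  proof (intro Bochner_Integration.integral_diff[symmetric] integrable_const_bound[where B=1] AE_I2)
    show "(\<lambda>\<omega>. joint_exc s t (y - X c \<omega>)) \<in> borel_measurable M"
      by (rule joint_exc_measurable) (use s t in auto)
    show "(\<lambda>\<omega>. bridge_exc D s t (y - X c \<omega>)) \<in> borel_measurable M"
      by (rule bridge_exc_measurable) (use D in auto)
  qed (use joint_exc_bounds[of s t] bridge_exc_bounds[of D s t] s t D in \<open>auto simp: abs_le_iff\<close>)
  finally show ?thesis by (simp add: c_def)
qed

lemma expectation_xi_sq:
  assumes D: "0 < D"
  shows "(\<integral>\<omega>. xi D y k \<omega> * xi D y k \<omega> \<partial>M) = (\<integral>\<omega>. V D (y - X (real k * D) \<omega>) \<partial>M)"
proof -
  let ?c = "real k * D"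
  define d where "d s t x = joint_exc s t x - bridge_exc D s t x" for s t x
  have [measurable]: "X ?c \<in> borel_measurable M" using D by auto
  interpret T: finite_measure "timed D" by (rule finite_measure_timed)
  have dm: "(\<lambda>w. d (f w) (g w) (h w)) \<in> borel_measurable N"
    if "f \<in> borel_measurable N" "g \<in> borel_measurable N" "h \<in> borel_measurable N"
      "\<And>w. w \<in> space N \<Longrightarrow> 0 < f w" "\<And>w. w \<in> space N \<Longrightarrow> 0 < g w" for f g h and N :: "'x measure"
    unfolding d_def using that D by (intro borel_measurable_diff joint_exc_measurable bridge_exc_measurable)
  have db: "\<bar>d s t x\<bar> \<le> 1" if "0 < s" "0 < t" for s t x
    using that D by (simp add: d_def exc_diff_bound)
  have X2: "(\<lambda>z. y - X ?c (snd z)) \<in> borel_measurable (N \<Otimes>\<^sub>M M)" for N :: "'x measure"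
    by measurable
  have "(\<integral>\<omega>. V D (y - X ?c \<omega>) \<partial>M) = (\<integral>\<omega>. (\<integral>s. (\<integral>t. d s t (y - X ?c \<omega>) \<partial>timed D) \<partial>timed D) \<partial>M)"
    by (simp add: V_def d_def)
  also have "\<dots> = (\<integral>s. (\<integral>\<omega>. (\<integral>t. d s t (y - X ?c \<omega>) \<partial>timed D) \<partial>M) \<partial>timed D)"
  proof (rule Fubini_bounded[where B="D * 1"])
    have "(\<lambda>z. d (fst (fst z)) (snd z) (y - X ?c (snd (fst z)))) \<in> borel_measurable ((timed D \<Otimes>\<^sub>M M) \<Otimes>\<^sub>M timed D)"
      by (rule dm) (auto simp: space_pair_measure intro: measurable_compose[OF measurable_fst X2])
    then have "(\<lambda>z. \<integral>t. d (fst z) t (y - X ?c (snd z)) \<partial>timed D) \<in> borel_measurable (timed D \<Otimes>\<^sub>M M)"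
      by (intro T.borel_measurable_lebesgue_integral) (simp add: case_prod_unfold)
    then show "(\<lambda>(s, \<omega>). \<integral>t. d s t (y - X ?c \<omega>) \<partial>timed D) \<in> borel_measurable (timed D \<Otimes>\<^sub>M M)"
      by (simp add: case_prod_unfold)
    show "\<bar>\<integral>t. d s t (y - X ?c \<omega>) \<partial>timed D\<bar> \<le> D * 1" if "s \<in> space (timed D)" for s \<omega>
      using that D by (intro timed_integral_bound db) auto
  qed unfold_locales
  also have "\<dots> = (\<integral>s. (\<integral>t. (\<integral>\<omega>. d s t (y - X ?c \<omega>) \<partial>M) \<partial>timed D) \<partial>timed D)"
  proof (rule Bochner_Integration.integral_cong[OF refl])
    fix s assume s: "s \<in> space (timed D)"
    show "(\<integral>\<omega>. (\<integral>t. d s t (y - X ?c \<omega>) \<partial>timed D) \<partial>M) = (\<integral>t. (\<integral>\<omega>. d s t (y - X ?c \<omega>) \<partial>M) \<partial>timed D)"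
    proof (rule Fubini_bounded[where B="1"])
      have "(\<lambda>z. d s (fst z) (y - X ?c (snd z))) \<in> borel_measurable (timed D \<Otimes>\<^sub>M M)"
        by (rule dm) (use s in \<open>auto simp: space_pair_measure intro: X2\<close>)
      then show "(\<lambda>(t, \<omega>). d s t (y - X ?c \<omega>)) \<in> borel_measurable (timed D \<Otimes>\<^sub>M M)"
        by (simp add: case_prod_unfold)
    qed (use s in \<open>auto intro!: db finite_measure_timed finite_measure_axioms\<close>)
  qed
  also have "\<dots> = (\<integral>s. (\<integral>t. (\<integral>\<omega>. eta D y k s \<omega> * eta D y k t \<omega> \<partial>M) \<partial>timed D) \<partial>timed D)"
    by (rule Bochner_Integration.integral_cong[OF refl], rule Bochner_Integration.integral_cong[OF refl])
       (simp add: expectation_eta_eta[OF D] d_def)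
  finally show ?thesis using D by (simp add: expectation_xi_xi)
qed

lemma expectation_xi_neq:
  assumes D: "0 < D" and jk: "j \<noteq> k"
  shows "(\<integral>\<omega>. xi D y j \<omega> * xi D y k \<omega> \<partial>M) = 0"
proof -
  have "(\<integral>\<omega>. xi D y j \<omega> * xi D y k \<omega> \<partial>M) = (\<integral>s. (\<integral>t. 0 \<partial>timed D) \<partial>timed D)"
    unfolding expectation_xi_xi[OF D]
    by (intro Bochner_Integration.integral_cong refl) (simp_all add: expectation_eta_eta_neq[OF D jk])
  then show ?thesis by simp
qed

section \<open>The conditional expectation given the observations\<close>

definition proj :: "real \<Rightarrow> real \<Rightarrow> nat \<Rightarrow> 'a \<Rightarrow> real" where
  "proj D y n \<omega> = (\<Sum>k<n. bint D (y - X (real k * D) \<omega>) (X (real (Suc k) * D) \<omega> - X (real k * D) \<omega>))"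

lemma occ_minus_proj:
  assumes "0 < D" "\<omega> \<in> space M"
  shows "occ X (real n * D) y \<omega> - proj D y n \<omega> = (\<Sum>k<n. xi D y k \<omega>)"
  using assms by (simp add: occ_eq_blocks proj_def xi_def xi_eq sum_subtractf del: of_nat_Suc)

lemma bint_bound: "0 < D \<Longrightarrow> \<bar>bint D x z\<bar> \<le> D * 1"
  unfolding bint_def by (intro timed_integral_bound) (auto simp: bridge_nonneg bridge_le_1)

lemma proj_measurable[measurable]: "0 < D \<Longrightarrow> proj D y n \<in> borel_measurable M"
  unfolding proj_def[abs_def] by (intro borel_measurable_sum bint_measurable borel_measurable_diff) auto

lemma proj_bound: "0 < D \<Longrightarrow> \<bar>proj D y n \<omega>\<bar> \<le> real n * D"
proof -
  assume D: "0 < D"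
  have "\<bar>proj D y n \<omega>\<bar> \<le> (\<Sum>k<n. D * 1)"
    unfolding proj_def by (rule order_trans[OF sum_abs]) (intro sum_mono bint_bound D)
  then show ?thesis by simp
qed

lemma integrable_proj: "0 < D \<Longrightarrow> integrable M (proj D y n)"
  by (intro integrable_const_bound[where B="real n * D"]) (auto simp: proj_bound)

lemma integrable_xi: "0 < D \<Longrightarrow> integrable M (xi D y k)"
  by (intro integrable_const_bound[where B="D"]) (auto simp: xi_bound)

lemma integrable_occ: "0 < D \<Longrightarrow> integrable M (occ X (real n * D) y)"
proof -
  assume D: "0 < D"
  have "integrable M (\<lambda>\<omega>. proj D y n \<omega> + (\<Sum>k<n. xi D y k \<omega>))"
    using D by (intro Bochner_Integration.integrable_add Bochner_Integration.integrable_sum integrable_xi integrable_proj)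
  moreover have "proj D y n \<omega> + (\<Sum>k<n. xi D y k \<omega>) = occ X (real n * D) y \<omega>" if "\<omega> \<in> space M" for \<omega>
    using occ_minus_proj[OF D that, of n y] by simp
  ultimately show ?thesis by (simp cong: Bochner_Integration.integrable_cong)
qed

text \<open>The sum of the block predictions is measurable with respect to the observations, and the
  block errors integrate to 0 over every observed event by \<open>expectation_eta\<close>.\<close>

lemma cond_exp_occ:
  assumes D: "0 < D" and n: "0 < n" and T: "T = real n * D"
  shows "AE \<omega> in M. real_cond_exp M (obs_sigma M X T n) (occ X T y) \<omega> = proj D y n \<omega>"
proof -
  have TD: "T / real n = D" using n by (simp add: T)
  have T0: "0 \<le> T" using D by (simp add: T)
  interpret F: finite_measure_subalgebra M "obs_sigma M X T n"
    by unfold_locales (rule obs_sigma_subalgebra[OF T0])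
  show ?thesis
  proof (rule F.real_cond_exp_charact)
    show "integrable M (occ X T y)" "integrable M (proj D y n)"
      unfolding T using D by (auto intro: integrable_occ integrable_proj)
    have sp: "space (obs_sigma M X T n) = space M"
      using obs_sigma_subalgebra[OF T0] by (simp add: subalgebra_def)
    have Xm: "X (real k * D) \<in> borel_measurable (obs_sigma M X T n)" if "k \<le> n" for k
    proof (cases "k = 0")
      case True
      \<comment> \<open>X at time 0 is not one of the observations, but it is constant.\<close>
      have "(\<lambda>\<omega>. 0) \<in> borel_measurable (obs_sigma M X T n)" by simp
      then show ?thesis by (rule measurable_cong[THEN iffD1, rotated]) (simp add: True sp X_0)
    next
      case False
      then show ?thesis
        unfolding obs_sigma_def using T0 that by (intro measurable_gen_sigma) (auto simp: TD[symmetric])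
    qed
    show "proj D y n \<in> borel_measurable (obs_sigma M X T n)"
      unfolding proj_def[abs_def]
      by (intro borel_measurable_sum bint_measurable borel_measurable_diff borel_measurable_const Xm) auto
    fix A assume A: "A \<in> sets (obs_sigma M X T n)"
    then have AM[measurable]: "A \<in> sets M" using obs_sigma_subalgebra[OF T0] by (auto simp: subalgebra_def)
    define S where "S = (\<lambda>k. real k * D) ` {..n}"
    obtain B where B[measurable]: "B \<in> sets (PiM S (\<lambda>_. borel))" and AB: "A = {\<omega> \<in> space M. (\<lambda>r\<in>S. X r \<omega>) \<in> B}"
      using obs_sigma_sets[OF T0 A, of S] by (auto simp: S_def TD)
    have ind: "indicator A \<omega> = (indicator B (\<lambda>r\<in>S. X r \<omega>) :: real)" if "\<omega> \<in> space M" for \<omega>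
      using that by (auto simp: AB indicator_def)
    have zero: "(\<integral>\<omega>. xi D y k \<omega> * indicator A \<omega> \<partial>M) = 0" if k: "k < n" for k
    proof -
      have "(\<integral>\<omega>. xi D y k \<omega> * indicator A \<omega> \<partial>M) = (\<integral>s. (\<integral>\<omega>. eta D y k s \<omega> * indicator A \<omega> \<partial>M) \<partial>timed D)"
        by (rule expectation_xi[OF D, where B=1]) (auto simp: indicator_def)
      also have "\<dots> = (\<integral>s. 0 \<partial>timed D)"
      proof (rule Bochner_Integration.integral_cong[OF refl])
        fix s assume s: "s \<in> space (timed D)"
        have "(\<integral>\<omega>. eta D y k s \<omega> * indicator A \<omega> \<partial>M) = (\<integral>\<omega>. eta D y k s \<omega> * indicator B (\<lambda>r\<in>S. X r \<omega>) \<partial>M)"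
          by (intro Bochner_Integration.integral_cong) (simp_all add: ind)
        also have "\<dots> = 0"
        proof (rule expectation_eta[OF D, where B=1])
          show "S \<inter> {real k * D<..<real (Suc k) * D} = {}"
          proof -
            have "real i * D \<notin> {real k * D<..<real (Suc k) * D}" for i
            proof
              assume "real i * D \<in> {real k * D<..<real (Suc k) * D}"
              then have "real k < real i" "real i < real (Suc k)" using D by (auto simp: mult_less_cancel_right simp del: of_nat_Suc)
              then show False by simp
            qed
            then show ?thesis by (auto simp: S_def simp del: of_nat_Suc)
          qed
          show "real k * D \<in> S" "real (Suc k) * D \<in> S" "finite S" "S \<subseteq> {0..}"
            using k D by (auto simp: S_def simp del: of_nat_Suc)
        qed (use s in \<open>auto simp: indicator_def\<close>)
        finally show "(\<integral>\<omega>. eta D y k s \<omega> * indicator A \<omega> \<partial>M) = 0" .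
      qed
      finally show ?thesis by simp
    qed
    have "(\<integral>\<omega>\<in>A. occ X T y \<omega> \<partial>M) = (\<integral>\<omega>. indicator A \<omega> * proj D y n \<omega> + (\<Sum>k<n. xi D y k \<omega> * indicator A \<omega>) \<partial>M)"
      unfolding set_lebesgue_integral_def
    proof (intro Bochner_Integration.integral_cong refl)
      fix \<omega> assume "\<omega> \<in> space M"
      then have "occ X T y \<omega> = proj D y n \<omega> + (\<Sum>k<n. xi D y k \<omega>)"
        using occ_minus_proj[OF D, of \<omega> n y] by (simp add: T)
      then show "indicator A \<omega> *\<^sub>R occ X T y \<omega> = indicator A \<omega> * proj D y n \<omega> + (\<Sum>k<n. xi D y k \<omega> * indicator A \<omega>)"
        by (simp add: algebra_simps sum_distrib_left)
    qed
    also have "\<dots> = (\<integral>\<omega>. indicator A \<omega> * proj D y n \<omega> \<partial>M) + (\<Sum>k<n. \<integral>\<omega>. xi D y k \<omega> * indicator A \<omega> \<partial>M)"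
    proof (subst Bochner_Integration.integral_add)
      have i: "integrable M (\<lambda>\<omega>. xi D y k \<omega> * indicator A \<omega>)" for k
        using integrable_xi[OF D] by (rule integrable_real_mult_indicator[OF AM])
      show "integrable M (\<lambda>\<omega>. indicator A \<omega> * proj D y n \<omega>)"
        using integrable_real_mult_indicator[OF AM integrable_proj[OF D]] by (simp add: mult.commute)
      show "integrable M (\<lambda>\<omega>. \<Sum>k<n. xi D y k \<omega> * indicator A \<omega>)" by (intro Bochner_Integration.integrable_sum i)
      show "(\<integral>\<omega>. indicator A \<omega> * proj D y n \<omega> \<partial>M) + (\<integral>\<omega>. (\<Sum>k<n. xi D y k \<omega> * indicator A \<omega>) \<partial>M)
        = (\<integral>\<omega>. indicator A \<omega> * proj D y n \<omega> \<partial>M) + (\<Sum>k<n. \<integral>\<omega>. xi D y k \<omega> * indicator A \<omega> \<partial>M)"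
        by (subst Bochner_Integration.integral_sum) (auto intro: i)
    qed
    also have "\<dots> = (\<integral>\<omega>\<in>A. proj D y n \<omega> \<partial>M)"
      by (simp add: zero set_lebesgue_integral_def)
    finally show "(\<integral>\<omega>\<in>A. occ X T y \<omega> \<partial>M) = (\<integral>\<omega>\<in>A. proj D y n \<omega> \<partial>M)" .
  qed
qed

text \<open>The error is the second moment of the sum of the block errors. Distinct blocks are
  orthogonal, and a diagonal term is the average of \<open>V\<close> over the starting point of its
  block.\<close>

theorem approx_err_eq:
  assumes D: "0 < D" and n: "0 < n" and T: "T = real n * D"
  shows "approx_err M X T y n = (\<Sum>k<n. \<integral>\<omega>. V D (y - X (real k * D) \<omega>) \<partial>M)"
proof -
  have [measurable]: "occ X T y \<in> borel_measurable M" using integrable_occ[OF D, of n y] by (auto simp: T)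
  have [measurable]: "proj D y n \<in> borel_measurable M" using D by simp
  have [measurable]: "xi D y k \<in> borel_measurable M" for k using D by simp
  have "0 \<le> T" using D by (simp add: T)
  note subalg = obs_sigma_subalgebra[OF this, of n]
  have [measurable]: "real_cond_exp M (obs_sigma M X T n) (occ X T y) \<in> borel_measurable M"
    by (rule measurable_from_subalg[OF subalg]) simp
  have "approx_err M X T y n = (\<integral>\<omega>. (\<Sum>k<n. xi D y k \<omega>)\<^sup>2 \<partial>M)"
    unfolding approx_err_def
  proof (intro integral_cong_AE)
    show "AE \<omega> in M. (real_cond_exp M (obs_sigma M X T n) (occ X T y) \<omega> - occ X T y \<omega>)\<^sup>2 = (\<Sum>k<n. xi D y k \<omega>)\<^sup>2"
      using cond_exp_occ[OF D n T, of y] AE_space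
    proof eventually_elim
      case (elim \<omega>)
      have "(proj D y n \<omega> - occ X T y \<omega>)\<^sup>2 = (occ X T y \<omega> - proj D y n \<omega>)\<^sup>2"
        by (rule power2_commute)
      then show ?case using occ_minus_proj[OF D elim(2), of n y] elim(1) by (simp add: T)
    qed
  qed measurable
  also have "\<dots> = (\<integral>\<omega>. (\<Sum>j<n. \<Sum>k<n. xi D y j \<omega> * xi D y k \<omega>) \<partial>M)"
    by (simp add: power2_eq_square sum_product)
  also have "\<dots> = (\<Sum>j<n. \<Sum>k<n. \<integral>\<omega>. xi D y j \<omega> * xi D y k \<omega> \<partial>M)"
  proof -
    have "integrable M (\<lambda>\<omega>. xi D y j \<omega> * xi D y k \<omega>)" for j k
      using xi_bound[OF D, of y] D by (intro integrable_const_bound[where B="D * D"]) (auto simp: abs_mult intro!: mult_mono)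
    then show ?thesis by (subst Bochner_Integration.integral_sum | auto intro!: sum.cong Bochner_Integration.integral_sum)+
  qed
  also have "\<dots> = (\<Sum>j<n. \<Sum>k<n. if k = j then \<integral>\<omega>. V D (y - X (real j * D) \<omega>) \<partial>M else 0)"
    using D by (intro sum.cong refl) (auto simp: expectation_xi_sq expectation_xi_neq)
  also have "\<dots> = (\<Sum>k<n. \<integral>\<omega>. V D (y - X (real k * D) \<omega>) \<partial>M)"
    by simp
  finally show ?thesis .
qed

lemma approx_err_1: "0 < D \<Longrightarrow> approx_err M X D y 1 = V D y"
proof -
  assume D: "0 < D"
  have "(\<integral>\<omega>. V D (y - X 0 \<omega>) \<partial>M) = (\<integral>\<omega>. V D y \<partial>M)"
    by (intro Bochner_Integration.integral_cong) (auto simp: X_0)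
  then show ?thesis using approx_err_eq[OF D, of 1 D y] by (simp add: prob_space)
qed

subsection \<open>Self-similarity and reflection\<close>

text \<open>The condition is what keeps the exponent |u|^\<alpha> (t - s) unchanged. A negative
  \<open>a\<close> is included: a = -1 with D = 1 is the reflection, a = D^(-1/\<alpha>) the
  self-similarity.\<close>

lemma stable_process_scaled:
  assumes D: "0 < D" and a: "\<bar>a\<bar> powr \<alpha> * D = 1"
  shows "stable_process M \<alpha> (\<lambda>s \<omega>. a * X (D * s) \<omega>)"
proof -
  have "sym_stable_levy M \<alpha> (\<lambda>s \<omega>. a * X (D * s) \<omega>)"
    unfolding sym_stable_levy_def
  proof (intro conjI ballI allI impI)
    fix t :: real assume "0 \<le> t"
    then show "(\<lambda>\<omega>. a * X (D * t) \<omega>) \<in> borel_measurable M" using D by auto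
  next
    fix \<omega> assume "\<omega> \<in> space M" then show "a * X (D * 0) \<omega> = 0" by (simp add: X_0)
  next
    fix \<omega> t assume \<omega>: "\<omega> \<in> space M" and t: "(0::real) \<le> t"
    have "continuous (at_right (D * t)) (\<lambda>s. X s \<omega>)"
      using levy \<omega> t D by (auto simp: sym_stable_levy_def)
    then have "((\<lambda>s. X s \<omega>) \<longlongrightarrow> X (D * t) \<omega>) (at_right (D * t))" by (simp add: continuous_within)
    moreover have "filterlim (\<lambda>s. D * s) (at_right (D * t)) (at_right t)"
      unfolding filterlim_at using D
      by (auto intro!: tendsto_eq_intros simp: eventually_at_filter)
    ultimately have "((\<lambda>s. X (D * s) \<omega>) \<longlongrightarrow> X (D * t) \<omega>) (at_right t)"
      by (rule filterlim_compose)
    then show "continuous (at_right t) (\<lambda>s. a * X (D * s) \<omega>)"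
      unfolding continuous_within by (intro tendsto_mult tendsto_const)
  next
    fix \<omega> t assume \<omega>: "\<omega> \<in> space M" and t: "(0::real) < t"
    obtain l where l: "((\<lambda>s. X s \<omega>) \<longlongrightarrow> l) (at_left (D * t))"
      using levy \<omega> t D by (fastforce simp: sym_stable_levy_def)
    have "filterlim (\<lambda>s. D * s) (at_left (D * t)) (at_left t)"
      unfolding filterlim_at using D
      by (auto intro!: tendsto_eq_intros simp: eventually_at_filter)
    with l have "((\<lambda>s. X (D * s) \<omega>) \<longlongrightarrow> l) (at_left t)"
      by (rule filterlim_compose)
    then show "\<exists>l. ((\<lambda>s. a * X (D * s) \<omega>) \<longlongrightarrow> l) (at_left t)"
      by (intro exI[of _ "a * l"] tendsto_mult tendsto_const)
  next
    fix ts :: "nat \<Rightarrow> real" and n assume "0 \<le> ts 0" "\<forall>i<n. ts i < ts (Suc i)"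
    then have "indep_vars (\<lambda>_. borel) (\<lambda>i \<omega>. X (D * ts (Suc i)) \<omega> - X (D * ts i) \<omega>) {..<n}"
      using D by (intro indep_increments[of "\<lambda>i. D * ts i"]) auto
    then have "indep_vars (\<lambda>_. borel) (\<lambda>i \<omega>. a * (X (D * ts (Suc i)) \<omega> - X (D * ts i) \<omega>)) {..<n}"
      by (rule indep_vars_compose2) auto
    then show "indep_vars (\<lambda>_. borel) (\<lambda>i \<omega>. a * X (D * ts (Suc i)) \<omega> - a * X (D * ts i) \<omega>) {..<n}"
      by (simp add: right_diff_distrib)
  next
    fix s t :: real assume st: "0 \<le> s" "s \<le> t"
    have [measurable]: "X (D * s) \<in> borel_measurable M" "X (D * t) \<in> borel_measurable M" using st D by auto
    have "char (distr M borel (\<lambda>\<omega>. a * X (D * t) \<omega> - a * X (D * s) \<omega>)) u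
      = complex_of_real (exp (- (\<bar>u\<bar> powr \<alpha>) * (t - s)))" for u
    proof -
      have "char (distr M borel (\<lambda>\<omega>. a * X (D * t) \<omega> - a * X (D * s) \<omega>)) u
        = (\<integral>\<omega>. iexp (u * (a * X (D * t) \<omega> - a * X (D * s) \<omega>)) \<partial>M)"
        unfolding char_def by (subst integral_distr) auto
      also have "\<dots> = (\<integral>\<omega>. iexp ((u * a) * (X (D * t) \<omega> - X (D * s) \<omega>)) \<partial>M)"
        by (simp add: algebra_simps)
      also have "\<dots> = char (distr M borel (\<lambda>\<omega>. X (D * t) \<omega> - X (D * s) \<omega>)) (u * a)"
        unfolding char_def by (subst integral_distr) auto
      also have "\<dots> = complex_of_real (exp (- (\<bar>u * a\<bar> powr \<alpha>) * (D * t - D * s)))"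
        using char_increment[of "D * s" "D * t"] st D by simp
      also have "\<bar>u * a\<bar> powr \<alpha> * (D * t - D * s) = \<bar>u\<bar> powr \<alpha> * (t - s)"
      proof -
        have "\<bar>u * a\<bar> powr \<alpha> * (D * t - D * s) = \<bar>u\<bar> powr \<alpha> * (t - s) * (\<bar>a\<bar> powr \<alpha> * D)"
          by (simp add: abs_mult powr_mult algebra_simps)
        then show ?thesis using a by simp
      qed
      then have "- (\<bar>u * a\<bar> powr \<alpha>) * (D * t - D * s) = - (\<bar>u\<bar> powr \<alpha>) * (t - s)" by simp
      finally show ?thesis .
    qed
    then show "char (distr M borel (\<lambda>\<omega>. a * X (D * t) \<omega> - a * X (D * s) \<omega>)) =
      (\<lambda>u. complex_of_real (exp (- (\<bar>u\<bar> powr \<alpha>) * (t - s))))" by auto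
  qed
  then show ?thesis by unfold_locales (simp_all add: \<alpha>_pos)
qed

text \<open>Laws at two times are fixed by \<alpha>, since the increments of both processes have the
  same joint density. \<open>V\<close> involves the process at no more than two times, so this
  suffices to transfer it.\<close>

lemma expectation_two_law:
  fixes f :: "real \<Rightarrow> real \<Rightarrow> real"
  assumes Y: "stable_process M \<alpha> Y" and st: "0 < s" "s < t"
    and [measurable]: "(\<lambda>(a, b). f a b) \<in> borel_measurable (borel \<Otimes>\<^sub>M borel)"
  shows "(\<integral>\<omega>. f (Y s \<omega>) (Y t \<omega>) \<partial>M) = (\<integral>\<omega>. f (X s \<omega>) (X t \<omega>) \<partial>M)"
proof -
  interpret Y: stable_process M \<alpha> Y by fact
  have [measurable]: "X s \<in> borel_measurable M" "X t \<in> borel_measurable M" "X 0 \<in> borel_measurable M"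
    "Y s \<in> borel_measurable M" "Y t \<in> borel_measurable M" "Y 0 \<in> borel_measurable M"
    using st by auto
  have [measurable]: "(\<lambda>(a, b). f a (a + b)) \<in> borel_measurable (lborel \<Otimes>\<^sub>M lborel)"
    "(\<lambda>(a, b). f a (a + b)) \<in> borel_measurable (borel \<Otimes>\<^sub>M borel)"
    by measurable
  have eq: "(\<integral>\<omega>. f (Z s \<omega>) (Z t \<omega>) \<partial>M) = (\<integral>w. (\<lambda>(a, b). f a (a + b)) w \<partial>distr M (lborel \<Otimes>\<^sub>M lborel) (\<lambda>\<omega>. (Z s \<omega> - Z 0 \<omega>, Z t \<omega> - Z s \<omega>)))"
    if [measurable]: "Z s \<in> borel_measurable M" "Z t \<in> borel_measurable M" "Z 0 \<in> borel_measurable M"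
      and z: "\<And>\<omega>. \<omega> \<in> space M \<Longrightarrow> Z 0 \<omega> = 0" for Z :: "real \<Rightarrow> 'a \<Rightarrow> real"
    by (subst integral_distr) (auto intro!: Bochner_Integration.integral_cong simp: z)
  have "distr M (lborel \<Otimes>\<^sub>M lborel) (\<lambda>\<omega>. (X s \<omega> - X 0 \<omega>, X t \<omega> - X s \<omega>)) = distr M (lborel \<Otimes>\<^sub>M lborel) (\<lambda>\<omega>. (Y s \<omega> - Y 0 \<omega>, Y t \<omega> - Y s \<omega>))"
    using distributed_distr_eq_density[OF distributed_two_increments[of 0 s t]]
      distributed_distr_eq_density[OF Y.distributed_two_increments[of 0 s t]] st by simp
  then show ?thesis
    by (subst (1 2) eq) (auto simp: X_0 Y.X_0)
qed

lemma expectation_one_law: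
  fixes f :: "real \<Rightarrow> real"
  assumes Y: "stable_process M \<alpha> Y" and s: "0 < s" and [measurable]: "f \<in> borel_measurable borel"
  shows "(\<integral>\<omega>. f (Y s \<omega>) \<partial>M) = (\<integral>\<omega>. f (X s \<omega>) \<partial>M)"
  using expectation_two_law[OF Y s, of "s + 1" "\<lambda>a b. f a"] by simp

lemma joint_exc_commute: "joint_exc s t x = joint_exc t s x"
  by (simp add: joint_exc_def mult.commute)

lemma joint_exc_law:
  assumes Y: "stable_process M \<alpha> Y" and st: "0 < s" "0 < t"
  shows "(\<integral>\<omega>. hv x (Y s \<omega>) * hv x (Y t \<omega>) \<partial>M) = joint_exc s t x"
proof -
  consider "s < t" | "t < s" | "s = t" by linarith
  then show ?thesis
  proof cases
    case 1 then show ?thesis unfolding joint_exc_def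
      using expectation_two_law[OF Y, of s t "\<lambda>a b. hv x a * hv x b"] st by simp
  next
    case 2 then show ?thesis unfolding joint_exc_def
      using expectation_two_law[OF Y, of t s "\<lambda>a b. hv x b * hv x a"] st by simp
  next
    case 3 then show ?thesis unfolding joint_exc_def
      using expectation_one_law[OF Y, of t "\<lambda>a. hv x a * hv x a"] st by simp
  qed
qed

lemma scaled_process:
  assumes "0 < D"
  shows "stable_process M \<alpha> (\<lambda>s \<omega>. D powr (- 1 / \<alpha>) * X (D * s) \<omega>)"
proof (rule stable_process_scaled[OF assms])
  have "(D powr (- 1 / \<alpha>)) powr \<alpha> = D powr (- 1)" using \<alpha>_pos by (simp add: powr_powr)
  then show "\<bar>D powr (- 1 / \<alpha>)\<bar> powr \<alpha> * D = 1" using assms by (simp add: powr_minus)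
qed

lemma hv_scale: "0 < a \<Longrightarrow> hv x (a * u) = hv (x / a) u"
  by (simp add: hv_def field_simps)

lemma joint_exc_scale:
  assumes D: "0 < D" and st: "0 < s" "0 < t"
  shows "joint_exc (D * s) (D * t) (D powr (1 / \<alpha>) * x) = joint_exc s t x"
proof -
  have "x / D powr (- 1 / \<alpha>) = D powr (1 / \<alpha>) * x" using D by (simp add: powr_minus field_simps)
  moreover have "0 < D powr (- 1 / \<alpha>)" using D by simp
  ultimately show ?thesis
    using joint_exc_law[OF scaled_process[OF D] st, of x] by (simp add: joint_exc_def hv_scale)
qed

text \<open>The substitution v -> D^(1/\<alpha>) v contributes a factor D^(1/\<alpha>), and each of
  the two densities contributes D^(-1/\<alpha>).\<close>

lemma bridge_num_scale:
  assumes D: "0 < D" and ab: "0 < a" "0 < b"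
  shows "bridge_num \<alpha> (D * a) (D * b) (D powr (1 / \<alpha>) * x) (D powr (1 / \<alpha>) * z)
    = ennreal (D powr (- 1 / \<alpha>)) * bridge_num \<alpha> a b x z"
proof -
  define k where "k = D powr (1 / \<alpha>)"
  have k: "0 < k" "D powr (- 1 / \<alpha>) = 1 / k" using D by (auto simp: k_def powr_minus field_simps)
  have sc: "p (D * t) (k * u) = 1 / k * p t u" if "0 < t" for t u
    using stable_dens_scale[OF \<alpha>_pos that D, of u] k by (simp add: k_def)
  have "bridge_num \<alpha> (D * a) (D * b) (k * x) (k * z) = ennreal \<bar>k\<bar> * (\<integral>\<^sup>+v. (if k * x \<le> k * z - (0 + k * v) then 1 else 0) *
     (ennreal (p (D * a) (k * z - (0 + k * v))) * ennreal (p (D * b) (0 + k * v))) \<partial>lborel)"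
    unfolding bridge_num_def using k by (subst nn_integral_real_affine[where c=k and t=0]) auto
  also have "\<dots> = ennreal k * (\<integral>\<^sup>+v. ennreal (1 / k * (1 / k)) * ((if x \<le> z - v then 1 else 0) * (ennreal (p a (z - v)) * ennreal (p b v))) \<partial>lborel)"
  proof -
    have "(if k * x \<le> k * z - (0 + k * v) then 1 else 0) * (ennreal (p (D * a) (k * z - (0 + k * v))) * ennreal (p (D * b) (0 + k * v)))
      = ennreal (1 / k * (1 / k)) * ((if x \<le> z - v then 1 else 0) * (ennreal (p a (z - v)) * ennreal (p b v)))" for v
    proof -
      have "(k * x \<le> k * z - (0 + k * v)) = (x \<le> z - v)"
        using k by (simp add: right_diff_distrib[symmetric])
      moreover have "k * z - (0 + k * v) = k * (z - v)" by (simp add: algebra_simps)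
      ultimately show ?thesis using ab k p_nonneg[OF ab(1)] p_nonneg[OF ab(2)]
        by (simp add: sc ennreal_mult[symmetric])
    qed
    then show ?thesis using k by simp
  qed
  also have "\<dots> = ennreal k * (ennreal (1 / k * (1 / k)) * bridge_num \<alpha> a b x z)"
    unfolding bridge_num_def by (subst nn_integral_cmult) auto
  also have "\<dots> = ennreal (1 / k) * bridge_num \<alpha> a b x z"
    using k by (simp add: mult.assoc[symmetric] ennreal_mult[symmetric])
  finally show ?thesis unfolding k(2) unfolding k_def .
qed

text \<open>Numerator and density scale by the same factor, which cancels.\<close>

lemma bridge_scale:
  assumes D: "0 < D" and ab: "0 < a" "0 < b"
  shows "bridge \<alpha> (D * a) (D * b) (D powr (1 / \<alpha>) * x) (D powr (1 / \<alpha>) * z) = bridge \<alpha> a b x z"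
proof -
  let ?r = "D powr (- 1 / \<alpha>)"
  have r: "0 < ?r" using D by simp
  have "p (D * a + D * b) (D powr (1 / \<alpha>) * z) = ?r * p (a + b) z"
    using stable_dens_scale[OF \<alpha>_pos _ D, of "a + b" z] ab by (simp add: distrib_left)
  then have "p (D * a + D * b) (D powr (1 / \<alpha>) * z) = p (a + b) z * ?r" by (simp only: mult.commute)
  then have e: "ennreal (p (D * a + D * b) (D powr (1 / \<alpha>) * z)) = ennreal (p (a + b) z) * ennreal ?r"
    using r ab p_nonneg[of "a + b" z] by (simp only: ennreal_mult less_imp_le add_pos_pos)
  have r0: "ennreal ?r \<noteq> 0" "ennreal ?r \<noteq> \<infinity>" using r by (auto simp: ennreal_eq_0_iff)
  show ?thesis
    unfolding bridge_def bridge_num_scale[OF D ab] e mult.commute[of "ennreal ?r"] divide_mult_eq[OF r0] ..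
qed

lemma bridge_exc_scale:
  assumes D: "0 < D" and st: "s \<in> {0<..<1}" "t \<in> {0<..<1}"
  shows "bridge_exc D (D * s) (D * t) (D powr (1 / \<alpha>) * x) = bridge_exc 1 s t x"
proof -
  have k: "D powr (1 / \<alpha>) * (D powr (- 1 / \<alpha>) * z) = z" for z
    using D by (simp add: powr_minus)
  have b: "bridge \<alpha> (D * s) (D - D * s) (D powr (1 / \<alpha>) * x) z = bridge \<alpha> s (1 - s) x (D powr (- 1 / \<alpha>) * z)"
    if "s \<in> {0<..<1}" for s z
    using bridge_scale[OF D, of s "1 - s" x "D powr (- 1 / \<alpha>) * z"] that unfolding k by (simp add: right_diff_distrib)
  have [measurable]: "X D \<in> borel_measurable M" "X 1 \<in> borel_measurable M" using D by auto
  have "bridge_exc D (D * s) (D * t) (D powr (1 / \<alpha>) * x)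
    = (\<integral>\<omega>. (\<lambda>z. bridge \<alpha> s (1 - s) x z * bridge \<alpha> t (1 - t) x z) (D powr (- 1 / \<alpha>) * X (D * 1) \<omega>) \<partial>M)"
    using st by (simp add: bridge_exc_def b)
  also have "\<dots> = (\<integral>\<omega>. (\<lambda>z. bridge \<alpha> s (1 - s) x z * bridge \<alpha> t (1 - t) x z) (X 1 \<omega>) \<partial>M)"
    by (rule expectation_one_law[OF scaled_process[OF D]]) auto
  finally show ?thesis by (simp add: bridge_exc_def)
qed

lemma integral_timed_scale:
  fixes f :: "real \<Rightarrow> real"
  assumes D: "0 < D"
  shows "(\<integral>s. f s \<partial>timed D) = D * (\<integral>s. f (D * s) \<partial>timed 1)"
proof -
  have "(\<integral>s. f s \<partial>timed D) = \<bar>D\<bar> *\<^sub>R (LINT s|lborel. indicator {0<..<D} (0 + D * s) * f (0 + D * s))"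
    unfolding integral_timed using D by (intro lborel_integral_real_affine) auto
  also have "\<dots> = D * (\<integral>s. f (D * s) \<partial>timed 1)"
    unfolding integral_timed using D
    by (auto intro!: Bochner_Integration.integral_cong simp: indicator_def zero_less_mult_iff)
  finally show ?thesis .
qed

text \<open>The integrand is invariant under the joint scaling of the times and the level, and each
  of the two time integrals contributes a factor D.\<close>

theorem V_scale:
  assumes D: "0 < D"
  shows "V D x = D\<^sup>2 * V 1 (D powr (- 1 / \<alpha>) * x)"
proof -
  define x' where "x' = D powr (- 1 / \<alpha>) * x"
  have x: "x = D powr (1 / \<alpha>) * x'" using D by (simp add: x'_def powr_minus)
  have "V D x = D * (\<integral>s. D * (\<integral>t. joint_exc (D * s) (D * t) x - bridge_exc D (D * s) (D * t) x \<partial>timed 1) \<partial>timed 1)"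
    unfolding V_def by (subst (1 2) integral_timed_scale[OF D]) rule
  also have "\<dots> = D * (\<integral>s. D * (\<integral>t. joint_exc s t x' - bridge_exc 1 s t x' \<partial>timed 1) \<partial>timed 1)"
  proof -
    have "(\<integral>t. joint_exc (D * s) (D * t) x - bridge_exc D (D * s) (D * t) x \<partial>timed 1) = (\<integral>t. joint_exc s t x' - bridge_exc 1 s t x' \<partial>timed 1)"
      if "s \<in> space (timed 1)" for s
      using that D by (intro Bochner_Integration.integral_cong refl) (simp add: x joint_exc_scale bridge_exc_scale)
    then have "(\<integral>s. D * (\<integral>t. joint_exc (D * s) (D * t) x - bridge_exc D (D * s) (D * t) x \<partial>timed 1) \<partial>timed 1)
      = (\<integral>s. D * (\<integral>t. joint_exc s t x' - bridge_exc 1 s t x' \<partial>timed 1) \<partial>timed 1)"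
      by (intro Bochner_Integration.integral_cong[OF refl]) (rule arg_cong)
    then show ?thesis by (rule arg_cong)
  qed
  also have "\<dots> = D\<^sup>2 * V 1 x'"
    by (simp add: V_def power2_eq_square)
  finally show ?thesis by (simp add: x'_def)
qed

text \<open>A single observation at the horizon 1 generates the same sigma-algebra as X at time 1,
  so this is the approximation error with one block.\<close>

lemma integral_cond_var: "(\<integral>\<omega>. cond_var M (gen_sigma M {X 1}) (occ X 1 x) \<omega> \<partial>M) = V 1 x"
proof -
  let ?F = "gen_sigma M {X 1}"
  have F: "obs_sigma M X 1 1 = ?F"
    unfolding obs_sigma_def by (rule arg_cong[where f="gen_sigma M"]) auto
  have sub: "subalgebra M ?F" using obs_sigma_subalgebra[of 1 1] F by simp
  interpret F: finite_measure_subalgebra M ?F by unfold_locales (rule sub)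
  have io: "integrable M (occ X 1 x)" using integrable_occ[of 1 1 x] by simp
  have [measurable]: "occ X 1 x \<in> borel_measurable M" using io by auto
  have [measurable]: "real_cond_exp M ?F (occ X 1 x) \<in> borel_measurable M"
    by (rule measurable_from_subalg[OF sub]) simp
  have ae: "AE \<omega> in M. real_cond_exp M ?F (occ X 1 x) \<omega> = proj 1 x 1 \<omega>"
    using cond_exp_occ[of 1 1 1 x] F by simp
  have "integrable M (\<lambda>\<omega>. (occ X 1 x \<omega> - real_cond_exp M ?F (occ X 1 x) \<omega>)\<^sup>2)"
  proof (rule integrable_const_bound[where B=1])
    show "AE \<omega> in M. norm ((occ X 1 x \<omega> - real_cond_exp M ?F (occ X 1 x) \<omega>)\<^sup>2) \<le> 1"
      using ae AE_space
    proof eventually_elim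
      case (elim \<omega>)
      have "occ X 1 x \<omega> - proj 1 x 1 \<omega> = xi 1 x 0 \<omega>"
        using occ_minus_proj[of 1 \<omega> 1 x] elim by simp
      then show ?case using xi_bound[of 1 x 0 \<omega>] elim by (simp add: abs_square_le_1)
    qed
  qed measurable
  then have "(\<integral>\<omega>. cond_var M ?F (occ X 1 x) \<omega> \<partial>M) = (\<integral>\<omega>. (occ X 1 x \<omega> - real_cond_exp M ?F (occ X 1 x) \<omega>)\<^sup>2 \<partial>M)"
    unfolding cond_var_def by (rule F.real_cond_exp_int(2))
  also have "\<dots> = approx_err M X 1 x 1"
    unfolding approx_err_def F by (simp add: power2_commute)
  finally show ?thesis using approx_err_1[of 1 x] by simp
qed

lemma V_nonneg: "0 < D \<Longrightarrow> 0 \<le> V D x"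
  by (subst approx_err_1[symmetric]) (auto simp: approx_err_def)

section \<open>Reflection symmetry and control of \<open>V\<close> by tail probabilities\<close>

definition tail_prob :: "real \<Rightarrow> real \<Rightarrow> real" where
  "tail_prob s x = (\<integral>\<omega>. hv x (X s \<omega>) \<partial>M)"

lemma bridge_num_minus:
  assumes "0 < a" "0 < b"
  shows "bridge_num \<alpha> a b (- x) (- z) = (\<integral>\<^sup>+v. (if z - v \<le> x then 1 else 0) * (ennreal (p a (z - v)) * ennreal (p b v)) \<partial>lborel)"
proof -
  have "bridge_num \<alpha> a b (- x) (- z) = ennreal \<bar>-1\<bar> * (\<integral>\<^sup>+v. (if - x \<le> - z - (0 + (-1) * v) then 1 else 0) *
     (ennreal (p a (- z - (0 + (-1) * v))) * ennreal (p b (0 + (-1) * v))) \<partial>lborel)"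
    unfolding bridge_num_def by (subst nn_integral_real_affine[where c="-1" and t=0]) auto
  also have "\<dots> = (\<integral>\<^sup>+v. (if z - v \<le> x then 1 else 0) * (ennreal (p a (z - v)) * ennreal (p b v)) \<partial>lborel)"
  proof -
    have "(if - x \<le> - z - (0 + (-1) * v) then 1 else 0) * (ennreal (p a (- z - (0 + (-1) * v))) * ennreal (p b (0 + (-1) * v)))
      = (if z - v \<le> x then 1 else 0) * (ennreal (p a (z - v)) * ennreal (p b v))" for v
      using stable_dens_minus[of \<alpha> a "z - v"] stable_dens_minus[of \<alpha> b v] \<alpha>_pos by (simp add: algebra_simps)
    then show ?thesis by simp
  qed
  finally show ?thesis .
qed

text \<open>Reflection exchanges the event with its complement, up to a single value of v. The two
  numerators therefore add up to the convolution, that is, to the density, by which one may divide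
  where it is positive.\<close>

lemma bridge_minus:
  assumes ab: "0 < a" "0 < b"
  shows "AE z in lborel. 0 < p (a + b) z \<longrightarrow> bridge \<alpha> a b (- x) (- z) = 1 - bridge \<alpha> a b x z"
proof -
  have ae2: "AE z in lborel. ennreal (bridge \<alpha> a b (- x) (0 + (-1) * z)) * ennreal (p (a + b) (0 + (-1) * z)) = bridge_num \<alpha> a b (- x) (0 + (-1) * z)"
    using bridge_times_density[OF ab] by (intro AE_borel_affine) auto
  show ?thesis
    using bridge_times_density[OF ab, of x] ae2 convolution_p[OF ab]
  proof eventually_elim
    case (elim z)
    have m: "p (a + b) (- z) = p (a + b) z" by (rule stable_dens_minus[OF \<alpha>_pos])
    have "bridge_num \<alpha> a b x z + bridge_num \<alpha> a b (- x) (- z)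
      = (\<integral>\<^sup>+v. ((if x \<le> z - v then 1 else 0) + (if z - v \<le> x then 1 else 0)) * (ennreal (p a (z - v)) * ennreal (p b v)) \<partial>lborel)"
      unfolding bridge_num_minus[OF ab] unfolding bridge_num_def
      by (subst nn_integral_add[symmetric]) (auto simp: distrib_right intro!: nn_integral_cong)
    also have "\<dots> = (\<integral>\<^sup>+v. ennreal (p a (z - v)) * ennreal (p b v) \<partial>lborel)"
      by (intro nn_integral_cong_AE eventually_mono[OF AE_lborel_singleton[of "z - x"]]) auto
    also have "\<dots> = ennreal (p (a + b) z)" by (rule elim(3))
    finally have "ennreal (bridge \<alpha> a b x z) * ennreal (p (a + b) z) + ennreal (bridge \<alpha> a b (- x) (- z)) * ennreal (p (a + b) z) = ennreal (p (a + b) z)"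
      using elim(1,2) m by simp
    then have "ennreal ((bridge \<alpha> a b x z + bridge \<alpha> a b (- x) (- z)) * p (a + b) z) = ennreal (p (a + b) z)"
      using p_nonneg[of "a + b" z] ab by (simp add: ennreal_mult ennreal_plus bridge_nonneg distrib_right)
    then have "(bridge \<alpha> a b x z + bridge \<alpha> a b (- x) (- z)) * p (a + b) z = p (a + b) z"
      using p_nonneg[of "a + b" z] ab by (simp add: ennreal_inj bridge_nonneg)
    then show ?case by auto
  qed
qed

text \<open>X at time D almost surely avoids the zeros of its density.\<close>

lemma AE_X:
  assumes D: "0 < D" and [measurable]: "Measurable.pred borel P" and P: "AE z in lborel. 0 < p D z \<longrightarrow> P z"
  shows "AE \<omega> in M. P (X D \<omega>)"
proof -
  have [measurable]: "X D \<in> borel_measurable M" using D by auto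
  have "AE z in distr M lborel (X D). P z"
    unfolding distributed_distr_eq_density[OF distributed_X[OF D]]
    using P by (subst AE_density) (auto simp: ennreal_less_zero_iff)
  then show ?thesis by (subst (asm) AE_distr_iff) auto
qed

lemma expectation_bridge_X:
  assumes s: "s \<in> {0<..<D}" and F: "F \<in> borel_measurable borel" "\<And>x. \<bar>F x\<bar> \<le> B"
  shows "(\<integral>\<omega>. bridge \<alpha> s (D - s) x (X D \<omega>) * F (X D \<omega>) \<partial>M) = (\<integral>\<omega>. hv x (X s \<omega>) * F (X D \<omega>) \<partial>M)"
proof -
  have "(\<integral>\<omega>. (if x \<le> X s \<omega> - X 0 \<omega> then 1 else 0) * F (X D \<omega> - X 0 \<omega>) \<partial>M)
    = (\<integral>\<omega>. bridge \<alpha> (s - 0) (D - s) x (X D \<omega> - X 0 \<omega>) * F (X D \<omega> - X 0 \<omega>) \<partial>M)"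
    by (rule expectation_bridge) (use s F in auto)
  moreover have "(\<integral>\<omega>. (if x \<le> X s \<omega> - X 0 \<omega> then 1 else 0) * F (X D \<omega> - X 0 \<omega>) \<partial>M) = (\<integral>\<omega>. hv x (X s \<omega>) * F (X D \<omega>) \<partial>M)"
    by (intro Bochner_Integration.integral_cong) (auto simp: X_0 hv_def)
  moreover have "(\<integral>\<omega>. bridge \<alpha> (s - 0) (D - s) x (X D \<omega> - X 0 \<omega>) * F (X D \<omega> - X 0 \<omega>) \<partial>M) = (\<integral>\<omega>. bridge \<alpha> s (D - s) x (X D \<omega>) * F (X D \<omega>) \<partial>M)"
    by (intro Bochner_Integration.integral_cong) (auto simp: X_0)
  ultimately show ?thesis by simp
qed

lemma expectation_bridge_tail_prob: "s \<in> {0<..<D} \<Longrightarrow> (\<integral>\<omega>. bridge \<alpha> s (D - s) x (X D \<omega>) \<partial>M) = tail_prob s x"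
  using expectation_bridge_X[of s D "\<lambda>_. 1" 1] by (simp add: tail_prob_def)

lemma minus_process: "stable_process M \<alpha> (\<lambda>s \<omega>. - X s \<omega>)"
  using stable_process_scaled[of 1 "-1"] by simp

lemma integral_one_minus_times:
  assumes [measurable]: "f \<in> borel_measurable M" "g \<in> borel_measurable M"
    and b: "\<And>\<omega>. 0 \<le> f \<omega>" "\<And>\<omega>. f \<omega> \<le> 1" "\<And>\<omega>. 0 \<le> g \<omega>" "\<And>\<omega>. g \<omega> \<le> (1::real)"
  shows "(\<integral>\<omega>. (1 - f \<omega>) * (1 - g \<omega>) \<partial>M) = 1 - (\<integral>\<omega>. f \<omega> \<partial>M) - (\<integral>\<omega>. g \<omega> \<partial>M) + (\<integral>\<omega>. f \<omega> * g \<omega> \<partial>M)"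
proof -
  have i: "integrable M f" "integrable M g" "integrable M (\<lambda>\<omega>. f \<omega> * g \<omega>)" "integrable M (\<lambda>\<omega>. 1 :: real)"
    using b by (auto intro!: integrable_const_bound[where B=1] AE_I2 mult_le_one simp: abs_mult)
  have "(\<integral>\<omega>. (1 - f \<omega>) * (1 - g \<omega>) \<partial>M) = (\<integral>\<omega>. (1 - f \<omega>) - g \<omega> + f \<omega> * g \<omega> \<partial>M)"
    by (simp add: algebra_simps)
  then show ?thesis using i by (simp add: prob_space)
qed

text \<open>Inclusion-exclusion for the complementary events. The correction is the same as in
  \<open>bridge_exc_minus\<close>, so it cancels in \<open>V\<close>, which is thus even.\<close>

lemma joint_exc_minus:
  assumes st: "0 < s" "0 < t"
  shows "joint_exc s t (- x) = 1 - tail_prob s x - tail_prob t x + joint_exc s t x"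
proof -
  have [measurable]: "X s \<in> borel_measurable M" "X t \<in> borel_measurable M" using st by auto
  have ne: "AE \<omega> in M. X r \<omega> \<noteq> x" if "0 < r" for r
    by (rule AE_X[OF that]) (auto intro: eventually_mono[OF AE_lborel_singleton[of x]])
  have "joint_exc s t (- x) = (\<integral>\<omega>. hv (- x) (- X s \<omega>) * hv (- x) (- X t \<omega>) \<partial>M)"
    using joint_exc_law[OF minus_process st, of "- x"] by simp
  also have "\<dots> = (\<integral>\<omega>. (1 - hv x (X s \<omega>)) * (1 - hv x (X t \<omega>)) \<partial>M)"
    using ne[OF st(1)] ne[OF st(2)] by (intro integral_cong_AE) (auto simp: hv_def)
  also have "\<dots> = 1 - tail_prob s x - tail_prob t x + joint_exc s t x"
    unfolding tail_prob_def joint_exc_def by (intro integral_one_minus_times) (auto simp: hv_bounds)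
  finally show ?thesis .
qed

lemma bridge_exc_minus:
  assumes D: "0 < D" and st: "s \<in> {0<..<D}" "t \<in> {0<..<D}"
  shows "bridge_exc D s t (- x) = 1 - tail_prob s x - tail_prob t x + bridge_exc D s t x"
proof -
  have [measurable]: "X D \<in> borel_measurable M" using D by auto
  have ae: "AE \<omega> in M. bridge \<alpha> s (D - s) (- x) (- X D \<omega>) = 1 - bridge \<alpha> s (D - s) x (X D \<omega>)" if "s \<in> {0<..<D}" for s
    by (rule AE_X[OF D]) (use bridge_minus[of s "D - s" x] that in auto)
  have "bridge_exc D s t (- x) = (\<integral>\<omega>. bridge \<alpha> s (D - s) (- x) (- X D \<omega>) * bridge \<alpha> t (D - t) (- x) (- X D \<omega>) \<partial>M)"
    unfolding bridge_exc_def
    by (rule expectation_one_law[OF minus_process D, of "\<lambda>z. bridge \<alpha> s (D - s) (- x) z * bridge \<alpha> t (D - t) (- x) z", symmetric]) measurable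
  also have "\<dots> = (\<integral>\<omega>. (1 - bridge \<alpha> s (D - s) x (X D \<omega>)) * (1 - bridge \<alpha> t (D - t) x (X D \<omega>)) \<partial>M)"
    using ae[OF st(1)] ae[OF st(2)] by (intro integral_cong_AE) auto
  also have "\<dots> = 1 - tail_prob s x - tail_prob t x + bridge_exc D s t x"
    unfolding bridge_exc_def expectation_bridge_tail_prob[OF st(1), symmetric] expectation_bridge_tail_prob[OF st(2), symmetric]
    by (intro integral_one_minus_times) (auto simp: bridge_nonneg bridge_le_1)
  finally show ?thesis .
qed

lemma V_minus: "0 < D \<Longrightarrow> V D (- x) = V D x"
proof -
  assume D: "0 < D"
  have "(\<integral>t. joint_exc s t (- x) - bridge_exc D s t (- x) \<partial>timed D) = (\<integral>t. joint_exc s t x - bridge_exc D s t x \<partial>timed D)"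
    if "s \<in> space (timed D)" for s
    using that D by (intro Bochner_Integration.integral_cong) (auto simp: joint_exc_minus bridge_exc_minus)
  then show ?thesis unfolding V_def by (rule Bochner_Integration.integral_cong[OF refl])
qed

lemma tail_prob_bounds: "0 \<le> tail_prob s x" "0 \<le> s \<Longrightarrow> tail_prob s x \<le> 1"
proof -
  show "0 \<le> tail_prob s x" unfolding tail_prob_def by (intro Bochner_Integration.integral_nonneg) (auto simp: hv_bounds)
  assume [simp]: "0 \<le> s"
  have "tail_prob s x \<le> (\<integral>\<omega>. 1 \<partial>M)" unfolding tail_prob_def
    by (intro integral_mono integrable_const_bound[where B=1]) (auto simp: hv_def)
  then show "tail_prob s x \<le> 1" by (simp add: prob_space)
qed

lemma tail_prob_antimono: "0 \<le> s \<Longrightarrow> x \<le> y \<Longrightarrow> tail_prob s y \<le> tail_prob s x"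
  unfolding tail_prob_def by (intro integral_mono integrable_const_bound[where B=1]) (auto simp: hv_def)

lemma tail_prob_scale:
  assumes s: "0 < s"
  shows "tail_prob s x = tail_prob 1 (s powr (- 1 / \<alpha>) * x)"
proof -
  have "tail_prob 1 (s powr (- 1 / \<alpha>) * x) = (\<integral>\<omega>. hv (s powr (- 1 / \<alpha>) * x) (s powr (- 1 / \<alpha>) * X (s * 1) \<omega>) \<partial>M)"
    unfolding tail_prob_def by (rule expectation_one_law[OF scaled_process[OF s], symmetric]) auto
  then show ?thesis using s by (simp add: tail_prob_def hv_scale)
qed

lemma tail_prob_le_tail_prob_1:
  assumes "0 < s" "s \<le> 1" "0 \<le> x"
  shows "tail_prob s x \<le> tail_prob 1 x"
proof -
  have "1 \<le> s powr (- 1 / \<alpha>)" using assms \<alpha>_pos powr_mono2'[of "- 1 / \<alpha>" s 1] by simp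
  then have "x \<le> s powr (- 1 / \<alpha>) * x" using mult_right_mono[of 1 "s powr (- 1 / \<alpha>)" x] assms by simp
  then show ?thesis using assms by (simp add: tail_prob_scale[of s] tail_prob_antimono)
qed

lemma joint_exc_le_tail_prob: "0 \<le> s \<Longrightarrow> 0 \<le> t \<Longrightarrow> joint_exc s t x \<le> tail_prob s x"
  unfolding tail_prob_def joint_exc_def
  by (intro integral_mono integrable_const_bound[where B=1]) (auto simp: hv_def)

text \<open>The subtracted bridge term is nonnegative, and at a nonnegative level the tail
  probability over times up to 1 is largest at time 1.\<close>

lemma V_le_tail_prob:
  assumes x: "0 \<le> x"
  shows "V 1 x \<le> tail_prob 1 x"
proof -
  interpret T: finite_measure "timed 1" by (rule finite_measure_timed)
  have le: "joint_exc s t x - bridge_exc 1 s t x \<le> tail_prob 1 x" if "s \<in> {0<..<1}" "t \<in> {0<..<1}" for s t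
    using joint_exc_le_tail_prob[of s t x] tail_prob_le_tail_prob_1[of s x] bridge_exc_bounds(1)[of 1 s t x] that x by auto
  have upper: "(\<integral>s. f s \<partial>timed 1) \<le> B" if "\<And>s. s \<in> {0<..<1} \<Longrightarrow> f s \<le> B" "0 \<le> B" for f and B :: real
  proof (cases "integrable (timed 1) f")
    case True
    have "(\<integral>s. f s \<partial>timed 1) \<le> (\<integral>s. B \<partial>timed 1)" using True that by (intro integral_mono) auto
    then show ?thesis by simp
  qed (use that in \<open>simp add: not_integrable_integral_eq\<close>)
  show ?thesis unfolding V_def by (intro upper le tail_prob_bounds)
qed

end

subsection \<open>Tail bounds\<close>

text \<open>exp(-z^2/2) is the characteristic function of the standard normal law. Inserting it and
  exchanging the integrals turns a Gaussian weight under \<open>\<mu>\<close> into a Gaussian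
  average of the characteristic function of \<open>\<mu>\<close>.\<close>

lemma integral_iexp_gauss:
  assumes "real_distribution \<mu>"
  shows "(CLINT z|\<mu>. iexp (u * z) * exp (- z\<^sup>2 / 2)) = (CLINT r|std_normal_distribution. char \<mu> (u + r))"
proof -
  interpret \<mu>: real_distribution \<mu> by fact
  interpret N: real_distribution std_normal_distribution by (rule real_dist_normal_dist)
  interpret P: pair_prob_space std_normal_distribution \<mu> ..
  have m[measurable_cong]: "sets \<mu> = sets borel" "sets std_normal_distribution = sets borel" by simp_all
  have "(CLINT z|\<mu>. iexp (u * z) * exp (- z\<^sup>2 / 2)) = (CLINT z|\<mu>. (CLINT r|std_normal_distribution. iexp ((u + r) * z)))"
  proof (rule Bochner_Integration.integral_cong[OF refl])
    fix z
    have "complex_of_real (exp (- z\<^sup>2 / 2)) = (CLINT r|std_normal_distribution. iexp (z * r))"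
      using char_std_normal_distribution by (simp add: char_def fun_eq_iff)
    then have "iexp (u * z) * exp (- z\<^sup>2 / 2) = (CLINT r|std_normal_distribution. iexp (u * z) * iexp (z * r))"
      by (simp add: N.integrable_iexp)
    also have "\<dots> = (CLINT r|std_normal_distribution. iexp ((u + r) * z))"
      by (intro Bochner_Integration.integral_cong refl) (simp add: exp_add[symmetric] algebra_simps)
    finally show "iexp (u * z) * exp (- z\<^sup>2 / 2) = (CLINT r|std_normal_distribution. iexp ((u + r) * z))" .
  qed
  also have "\<dots> = (CLINT r|std_normal_distribution. (CLINT z|\<mu>. iexp ((u + r) * z)))"
    by (intro P.Fubini_integral P.P.integrable_const_bound[where B=1]) (auto simp: split_beta)
  finally show ?thesis by (simp add: char_def)
qed

lemma integral_one_minus_gauss: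
  assumes \<mu>: "real_distribution \<mu>" and ch: "\<And>r. char \<mu> r = complex_of_real (f r)"
  shows "(LINT z|\<mu>. 1 - exp (- z\<^sup>2 / 2)) = (LINT r|std_normal_distribution. 1 - f r)"
proof -
  interpret \<mu>: real_distribution \<mu> by fact
  interpret N: real_distribution std_normal_distribution by (rule real_dist_normal_dist)
  have [measurable]: "f \<in> borel_measurable borel"
  proof -
    have "f = (\<lambda>r. Re (char \<mu> r))" by (simp add: ch)
    then show ?thesis by simp
  qed
  have fb: "\<bar>f r\<bar> \<le> 1" for r using \<mu>.cmod_char_le_1[of r] by (simp add: ch)
  have "complex_of_real (LINT z|\<mu>. exp (- z\<^sup>2 / 2)) = complex_of_real (LINT r|std_normal_distribution. f r)"
    using integral_iexp_gauss[OF \<mu>, of 0] by (simp add: ch)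
  then have eq: "(LINT z|\<mu>. exp (- z\<^sup>2 / 2)) = (LINT r|std_normal_distribution. f r)"
    by (simp only: of_real_eq_iff)
  have i1: "integrable \<mu> (\<lambda>z. exp (- z\<^sup>2 / 2))" by (rule \<mu>.integrable_const_bound[where B=1]) auto
  have i2: "integrable std_normal_distribution f" by (rule N.integrable_const_bound[where B=1]) (auto simp: fb)
  show ?thesis using i1 i2 eq \<mu>.prob_space N.prob_space by simp
qed

lemma powr_le_one_plus_square:
  fixes r a :: real
  assumes "0 < a" "a \<le> 2"
  shows "\<bar>r\<bar> powr a \<le> 1 + r\<^sup>2"
proof (cases "\<bar>r\<bar> \<le> 1")
  case True
  then have "\<bar>r\<bar> powr a \<le> 1" using assms by (simp add: powr_le1)
  then show ?thesis by (simp add: add_increasing2)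
next
  case False
  then have "\<bar>r\<bar> powr a \<le> \<bar>r\<bar> powr 2" using assms by (intro powr_mono) auto
  also have "\<dots> = r\<^sup>2" using False by (simp add: powr_numeral)
  finally show ?thesis by simp
qed

lemma integrable_powr_normal:
  fixes a :: real
  assumes "0 < a" "a \<le> 2"
  shows "integrable std_normal_distribution (\<lambda>r. \<bar>r\<bar> powr a)"
proof (rule Bochner_Integration.integrable_bound)
  interpret N: real_distribution std_normal_distribution by (rule real_dist_normal_dist)
  show "integrable std_normal_distribution (\<lambda>r. 1 + r\<^sup>2)"
    using integrable_std_normal_distribution_moment[of 2] by simp
  show "AE r in std_normal_distribution. norm (\<bar>r\<bar> powr a) \<le> norm (1 + r\<^sup>2)"
    using powr_le_one_plus_square[OF assms] by (auto simp: abs_of_nonneg)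
qed simp

context stable_process
begin

lemma real_distribution_X: "0 \<le> t \<Longrightarrow> real_distribution (distr M borel (\<lambda>\<omega>. a * X t \<omega>))"
  by (intro real_distribution_distr) auto

lemma char_scaled_X1: "char (distr M borel (\<lambda>\<omega>. a * X 1 \<omega>)) r = complex_of_real (exp (- (\<bar>r * a\<bar> powr \<alpha>)))"
proof -
  have [measurable]: "X 1 \<in> borel_measurable M" "X 0 \<in> borel_measurable M" by auto
  have "char (distr M borel (\<lambda>\<omega>. a * X 1 \<omega>)) r = (\<integral>\<omega>. iexp (r * (a * X 1 \<omega>)) \<partial>M)"
    unfolding char_def by (subst integral_distr) auto
  also have "\<dots> = (\<integral>\<omega>. iexp ((r * a) * (X 1 \<omega> - X 0 \<omega>)) \<partial>M)"
    by (intro Bochner_Integration.integral_cong) (auto simp: X_0 mult.assoc)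
  also have "\<dots> = char (distr M borel (\<lambda>\<omega>. X 1 \<omega> - X 0 \<omega>)) (r * a)"
    unfolding char_def by (subst integral_distr) auto
  finally show ?thesis using char_increment[of 0 1] by simp
qed

definition gauss_moment :: real where
  "gauss_moment = (LINT r|std_normal_distribution. \<bar>r\<bar> powr \<alpha>)"

text \<open>Where X_1 >= x, the weight 1 - exp(-(X_1/x)^2/2) is at least 1 - exp(-1/2). The
  expectation of the weight is the Gaussian average of 1 - exp(-|r/x|^\<alpha>), which is at most
  |r/x|^\<alpha>.\<close>

lemma tail_prob_le_powr:
  assumes \<alpha>2: "\<alpha> \<le> 2" and x: "0 < x"
  shows "tail_prob 1 x \<le> gauss_moment / (1 - exp (- 1 / 2)) * x powr (- \<alpha>)"
proof -
  define \<mu> where "\<mu> = distr M borel (\<lambda>\<omega>. (1 / x) * X 1 \<omega>)"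
  have \<mu>: "real_distribution \<mu>" unfolding \<mu>_def by (rule real_distribution_X) simp
  interpret N: real_distribution std_normal_distribution by (rule real_dist_normal_dist)
  have [measurable]: "X 1 \<in> borel_measurable M" by auto
  define c where "c = 1 - exp (- 1 / 2 :: real)"
  have c: "0 < c" by (simp add: c_def)
  have "c * tail_prob 1 x = (\<integral>\<omega>. c * hv x (X 1 \<omega>) \<partial>M)" by (simp add: tail_prob_def)
  also have "\<dots> \<le> (\<integral>\<omega>. 1 - exp (- ((1 / x) * X 1 \<omega>)\<^sup>2 / 2) \<partial>M)"
  proof (intro integral_mono integrable_const_bound[where B=1] AE_I2)
    fix \<omega>
    show "c * hv x (X 1 \<omega>) \<le> 1 - exp (- ((1 / x) * X 1 \<omega>)\<^sup>2 / 2)"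
    proof (cases "x \<le> X 1 \<omega>")
      case True
      then have "1 \<le> (1 / x) * X 1 \<omega>" using x by (simp add: field_simps)
      then have "1 \<le> ((1 / x) * X 1 \<omega>)\<^sup>2" by (simp add: one_le_power)
      then show ?thesis using True by (simp add: hv_def c_def)
    qed (simp add: hv_def)
  qed (use c in \<open>auto simp: hv_def c_def\<close>)
  also have "\<dots> = (LINT z|\<mu>. 1 - exp (- z\<^sup>2 / 2))"
    unfolding \<mu>_def by (subst integral_distr) auto
  also have "\<dots> = (LINT r|std_normal_distribution. 1 - exp (- (\<bar>r * (1 / x)\<bar> powr \<alpha>)))"
    by (intro integral_one_minus_gauss[OF \<mu>]) (auto simp only: \<mu>_def char_scaled_X1)
  also have "\<dots> \<le> (LINT r|std_normal_distribution. x powr (- \<alpha>) * \<bar>r\<bar> powr \<alpha>)"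
  proof (rule integral_mono)
    show "integrable std_normal_distribution (\<lambda>r. 1 - exp (- (\<bar>r * (1 / x)\<bar> powr \<alpha>)))"
      by (rule N.integrable_const_bound[where B=1]) auto
    show "integrable std_normal_distribution (\<lambda>r. x powr (- \<alpha>) * \<bar>r\<bar> powr \<alpha>)"
      by (intro integrable_mult_right integrable_powr_normal \<alpha>_pos \<alpha>2)
    fix r :: real
    have "1 - exp (- (\<bar>r * (1 / x)\<bar> powr \<alpha>)) \<le> \<bar>r * (1 / x)\<bar> powr \<alpha>"
      using exp_ge_add_one_self[of "- (\<bar>r * (1 / x)\<bar> powr \<alpha>)"] by linarith
    also have "\<dots> = x powr (- \<alpha>) * \<bar>r\<bar> powr \<alpha>"
      using x by (simp add: abs_mult powr_divide powr_minus field_simps)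
    finally show "1 - exp (- (\<bar>r * (1 / x)\<bar> powr \<alpha>)) \<le> x powr (- \<alpha>) * \<bar>r\<bar> powr \<alpha>" .
  qed
  also have "\<dots> = gauss_moment * x powr (- \<alpha>)" by (simp add: gauss_moment_def)
  finally show ?thesis using c by (simp add: c_def field_simps)
qed

end

section \<open>Integrability of \<open>V 1\<close> for \<alpha> > 1\<close>

lemma integral_even:
  fixes f :: "real \<Rightarrow> real"
  assumes f: "integrable lborel f" and even: "\<And>x. f (- x) = f x"
  shows "(LINT x|lborel. f x) = 2 * (LINT x:{0..}|lborel. f x)"
proof -
  have s: "set_integrable lborel A f" if "A \<in> sets borel" for A
    unfolding set_integrable_def using that f by (intro integrable_mult_indicator) auto
  have U: "{0..} \<union> {..0} = (UNIV :: real set)" by auto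
  have "(LINT x|lborel. f x) = (LINT x:{0..} \<union> {..0}|lborel. f x)"
    unfolding U by (simp add: set_lebesgue_integral_def)
  also have "\<dots> = (LINT x:{0..}|lborel. f x) + (LINT x:{..0}|lborel. f x)"
    by (intro set_integral_Un_AE s eventually_mono[OF AE_lborel_singleton[of 0]]) auto
  also have "(LINT x:{..0}|lborel. f x) = (LINT x:{0..}|lborel. f x)"
  proof -
    have "(LINT x:{..0}|lborel. f x) = \<bar>-1\<bar> *\<^sub>R (LINT x|lborel. indicator {..0} (0 + (-1) * x) *\<^sub>R f (0 + (-1) * x))"
      unfolding set_lebesgue_integral_def by (intro lborel_integral_real_affine) auto
    then show ?thesis
      by (simp add: even set_lebesgue_integral_def indicator_def)
  qed
  finally show ?thesis by simp
qed

lemma integrable_powr_to_inf: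
  fixes a :: real
  assumes "1 < a"
  shows "set_integrable lborel {1..} (\<lambda>x. x powr (- a))"
proof -
  have "((\<lambda>x. x powr (- a)) has_integral - (1 powr (- a + 1)) / (- a + 1)) {1..}"
    using has_integral_powr_to_inf[of "- a" 1] assms by simp
  then have "(\<lambda>x. x powr (- a)) absolutely_integrable_on {1..}"
    by (intro nonnegative_absolutely_integrable_1) (auto simp: integrable_on_def)
  then show ?thesis
    unfolding set_integrable_def by (subst (asm) integrable_completion) auto
qed

text \<open>The majorant for \<open>V 1\<close>: constant on [-1, 1] and a power of |x| on both
  sides.\<close>

lemma integrable_min_powr:
  fixes a K :: real
  assumes "1 < a"
  shows "integrable lborel (\<lambda>x. indicator {-1..1} x + K * (indicator {1..} x * x powr (- a) + indicator {1..} (- x) * (- x) powr (- a)))"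
proof -
  have i: "integrable lborel (\<lambda>x. indicator {1..} x * x powr (- a))"
    using integrable_powr_to_inf[OF assms] by (simp add: set_integrable_def)
  have "integrable lborel (\<lambda>x. indicator {1..} (0 + (-1) * x) * (0 + (-1) * x) powr (- a))"
    using i by (subst lborel_integrable_real_affine_iff) auto
  with i show ?thesis
    by (intro Bochner_Integration.integrable_add integrable_mult_right integrable_real_indicator) auto
qed

context stable_process
begin

text \<open>\<open>V 1\<close> is at most 1, and by evenness it is bounded by the tail probability
  at |x|; the power |x|^(-\<alpha>) is integrable at infinity because \<alpha> > 1.\<close>

lemma integrable_V:
  assumes \<alpha>1: "1 < \<alpha>" and \<alpha>2: "\<alpha> \<le> 2"
  shows "integrable lborel (V 1)"
proof -
  define K where "K = gauss_moment / (1 - exp (- 1 / 2))"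
  have K: "tail_prob 1 x \<le> K * x powr (- \<alpha>)" if "0 < x" for x
    using tail_prob_le_powr[OF \<alpha>2 that] by (simp add: K_def)
  have K0: "0 \<le> K" using order_trans[OF tail_prob_bounds(1) K[of 1]] by simp
  show ?thesis
  proof (rule Bochner_Integration.integrable_bound[OF integrable_min_powr[OF \<alpha>1, of K]])
    have b: "V 1 x \<le> 1" for x using V_bound[of 1 x] by simp
    have b2: "V 1 x \<le> K * x powr (- \<alpha>)" if "0 < x" for x using V_le_tail_prob[of x] K[of x] that by simp
    show "AE x in lborel. norm (V 1 x) \<le> norm (indicator {-1..1} x + K * (indicator {1..} x * x powr (- \<alpha>) + indicator {1..} (- x) * (- x) powr (- \<alpha>)))"
    proof (intro AE_I2)
      fix x :: real
      have "V 1 x \<le> indicator {-1..1} x + K * (indicator {1..} x * x powr (- \<alpha>) + indicator {1..} (- x) * (- x) powr (- \<alpha>))"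
      proof -
        consider "\<bar>x\<bar> \<le> 1" | "1 < x" | "x < -1" by linarith
        then show ?thesis
        proof cases
          case 1 then show ?thesis using b[of x] K0 by (auto simp: indicator_def add_increasing2)
        next
          case 2 then show ?thesis using b2[of x] by auto
        next
          case 3 then show ?thesis using b2[of "- x"] V_minus[of 1 x] by auto
        qed
      qed
      then show "norm (V 1 x) \<le> norm (indicator {-1..1} x + K * (indicator {1..} x * x powr (- \<alpha>) + indicator {1..} (- x) * (- x) powr (- \<alpha>)))"
        using V_nonneg[of 1 x] by simp
    qed
  qed simp
qed

lemma integral_V_half:
  assumes "1 < \<alpha>" "\<alpha> \<le> 2"
  shows "(LINT x|lborel. V 1 x) = 2 * (LINT x:{0..}|lborel. V 1 x)"
  by (rule integral_even[OF integrable_V[OF assms]]) (simp add: V_minus)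

end

subsection \<open>Riemann sums and the local time\<close>

lemma timed_integrable_iff:
  "integrable (timed D) f \<longleftrightarrow> integrable lborel (\<lambda>s. indicator {0<..<D} s * (f s :: real))"
  unfolding timed_def by (subst integrable_restrict_space) (auto simp: set_integrable_def)

lemma integrable_timed_powr:
  fixes b :: real
  assumes "b < 1" "0 \<le> T"
  shows "integrable (timed T) (\<lambda>t. t powr (- b))"
proof -
  have "(\<lambda>t. t powr (- b)) absolutely_integrable_on {0..T}"
    using assms by (intro nonnegative_absolutely_integrable_1 integrable_on_powr_from_0) auto
  then have "set_integrable lborel {0..T} (\<lambda>t. t powr (- b))"
    unfolding set_integrable_def by (subst (asm) integrable_completion) auto
  then have "set_integrable lborel {0<..<T} (\<lambda>t. t powr (- b))"
    by (rule set_integrable_subset) auto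
  then show ?thesis by (simp add: timed_integrable_iff set_integrable_def)
qed

context stable_process
begin

abbreviation "K \<equiv> stable_dens_sup \<alpha>"

lemma K_nonneg: "0 \<le> K" by (rule stable_dens_sup_nonneg[OF \<alpha>_pos])

lemma p_le: "p t x \<le> K * t powr (- 1 / \<alpha>)"
  by (rule stable_dens_le[OF \<alpha>_pos])

text \<open>Arises from the substitution z = y - D^(1/\<alpha>) x in the expectation of
  \<open>V D (y - z)\<close> over the density of z: a Riemann sum of that density in time. It runs
  over \<open>Suc k\<close> because X at time 0 is constant and has no density, so the first block
  is treated apart.\<close>

definition rsum :: "real \<Rightarrow> real \<Rightarrow> nat \<Rightarrow> real \<Rightarrow> real" where
  "rsum D y n x = (\<Sum>k<n. D * p (real (Suc k) * D) (y - D powr (1 / \<alpha>) * x))"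

text \<open>The step function behind \<open>rsum\<close>, with the value at the right end of each
  cell. It vanishes on the last cell, since n + 1 blocks have only n positive starting
  times.\<close>

definition rstep :: "real \<Rightarrow> nat \<Rightarrow> real \<Rightarrow> real \<Rightarrow> real" where
  "rstep D n u t = (if t < real n * D then p ((real_of_int \<lfloor>max 0 t / D\<rfloor> + 1) * D) u else 0)"

lemma rstep_measurable[measurable]: "(\<lambda>t. rstep D n u t) \<in> borel_measurable borel"
  unfolding rstep_def by measurable

lemma rsum_measurable: "(\<lambda>x. rsum D y n x) \<in> borel_measurable borel"
  unfolding rsum_def
  by (intro borel_measurable_sum borel_measurable_times borel_measurable_const p_measurable borel_measurable_diff) simp

lemma floor_block:
  assumes "0 < D" "0 \<le> t"
  shows "t < (real_of_int \<lfloor>t / D\<rfloor> + 1) * D" "(real_of_int \<lfloor>t / D\<rfloor> + 1) * D \<le> t + D"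
proof -
  have "t / D < real_of_int \<lfloor>t / D\<rfloor> + 1" by linarith
  then show "t < (real_of_int \<lfloor>t / D\<rfloor> + 1) * D" by (simp only: pos_divide_less_eq[OF assms(1)])
  have "real_of_int \<lfloor>t / D\<rfloor> \<le> t / D" by linarith
  then show "(real_of_int \<lfloor>t / D\<rfloor> + 1) * D \<le> t + D" using assms by (simp add: le_divide_eq distrib_right)
qed

text \<open>The right end of a cell lies after t, where the bound on the density is smaller. This
  gives one dominating function for all meshes.\<close>

lemma rstep_bounds:
  assumes D: "0 < D" and t: "0 < t"
  shows "0 \<le> rstep D n u t" "rstep D n u t \<le> K * t powr (- 1 / \<alpha>)"
proof -
  let ?r = "(real_of_int \<lfloor>max 0 t / D\<rfloor> + 1) * D"
  have r: "t < ?r" using floor_block(1)[OF D, of t] t by simp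
  then have r0: "0 < ?r" using t by linarith
  show "0 \<le> rstep D n u t" using p_nonneg[OF r0] by (simp add: rstep_def)
  have "?r powr (- 1 / \<alpha>) \<le> t powr (- 1 / \<alpha>)"
    using t r \<alpha>_pos by (intro powr_mono2') auto
  then have "p ?r u \<le> K * t powr (- 1 / \<alpha>)"
    using p_le[of ?r u] mult_left_mono[OF _ K_nonneg] by (meson order_trans)
  then show "rstep D n u t \<le> K * t powr (- 1 / \<alpha>)"
    using K_nonneg by (simp add: rstep_def)
qed

lemma rstep_norm: "0 < D \<Longrightarrow> 0 < t \<Longrightarrow> norm (rstep D n u t) \<le> K * t powr (- 1 / \<alpha>)"
  using rstep_bounds[of D t n u] by simp

lemma rsum_eq:
  assumes D: "0 < D"
  shows "rsum D y n x = (\<integral>t. rstep D n (y - D powr (1 / \<alpha>) * x) t \<partial>timed (real (Suc n) * D))"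
proof -
  define u where "u = y - D powr (1 / \<alpha>) * x"
  have b: "\<bar>rstep D n u t\<bar> \<le> K * D powr (- 1 / \<alpha>)" for t
  proof -
    let ?r = "(real_of_int \<lfloor>max 0 t / D\<rfloor> + 1) * D"
    have "0 \<le> \<lfloor>max 0 t / D\<rfloor>" using D by simp
    then have r: "D \<le> ?r" using D by (simp add: distrib_right)
    then have "?r powr (- 1 / \<alpha>) \<le> D powr (- 1 / \<alpha>)" using D \<alpha>_pos by (intro powr_mono2') auto
    then have "p ?r u \<le> K * D powr (- 1 / \<alpha>)"
      using p_le[of ?r u] mult_left_mono[OF _ K_nonneg] by (meson order_trans)
    moreover have "0 \<le> p ?r u" using r D by (intro p_nonneg) linarith
    ultimately show ?thesis using K_nonneg by (simp add: rstep_def)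
  qed
  have "(\<integral>t. rstep D n u t \<partial>timed (real (Suc n) * D)) = (LINT t:{0..real (Suc n) * D}|lborel. rstep D n u t)"
    using integral_block[of "rstep D n u" 0 "real (Suc n) * D"] by simp
  also have "\<dots> = (\<Sum>k<Suc n. \<integral>s. rstep D n u (real k * D + s) \<partial>timed D)"
    by (rule integral_blocks[OF _ b]) (use D in auto)
  also have "\<dots> = (\<Sum>k<n. D * p (real (Suc k) * D) u)"
  proof -
    have "(\<integral>s. rstep D n u (real n * D + s) \<partial>timed D) = (\<integral>s. 0 \<partial>timed D)"
      by (intro Bochner_Integration.integral_cong) (auto simp: rstep_def)
    moreover have "(\<integral>s. rstep D n u (real k * D + s) \<partial>timed D) = D * p (real (Suc k) * D) u" if "k < n" for k
    proof -
      have "(\<integral>s. rstep D n u (real k * D + s) \<partial>timed D) = (\<integral>s. p (real (Suc k) * D) u \<partial>timed D)"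
      proof (rule Bochner_Integration.integral_cong[OF refl])
        fix s assume "s \<in> space (timed D)"
        then have s: "0 < s" "s < D" by auto
        have pos: "0 \<le> real k * D + s" using D s by simp
        have "(real k * D + s) / D = real k + s / D" using D by (simp add: add_divide_distrib)
        moreover have "0 < s / D" "s / D < 1" using s D by auto
        ultimately have fl: "\<lfloor>(real k * D + s) / D\<rfloor> = int k" by linarith
        have "real (Suc k) * D \<le> real n * D" using that D by (intro mult_right_mono) auto
        then have "real k * D + s < real n * D" using s by (simp add: distrib_right)
        then show "rstep D n u (real k * D + s) = p (real (Suc k) * D) u"
          using pos unfolding rstep_def max_absorb2[OF pos] fl by (simp add: add.commute)
      qed
      then show ?thesis using D by simp
    qed
    ultimately show ?thesis by simp
  qed
  finally show ?thesis by (simp add: rsum_def u_def)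
qed

lemma rsum_bounds:
  assumes \<alpha>1: "1 < \<alpha>" and D: "0 < D"
  shows "0 \<le> rsum D y n x" "rsum D y n x \<le> (\<integral>t. K * t powr (- 1 / \<alpha>) \<partial>timed (real (Suc n) * D))"
proof -
  show "0 \<le> rsum D y n x" unfolding rsum_eq[OF D]
    by (intro Bochner_Integration.integral_nonneg) (auto intro!: rstep_bounds D)
  have i: "integrable (timed (real (Suc n) * D)) (\<lambda>t. K * t powr (- 1 / \<alpha>))"
    using integrable_timed_powr[of "1 / \<alpha>" "real (Suc n) * D"] \<alpha>1 D by (intro integrable_mult_right) auto
  show "rsum D y n x \<le> (\<integral>t. K * t powr (- 1 / \<alpha>) \<partial>timed (real (Suc n) * D))"
    unfolding rsum_eq[OF D]
  proof (rule integral_mono[OF Bochner_Integration.integrable_bound[OF i] i])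
    show "AE t in timed (real (Suc n) * D). norm (rstep D n (y - D powr (1 / \<alpha>) * x) t) \<le> norm (K * t powr (- 1 / \<alpha>))"
      by (intro AE_I2 order_trans[OF rstep_norm[OF D]]) auto
    show "rstep D n (y - D powr (1 / \<alpha>) * x) t \<le> K * t powr (- 1 / \<alpha>)" if "t \<in> space (timed (real (Suc n) * D))" for t
      using that by (intro rstep_bounds(2) D) auto
  qed (auto intro: measurable_timed)
qed

text \<open>In every block but the first, D^2 from the scaling of \<open>V\<close> and
  D^(1/\<alpha>) from the substitution combine with the normalisation to D, the mesh of the Riemann
  sum. The first block starts at the point 0 and is the separate term.\<close>

lemma approx_err_eq_rsum:
  assumes \<alpha>1: "1 < \<alpha>" "\<alpha> \<le> 2" and D: "0 < D" and T: "T = real (Suc n) * D"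
  shows "D powr (-1 - 1 / \<alpha>) * approx_err M X T y (Suc n) = D powr (1 - 1 / \<alpha>) * V 1 (D powr (- 1 / \<alpha>) * y)
    + (LINT x|lborel. rsum D y n x * V 1 x)"
proof -
  define \<kappa> where "\<kappa> = D powr (1 / \<alpha>)"
  have \<kappa>: "0 < \<kappa>" "D powr (- 1 / \<alpha>) * \<kappa> = 1" using D by (auto simp: \<kappa>_def powr_minus)
  have e1: "D powr (-1 - 1 / \<alpha>) * D\<^sup>2 = D powr (1 - 1 / \<alpha>)"
    using D by (simp add: powr_numeral[symmetric] powr_add[symmetric] del: powr_numeral)
  have e2: "D powr (1 - 1 / \<alpha>) * \<kappa> = D" using D by (simp add: \<kappa>_def powr_add[symmetric])
  have iV: "integrable lborel (V 1)" by (rule integrable_V[OF \<alpha>1])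
  have step: "D powr (-1 - 1 / \<alpha>) * (\<integral>\<omega>. V D (y - X (real (Suc k) * D) \<omega>) \<partial>M) = (LINT x|lborel. D * p (real (Suc k) * D) (y - \<kappa> * x) * V 1 x)" for k
  proof -
    let ?t = "real (Suc k) * D"
    have t: "0 < ?t" using D by simp
    have "(\<integral>\<omega>. V D (y - X ?t \<omega>) \<partial>M) = (LINT z|lborel. p ?t z * V D (y - z))"
      using expectation_X[OF t, of "\<lambda>z. V D (y - z)"] D by simp
    also have "\<dots> = \<bar>- \<kappa>\<bar> *\<^sub>R (LINT x|lborel. p ?t (y + (- \<kappa>) * x) * V D (y - (y + (- \<kappa>) * x)))"
      using \<kappa> by (intro lborel_integral_real_affine) auto
    also have "\<dots> = \<kappa> * (LINT x|lborel. D\<^sup>2 * (p ?t (y - \<kappa> * x) * V 1 x))"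
    proof -
      have "D powr (- 1 / \<alpha>) * (\<kappa> * x) = x" for x using \<kappa>(2) by (simp add: mult.assoc[symmetric])
      then have "V D (\<kappa> * x) = D\<^sup>2 * V 1 x" for x by (simp only: V_scale[OF D])
      then have eq: "p ?t (y + (- \<kappa>) * x) * V D (y - (y + (- \<kappa>) * x)) = D\<^sup>2 * (p ?t (y - \<kappa> * x) * V 1 x)" for x
        by simp
      show ?thesis unfolding eq using \<kappa> by simp
    qed
    also have "\<dots> = \<kappa> * D\<^sup>2 * (LINT x|lborel. p ?t (y - \<kappa> * x) * V 1 x)" by simp
    finally have "D powr (-1 - 1 / \<alpha>) * (\<integral>\<omega>. V D (y - X ?t \<omega>) \<partial>M) = (D powr (-1 - 1 / \<alpha>) * D\<^sup>2 * \<kappa>) * (LINT x|lborel. p ?t (y - \<kappa> * x) * V 1 x)"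
      by simp
    also have "\<dots> = D * (LINT x|lborel. p ?t (y - \<kappa> * x) * V 1 x)" by (simp only: e1 e2)
    also have "\<dots> = (LINT x|lborel. D * p ?t (y - \<kappa> * x) * V 1 x)" by (simp add: mult.assoc)
    finally show ?thesis .
  qed
  have int: "integrable lborel (\<lambda>x. D * p (real (Suc k) * D) (y - \<kappa> * x) * V 1 x)" for k
  proof (rule Bochner_Integration.integrable_bound)
    let ?t = "real (Suc k) * D"
    have t: "0 < ?t" using D by simp
    show "integrable lborel (\<lambda>x. D * (K * ?t powr (- 1 / \<alpha>)) * V 1 x)" using iV by simp
    show "AE x in lborel. norm (D * p ?t (y - \<kappa> * x) * V 1 x) \<le> norm (D * (K * ?t powr (- 1 / \<alpha>)) * V 1 x)"
    proof (intro AE_I2)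
      fix x
      have "norm (D * p ?t (y - \<kappa> * x) * V 1 x) = D * p ?t (y - \<kappa> * x) * \<bar>V 1 x\<bar>"
        using D p_nonneg[OF t] by (simp add: abs_mult abs_of_nonneg del: of_nat_Suc)
      also have "\<dots> \<le> D * (K * ?t powr (- 1 / \<alpha>)) * \<bar>V 1 x\<bar>"
        by (intro mult_right_mono mult_left_mono p_le) (use D in auto)
      also have "\<dots> = norm (D * (K * ?t powr (- 1 / \<alpha>)) * V 1 x)"
        using D K_nonneg by (simp add: abs_mult abs_of_nonneg del: of_nat_Suc)
      finally show "norm (D * p ?t (y - \<kappa> * x) * V 1 x) \<le> norm (D * (K * ?t powr (- 1 / \<alpha>)) * V 1 x)" .
    qed
  qed simp
  have "D powr (-1 - 1 / \<alpha>) * approx_err M X T y (Suc n) = (\<Sum>k<Suc n. D powr (-1 - 1 / \<alpha>) * (\<integral>\<omega>. V D (y - X (real k * D) \<omega>) \<partial>M))"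
    by (simp only: approx_err_eq[OF D zero_less_Suc T] sum_distrib_left)
  also have "\<dots> = D powr (-1 - 1 / \<alpha>) * (\<integral>\<omega>. V D (y - X (real 0 * D) \<omega>) \<partial>M) + (\<Sum>k<n. D powr (-1 - 1 / \<alpha>) * (\<integral>\<omega>. V D (y - X (real (Suc k) * D) \<omega>) \<partial>M))"
    by (rule sum.lessThan_Suc_shift)
  also have "(\<integral>\<omega>. V D (y - X (real 0 * D) \<omega>) \<partial>M) = (\<integral>\<omega>. V D y \<partial>M)"
    by (intro Bochner_Integration.integral_cong) (auto simp: X_0)
  also have "D powr (-1 - 1 / \<alpha>) * (\<integral>\<omega>. V D y \<partial>M) = D powr (1 - 1 / \<alpha>) * V 1 (D powr (- 1 / \<alpha>) * y)"
    by (simp add: prob_space V_scale[OF D, of y] mult.assoc[symmetric] e1)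
  also have "(\<Sum>k<n. D powr (-1 - 1 / \<alpha>) * (\<integral>\<omega>. V D (y - X (real (Suc k) * D) \<omega>) \<partial>M)) = (LINT x|lborel. (\<Sum>k<n. D * p (real (Suc k) * D) (y - \<kappa> * x) * V 1 x))"
    by (subst Bochner_Integration.integral_sum) (auto simp only: step intro: int)
  also have "\<dots> = (LINT x|lborel. rsum D y n x * V 1 x)"
    by (simp add: rsum_def \<kappa>_def sum_distrib_right)
  finally show ?thesis .
qed

text \<open>Dominated convergence in t: the sampled time tends to t and the level to y, and
  t^(-1/\<alpha>) is integrable at 0 because \<alpha> > 1.\<close>

lemma rsum_tendsto:
  assumes \<alpha>1: "1 < \<alpha>" and T: "0 < T"
  shows "(\<lambda>n. rsum (T / real (Suc n)) y n x) \<longlonglongrightarrow> (\<integral>t. p t y \<partial>timed T)"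
proof -
  define D where "D n = T / real (Suc n)" for n
  have D: "0 < D n" for n using T by (simp add: D_def)
  have DT: "real (Suc n) * D n = T" for n by (simp add: D_def)
  have D0: "D \<longlonglongrightarrow> 0"
    unfolding D_def using LIMSEQ_Suc[OF lim_const_over_n[of T]] by simp
  have k0: "(\<lambda>n. D n powr (1 / \<alpha>)) \<longlonglongrightarrow> 0"
    using tendsto_powr'[OF D0 tendsto_const, of "1 / \<alpha>"] \<alpha>1 D by (auto simp: less_imp_le)
  have u: "(\<lambda>n. y - D n powr (1 / \<alpha>) * x) \<longlonglongrightarrow> y"
    using tendsto_diff[OF tendsto_const tendsto_mult[OF k0 tendsto_const], of y x] by simp
  have "(\<lambda>n. \<integral>t. rstep (D n) n (y - D n powr (1 / \<alpha>) * x) t \<partial>timed T) \<longlonglongrightarrow> (\<integral>t. p t y \<partial>timed T)"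
  proof (rule integral_dominated_convergence[where w="\<lambda>t. K * t powr (- 1 / \<alpha>)"])
    show "integrable (timed T) (\<lambda>t. K * t powr (- 1 / \<alpha>))"
      using integrable_timed_powr[of "1 / \<alpha>" T] \<alpha>1 T by (intro integrable_mult_right) auto
    show "AE t in timed T. norm (rstep (D n) n (y - D n powr (1 / \<alpha>) * x) t) \<le> K * t powr (- 1 / \<alpha>)" for n
      by (intro AE_I2 rstep_norm[OF D]) auto
    show "AE t in timed T. (\<lambda>n. rstep (D n) n (y - D n powr (1 / \<alpha>) * x) t) \<longlonglongrightarrow> p t y"
    proof (intro AE_I2)
      fix t assume "t \<in> space (timed T)"
      then have t: "0 < t" "t < T" by auto
      define r where "r n = (real_of_int \<lfloor>t / D n\<rfloor> + 1) * D n" for n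
      have "r \<longlonglongrightarrow> t"
      proof (rule tendsto_sandwich[of "\<lambda>_. t" _ _ "\<lambda>n. t + D n"])
        show "(\<lambda>n. t + D n) \<longlonglongrightarrow> t" using tendsto_add[OF tendsto_const D0, of t] by simp
      qed (use floor_block[OF D, of t] t in \<open>auto simp: r_def intro!: always_eventually less_imp_le\<close>)
      then have lim: "(\<lambda>n. p (r n) (y - D n powr (1 / \<alpha>) * x)) \<longlonglongrightarrow> p t y"
        by (rule tendsto_stable_dens[OF \<alpha>_pos _ u t(1)])
      have "eventually (\<lambda>n. D n < T - t) sequentially"
        using D0 t by (intro order_tendstoD(2)) auto
      then have "eventually (\<lambda>n. p (r n) (y - D n powr (1 / \<alpha>) * x) = rstep (D n) n (y - D n powr (1 / \<alpha>) * x) t) sequentially"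
      proof eventually_elim
        case (elim n)
        have "real n * D n = T - D n" using DT[of n] by (simp add: distrib_right)
        then show ?case using elim t by (simp add: rstep_def r_def)
      qed
      with lim show "(\<lambda>n. rstep (D n) n (y - D n powr (1 / \<alpha>) * x) t) \<longlonglongrightarrow> p t y"
        by (rule Lim_transform_eventually)
    qed
  qed (auto intro: measurable_timed)
  then show ?thesis unfolding D_def[symmetric] rsum_eq[OF D] DT .
qed

theorem approx_err_limit_gt1:
  assumes \<alpha>1: "1 < \<alpha>" "\<alpha> \<le> 2" and T: "0 < T"
  shows "(\<lambda>n. (T / real n) powr (-1 - 1 / \<alpha>) * approx_err M X T y n) \<longlonglongrightarrow> (LINT x|lborel. V 1 x) * (\<integral>t. p t y \<partial>timed T)"
proof -
  define D where "D n = T / real (Suc n)" for n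
  have D: "0 < D n" for n using T by (simp add: D_def)
  have DT: "real (Suc n) * D n = T" for n by (simp add: D_def)
  have D0: "D \<longlonglongrightarrow> 0"
    unfolding D_def using LIMSEQ_Suc[OF lim_const_over_n[of T]] by simp
  have iV: "integrable lborel (V 1)" by (rule integrable_V[OF \<alpha>1])
  \<comment> \<open>The first block is negligible: \<open>V 1\<close> is bounded, and the exponent 1
    - 1/\<alpha> is positive.\<close>
  have l1: "(\<lambda>n. D n powr (1 - 1 / \<alpha>) * V 1 (D n powr (- 1 / \<alpha>) * y)) \<longlonglongrightarrow> 0"
  proof (rule tendsto_0_le[where K=1])
    show "(\<lambda>n. D n powr (1 - 1 / \<alpha>)) \<longlonglongrightarrow> 0"
      using tendsto_powr'[OF D0 tendsto_const, of "1 - 1 / \<alpha>"] \<alpha>1 D by (auto simp: less_imp_le)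
    show "\<forall>\<^sub>F n in sequentially. norm (D n powr (1 - 1 / \<alpha>) * V 1 (D n powr (- 1 / \<alpha>) * y)) \<le> norm (D n powr (1 - 1 / \<alpha>)) * 1"
      using V_bound[of 1] by (intro always_eventually allI) (auto simp: abs_mult intro!: mult_left_le)
  qed
  have l2: "(\<lambda>n. LINT x|lborel. rsum (D n) y n x * V 1 x) \<longlonglongrightarrow> (LINT x|lborel. (\<integral>t. p t y \<partial>timed T) * V 1 x)"
  proof (rule integral_dominated_convergence[where w="\<lambda>x. (\<integral>t. K * t powr (- 1 / \<alpha>) \<partial>timed T) * V 1 x"])
    show "integrable lborel (\<lambda>x. (\<integral>t. K * t powr (- 1 / \<alpha>) \<partial>timed T) * V 1 x)" using iV by simp
    show "AE x in lborel. (\<lambda>n. rsum (D n) y n x * V 1 x) \<longlonglongrightarrow> (\<integral>t. p t y \<partial>timed T) * V 1 x"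
      using rsum_tendsto[OF \<alpha>1(1) T] by (intro AE_I2 tendsto_mult tendsto_const) (simp add: D_def)
    show "AE x in lborel. norm (rsum (D n) y n x * V 1 x) \<le> (\<integral>t. K * t powr (- 1 / \<alpha>) \<partial>timed T) * V 1 x" for n
      using rsum_bounds[OF \<alpha>1(1) D[of n], of y n, unfolded DT] V_nonneg[of 1]
      by (intro AE_I2) (auto simp: abs_mult abs_of_nonneg intro!: mult_right_mono)
    have Vm: "V 1 \<in> borel_measurable lborel" using iV by auto
    show "(\<lambda>x. rsum (D n) y n x * V 1 x) \<in> borel_measurable lborel" for n
      by (intro borel_measurable_times Vm) (simp add: rsum_measurable)
    show "(\<lambda>x. (\<integral>t. p t y \<partial>timed T) * V 1 x) \<in> borel_measurable lborel"
      by (intro borel_measurable_times Vm) simp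
  qed
  have "(\<lambda>n. D n powr (-1 - 1 / \<alpha>) * approx_err M X T y (Suc n)) \<longlonglongrightarrow> 0 + (LINT x|lborel. (\<integral>t. p t y \<partial>timed T) * V 1 x)"
    using tendsto_add[OF l1 l2] by (simp only: approx_err_eq_rsum[OF \<alpha>1 D DT[symmetric]])
  then have "(\<lambda>n. (T / real (Suc n)) powr (-1 - 1 / \<alpha>) * approx_err M X T y (Suc n)) \<longlonglongrightarrow> (LINT x|lborel. V 1 x) * (\<integral>t. p t y \<partial>timed T)"
    by (simp add: D_def mult.commute)
  then show ?thesis by (rule LIMSEQ_imp_Suc)
qed

end

section \<open>The mean of the local time\<close>

lemma integral_abs_shift_powr_le:
  fixes b :: real
  assumes b: "b < 1" and T: "0 \<le> T"
  shows "integrable (timed T) (\<lambda>t. \<bar>t - s\<bar> powr (- b))"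
    and "s \<in> {0<..<T} \<Longrightarrow> (\<integral>t. \<bar>t - s\<bar> powr (- b) \<partial>timed T) \<le> 2 * (\<integral>t. t powr (- b) \<partial>timed T)"
proof -
  define g where "g r = indicator {0<..<T} r * r powr (- b)" for r :: real
  have ig: "integrable lborel g"
    using integrable_timed_powr[OF b T] by (simp add: timed_integrable_iff g_def[abs_def])
  have Ig: "(LINT r|lborel. g r) = (\<integral>t. t powr (- b) \<partial>timed T)"
    by (simp add: integral_timed g_def)
  have ig2: "integrable lborel (\<lambda>r. g (0 + (-1) * r))"
    using ig by (subst lborel_integrable_real_affine_iff) auto
  \<comment> \<open>Reflecting \<open>g\<close> covers both sides of the singularity at s; this is
    the origin of the factor 2, which is uniform in s.\<close>
  define f where "f r = g r + g (- r)" for r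
  have if1: "integrable lborel f" using ig ig2 by (simp add: f_def[abs_def])
  have "(LINT r|lborel. g r) = \<bar>-1\<bar> *\<^sub>R (LINT r|lborel. g (0 + (-1) * r))"
    by (rule lborel_integral_real_affine) simp
  then have "(LINT r|lborel. g (- r)) = (LINT r|lborel. g r)" by simp
  then have If: "(LINT r|lborel. f r) = 2 * (\<integral>t. t powr (- b) \<partial>timed T)"
    using ig ig2 by (simp add: f_def[abs_def] Ig)
  show int: "integrable (timed T) (\<lambda>t. \<bar>t - s\<bar> powr (- b))"
  proof -
    define R where "R = T + \<bar>s\<bar>"
    define g' where "g' r = indicator {0<..<R} r * r powr (- b)" for r :: real
    have "integrable lborel g'"
      using integrable_timed_powr[OF b, of R] T by (simp add: timed_integrable_iff g'_def[abs_def] R_def)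
    then have "integrable lborel (\<lambda>t. g' (- s + 1 * t))" "integrable lborel (\<lambda>t. g' (s + (-1) * t))"
      by (subst lborel_integrable_real_affine_iff; simp)+
    then have "integrable lborel (\<lambda>t. g' (- s + 1 * t) + g' (s + (-1) * t))"
      by (rule Bochner_Integration.integrable_add)
    then show ?thesis
      unfolding timed_integrable_iff
      by (rule Bochner_Integration.integrable_bound) (auto simp: g'_def R_def indicator_def abs_if)
  qed
  assume s: "s \<in> {0<..<T}"
  have "(\<integral>t. \<bar>t - s\<bar> powr (- b) \<partial>timed T) \<le> (LINT t|lborel. f (- s + 1 * t))"
    unfolding integral_timed
  proof (rule integral_mono)
    show "integrable lborel (\<lambda>t. indicator {0<..<T} t * \<bar>t - s\<bar> powr (- b))"
      using int by (simp add: timed_integrable_iff)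
    show "integrable lborel (\<lambda>t. f (- s + 1 * t))"
      using if1 by (subst lborel_integrable_real_affine_iff) auto
    show "indicator {0<..<T} t * \<bar>t - s\<bar> powr (- b) \<le> f (- s + 1 * t)" for t
      using s by (auto simp: f_def g_def indicator_def abs_if)
  qed
  also have "\<dots> = (LINT r|lborel. f r)"
    using lborel_integral_real_affine[of 1 f "- s"] by simp
  finally show "(\<integral>t. \<bar>t - s\<bar> powr (- b) \<partial>timed T) \<le> 2 * (\<integral>t. t powr (- b) \<partial>timed T)"
    by (simp add: If)
qed

context stable_process
begin

text \<open>The increment from s to t is independent of X at time s, and an interval of length
  \<open>\<delta>\<close> has probability at most \<open>\<delta>\<close> times the bound on the
  density.\<close>

lemma expectation_window_window:
  assumes st: "0 < s" "s < t" and \<delta>: "0 \<le> \<delta>"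
  shows "(\<integral>\<omega>. indicat_real {y..y+\<delta>} (X s \<omega>) * indicat_real {y..y+\<delta>} (X t \<omega>) \<partial>M)
    \<le> (K * s powr (- 1 / \<alpha>) * \<delta>) * (K * (t - s) powr (- 1 / \<alpha>) * \<delta>)"
proof -
  let ?I = "{y..y+\<delta>}"
  have [measurable]: "X s \<in> borel_measurable M" "X t \<in> borel_measurable M" "X 0 \<in> borel_measurable M" using st by auto
  have ind: "indep_pair borel (\<lambda>\<omega>. X s \<omega> - X 0 \<omega>) borel (\<lambda>\<omega>. X t \<omega> - X s \<omega>)"
    using st by (intro indep_var_imp_indep_pair indep_two_increments) auto
  have pb: "(LINT z|lborel. p r z * indicat_real ?I (u + z)) \<le> K * r powr (- 1 / \<alpha>) * \<delta>" if r: "0 < r" for r u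
  proof -
    have i: "integrable lborel (\<lambda>z. indicat_real {y-u..y+\<delta>-u} z :: real)"
      by (intro integrable_real_indicator) (auto simp: emeasure_lborel_Icc_eq)
    have e: "indicat_real ?I (u + z) = (indicat_real {y-u..y+\<delta>-u} z :: real)" for z by (auto simp: indicator_def)
    have "(LINT z|lborel. p r z * indicat_real ?I (u + z)) \<le> (LINT z|lborel. (K * r powr (- 1 / \<alpha>)) * indicat_real {y-u..y+\<delta>-u} z)"
      unfolding e
    proof (rule integral_mono)
      show "integrable lborel (\<lambda>z. p r z * indicat_real {y-u..y+\<delta>-u} z)"
        using integrable_p[OF r] by (rule integrable_real_mult_indicator[rotated]) simp
      show "integrable lborel (\<lambda>z. (K * r powr (- 1 / \<alpha>)) * indicat_real {y-u..y+\<delta>-u} z)"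
        using i by (rule integrable_mult_right)
    qed (intro mult_right_mono p_le, simp)
    also have "\<dots> = K * r powr (- 1 / \<alpha>) * \<delta>" using \<delta> by simp
    finally show ?thesis .
  qed
  have "(\<integral>\<omega>. indicat_real ?I (X s \<omega>) * indicat_real ?I (X t \<omega>) \<partial>M)
    = (\<integral>\<omega>. (\<lambda>(a, b). indicat_real ?I a * indicat_real ?I (a + b)) (X s \<omega> - X 0 \<omega>, X t \<omega> - X s \<omega>) \<partial>M)"
    by (intro Bochner_Integration.integral_cong) (auto simp: X_0)
  also have "\<dots> = (\<integral>\<omega>. (\<integral>\<omega>'. (\<lambda>(a, b). indicat_real ?I a * indicat_real ?I (a + b)) (X s \<omega> - X 0 \<omega>, X t \<omega>' - X s \<omega>') \<partial>M) \<partial>M)"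
    by (rule integral_indep_pair[OF ind, where B=1]) (auto simp: indicator_def)
  also have "\<dots> = (\<integral>\<omega>. indicat_real ?I (X s \<omega>) * (LINT z|lborel. p (t - s) z * indicat_real ?I (X s \<omega> + z)) \<partial>M)"
  proof (rule Bochner_Integration.integral_cong[OF refl])
    fix \<omega> assume "\<omega> \<in> space M"
    then show "(\<integral>\<omega>'. (\<lambda>(a, b). indicat_real ?I a * indicat_real ?I (a + b)) (X s \<omega> - X 0 \<omega>, X t \<omega>' - X s \<omega>') \<partial>M)
      = indicat_real ?I (X s \<omega>) * (LINT z|lborel. p (t - s) z * indicat_real ?I (X s \<omega> + z))"
      using expectation_increment[of s t "\<lambda>b. indicat_real ?I (X s \<omega> + b) :: real"] st by (simp add: X_0)
  qed
  also have "\<dots> \<le> (\<integral>\<omega>. indicat_real ?I (X s \<omega>) * (K * (t - s) powr (- 1 / \<alpha>) * \<delta>) \<partial>M)"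
  proof (rule integral_mono)
    have b0: "0 \<le> (LINT z|lborel. p (t - s) z * indicat_real ?I (X s \<omega> + z))" for \<omega>
      using st by (intro Bochner_Integration.integral_nonneg) (auto simp: p_nonneg)
    have b1: "(LINT z|lborel. p (t - s) z * indicat_real ?I (X s \<omega> + z)) \<le> K * (t - s) powr (- 1 / \<alpha>) * \<delta>" for \<omega>
      using st by (intro pb) auto
    have C0: "0 \<le> K * (t - s) powr (- 1 / \<alpha>) * \<delta>" using order_trans[OF b0 b1] .
    show "integrable M (\<lambda>\<omega>. indicat_real ?I (X s \<omega>) * (LINT z|lborel. p (t - s) z * indicat_real ?I (X s \<omega> + z)))"
    proof (rule integrable_const_bound[where B="K * (t - s) powr (- 1 / \<alpha>) * \<delta>"])
      show "AE \<omega> in M. norm (indicat_real ?I (X s \<omega>) * (LINT z|lborel. p (t - s) z * indicat_real ?I (X s \<omega> + z))) \<le> K * (t - s) powr (- 1 / \<alpha>) * \<delta>"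
        using b0 b1 C0 by (intro AE_I2) (auto simp: indicator_def[of ?I "X s _"] abs_of_nonneg)
    qed measurable
    show "integrable M (\<lambda>\<omega>. indicat_real ?I (X s \<omega>) * (K * (t - s) powr (- 1 / \<alpha>) * \<delta>))"
      using C0 by (intro integrable_const_bound[where B="K * (t - s) powr (- 1 / \<alpha>) * \<delta>"]) (auto simp: indicator_def)
    show "indicat_real ?I (X s \<omega>) * (LINT z|lborel. p (t - s) z * indicat_real ?I (X s \<omega> + z)) \<le> indicat_real ?I (X s \<omega>) * (K * (t - s) powr (- 1 / \<alpha>) * \<delta>)" for \<omega>
      using b1 by (intro mult_left_mono) auto
  qed
  also have "\<dots> = (\<integral>\<omega>. indicat_real ?I (X s \<omega>) \<partial>M) * (K * (t - s) powr (- 1 / \<alpha>) * \<delta>)" by simp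
  also have "\<dots> \<le> (K * s powr (- 1 / \<alpha>) * \<delta>) * (K * (t - s) powr (- 1 / \<alpha>) * \<delta>)"
  proof (rule mult_right_mono)
    show "(\<integral>\<omega>. indicat_real ?I (X s \<omega>) \<partial>M) \<le> K * s powr (- 1 / \<alpha>) * \<delta>"
      using expectation_X[OF st(1), of "indicat_real ?I"] pb[OF st(1), of 0] by simp
  qed (use K_nonneg \<delta> in auto)
  finally show ?thesis .
qed

text \<open>Where a local time exists, this is its mean value over [y, y + \<delta>], see
  \<open>window_tendsto\<close>.\<close>

definition window :: "real \<Rightarrow> real \<Rightarrow> real \<Rightarrow> 'a \<Rightarrow> real" where
  "window T y \<delta> \<omega> = (\<integral>s. indicat_real {y..y+\<delta>} (X s \<omega>) \<partial>timed T) / \<delta>"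

lemma X_timed_measurable: "(\<lambda>(s, \<omega>). X s \<omega>) \<in> borel_measurable (timed T \<Otimes>\<^sub>M M)"
  unfolding split_beta by (rule X_comp_measurable) (auto simp: space_pair_measure)

lemma X_ind_measurable: "(\<lambda>(s, \<omega>). indicat_real {y..y+\<delta>} (X s \<omega>) :: real) \<in> borel_measurable (timed T \<Otimes>\<^sub>M M)"
  using measurable_compose[OF X_timed_measurable, of "indicat_real {y..y+\<delta>} :: real \<Rightarrow> real" borel T] by (simp add: split_beta)

lemma window_measurable[measurable]: "window T y \<delta> \<in> borel_measurable M"
proof -
  interpret T: sigma_finite_measure "timed T" by (rule sigma_finite_timed)
  have "(\<lambda>(\<omega>, s). indicat_real {y..y+\<delta>} (X s \<omega>) :: real) \<in> borel_measurable (M \<Otimes>\<^sub>M timed T)"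
    using measurable_compose[OF measurable_pair_swap' X_ind_measurable] by (simp add: split_beta)
  then have "(\<lambda>\<omega>. \<integral>s. indicat_real {y..y+\<delta>} (X s \<omega>) \<partial>timed T) \<in> borel_measurable M"
    by (rule T.borel_measurable_lebesgue_integral)
  then show ?thesis unfolding window_def[abs_def] by measurable
qed

lemma window_bounds:
  assumes "0 < \<delta>" "0 \<le> T"
  shows "0 \<le> window T y \<delta> \<omega>" "window T y \<delta> \<omega> \<le> T / \<delta>"
proof -
  show "0 \<le> window T y \<delta> \<omega>" using assms unfolding window_def by (intro divide_nonneg_pos Bochner_Integration.integral_nonneg) auto
  have "\<bar>\<integral>s. indicat_real {y..y+\<delta>} (X s \<omega>) \<partial>timed T\<bar> \<le> T * 1"
    by (rule timed_integral_bound) (auto simp: indicator_def assms)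
  then show "window T y \<delta> \<omega> \<le> T / \<delta>" unfolding window_def using assms by (intro divide_right_mono) auto
qed

lemma expectation_window:
  assumes \<delta>: "0 < \<delta>" and T: "0 \<le> T"
  shows "(\<integral>\<omega>. window T y \<delta> \<omega> \<partial>M) = (\<integral>s. (\<integral>u. p s (y + \<delta> * u) \<partial>timed 1) \<partial>timed T)"
proof -
  have "(\<integral>\<omega>. (\<integral>s. indicat_real {y..y+\<delta>} (X s \<omega>) \<partial>timed T) \<partial>M) = (\<integral>s. (\<integral>\<omega>. indicat_real {y..y+\<delta>} (X s \<omega>) \<partial>M) \<partial>timed T)"
    by (rule Fubini_bounded[where B=1, OF finite_measure_timed finite_measure_axioms X_ind_measurable]) simp
  also have "\<dots> = (\<integral>s. \<delta> * (\<integral>u. p s (y + \<delta> * u) \<partial>timed 1) \<partial>timed T)"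
  proof (rule Bochner_Integration.integral_cong[OF refl])
    fix s assume "s \<in> space (timed T)"
    then have s: "0 < s" by simp
    have "(\<integral>\<omega>. indicat_real {y..y+\<delta>} (X s \<omega>) \<partial>M) = (LINT z:{y..y+\<delta>}|lborel. p s z)"
      using expectation_X[OF s, of "indicat_real {y..y+\<delta>}"] by (simp add: set_lebesgue_integral_def mult.commute)
    also have "\<dots> = (\<integral>u. p s (y + u) \<partial>timed \<delta>)" by (rule integral_block) simp
    also have "\<dots> = \<delta> * (\<integral>u. p s (y + \<delta> * u) \<partial>timed 1)" by (rule integral_timed_scale[OF \<delta>])
    finally show "(\<integral>\<omega>. indicat_real {y..y+\<delta>} (X s \<omega>) \<partial>M) = \<delta> * (\<integral>u. p s (y + \<delta> * u) \<partial>timed 1)" .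
  qed
  finally show ?thesis using \<delta> by (simp add: window_def)
qed

text \<open>The mean of a window is an average of densities near y; K t^(-1/\<alpha>) dominates them
  all, uniformly in the width of the window.\<close>

lemma expectation_window_tendsto:
  assumes \<alpha>1: "1 < \<alpha>" and T: "0 < T" and \<delta>: "\<delta> \<longlonglongrightarrow> 0" "\<And>n. 0 < \<delta> n"
  shows "(\<lambda>n. \<integral>\<omega>. window T y (\<delta> n) \<omega> \<partial>M) \<longlonglongrightarrow> (\<integral>s. p s y \<partial>timed T)"
proof -
  interpret S: sigma_finite_measure "timed 1" by (rule sigma_finite_timed)
  interpret S1: finite_measure "timed 1" by (rule finite_measure_timed)
  have pb: "\<bar>p s u\<bar> \<le> K * s powr (- 1 / \<alpha>)" if "0 < s" for s u
    using p_le[of s u] p_nonneg[OF that] by simp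
  have "(\<lambda>n. \<integral>s. (\<integral>u. p s (y + \<delta> n * u) \<partial>timed 1) \<partial>timed T) \<longlonglongrightarrow> (\<integral>s. p s y \<partial>timed T)"
  proof (rule integral_dominated_convergence[where w="\<lambda>t. K * t powr (- 1 / \<alpha>)"])
    show "integrable (timed T) (\<lambda>t. K * t powr (- 1 / \<alpha>))"
      using integrable_timed_powr[of "1 / \<alpha>" T] \<alpha>1 T by (intro integrable_mult_right) auto
    show "(\<lambda>s. p s y) \<in> borel_measurable (timed T)" by measurable
    show "(\<lambda>s. \<integral>u. p s (y + \<delta> n * u) \<partial>timed 1) \<in> borel_measurable (timed T)" for n
      by (intro S.borel_measurable_lebesgue_integral) measurable
    show "AE s in timed T. norm (\<integral>u. p s (y + \<delta> n * u) \<partial>timed 1) \<le> K * s powr (- 1 / \<alpha>)" for n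
    proof (rule AE_I2)
      fix s assume "s \<in> space (timed T)"
      then have "\<bar>\<integral>u. p s (y + \<delta> n * u) \<partial>timed 1\<bar> \<le> 1 * (K * s powr (- 1 / \<alpha>))"
        by (intro timed_integral_bound pb) (auto simp: K_nonneg)
      then show "norm (\<integral>u. p s (y + \<delta> n * u) \<partial>timed 1) \<le> K * s powr (- 1 / \<alpha>)" by simp
    qed
    show "AE s in timed T. (\<lambda>n. \<integral>u. p s (y + \<delta> n * u) \<partial>timed 1) \<longlonglongrightarrow> p s y"
    proof (rule AE_I2)
      fix s assume "s \<in> space (timed T)"
      then have s: "0 < s" by simp
      have "(\<lambda>n. \<integral>u. p s (y + \<delta> n * u) \<partial>timed 1) \<longlonglongrightarrow> (\<integral>u. p s y \<partial>timed 1)"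
      proof (rule integral_dominated_convergence[where w="\<lambda>_. K * s powr (- 1 / \<alpha>)"])
        show "AE u in timed 1. (\<lambda>n. p s (y + \<delta> n * u)) \<longlonglongrightarrow> p s y"
        proof (rule AE_I2)
          fix u
          have "(\<lambda>n. y + \<delta> n * u) \<longlonglongrightarrow> y"
            using tendsto_add[OF tendsto_const tendsto_mult[OF \<delta>(1) tendsto_const], of y u] by simp
          then show "(\<lambda>n. p s (y + \<delta> n * u)) \<longlonglongrightarrow> p s y"
            by (rule tendsto_stable_dens[OF \<alpha>_pos tendsto_const _ s])
        qed
        show "AE u in timed 1. norm (p s (y + \<delta> n * u)) \<le> K * s powr (- 1 / \<alpha>)" for n
          using pb[OF s] by (intro AE_I2) simp
        show "(\<lambda>u. p s (y + \<delta> n * u)) \<in> borel_measurable (timed 1)" for n by measurable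
      qed simp_all
      then show "(\<lambda>n. \<integral>u. p s (y + \<delta> n * u) \<partial>timed 1) \<longlonglongrightarrow> p s y" by simp
    qed
  qed
  then show ?thesis using \<delta>(2) T by (simp add: expectation_window)
qed

text \<open>The bound is uniform in \<open>\<delta>\<close>. The probability of being in the window
  at both times is at most \<open>\<delta>\<close> squared times singularities at min(s, t) and at
  |t - s|, and these are integrable because the exponent 1/\<alpha> is below 1.\<close>

lemma expectation_window_sq:
  assumes \<alpha>1: "1 < \<alpha>" and T: "0 < T" and \<delta>: "0 < \<delta>"
  shows "(\<integral>\<omega>. (window T y \<delta> \<omega>)\<^sup>2 \<partial>M) \<le> 6 * K\<^sup>2 * (\<integral>t. t powr (- (1 / \<alpha>)) \<partial>timed T)\<^sup>2"
proof -
  let ?I = "{y..y+\<delta>}"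
  define b where "b = 1 / \<alpha>"
  have b: "0 < b" "b < 1" "- 1 / \<alpha> = - b" using \<alpha>1 by (auto simp: b_def)
  define A where "A = (\<integral>t. t powr (- b) \<partial>timed T)"
  define O1 where "O1 \<omega> = (\<integral>s. indicat_real ?I (X s \<omega>) \<partial>timed T)" for \<omega>
  have O1: "O1 \<omega> = \<delta> * window T y \<delta> \<omega>" for \<omega> using \<delta> by (simp add: O1_def window_def)
  have [measurable]: "O1 \<in> borel_measurable M" unfolding O1[abs_def] by measurable
  have O1b: "\<bar>O1 \<omega>\<bar> \<le> T" for \<omega>
    using timed_integral_bound[of T "\<lambda>s. indicat_real ?I (X s \<omega>)" 1] T by (auto simp: O1_def indicator_def)
  have A0: "0 \<le> A" unfolding A_def by (intro Bochner_Integration.integral_nonneg) auto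
  have iA: "integrable (timed T) (\<lambda>t. t powr (- b))" using b T by (intro integrable_timed_powr) auto
  define E where "E s t = (\<integral>\<omega>. indicat_real ?I (X s \<omega>) * indicat_real ?I (X t \<omega>) \<partial>M :: real)" for s t
  have swap: "(\<integral>\<omega>. O1 \<omega> * g \<omega> \<partial>M) = (\<integral>s. (\<integral>\<omega>. indicat_real ?I (X s \<omega>) * g \<omega> \<partial>M) \<partial>timed T)"
    if [measurable]: "g \<in> borel_measurable M" and g: "\<And>\<omega>. \<bar>g \<omega>\<bar> \<le> B" for g B
  proof -
    note [measurable] = X_ind_measurable
    have "(\<integral>\<omega>. O1 \<omega> * g \<omega> \<partial>M) = (\<integral>\<omega>. (\<integral>s. indicat_real ?I (X s \<omega>) * g \<omega> \<partial>timed T) \<partial>M)"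
      by (simp add: O1_def)
    also have "\<dots> = (\<integral>s. (\<integral>\<omega>. indicat_real ?I (X s \<omega>) * g \<omega> \<partial>M) \<partial>timed T)"
    proof (rule Fubini_bounded[where B="1 * B"])
      show "\<bar>indicat_real ?I (X s \<omega>) * g \<omega>\<bar> \<le> 1 * B" for s \<omega>
        unfolding abs_mult using g by (intro mult_mono) (auto simp: indicator_def)
    qed (simp_all add: finite_measure_timed finite_measure_axioms)
    finally show ?thesis .
  qed
  have "(\<integral>\<omega>. (O1 \<omega>)\<^sup>2 \<partial>M) = (\<integral>s. (\<integral>\<omega>. indicat_real ?I (X s \<omega>) * O1 \<omega> \<partial>M) \<partial>timed T)"
    unfolding power2_eq_square by (rule swap[OF _ O1b]) simp
  also have "\<dots> = (\<integral>s. (\<integral>t. E s t \<partial>timed T) \<partial>timed T)"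
  proof (rule Bochner_Integration.integral_cong[OF refl])
    fix s assume "s \<in> space (timed T)"
    then have [measurable]: "X s \<in> borel_measurable M" by auto
    have "(\<integral>\<omega>. O1 \<omega> * indicat_real ?I (X s \<omega>) \<partial>M) = (\<integral>t. (\<integral>\<omega>. indicat_real ?I (X t \<omega>) * indicat_real ?I (X s \<omega>) \<partial>M) \<partial>timed T)"
      by (rule swap[of "\<lambda>\<omega>. indicat_real ?I (X s \<omega>)" 1]) (auto simp: indicator_def)
    then show "(\<integral>\<omega>. indicat_real ?I (X s \<omega>) * O1 \<omega> \<partial>M) = (\<integral>t. E s t \<partial>timed T)"
      by (simp add: E_def mult.commute)
  qed
  also have "\<dots> \<le> (\<integral>s. 6 * (K * \<delta>)\<^sup>2 * A * s powr (- b) \<partial>timed T)"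
  proof (rule integral_mono')
    show "integrable (timed T) (\<lambda>s. 6 * (K * \<delta>)\<^sup>2 * A * s powr (- b))" using iA by simp
    show "0 \<le> 6 * (K * \<delta>)\<^sup>2 * A * s powr (- b)" for s using A0 by simp
    fix s assume "s \<in> space (timed T)"
    then have s: "0 < s" "s < T" by auto
    \<comment> \<open>One bound for both orders of s and t, with s^(-b) factored out for the outer
      integral.\<close>
    have Eb: "E s t \<le> 2 * (K * \<delta>)\<^sup>2 * s powr (- b) * (\<bar>t - s\<bar> powr (- b) + t powr (- b))" if t: "0 < t" "t \<noteq> s" for t
    proof (cases "s < t")
      case True
      have "E s t \<le> (K * s powr (- b) * \<delta>) * (K * (t - s) powr (- b) * \<delta>)"
        unfolding E_def using expectation_window_window[OF s(1) True less_imp_le[OF \<delta>], of y] unfolding b(3) .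
      also have "\<dots> = (K * \<delta>)\<^sup>2 * s powr (- b) * \<bar>t - s\<bar> powr (- b)" using True by (simp add: power2_eq_square)
      also have "\<dots> \<le> 2 * (K * \<delta>)\<^sup>2 * s powr (- b) * (\<bar>t - s\<bar> powr (- b) + t powr (- b))"
        by (intro mult_mono) (auto intro!: mult_nonneg_nonneg)
      finally show ?thesis .
    next
      case False
      then have ts: "t < s" using t by simp
      \<comment> \<open>Either t or s - t is at least s / 2, so one of the two singular factors is
        at most 2 s^(-b), where 2^b <= 2 is used.\<close>
      have key: "t powr (- b) * (s - t) powr (- b) \<le> (2 * s powr (- b)) * (\<bar>t - s\<bar> powr (- b) + t powr (- b))"
      proof -
        have half: "(s / 2) powr (- b) \<le> 2 * s powr (- b)"
        proof -
          have "(s / 2) powr (- b) = 2 powr b * s powr (- b)" using s by (simp add: powr_divide powr_minus field_simps)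
          also have "\<dots> \<le> 2 powr 1 * s powr (- b)" using b by (intro mult_right_mono powr_mono) auto
          finally show ?thesis by simp
        qed
        have h: "r powr (- b) \<le> 2 * s powr (- b)" if "s / 2 \<le> r" for r
          using powr_mono2'[of "- b" "s / 2" r] that half b s by linarith
        consider "s / 2 \<le> t" | "s / 2 \<le> s - t" by linarith
        then show ?thesis
        proof cases
          case 1
          have "t powr (- b) * (s - t) powr (- b) \<le> (2 * s powr (- b)) * (s - t) powr (- b)"
            using h[OF 1] by (intro mult_right_mono) auto
          also have "\<dots> \<le> (2 * s powr (- b)) * (\<bar>t - s\<bar> powr (- b) + t powr (- b))"
            using ts by (intro mult_left_mono) auto
          finally show ?thesis .
        next
          case 2
          have "t powr (- b) * (s - t) powr (- b) \<le> t powr (- b) * (2 * s powr (- b))"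
            using h[OF 2] by (intro mult_left_mono) auto
          also have "\<dots> = (2 * s powr (- b)) * t powr (- b)" by simp
          also have "\<dots> \<le> (2 * s powr (- b)) * (\<bar>t - s\<bar> powr (- b) + t powr (- b))"
            by (intro mult_left_mono) auto
          finally show ?thesis .
        qed
      qed
      have "E s t = E t s" by (simp add: E_def mult.commute)
      also have "\<dots> \<le> (K * t powr (- b) * \<delta>) * (K * (s - t) powr (- b) * \<delta>)"
        unfolding E_def using expectation_window_window[OF t(1) ts less_imp_le[OF \<delta>], of y] unfolding b(3) .
      also have "\<dots> = (K * \<delta>)\<^sup>2 * (t powr (- b) * (s - t) powr (- b))" by (simp add: power2_eq_square)
      also have "\<dots> \<le> (K * \<delta>)\<^sup>2 * ((2 * s powr (- b)) * (\<bar>t - s\<bar> powr (- b) + t powr (- b)))"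
        by (rule mult_left_mono[OF key]) simp
      finally show ?thesis by (simp add: mult_ac)
    qed
    have i1: "integrable (timed T) (\<lambda>t. \<bar>t - s\<bar> powr (- b))" using b T by (intro integral_abs_shift_powr_le) auto
    have i2: "integrable (timed T) (\<lambda>t. 2 * (K * \<delta>)\<^sup>2 * s powr (- b) * (\<bar>t - s\<bar> powr (- b) + t powr (- b)))"
      using i1 iA by (intro integrable_mult_right Bochner_Integration.integrable_add)
    have ne: "AE t in timed T. t \<noteq> s"
      unfolding timed_def by (subst AE_restrict_space_iff) (auto intro: eventually_mono[OF AE_lborel_singleton[of s]])
    have "(\<integral>t. E s t \<partial>timed T) \<le> (\<integral>t. 2 * (K * \<delta>)\<^sup>2 * s powr (- b) * (\<bar>t - s\<bar> powr (- b) + t powr (- b)) \<partial>timed T)"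
    proof (cases "integrable (timed T) (E s)")
      case True
      have "AE t in timed T. E s t \<le> 2 * (K * \<delta>)\<^sup>2 * s powr (- b) * (\<bar>t - s\<bar> powr (- b) + t powr (- b))"
        using ne AE_space by eventually_elim (auto intro: Eb)
      with True i2 show ?thesis by (rule integral_mono_AE)
    next
      \<comment> \<open>The integral on the left is then 0 by convention, and the one on the right
        is nonnegative.\<close>
      case False
      then show ?thesis
        by (simp add: not_integrable_integral_eq)
    qed
    also have "\<dots> = 2 * (K * \<delta>)\<^sup>2 * s powr (- b) * ((\<integral>t. \<bar>t - s\<bar> powr (- b) \<partial>timed T) + A)"
      using i1 iA by (simp add: A_def)
    \<comment> \<open>The singularity at s costs 2 A and the one at 0 costs A; with the factor 2 in
      front this is the 6 of the statement.\<close>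
    also have "\<dots> \<le> 2 * (K * \<delta>)\<^sup>2 * s powr (- b) * (2 * A + A)"
      using integral_abs_shift_powr_le(2)[of b T s] b T s by (intro mult_left_mono) (auto simp: A_def)
    also have "\<dots> = 6 * (K * \<delta>)\<^sup>2 * A * s powr (- b)" by simp
    finally show "(\<integral>t. E s t \<partial>timed T) \<le> 6 * (K * \<delta>)\<^sup>2 * A * s powr (- b)" .
  qed
  also have "\<dots> = \<delta>\<^sup>2 * (6 * K\<^sup>2 * A\<^sup>2)" by (simp add: A_def[symmetric] power2_eq_square)
  finally have "(\<integral>\<omega>. \<delta>\<^sup>2 * (window T y \<delta> \<omega>)\<^sup>2 \<partial>M) \<le> \<delta>\<^sup>2 * (6 * K\<^sup>2 * A\<^sup>2)"
    by (simp add: O1 power_mult_distrib)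
  then show ?thesis using \<delta> by (simp add: A_def b_def)
qed

text \<open>The occupation formula on [y, y + \<delta>] writes the window as an average of the
  density \<open>l\<close>, which is continuous at y.\<close>

lemma window_tendsto:
  assumes T: "0 < T" and \<omega>: "\<omega> \<in> space M" and l: "continuous_on UNIV l" "\<And>z. 0 \<le> l z"
    and occ: "\<And>A. A \<in> sets borel \<Longrightarrow> (\<integral>\<^sup>+z. ennreal (l z) * indicator A z \<partial>lborel) = emeasure lborel {s\<in>{0..T}. X s \<omega> \<in> A}"
    and \<delta>: "\<delta> \<longlonglongrightarrow> 0" "\<And>n. 0 < \<delta> n" "\<And>n. \<delta> n \<le> 1"
  shows "(\<lambda>n. window T y (\<delta> n) \<omega>) \<longlonglongrightarrow> l y"
proof -
  note [measurable] = path_measurable[OF \<omega>]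
  have [measurable]: "l \<in> borel_measurable borel" using l(1) by (rule borel_measurable_continuous_onI)
  interpret S1: finite_measure "timed 1" by (rule finite_measure_timed)
  have eq: "window T y d \<omega> = (\<integral>u. l (y + d * u) \<partial>timed 1)" if d: "0 < d" for d
  proof -
    let ?I = "{y..y+d}"
    have "ennreal (LINT z:?I|lborel. l z) = (\<integral>\<^sup>+z. ennreal (indicator ?I z * l z) \<partial>lborel)"
      unfolding set_lebesgue_integral_def
    proof (subst nn_integral_eq_integral)
      show "integrable lborel (\<lambda>z. indicator ?I z * l z)"
        using borel_integrable_atLeastAtMost'[of y "y + d" l] l(1) by (auto simp: set_integrable_def intro: continuous_on_subset)
    qed (auto simp: l)
    also have "\<dots> = (\<integral>\<^sup>+z. ennreal (l z) * indicator ?I z \<partial>lborel)"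
      by (intro nn_integral_cong) (auto simp: indicator_def)
    also have "\<dots> = emeasure lborel {s\<in>{0..T}. X s \<omega> \<in> ?I}" by (rule occ) simp
    also have "{s\<in>{0..T}. X s \<omega> \<in> ?I} = {s\<in>{0..T}. X (max 0 s) \<omega> \<in> ?I}" by auto
    also have "emeasure lborel \<dots> = ennreal (LINT s:{0..T}|lborel. indicator ?I (X (max 0 s) \<omega>))"
    proof -
      let ?A = "{s\<in>{0..T}. X (max 0 s) \<omega> \<in> ?I}"
      have A: "?A \<in> sets lborel" by measurable
      have "emeasure lborel ?A \<le> emeasure lborel {0..T}" by (rule emeasure_mono) auto
      then have fin: "emeasure lborel ?A < \<infinity>" using T by (auto intro: le_less_trans)
      have "(LINT s:{0..T}|lborel. indicator ?I (X (max 0 s) \<omega>)) = (LINT s|lborel. indicat_real ?A s)"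
        unfolding set_lebesgue_integral_def by (intro Bochner_Integration.integral_cong) (auto simp: indicator_def)
      also have "\<dots> = measure lborel ?A" using A by simp
      finally show ?thesis using fin by (simp add: emeasure_eq_ennreal_measure less_top[symmetric])
    qed
    also have "(LINT s:{0..T}|lborel. indicator ?I (X (max 0 s) \<omega>)) = (\<integral>s. indicat_real ?I (X (max 0 (0 + s)) \<omega>) \<partial>timed T)"
      using integral_block[of "\<lambda>s. indicat_real ?I (X (max 0 s) \<omega>)" 0 T] by simp
    also have "\<dots> = d * window T y d \<omega>"
      unfolding window_def using d by (auto intro!: Bochner_Integration.integral_cong)
    finally have "ennreal (LINT z:?I|lborel. l z) = ennreal (d * window T y d \<omega>)" .
    moreover have "0 \<le> (LINT z:?I|lborel. l z)"
      unfolding set_lebesgue_integral_def by (intro Bochner_Integration.integral_nonneg) (auto simp: l)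
    moreover have "0 \<le> d * window T y d \<omega>" using d T window_bounds(1)[of d T y \<omega>] by simp
    ultimately have "d * window T y d \<omega> = (LINT z:?I|lborel. l z)" by simp
    also have "\<dots> = (\<integral>u. l (y + u) \<partial>timed d)" by (rule integral_block) simp
    also have "\<dots> = d * (\<integral>u. l (y + d * u) \<partial>timed 1)" by (rule integral_timed_scale[OF d])
    finally show ?thesis using d by simp
  qed
  have "compact (l ` {y..y+1})" using l(1) by (intro compact_continuous_image) (auto intro: continuous_on_subset)
  then have "bounded (l ` {y..y+1})" by (rule compact_imp_bounded)
  then obtain B where "\<forall>x\<in>l ` {y..y+1}. norm x \<le> B" unfolding bounded_iff by blast
  then have B: "norm (l z) \<le> B" if "z \<in> {y..y+1}" for z using that by blast
  have "(\<lambda>n. \<integral>u. l (y + \<delta> n * u) \<partial>timed 1) \<longlonglongrightarrow> (\<integral>u. l y \<partial>timed 1)"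
  proof (rule integral_dominated_convergence[where w="\<lambda>_. B"])
    show "(\<lambda>u. l (y + \<delta> n * u)) \<in> borel_measurable (timed 1)" for n by measurable
    show "AE u in timed 1. (\<lambda>n. l (y + \<delta> n * u)) \<longlonglongrightarrow> l y"
    proof (rule AE_I2)
      fix u
      have "(\<lambda>n. y + \<delta> n * u) \<longlonglongrightarrow> y"
        using tendsto_add[OF tendsto_const tendsto_mult[OF \<delta>(1) tendsto_const], of y u] by simp
      moreover have "isCont l y" using l(1) by (simp add: continuous_on_eq_continuous_at)
      ultimately show "(\<lambda>n. l (y + \<delta> n * u)) \<longlonglongrightarrow> l y" by (rule isCont_tendsto_compose[rotated])
    qed
    show "AE u in timed 1. norm (l (y + \<delta> n * u)) \<le> B" for n
    proof (rule AE_I2)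
      fix u assume "u \<in> space (timed 1)"
      then have "0 \<le> \<delta> n * u" "\<delta> n * u \<le> 1" using \<delta>(2,3)[of n] by (auto intro!: mult_le_one)
      then show "norm (l (y + \<delta> n * u)) \<le> B" by (intro B) auto
    qed
  qed simp_all
  then show ?thesis using \<delta>(2) by (simp add: eq)
qed

text \<open>The windows converge almost surely, but this alone does not give convergence of their
  means. Truncation at m makes the problem bounded, the uniform second moment bounds what is cut off
  by C / m, and then m tends to infinity.\<close>

theorem expectation_local_time:
  assumes \<alpha>1: "1 < \<alpha>" and T: "0 < T" and L: "is_local_time M X T L"
  shows "(\<integral>\<omega>. L y \<omega> \<partial>M) = (\<integral>s. p s y \<partial>timed T)"
proof -
  define I where "I = (\<integral>s. p s y \<partial>timed T)"
  define C where "C = 6 * K\<^sup>2 * (\<integral>t. t powr (- (1 / \<alpha>)) \<partial>timed T)\<^sup>2"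
  define \<delta> where "\<delta> n = inverse (real (Suc n))" for n
  have \<delta>: "\<delta> \<longlonglongrightarrow> 0" "\<And>n. 0 < \<delta> n" "\<And>n. \<delta> n \<le> 1"
    using LIMSEQ_inverse_real_of_nat by (auto simp: \<delta>_def[abs_def] divide_simps)
  define W where "W n = window T y (\<delta> n)" for n
  have [measurable]: "W n \<in> borel_measurable M" for n unfolding W_def by simp
  have Lm[measurable]: "L y \<in> borel_measurable M" using L by (simp add: is_local_time_def)
  have good: "AE \<omega> in M. 0 \<le> L y \<omega> \<and> (\<lambda>n. W n \<omega>) \<longlonglongrightarrow> L y \<omega>"
  proof -
    have "AE \<omega> in M. continuous_on UNIV (\<lambda>y. L y \<omega>) \<and> (\<forall>y. 0 \<le> L y \<omega>) \<and>
        (\<forall>A\<in>sets borel. (\<integral>\<^sup>+ y. ennreal (L y \<omega>) * indicator A y \<partial>lborel) = emeasure lborel {s\<in>{0..T}. X s \<omega> \<in> A})"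
      using L by (simp add: is_local_time_def)
    then show ?thesis using AE_space
    proof eventually_elim
      case (elim \<omega>)
      then have "(\<lambda>n. window T y (\<delta> n) \<omega>) \<longlonglongrightarrow> L y \<omega>"
        by (intro window_tendsto[OF T _ _ _ _ \<delta>]) auto
      then show ?case using elim by (simp add: W_def)
    qed
  qed
  have W0: "0 \<le> W n \<omega>" for n \<omega> using window_bounds(1)[OF \<delta>(2), of T y n \<omega>] T by (simp add: W_def)
  have Wb: "W n \<omega> \<le> T / \<delta> n" for n \<omega> using window_bounds(2)[OF \<delta>(2), of T y n \<omega>] T by (simp add: W_def)
  have EW: "(\<lambda>n. \<integral>\<omega>. W n \<omega> \<partial>M) \<longlonglongrightarrow> I"
    unfolding W_def I_def by (rule expectation_window_tendsto[OF \<alpha>1 T \<delta>(1,2)])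
  have EW2: "(\<integral>\<omega>. (W n \<omega>)\<^sup>2 \<partial>M) \<le> C" for n
    unfolding W_def C_def by (rule expectation_window_sq[OF \<alpha>1 T \<delta>(2)])
  have iW: "integrable M (W n)" for n
    using W0 Wb by (intro integrable_const_bound[where B="T / \<delta> n"]) (auto simp: abs_of_nonneg)
  have iW2: "integrable M (\<lambda>\<omega>. (W n \<omega>)\<^sup>2)" for n
    using W0 Wb by (intro integrable_const_bound[where B="(T / \<delta> n)\<^sup>2"]) (auto intro!: power_mono)
  have imin: "integrable M (\<lambda>\<omega>. min (f \<omega>) m)" if [measurable]: "f \<in> borel_measurable M" and "AE \<omega> in M. 0 \<le> f \<omega>" "0 \<le> m" for f and m :: real
    by (rule integrable_const_bound[where B=m]) (use that in \<open>auto elim!: eventually_mono\<close>)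
  have lim_min: "(\<lambda>n. \<integral>\<omega>. min (W n \<omega>) m \<partial>M) \<longlonglongrightarrow> (\<integral>\<omega>. min (L y \<omega>) m \<partial>M)" if "0 < m" for m
  proof (rule integral_dominated_convergence[where w="\<lambda>_. m"])
    show "AE \<omega> in M. (\<lambda>n. min (W n \<omega>) m) \<longlonglongrightarrow> min (L y \<omega>) m"
      using good by eventually_elim (auto intro!: tendsto_min)
    show "AE \<omega> in M. norm (min (W n \<omega>) m) \<le> m" for n using W0 that by (intro AE_I2) (auto simp: abs_of_nonneg)
  qed auto
  have upper: "(\<integral>\<omega>. min (L y \<omega>) m \<partial>M) \<le> I" if m: "0 < m" for m
    by (rule LIMSEQ_le[OF lim_min[OF m] EW])
       (auto intro!: exI[of _ 0] integral_mono imin iW simp: W0 less_imp_le[OF m])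
  have lower: "I - C / m \<le> (\<integral>\<omega>. min (L y \<omega>) m \<partial>M)" if m: "0 < m" for m
  proof (rule LIMSEQ_le[OF tendsto_diff[OF EW tendsto_const] lim_min[OF m]])
    have "(\<integral>\<omega>. W n \<omega> \<partial>M) - C / m \<le> (\<integral>\<omega>. min (W n \<omega>) m \<partial>M)" for n
    proof -
      \<comment> \<open>Above m one has W <= W^2 / m, so the left-hand side is at most 0
        there.\<close>
      have pt: "W n \<omega> - (W n \<omega>)\<^sup>2 / m \<le> min (W n \<omega>) m" for \<omega>
      proof (cases "W n \<omega> \<le> m")
        case True then show ?thesis using m by simp
      next
        case False
        then have "W n \<omega> * m \<le> W n \<omega> * W n \<omega>" using W0[of n \<omega>] by (intro mult_left_mono) auto
        then have "W n \<omega> \<le> (W n \<omega>)\<^sup>2 / m" using m by (simp add: power2_eq_square pos_le_divide_eq)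
        then show ?thesis using False m by simp
      qed
      have "(\<integral>\<omega>. W n \<omega> \<partial>M) - C / m \<le> (\<integral>\<omega>. W n \<omega> \<partial>M) - (\<integral>\<omega>. (W n \<omega>)\<^sup>2 \<partial>M) / m"
        using EW2[of n] m by (simp add: divide_right_mono)
      also have "\<dots> = (\<integral>\<omega>. W n \<omega> - (W n \<omega>)\<^sup>2 / m \<partial>M)" using iW[of n] iW2[of n] by simp
      also have "\<dots> \<le> (\<integral>\<omega>. min (W n \<omega>) m \<partial>M)"
        using iW[of n] iW2[of n] pt m by (intro integral_mono imin) (auto simp: W0)
      finally show ?thesis .
    qed
    then show "\<exists>N. \<forall>n\<ge>N. (\<integral>\<omega>. W n \<omega> \<partial>M) - C / m \<le> (\<integral>\<omega>. min (W n \<omega>) m \<partial>M)" by blast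
  qed
  have Lnn: "AE \<omega> in M. 0 \<le> L y \<omega>" using good by (auto elim: eventually_mono)
  have "(\<lambda>m. \<integral>\<omega>. min (L y \<omega>) (real (Suc m)) \<partial>M) \<longlonglongrightarrow> I"
  proof (rule tendsto_sandwich[of "\<lambda>m. I - C / real (Suc m)" _ _ "\<lambda>m. I"])
    have "(\<lambda>m. C / real (Suc m)) \<longlonglongrightarrow> 0" using LIMSEQ_Suc[OF lim_const_over_n[of C]] by simp
    then show "(\<lambda>m. I - C / real (Suc m)) \<longlonglongrightarrow> I" using tendsto_diff[OF tendsto_const] by fastforce
  qed (auto intro!: always_eventually lower upper simp del: of_nat_Suc)
  then have "integral\<^sup>L M (L y) = I"
  proof (rule integral_monotone_convergence_nonneg(2)[rotated 4])
    show "integrable M (\<lambda>\<omega>. min (L y \<omega>) (real (Suc m)))" for m by (intro imin Lnn) auto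
    show "AE \<omega> in M. mono (\<lambda>m. min (L y \<omega>) (real (Suc m)))" by (intro AE_I2 monoI) (auto simp: min_def)
    show "AE \<omega> in M. 0 \<le> min (L y \<omega>) (real (Suc m))" for m using Lnn by eventually_elim auto
    show "AE \<omega> in M. (\<lambda>m. min (L y \<omega>) (real (Suc m))) \<longlonglongrightarrow> L y \<omega>"
    proof (intro AE_I2 tendsto_eventually)
      fix \<omega>
      obtain N where N: "L y \<omega> \<le> real N" using real_arch_simple by blast
      show "eventually (\<lambda>m. min (L y \<omega>) (real (Suc m)) = L y \<omega>) sequentially"
        using eventually_ge_at_top[of N] by eventually_elim (use N in auto)
    qed
  qed simp
  then show ?thesis by (simp add: I_def)
qed

theorem approx_err_limit_local_time:
  assumes \<alpha>1: "1 < \<alpha>" "\<alpha> \<le> 2" and T: "0 < T" and L: "is_local_time M X T L"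
  shows "(\<lambda>n. (T / real n) powr (-1 - 1 / \<alpha>) * approx_err M X T y n)
          \<longlonglongrightarrow> 2 * integral\<^sup>L M (L y) *
              set_lebesgue_integral lborel {0..}
                (\<lambda>x. integral\<^sup>L M (cond_var M (gen_sigma M {X 1}) (occ X 1 x)))"
proof -
  have "(\<lambda>x. integral\<^sup>L M (cond_var M (gen_sigma M {X 1}) (occ X 1 x))) = V 1"
    using integral_cond_var by auto
  then have "2 * integral\<^sup>L M (L y) * set_lebesgue_integral lborel {0..} (\<lambda>x. integral\<^sup>L M (cond_var M (gen_sigma M {X 1}) (occ X 1 x)))
    = (LINT x|lborel. V 1 x) * (\<integral>t. p t y \<partial>timed T)"
    using integral_V_half[OF \<alpha>1] expectation_local_time[OF \<alpha>1(1) T L, of y] by simp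
  then show ?thesis using approx_err_limit_gt1[OF \<alpha>1 T, of y] by simp
qed

end

subsection \<open>The tail of the conditional variance\<close>

lemma integral_timed_FTC:
  fixes f F :: "real \<Rightarrow> real"
  assumes D: "0 \<le> D" and F: "\<And>x. (F has_real_derivative f x) (at x)" and f: "continuous_on UNIV f"
  shows "(\<integral>s. f s \<partial>timed D) = F D - F 0"
proof -
  have [measurable]: "f \<in> borel_measurable borel" using f by (rule borel_measurable_continuous_onI)
  have "has_bochner_integral lborel (\<lambda>x. f x * indicator {0..D} x) (F D - F 0)"
    using assms by (intro has_bochner_integral_FTC_Icc_real) (auto simp: continuous_on_eq_continuous_at)
  then have "(LINT s:{0..D}|lborel. f s) = F D - F 0"
    by (simp add: set_lebesgue_integral_def has_bochner_integral_iff mult.commute)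
  then show ?thesis using integral_block[of f 0 D] by simp
qed

lemma integral_timed_reflect:
  fixes f :: "real \<Rightarrow> real"
  shows "(\<integral>s. f (D - s) \<partial>timed D) = (\<integral>s. f s \<partial>timed D)"
proof -
  have "(\<integral>s. f s \<partial>timed D) = \<bar>-1\<bar> *\<^sub>R (LINT s|lborel. indicator {0<..<D} (D + (-1) * s) * f (D + (-1) * s))"
    unfolding integral_timed by (intro lborel_integral_real_affine) auto
  also have "\<dots> = (\<integral>s. f (D - s) \<partial>timed D)"
    unfolding integral_timed by (auto intro!: Bochner_Integration.integral_cong simp: indicator_def)
  finally show ?thesis ..
qed

lemma AE_timed_neq: "AE t in timed D. t \<noteq> s"
  unfolding timed_def by (subst AE_restrict_space_iff) (auto intro: eventually_mono[OF AE_lborel_singleton[of s]])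

lemma integral_min:
  assumes s: "s \<in> {0<..<1::real}"
  shows "(\<integral>t. min s t \<partial>timed 1) = s - s\<^sup>2 / 2"
proof -
  interpret T: finite_measure "timed 1" by (rule finite_measure_timed)
  have i: "(\<integral>t. t \<partial>timed s) = s\<^sup>2 / 2"
  proof -
    have "((\<lambda>t. t\<^sup>2 / 2) has_real_derivative x) (at x)" for x :: real
      by (auto intro!: derivative_eq_intros)
    then show ?thesis using s integral_timed_FTC[of s "\<lambda>t. t\<^sup>2 / 2" "\<lambda>t. t"] by simp
  qed
  have "(\<integral>t. min s t \<partial>timed 1) = (LINT t:{0..1}|lborel. min s t)"
    using integral_block[of "\<lambda>t. min s t" 0 1] by simp
  also have "{0..1} = {0..s} \<union> {s..1}" using s by auto
  also have "(LINT t:{0..s} \<union> {s..1}|lborel. min s t) = (LINT t:{0..s}|lborel. min s t) + (LINT t:{s..1}|lborel. min s t)"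
    by (intro set_integral_Un_AE borel_integrable_atLeastAtMost' continuous_intros eventually_mono[OF AE_lborel_singleton[of s]]) auto
  also have "(LINT t:{0..s}|lborel. min s t) = (\<integral>t. t \<partial>timed s)"
    using integral_block[of "\<lambda>t. min s t" 0 s] by (auto intro!: Bochner_Integration.integral_cong)
  also have "(LINT t:{s..1}|lborel. min s t) = (LINT t:{s..1}|lborel. s)"
    by (intro set_lebesgue_integral_cong) auto
  also have "\<dots> = (1 - s) * s" using s by (simp add: set_lebesgue_integral_def)
  finally show ?thesis by (simp add: i power2_eq_square field_simps)
qed

context stable_process
begin

lemma tail_prob_uminus: "0 < s \<Longrightarrow> tail_prob s (- x) = 1 - tail_prob s x"
proof -
  assume s: "0 < s"
  then have [measurable]: "X s \<in> borel_measurable M" by auto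
  have ne: "AE \<omega> in M. X s \<omega> \<noteq> x"
    by (rule AE_X[OF s]) (auto intro: eventually_mono[OF AE_lborel_singleton[of x]])
  have "tail_prob s (- x) = (\<integral>\<omega>. hv (- x) (- X s \<omega>) \<partial>M)"
    unfolding tail_prob_def by (rule expectation_one_law[OF minus_process s, symmetric]) measurable
  also have "\<dots> = (\<integral>\<omega>. 1 - hv x (X s \<omega>) \<partial>M)"
    using ne by (intro integral_cong_AE) (auto simp: hv_def)
  also have "\<dots> = 1 - tail_prob s x"
    by (subst Bochner_Integration.integral_diff) (auto simp: tail_prob_def prob_space hv_bounds intro!: integrable_const_bound[where B=1])
  finally show ?thesis .
qed

lemma tail_prob_increment:
  assumes st: "0 \<le> s" "s < t"
  shows "(\<integral>\<omega>. hv x (X t \<omega> - X s \<omega>) \<partial>M) = tail_prob (t - s) x"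
  using expectation_increment[OF st, of "hv x"] expectation_X[of "t - s" "hv x"] st by (simp add: tail_prob_def)

lemma expectation_hv_hv_increment:
  assumes st: "0 < s" "s < t"
  shows "(\<integral>\<omega>. hv x (X s \<omega>) * hv y (X t \<omega> - X s \<omega>) \<partial>M) = tail_prob s x * tail_prob (t - s) y"
proof -
  have ind: "indep_pair borel (\<lambda>\<omega>. X s \<omega> - X 0 \<omega>) borel (\<lambda>\<omega>. X t \<omega> - X s \<omega>)"
    using st by (intro indep_var_imp_indep_pair indep_two_increments) auto
  have "(\<integral>\<omega>. hv x (X s \<omega>) * hv y (X t \<omega> - X s \<omega>) \<partial>M)
    = (\<integral>\<omega>. (\<lambda>(a, b). hv x a * hv y b) (X s \<omega> - X 0 \<omega>, X t \<omega> - X s \<omega>) \<partial>M)"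
    by (intro Bochner_Integration.integral_cong) (auto simp: X_0)
  also have "\<dots> = (\<integral>\<omega>. (\<integral>\<omega>'. (\<lambda>(a, b). hv x a * hv y b) (X s \<omega> - X 0 \<omega>, X t \<omega>' - X s \<omega>') \<partial>M) \<partial>M)"
    by (rule integral_indep_pair[OF ind, where B=1]) (auto simp: hv_def)
  also have "\<dots> = (\<integral>\<omega>. hv x (X s \<omega>) * tail_prob (t - s) y \<partial>M)"
    using st by (intro Bochner_Integration.integral_cong) (auto simp: X_0 tail_prob_increment)
  finally show ?thesis by (simp add: tail_prob_def)
qed

text \<open>A path that exceeds x by the margin u at time s and then loses at most u is above x at
  both times.\<close>

lemma joint_exc_ge:
  assumes st: "0 < s" "s < t" and u: "0 \<le> u"
  shows "tail_prob s (x + u) * tail_prob (t - s) (- u) \<le> joint_exc s t x"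
proof -
  have [measurable]: "X s \<in> borel_measurable M" "X t \<in> borel_measurable M" using st by auto
  have "(\<integral>\<omega>. hv (x + u) (X s \<omega>) * hv (- u) (X t \<omega> - X s \<omega>) \<partial>M) \<le> joint_exc s t x"
    unfolding joint_exc_def
    by (intro integral_mono integrable_const_bound[where B=1]) (use u in \<open>auto simp: hv_def\<close>)
  then show ?thesis using expectation_hv_hv_increment[OF st] by simp
qed

text \<open>Test-function form of the fact that \<open>bint 1 x\<close>, evaluated at X_1, is the
  conditional expectation of the occupation time given X_1.\<close>

lemma G_expectation:
  assumes F[measurable]: "F \<in> borel_measurable borel" and B: "\<And>x. \<bar>F x\<bar> \<le> B"
  shows "(\<integral>\<omega>. bint 1 x (X 1 \<omega>) * F (X 1 \<omega>) \<partial>M) = (\<integral>s. (\<integral>\<omega>. hv x (X s \<omega>) * F (X 1 \<omega>) \<partial>M) \<partial>timed 1)"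
proof -
  have [measurable]: "X 1 \<in> borel_measurable M" by auto
  have "(\<integral>\<omega>. bint 1 x (X 1 \<omega>) * F (X 1 \<omega>) \<partial>M) = (\<integral>\<omega>. (\<integral>s. bridge \<alpha> s (1 - s) x (X 1 \<omega>) * F (X 1 \<omega>) \<partial>timed 1) \<partial>M)"
    by (simp add: bint_def)
  also have "\<dots> = (\<integral>s. (\<integral>\<omega>. bridge \<alpha> s (1 - s) x (X 1 \<omega>) * F (X 1 \<omega>) \<partial>M) \<partial>timed 1)"
  proof (rule Fubini_bounded[OF finite_measure_timed finite_measure_axioms, where B="1 * B"])
    show "\<bar>bridge \<alpha> s (1 - s) x (X 1 \<omega>) * F (X 1 \<omega>)\<bar> \<le> 1 * B" for s \<omega>
      unfolding abs_mult using B by (intro mult_mono) (auto simp: bridge_nonneg bridge_le_1)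
  qed measurable
  also have "\<dots> = (\<integral>s. (\<integral>\<omega>. hv x (X s \<omega>) * F (X 1 \<omega>) \<partial>M) \<partial>timed 1)"
    by (rule Bochner_Integration.integral_cong[OF refl]) (rule expectation_bridge_X, use B in auto)
  finally show ?thesis .
qed

lemma bint_range: "0 \<le> bint 1 x z" "bint 1 x z \<le> 1"
proof -
  show "0 \<le> bint 1 x z" unfolding bint_def by (intro Bochner_Integration.integral_nonneg) (simp add: bridge_nonneg)
  show "bint 1 x z \<le> 1" using bint_bound[of 1 x z] by simp
qed

lemma bridge_exc_eq_G: "(\<integral>s. (\<integral>t. bridge_exc 1 s t x \<partial>timed 1) \<partial>timed 1) = (\<integral>\<omega>. bint 1 x (X 1 \<omega>) * bint 1 x (X 1 \<omega>) \<partial>M)"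
proof -
  have [measurable]: "X 1 \<in> borel_measurable M" by auto
  interpret T: sigma_finite_measure "timed 1" by (rule sigma_finite_timed)
  have sw: "(\<integral>\<omega>. bint 1 x (X 1 \<omega>) * g \<omega> \<partial>M) = (\<integral>s. (\<integral>\<omega>. bridge \<alpha> s (1 - s) x (X 1 \<omega>) * g \<omega> \<partial>M) \<partial>timed 1)"
    if [measurable]: "g \<in> borel_measurable M" and g: "\<And>\<omega>. \<bar>g \<omega>\<bar> \<le> 1" for g
  proof -
    have "(\<integral>\<omega>. bint 1 x (X 1 \<omega>) * g \<omega> \<partial>M) = (\<integral>\<omega>. (\<integral>s. bridge \<alpha> s (1 - s) x (X 1 \<omega>) * g \<omega> \<partial>timed 1) \<partial>M)"
      by (simp add: bint_def)
    also have "\<dots> = (\<integral>s. (\<integral>\<omega>. bridge \<alpha> s (1 - s) x (X 1 \<omega>) * g \<omega> \<partial>M) \<partial>timed 1)"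
    proof (rule Fubini_bounded[OF finite_measure_timed finite_measure_axioms, where B="1"])
      show "\<bar>bridge \<alpha> s (1 - s) x (X 1 \<omega>) * g \<omega>\<bar> \<le> 1" for s \<omega>
        unfolding abs_mult using g by (intro mult_le_one) (auto simp: bridge_nonneg bridge_le_1)
    qed measurable
    finally show ?thesis .
  qed
  have "(\<integral>\<omega>. bint 1 x (X 1 \<omega>) * bint 1 x (X 1 \<omega>) \<partial>M) = (\<integral>s. (\<integral>\<omega>. bridge \<alpha> s (1 - s) x (X 1 \<omega>) * bint 1 x (X 1 \<omega>) \<partial>M) \<partial>timed 1)"
    by (rule sw) (auto simp: bint_range abs_of_nonneg)
  also have "\<dots> = (\<integral>s. (\<integral>t. bridge_exc 1 s t x \<partial>timed 1) \<partial>timed 1)"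
  proof (rule Bochner_Integration.integral_cong[OF refl])
    fix s
    show "(\<integral>\<omega>. bridge \<alpha> s (1 - s) x (X 1 \<omega>) * bint 1 x (X 1 \<omega>) \<partial>M) = (\<integral>t. bridge_exc 1 s t x \<partial>timed 1)"
      using sw[of "\<lambda>\<omega>. bridge \<alpha> s (1 - s) x (X 1 \<omega>)"] by (simp add: bridge_exc_def mult.commute bridge_nonneg bridge_le_1)
  qed
  finally show ?thesis ..
qed

text \<open>Time reversal: the increments over the first and over the last stretch of length s have
  the same law, and exchanging two independent increments preserves their sum X_1.\<close>

lemma reverse_law:
  assumes s: "s \<in> {0<..<1}" and [measurable]: "(\<lambda>(a, b). f a b) \<in> borel_measurable (borel \<Otimes>\<^sub>M borel)"
  shows "(\<integral>\<omega>. f (X s \<omega>) (X 1 \<omega>) \<partial>M) = (\<integral>\<omega>. f (X 1 \<omega> - X (1 - s) \<omega>) (X 1 \<omega>) \<partial>M :: real)"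
proof -
  have [measurable]: "X s \<in> borel_measurable M" "X 1 \<in> borel_measurable M" "X 0 \<in> borel_measurable M" "X (1 - s) \<in> borel_measurable M"
    using s by auto
  have [measurable]: "(\<lambda>(a, b). f a (a + b)) \<in> borel_measurable (lborel \<Otimes>\<^sub>M lborel)" by measurable
  have d1: "distributed M (lborel \<Otimes>\<^sub>M lborel) (\<lambda>\<omega>. (X s \<omega> - X 0 \<omega>, X 1 \<omega> - X s \<omega>)) (\<lambda>(x, y). ennreal (p s x) * ennreal (p (1 - s) y))"
    using distributed_two_increments[of 0 s 1] s by simp
  have "distributed M (lborel \<Otimes>\<^sub>M lborel) (\<lambda>\<omega>. (X (1 - s) \<omega> - X 0 \<omega>, X 1 \<omega> - X (1 - s) \<omega>)) (\<lambda>(x, y). ennreal (p (1 - s) x) * ennreal (p s y))"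
    using distributed_two_increments[of 0 "1 - s" 1] s by simp
  then have d2: "distributed M (lborel \<Otimes>\<^sub>M lborel) (\<lambda>\<omega>. (X 1 \<omega> - X (1 - s) \<omega>, X (1 - s) \<omega> - X 0 \<omega>)) (\<lambda>(x, y). ennreal (p s x) * ennreal (p (1 - s) y))"
    using distributed_swap[OF sigma_finite_lborel sigma_finite_lborel] by (fastforce simp: mult.commute split_beta)
  have "(\<integral>\<omega>. f (X s \<omega>) (X 1 \<omega>) \<partial>M) = (\<integral>w. (\<lambda>(a, b). f a (a + b)) w \<partial>distr M (lborel \<Otimes>\<^sub>M lborel) (\<lambda>\<omega>. (X s \<omega> - X 0 \<omega>, X 1 \<omega> - X s \<omega>)))"
    by (subst integral_distr) (auto intro!: Bochner_Integration.integral_cong simp: X_0)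
  also have "\<dots> = (\<integral>w. (\<lambda>(a, b). f a (a + b)) w \<partial>distr M (lborel \<Otimes>\<^sub>M lborel) (\<lambda>\<omega>. (X 1 \<omega> - X (1 - s) \<omega>, X (1 - s) \<omega> - X 0 \<omega>)))"
    using distributed_distr_eq_density[OF d1] distributed_distr_eq_density[OF d2] by simp
  also have "\<dots> = (\<integral>\<omega>. f (X 1 \<omega> - X (1 - s) \<omega>) (X 1 \<omega>) \<partial>M)"
    by (subst integral_distr) (auto intro!: Bochner_Integration.integral_cong simp: X_0)
  finally show ?thesis .
qed

text \<open>With \<open>O = occ X 1 x\<close>, these are the expectations of \<open>O\<close>, of \<open>O\<^sup>2\<close>, of \<open>O\<close> on the event \<open>X\<^sub>1 \<ge> x\<close>,
  and of the square of the conditional expectation of \<open>O\<close> given \<open>X\<^sub>1\<close>.\<close>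

definition EO :: "real \<Rightarrow> real" where "EO x = (\<integral>s. tail_prob s x \<partial>timed 1)"
definition EO2 :: "real \<Rightarrow> real" where "EO2 x = (\<integral>s. (\<integral>t. joint_exc s t x \<partial>timed 1) \<partial>timed 1)"
definition EOh :: "real \<Rightarrow> real" where "EOh x = (\<integral>s. joint_exc s 1 x \<partial>timed 1)"
definition EG2 :: "real \<Rightarrow> real" where "EG2 x = (\<integral>\<omega>. bint 1 x (X 1 \<omega>) * bint 1 x (X 1 \<omega>) \<partial>M)"

lemma integrable_timed_bounded:
  assumes "f \<in> borel_measurable (timed D)" "\<And>s. s \<in> {0<..<D} \<Longrightarrow> \<bar>f s\<bar> \<le> B"
  shows "integrable (timed D) (f :: real \<Rightarrow> real)"
proof -
  interpret T: finite_measure "timed D" by (rule finite_measure_timed)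
  show ?thesis using assms by (intro T.integrable_const_bound[where B=B]) auto
qed

lemma timed_double_measurable:
  assumes "(\<lambda>z. f (fst z) (snd z)) \<in> borel_measurable (timed D \<Otimes>\<^sub>M timed D)"
  shows "(\<lambda>s. \<integral>t. (f s t :: real) \<partial>timed D) \<in> borel_measurable (timed D)"
proof -
  interpret T: sigma_finite_measure "timed D" by (rule sigma_finite_timed)
  show ?thesis by (rule T.borel_measurable_lebesgue_integral) (use assms in \<open>simp add: split_beta\<close>)
qed

lemma joint_exc_timed_measurable: "(\<lambda>z. joint_exc (fst z) (snd z) x) \<in> borel_measurable (timed 1 \<Otimes>\<^sub>M timed 1)"
  by (rule joint_exc_measurable) (auto simp: space_pair_measure)

lemma bridge_exc_timed_measurable: "(\<lambda>z. bridge_exc 1 (fst z) (snd z) x) \<in> borel_measurable (timed 1 \<Otimes>\<^sub>M timed 1)"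
  by (rule bridge_exc_measurable) auto

lemma joint_exc_timed_measurable1: "0 < s \<Longrightarrow> (\<lambda>t. joint_exc s t x) \<in> borel_measurable (timed 1)"
  by (rule joint_exc_measurable) auto

lemma joint_exc_timed_measurable2: "0 < s \<Longrightarrow> (\<lambda>t. joint_exc t s x) \<in> borel_measurable (timed 1)"
  by (rule joint_exc_measurable) auto

lemma tail_prob_timed_measurable: "(\<lambda>s. tail_prob s x) \<in> borel_measurable (timed 1)"
proof -
  have "(\<lambda>s. joint_exc s s x) \<in> borel_measurable (timed 1)"
    by (rule joint_exc_measurable) auto
  moreover have "joint_exc s s x = tail_prob s x" for s
    unfolding joint_exc_def tail_prob_def by (intro Bochner_Integration.integral_cong) (auto simp: hv_def)
  ultimately show ?thesis by simp
qed

lemma V_decomp: "V 1 x = EO2 x - EG2 x"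
proof -
  have b1: "\<bar>joint_exc s t x\<bar> \<le> 1" if "0 < s" "0 < t" for s t using joint_exc_bounds[of s t x] that by simp
  have b2: "\<bar>bridge_exc 1 s t x\<bar> \<le> 1" for s t using bridge_exc_bounds[of 1 s t x] by simp
  have inner: "(\<integral>t. joint_exc s t x - bridge_exc 1 s t x \<partial>timed 1) = (\<integral>t. joint_exc s t x \<partial>timed 1) - (\<integral>t. bridge_exc 1 s t x \<partial>timed 1)"
    if s: "0 < s" for s
  proof (rule Bochner_Integration.integral_diff)
    show "integrable (timed 1) (\<lambda>t. joint_exc s t x)"
      by (rule integrable_timed_bounded[where B=1]) (use s b1 in \<open>auto intro: joint_exc_timed_measurable1\<close>)
    show "integrable (timed 1) (\<lambda>t. bridge_exc 1 s t x)"
      by (rule integrable_timed_bounded[where B=1]) (use b2 in \<open>auto intro: bridge_exc_measurable\<close>)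
  qed
  have "V 1 x = (\<integral>s. (\<integral>t. joint_exc s t x \<partial>timed 1) - (\<integral>t. bridge_exc 1 s t x \<partial>timed 1) \<partial>timed 1)"
    unfolding V_def by (rule Bochner_Integration.integral_cong[OF refl]) (simp add: inner)
  also have "\<dots> = EO2 x - EG2 x"
    unfolding EO2_def EG2_def bridge_exc_eq_G[symmetric]
  proof (rule Bochner_Integration.integral_diff)
    show "integrable (timed 1) (\<lambda>s. \<integral>t. joint_exc s t x \<partial>timed 1)"
    proof (rule integrable_timed_bounded[where B="1 * 1"])
      show "\<bar>\<integral>t. joint_exc s t x \<partial>timed 1\<bar> \<le> 1 * 1" if "s \<in> {0<..<1}" for s
        using that by (intro timed_integral_bound b1) auto
    qed (rule timed_double_measurable[OF joint_exc_timed_measurable])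
    show "integrable (timed 1) (\<lambda>s. \<integral>t. bridge_exc 1 s t x \<partial>timed 1)"
    proof (rule integrable_timed_bounded[where B="1 * 1"])
      show "\<bar>\<integral>t. bridge_exc 1 s t x \<partial>timed 1\<bar> \<le> 1 * 1" if "s \<in> {0<..<1}" for s
        by (intro timed_integral_bound b2) auto
    qed (rule timed_double_measurable[OF bridge_exc_timed_measurable])
  qed
  finally show ?thesis .
qed

text \<open>Completing the square: with h the indicator of X_1 >= x and h^2 = h, one has G^2 >= G h
  - h / 4. The comparison with h / 2 reflects that a single jump at a uniform time leaves on average
  half of the unit interval above the level, which makes the bound sharp in the limit.\<close>

lemma EG2_ge: "EOh x - tail_prob 1 x / 4 \<le> EG2 x"
proof -
  have [measurable]: "X 1 \<in> borel_measurable M" by auto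
  let ?G = "\<lambda>\<omega>. bint 1 x (X 1 \<omega>)" and ?h = "\<lambda>\<omega>. hv x (X 1 \<omega>)"
  have e: "EOh x = (\<integral>\<omega>. ?G \<omega> * ?h \<omega> \<partial>M)"
    unfolding EOh_def joint_exc_def by (rule G_expectation[of "hv x" 1, symmetric]) (auto simp: hv_bounds)
  have i: "integrable M (\<lambda>\<omega>. ?G \<omega> * ?h \<omega>)" "integrable M ?h" "integrable M (\<lambda>\<omega>. ?G \<omega> * ?G \<omega>)"
    by (auto intro!: integrable_const_bound[where B=1] AE_I2 mult_le_one simp: bint_range hv_bounds abs_mult abs_of_nonneg)
  have "EOh x - tail_prob 1 x / 4 = (\<integral>\<omega>. ?G \<omega> * ?h \<omega> - ?h \<omega> / 4 \<partial>M)" using i by (simp add: e tail_prob_def)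
  also have "\<dots> \<le> (\<integral>\<omega>. ?G \<omega> * ?G \<omega> \<partial>M)"
  proof (rule integral_mono)
    fix \<omega>
    have "0 \<le> (?G \<omega> - ?h \<omega> / 2)\<^sup>2" by simp
    moreover have "?h \<omega> * ?h \<omega> = ?h \<omega>" by (simp add: hv_def)
    ultimately show "?G \<omega> * ?h \<omega> - ?h \<omega> / 4 \<le> ?G \<omega> * ?G \<omega>"
      by (simp add: power2_eq_square algebra_simps)
  qed (use i in auto)
  finally show ?thesis by (simp add: EG2_def)
qed

text \<open>Let a and b be the indicators of X_s >= x and of X_1 - X_s >= x. Averaged over s, both
  E[a G] and, by time reversal, E[b G] equal E[G^2]. Since 0 <= G <= 1, a G + b G <= G + a b, and
  E[a b] is a product of two tail probabilities: two large increments are rare.\<close>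

lemma EG2_le:
  assumes x: "0 \<le> x"
  shows "EG2 x \<le> (EO x + (tail_prob 1 x)\<^sup>2) / 2"
proof -
  have [measurable]: "X 1 \<in> borel_measurable M" by auto
  let ?G = "\<lambda>\<omega>. bint 1 x (X 1 \<omega>)"
  have G1: "EG2 x = (\<integral>s. (\<integral>\<omega>. hv x (X s \<omega>) * ?G \<omega> \<partial>M) \<partial>timed 1)"
    unfolding EG2_def by (rule G_expectation[of "bint 1 x" 1]) (auto simp: bint_range abs_of_nonneg)
  have "EG2 x = (\<integral>s. (\<integral>\<omega>. hv x (X 1 \<omega> - X (1 - s) \<omega>) * ?G \<omega> \<partial>M) \<partial>timed 1)"
    unfolding G1 by (rule Bochner_Integration.integral_cong[OF refl]) (rule reverse_law[of _ "\<lambda>a b. hv x a * bint 1 x b"], auto)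
  also have "\<dots> = (\<integral>s. (\<integral>\<omega>. hv x (X 1 \<omega> - X s \<omega>) * ?G \<omega> \<partial>M) \<partial>timed 1)"
    using integral_timed_reflect[where f="\<lambda>s. \<integral>\<omega>. hv x (X 1 \<omega> - X s \<omega>) * ?G \<omega> \<partial>M" and D=1] by simp
  finally have G2: "EG2 x = (\<integral>s. (\<integral>\<omega>. hv x (X 1 \<omega> - X s \<omega>) * ?G \<omega> \<partial>M) \<partial>timed 1)" .
  have EG: "(\<integral>\<omega>. ?G \<omega> \<partial>M) = EO x"
    using G_expectation[of "\<lambda>_. 1" 1 x] by (simp add: EO_def tail_prob_def)
  have bnd: "\<bar>hv x u * bint 1 x w\<bar> \<le> 1" for u w
    unfolding abs_mult by (intro mult_le_one) (auto simp: hv_bounds bint_range abs_of_nonneg)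
  have m1: "(\<lambda>s. \<integral>\<omega>. hv x (X s \<omega>) * ?G \<omega> \<partial>M) \<in> borel_measurable (timed 1)"
  proof (rule borel_measurable_lebesgue_integral)
    have [measurable]: "(\<lambda>z. X (fst z) (snd z)) \<in> borel_measurable (timed 1 \<Otimes>\<^sub>M M)"
      using X_timed_measurable[of 1] by (simp add: split_beta)
    show "(\<lambda>(s, \<omega>). hv x (X s \<omega>) * ?G \<omega>) \<in> borel_measurable (timed 1 \<Otimes>\<^sub>M M)"
      unfolding split_beta by measurable
  qed
  have m2: "(\<lambda>s. \<integral>\<omega>. hv x (X 1 \<omega> - X s \<omega>) * ?G \<omega> \<partial>M) \<in> borel_measurable (timed 1)"
  proof (rule borel_measurable_lebesgue_integral)
    have [measurable]: "(\<lambda>z. X (fst z) (snd z)) \<in> borel_measurable (timed 1 \<Otimes>\<^sub>M M)"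
      using X_timed_measurable[of 1] by (simp add: split_beta)
    show "(\<lambda>(s, \<omega>). hv x (X 1 \<omega> - X s \<omega>) * ?G \<omega>) \<in> borel_measurable (timed 1 \<Otimes>\<^sub>M M)"
      unfolding split_beta by measurable
  qed
  have eb: "\<bar>\<integral>\<omega>. f \<omega> * ?G \<omega> \<partial>M\<bar> \<le> 1" if [measurable]: "f \<in> borel_measurable M" and f: "\<And>\<omega>. 0 \<le> f \<omega>" "\<And>\<omega>. f \<omega> \<le> 1" for f
  proof -
    have "\<bar>\<integral>\<omega>. f \<omega> * ?G \<omega> \<partial>M\<bar> \<le> (\<integral>\<omega>. \<bar>f \<omega> * ?G \<omega>\<bar> \<partial>M)" by (rule integral_abs_bound)
    also have "\<dots> \<le> (\<integral>\<omega>. 1 \<partial>M)"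
      by (intro integral_mono integrable_const_bound[where B=1] AE_I2)
         (use f in \<open>auto simp: abs_mult abs_of_nonneg bint_range intro!: mult_le_one\<close>)
    finally have "\<bar>\<integral>\<omega>. f \<omega> * ?G \<omega> \<partial>M\<bar> \<le> (\<integral>\<omega>. 1 \<partial>M)" .
    then show ?thesis by (simp add: prob_space)
  qed
  have i1: "integrable (timed 1) (\<lambda>s. \<integral>\<omega>. hv x (X s \<omega>) * ?G \<omega> \<partial>M)"
    by (rule integrable_timed_bounded[OF m1, where B=1]) (auto intro!: eb simp: hv_bounds)
  have i2: "integrable (timed 1) (\<lambda>s. \<integral>\<omega>. hv x (X 1 \<omega> - X s \<omega>) * ?G \<omega> \<partial>M)"
    by (rule integrable_timed_bounded[OF m2, where B=1]) (auto intro!: eb simp: hv_bounds)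
  have "2 * EG2 x = (\<integral>s. (\<integral>\<omega>. hv x (X s \<omega>) * ?G \<omega> \<partial>M) + (\<integral>\<omega>. hv x (X 1 \<omega> - X s \<omega>) * ?G \<omega> \<partial>M) \<partial>timed 1)"
    using i1 i2 G1 G2 by simp
  also have "\<dots> \<le> (\<integral>s. EO x + (tail_prob 1 x)\<^sup>2 \<partial>timed 1)"
  proof (rule integral_mono)
    fix s assume "s \<in> space (timed 1)"
    then have s: "0 < s" "s < 1" by auto
    then have [measurable]: "X s \<in> borel_measurable M" by auto
    have j: "integrable M (\<lambda>\<omega>. hv x (X s \<omega>) * ?G \<omega>)" "integrable M (\<lambda>\<omega>. hv x (X 1 \<omega> - X s \<omega>) * ?G \<omega>)"
      using bnd by (auto intro!: integrable_const_bound[where B=1] AE_I2)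
    have j2: "integrable M ?G" "integrable M (\<lambda>\<omega>. hv x (X s \<omega>) * hv x (X 1 \<omega> - X s \<omega>))"
      by (auto intro!: integrable_const_bound[where B=1] AE_I2 mult_le_one simp: bint_range hv_bounds abs_mult abs_of_nonneg)
    have "(\<integral>\<omega>. hv x (X s \<omega>) * ?G \<omega> \<partial>M) + (\<integral>\<omega>. hv x (X 1 \<omega> - X s \<omega>) * ?G \<omega> \<partial>M)
      = (\<integral>\<omega>. hv x (X s \<omega>) * ?G \<omega> + hv x (X 1 \<omega> - X s \<omega>) * ?G \<omega> \<partial>M)"
      using j by simp
    also have "\<dots> \<le> (\<integral>\<omega>. ?G \<omega> + hv x (X s \<omega>) * hv x (X 1 \<omega> - X s \<omega>) \<partial>M)"
    proof (rule integral_mono)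
      show "hv x (X s \<omega>) * ?G \<omega> + hv x (X 1 \<omega> - X s \<omega>) * ?G \<omega> \<le> ?G \<omega> + hv x (X s \<omega>) * hv x (X 1 \<omega> - X s \<omega>)" for \<omega>
        using bint_range[of x "X 1 \<omega>"] by (auto simp: hv_def)
    qed (use j j2 in auto)
    also have "\<dots> = EO x + tail_prob s x * tail_prob (1 - s) x"
      using j2 by (simp add: EG expectation_hv_hv_increment[OF s])
    also have "\<dots> \<le> EO x + (tail_prob 1 x)\<^sup>2"
      unfolding power2_eq_square using s x by (intro add_left_mono mult_mono tail_prob_le_tail_prob_1 tail_prob_bounds) auto
    finally show "(\<integral>\<omega>. hv x (X s \<omega>) * ?G \<omega> \<partial>M) + (\<integral>\<omega>. hv x (X 1 \<omega> - X s \<omega>) * ?G \<omega> \<partial>M) \<le> EO x + (tail_prob 1 x)\<^sup>2" .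
  qed (use i1 i2 finite_measure_timed[of 1] in \<open>auto intro: finite_measure.integrable_const\<close>)
  finally show ?thesis by simp
qed

end

section \<open>Limits at high levels\<close>

lemma tendsto_at_top_pos_sequences:
  fixes f :: "real \<Rightarrow> real"
  assumes "\<And>x :: nat \<Rightarrow> real. filterlim x at_top sequentially \<Longrightarrow> (\<And>n. 0 < x n) \<Longrightarrow> (\<lambda>n. f (x n)) \<longlonglongrightarrow> c"
  shows "(f \<longlongrightarrow> c) at_top"
proof (rule tendsto_at_topI_sequentially)
  fix x :: "nat \<Rightarrow> real" assume x: "filterlim x at_top sequentially"
  define y where "y n = max 1 (x n)" for n
  have ev: "eventually (\<lambda>n. x n = y n) sequentially"
    using x[unfolded filterlim_at_top, rule_format, of 1] by eventually_elim (simp add: y_def)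
  have "filterlim y at_top sequentially"
    by (rule filterlim_cong[THEN iffD1, OF refl refl ev x])
  moreover have "0 < y n" for n by (simp add: y_def)
  ultimately have "(\<lambda>n. f (y n)) \<longlonglongrightarrow> c" by (rule assms)
  moreover have "eventually (\<lambda>n. f (y n) = f (x n)) sequentially"
    using ev by eventually_elim simp
  ultimately show "(\<lambda>n. f (x n)) \<longlonglongrightarrow> c"
    by (rule Lim_transform_eventually)
qed

context stable_process
begin

definition tail_sup :: real where "tail_sup = gauss_moment / (1 - exp (- 1 / 2))"

lemma tail_prob_bound: "\<alpha> \<le> 2 \<Longrightarrow> 0 < x \<Longrightarrow> x powr \<alpha> * tail_prob 1 x \<le> tail_sup"
proof -
  assume a: "\<alpha> \<le> 2" "0 < x"
  have "x powr \<alpha> * tail_prob 1 x \<le> x powr \<alpha> * (tail_sup * x powr (- \<alpha>))"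
    using tail_prob_le_powr[OF a] by (intro mult_left_mono) (auto simp: tail_sup_def)
  also have "\<dots> = tail_sup" using a by (simp add: powr_minus)
  finally show ?thesis .
qed

context
  fixes c :: real and x :: "nat \<Rightarrow> real"
  assumes \<alpha>2: "\<alpha> \<le> 2"
    and tail: "((\<lambda>x. x powr \<alpha> * tail_prob 1 x) \<longlongrightarrow> c) at_top"
    and x: "filterlim x at_top sequentially" "\<And>n. 0 < x n"
begin

text \<open>By scaling, the tail at time s and level y is the tail at time 1 and level
  s^(-1/\<alpha>) y; the \<alpha>-th power of that factor yields the s in the limit.\<close>

lemma tail_prob_seq_lim:
  assumes s: "0 < s" and y: "filterlim y at_top sequentially" "\<And>n. 0 < y n"
  shows "(\<lambda>n. y n powr \<alpha> * tail_prob s (y n)) \<longlonglongrightarrow> c * s"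
proof -
  define k where "k = s powr (- 1 / \<alpha>)"
  have k: "0 < k" using s by (simp add: k_def)
  have "k powr \<alpha> = s powr (- 1)" unfolding k_def using \<alpha>_pos by (simp add: powr_powr)
  then have ks: "s * k powr \<alpha> = 1" using s by (simp add: powr_minus)
  have "filterlim (\<lambda>n. k * y n) at_top sequentially"
    by (rule filterlim_tendsto_pos_mult_at_top[OF tendsto_const k y(1)])
  then have "(\<lambda>n. (k * y n) powr \<alpha> * tail_prob 1 (k * y n)) \<longlonglongrightarrow> c"
    by (rule filterlim_compose[OF tail])
  then have "(\<lambda>n. s * ((k * y n) powr \<alpha> * tail_prob 1 (k * y n))) \<longlonglongrightarrow> s * c"
    by (intro tendsto_mult tendsto_const)
  moreover have "s * ((k * y n) powr \<alpha> * tail_prob 1 (k * y n)) = y n powr \<alpha> * tail_prob s (y n)" for n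
  proof -
    have "s * ((k * y n) powr \<alpha> * tail_prob 1 (k * y n)) = (s * k powr \<alpha>) * y n powr \<alpha> * tail_prob 1 (k * y n)"
      using k y(2)[of n] by (simp add: powr_mult)
    then show ?thesis unfolding ks using tail_prob_scale[OF s, of "y n"] by (simp add: k_def)
  qed
  ultimately show ?thesis by (simp add: mult.commute)
qed

lemma tail_prob_seq_0:
  assumes s: "0 < s" and y: "filterlim y at_top sequentially" "\<And>n. 0 < y n"
  shows "(\<lambda>n. tail_prob s (y n)) \<longlonglongrightarrow> 0"
proof -
  have "filterlim (\<lambda>n. y n powr \<alpha>) at_top sequentially"
    by (rule filterlim_compose[OF real_powr_at_top[OF \<alpha>_pos] y(1)])
  from tendsto_divide_0[OF tail_prob_seq_lim[OF s y] filterlim_at_top_imp_at_infinity[OF this]]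
  have "(\<lambda>n. y n powr \<alpha> * tail_prob s (y n) / y n powr \<alpha>) \<longlonglongrightarrow> 0" .
  moreover have "y n powr \<alpha> * tail_prob s (y n) / y n powr \<alpha> = tail_prob s (y n)" for n using y(2)[of n] by simp
  ultimately show ?thesis by simp
qed

text \<open>A high level reached by time s is typically still exceeded at the later time t. The
  margin sqrt(x) makes this precise: it tends to infinity, so the increment rarely consumes it, but
  it is negligible against x, so the tail at x + sqrt(x) has the same asymptotics.\<close>

lemma joint_seq_lim:
  assumes st: "0 < s" "s < t"
  shows "(\<lambda>n. x n powr \<alpha> * joint_exc s t (x n)) \<longlonglongrightarrow> c * s"
proof (rule tendsto_sandwich)
  show "\<forall>\<^sub>F n in sequentially. x n powr \<alpha> * (tail_prob s (x n + sqrt (x n)) * tail_prob (t - s) (- sqrt (x n))) \<le> x n powr \<alpha> * joint_exc s t (x n)"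
    using st x(2) by (intro always_eventually allI mult_left_mono joint_exc_ge) (auto simp: less_imp_le)
  show "\<forall>\<^sub>F n in sequentially. x n powr \<alpha> * joint_exc s t (x n) \<le> x n powr \<alpha> * tail_prob s (x n)"
    using st by (intro always_eventually allI mult_left_mono joint_exc_le_tail_prob) auto
  show "(\<lambda>n. x n powr \<alpha> * tail_prob s (x n)) \<longlonglongrightarrow> c * s" by (rule tail_prob_seq_lim[OF st(1) x])
  define y where "y n = x n + sqrt (x n)" for n
  have y0: "0 < y n" for n using x(2)[of n] by (simp add: y_def add_pos_nonneg)
  have sq: "filterlim (\<lambda>n. sqrt (x n)) at_top sequentially"
    by (rule filterlim_compose[OF sqrt_at_top x(1)])
  have y: "filterlim y at_top sequentially"
    unfolding y_def by (rule filterlim_at_top_add_at_top[OF x(1) sq])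
  have r: "(\<lambda>n. x n / y n) \<longlonglongrightarrow> 1"
  proof -
    have "(\<lambda>n. 1 / sqrt (x n)) \<longlonglongrightarrow> 0"
      by (rule tendsto_divide_0[OF tendsto_const filterlim_at_top_imp_at_infinity[OF sq]])
    then have "(\<lambda>n. 1 / (1 + 1 / sqrt (x n))) \<longlonglongrightarrow> 1 / (1 + 0)"
      by (intro tendsto_divide tendsto_add tendsto_const) auto
    moreover have "1 / (1 + 1 / sqrt (x n)) = x n / y n" for n
    proof -
      define r where "r = sqrt (x n)"
      have r: "x n = r * r" "0 < r" using x(2)[of n] by (auto simp: r_def)
      have "1 + 1 / r = (r + 1) / r" "r * r + r = r * (r + 1)" using r(2) by (simp_all add: field_simps)
      then have "1 / (1 + 1 / r) = r * r / (r * r + r)" using r(2) by simp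
      then show ?thesis unfolding y_def r_def[symmetric] by (simp only: r(1)[symmetric])
    qed
    ultimately show ?thesis by simp
  qed
  have "(\<lambda>n. (x n / y n) powr \<alpha> * (y n powr \<alpha> * tail_prob s (y n)) * (1 - tail_prob (t - s) (sqrt (x n)))) \<longlonglongrightarrow> 1 powr \<alpha> * (c * s) * (1 - 0)"
    using st x(2) by (intro tendsto_mult tendsto_diff tendsto_const tendsto_powr r tail_prob_seq_lim tail_prob_seq_0 y y0 sq) auto
  moreover have "(x n / y n) powr \<alpha> * (y n powr \<alpha> * tail_prob s (y n)) * (1 - tail_prob (t - s) (sqrt (x n)))
    = x n powr \<alpha> * (tail_prob s (x n + sqrt (x n)) * tail_prob (t - s) (- sqrt (x n)))" for n
  proof -
    have "(x n / y n) powr \<alpha> * y n powr \<alpha> = x n powr \<alpha>"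
      using x(2)[of n] y0[of n] by (simp add: powr_divide)
    then show ?thesis using st by (simp add: tail_prob_uminus y_def mult.assoc[symmetric])
  qed
  ultimately show "(\<lambda>n. x n powr \<alpha> * (tail_prob s (x n + sqrt (x n)) * tail_prob (t - s) (- sqrt (x n)))) \<longlonglongrightarrow> c * s" by simp
qed

lemma joint_seq_bound:
  assumes "0 < s" "s \<le> 1" "0 < t"
  shows "\<bar>x n powr \<alpha> * joint_exc s t (x n)\<bar> \<le> tail_sup"
proof -
  have "x n powr \<alpha> * joint_exc s t (x n) \<le> x n powr \<alpha> * tail_prob 1 (x n)"
    using joint_exc_le_tail_prob[of s t "x n"] tail_prob_le_tail_prob_1[of s "x n"] assms x(2)[of n] by (intro mult_left_mono) auto
  also have "\<dots> \<le> tail_sup" by (rule tail_prob_bound[OF \<alpha>2 x(2)])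
  finally show ?thesis using joint_exc_bounds(1)[of s t "x n"] by simp
qed

lemma EO_seq_lim: "(\<lambda>n. x n powr \<alpha> * EO (x n)) \<longlonglongrightarrow> c / 2"
proof -
  have "(\<lambda>n. \<integral>s. x n powr \<alpha> * tail_prob s (x n) \<partial>timed 1) \<longlonglongrightarrow> (\<integral>s. c * s \<partial>timed 1)"
  proof (rule integral_dominated_convergence[where w="\<lambda>_. tail_sup"])
    show "(\<lambda>s. x n powr \<alpha> * tail_prob s (x n)) \<in> borel_measurable (timed 1)" for n
      by (intro borel_measurable_times tail_prob_timed_measurable) simp
    show "integrable (timed 1) (\<lambda>_. tail_sup)" by (rule finite_measure.integrable_const[OF finite_measure_timed])
    show "AE s in timed 1. (\<lambda>n. x n powr \<alpha> * tail_prob s (x n)) \<longlonglongrightarrow> c * s"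
      by (intro AE_I2 tail_prob_seq_lim x) auto
    show "AE s in timed 1. norm (x n powr \<alpha> * tail_prob s (x n)) \<le> tail_sup" for n
    proof (rule AE_I2)
      fix s assume "s \<in> space (timed 1)"
      then have "x n powr \<alpha> * tail_prob s (x n) \<le> x n powr \<alpha> * tail_prob 1 (x n)"
        using tail_prob_le_tail_prob_1[of s "x n"] x(2)[of n] by (intro mult_left_mono) auto
      also have "\<dots> \<le> tail_sup" by (rule tail_prob_bound[OF \<alpha>2 x(2)])
      finally show "norm (x n powr \<alpha> * tail_prob s (x n)) \<le> tail_sup" using tail_prob_bounds(1)[of s "x n"] by simp
    qed
  qed simp
  moreover have "(\<integral>s. c * s \<partial>timed 1) = c / 2"
  proof -
    have "((\<lambda>t. c * t\<^sup>2 / 2) has_real_derivative c * x) (at x)" for x :: real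
      by (auto intro!: derivative_eq_intros)
    then show ?thesis
      using integral_timed_FTC[of 1 "\<lambda>t. c * t\<^sup>2 / 2" "\<lambda>t. c * t"] by (simp add: continuous_on_mult_left)
  qed
  ultimately have "(\<lambda>n. \<integral>s. x n powr \<alpha> * tail_prob s (x n) \<partial>timed 1) \<longlonglongrightarrow> c / 2" by (simp only:)
  then show ?thesis by (simp add: EO_def)
qed

lemma EOh_seq_lim: "(\<lambda>n. x n powr \<alpha> * EOh (x n)) \<longlonglongrightarrow> c / 2"
proof -
  have "(\<lambda>n. \<integral>s. x n powr \<alpha> * joint_exc s 1 (x n) \<partial>timed 1) \<longlonglongrightarrow> (\<integral>s. c * s \<partial>timed 1)"
  proof (rule integral_dominated_convergence[where w="\<lambda>_. tail_sup"])
    show "(\<lambda>s. x n powr \<alpha> * joint_exc s 1 (x n)) \<in> borel_measurable (timed 1)" for n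
      by (intro borel_measurable_times joint_exc_timed_measurable2) auto
    show "integrable (timed 1) (\<lambda>_. tail_sup)" by (rule finite_measure.integrable_const[OF finite_measure_timed])
    show "AE s in timed 1. (\<lambda>n. x n powr \<alpha> * joint_exc s 1 (x n)) \<longlonglongrightarrow> c * s"
      by (intro AE_I2 joint_seq_lim) auto
    show "AE s in timed 1. norm (x n powr \<alpha> * joint_exc s 1 (x n)) \<le> tail_sup" for n
      unfolding real_norm_def by (intro AE_I2 joint_seq_bound) auto
  qed simp
  moreover have "(\<integral>s. c * s \<partial>timed 1) = c / 2"
  proof -
    have "((\<lambda>t. c * t\<^sup>2 / 2) has_real_derivative c * x) (at x)" for x :: real
      by (auto intro!: derivative_eq_intros)
    then show ?thesis
      using integral_timed_FTC[of 1 "\<lambda>t. c * t\<^sup>2 / 2" "\<lambda>t. c * t"] by (simp add: continuous_on_mult_left)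
  qed
  ultimately have "(\<lambda>n. \<integral>s. x n powr \<alpha> * joint_exc s 1 (x n) \<partial>timed 1) \<longlonglongrightarrow> c / 2" by (simp only:)
  then show ?thesis by (simp add: EOh_def)
qed

text \<open>The pair (s, t) contributes c min(s, t), the weight of a jump before both times, and
  min(s, t) has integral 1/3 over the unit square.\<close>

lemma EO2_seq_lim: "(\<lambda>n. x n powr \<alpha> * EO2 (x n)) \<longlonglongrightarrow> c / 3"
proof -
  interpret T: finite_measure "timed 1" by (rule finite_measure_timed)
  have Cw: "integrable (timed 1) (\<lambda>_. tail_sup)" by (rule T.integrable_const)
  have C0: "0 \<le> tail_sup" using order_trans[OF abs_ge_zero joint_seq_bound[of 1 1 0]] by simp
  have "(\<lambda>n. \<integral>s. (\<integral>t. x n powr \<alpha> * joint_exc s t (x n) \<partial>timed 1) \<partial>timed 1) \<longlonglongrightarrow> (\<integral>s. c * (s - s\<^sup>2 / 2) \<partial>timed 1)"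
  proof (rule integral_dominated_convergence[where w="\<lambda>_. 1 * tail_sup"])
    show "(\<lambda>s. \<integral>t. x n powr \<alpha> * joint_exc s t (x n) \<partial>timed 1) \<in> borel_measurable (timed 1)" for n
      by (intro timed_double_measurable borel_measurable_times joint_exc_timed_measurable) simp
    show "AE s in timed 1. norm (\<integral>t. x n powr \<alpha> * joint_exc s t (x n) \<partial>timed 1) \<le> 1 * tail_sup" for n
      unfolding real_norm_def by (intro AE_I2 timed_integral_bound joint_seq_bound C0) auto
    show "AE s in timed 1. (\<lambda>n. \<integral>t. x n powr \<alpha> * joint_exc s t (x n) \<partial>timed 1) \<longlonglongrightarrow> c * (s - s\<^sup>2 / 2)"
    proof (rule AE_I2)
      fix s assume "s \<in> space (timed 1)"
      then have s: "0 < s" "s < 1" by auto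
      have "(\<lambda>n. \<integral>t. x n powr \<alpha> * joint_exc s t (x n) \<partial>timed 1) \<longlonglongrightarrow> (\<integral>t. c * min s t \<partial>timed 1)"
      proof (rule integral_dominated_convergence[OF _ _ Cw])
        show "(\<lambda>t. x n powr \<alpha> * joint_exc s t (x n)) \<in> borel_measurable (timed 1)" for n
          using s by (intro borel_measurable_times joint_exc_timed_measurable1) auto
        show "AE t in timed 1. norm (x n powr \<alpha> * joint_exc s t (x n)) \<le> tail_sup" for n
          unfolding real_norm_def using s by (intro AE_I2 joint_seq_bound) auto
        show "AE t in timed 1. (\<lambda>n. x n powr \<alpha> * joint_exc s t (x n)) \<longlonglongrightarrow> c * min s t"
          using AE_timed_neq[of s] AE_space
        proof eventually_elim
          case (elim t)
          show ?case
          proof (cases "s < t")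
            case True
            then show ?thesis using joint_seq_lim[OF s(1) True] by (simp add: min_def)
          next
            case False
            then have "t < s" using elim by simp
            then show ?thesis using joint_seq_lim[of t s] elim by (simp add: min_def joint_exc_commute[of s t])
          qed
        qed
      qed measurable
      then show "(\<lambda>n. \<integral>t. x n powr \<alpha> * joint_exc s t (x n) \<partial>timed 1) \<longlonglongrightarrow> c * (s - s\<^sup>2 / 2)"
        using s by (simp add: integral_min)
    qed
  qed (use Cw in auto)
  moreover have "(\<integral>s. c * (s - s\<^sup>2 / 2) \<partial>timed 1) = c / 3"
  proof -
    have "((\<lambda>t. c * (t\<^sup>2 / 2 - t ^ 3 / 6)) has_real_derivative c * (x - x\<^sup>2 / 2)) (at x)" for x :: real
      by (auto intro!: derivative_eq_intros)
    then show ?thesis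
      using integral_timed_FTC[of 1 "\<lambda>t. c * (t\<^sup>2 / 2 - t ^ 3 / 6)" "\<lambda>s. c * (s - s\<^sup>2 / 2)"]
      by (simp add: continuous_intros)
  qed
  ultimately have "(\<lambda>n. \<integral>s. (\<integral>t. x n powr \<alpha> * joint_exc s t (x n) \<partial>timed 1) \<partial>timed 1) \<longlonglongrightarrow> c / 3" by (simp only:)
  then show ?thesis by (simp add: EO2_def)
qed

text \<open>The two bounds for \<open>EG2\<close> meet at c / 4: from below as c / 2 - c / 4, from
  above as half of c / 2, the squared tail being of smaller order. What remains is c / 3 - c /
  4.\<close>

lemma V_seq_lim: "(\<lambda>n. x n powr \<alpha> * V 1 (x n)) \<longlonglongrightarrow> c / 12"
proof -
  have t1: "(\<lambda>n. x n powr \<alpha> * tail_prob 1 (x n)) \<longlonglongrightarrow> c" using tail_prob_seq_lim[of 1 x] x by simp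
  have t0: "(\<lambda>n. tail_prob 1 (x n)) \<longlonglongrightarrow> 0" using tail_prob_seq_0[of 1 x] x by simp
  have "(\<lambda>n. x n powr \<alpha> * EG2 (x n)) \<longlonglongrightarrow> c / 4"
  proof (rule tendsto_sandwich)
    show "\<forall>\<^sub>F n in sequentially. x n powr \<alpha> * EOh (x n) - x n powr \<alpha> * tail_prob 1 (x n) / 4 \<le> x n powr \<alpha> * EG2 (x n)"
      using mult_left_mono[OF EG2_ge, of "x _ powr \<alpha>"] by (intro always_eventually allI) (simp add: right_diff_distrib)
    show "\<forall>\<^sub>F n in sequentially. x n powr \<alpha> * EG2 (x n) \<le> (x n powr \<alpha> * EO (x n) + (x n powr \<alpha> * tail_prob 1 (x n)) * tail_prob 1 (x n)) / 2"
    proof (intro always_eventually allI)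
      fix n
      have "x n powr \<alpha> * EG2 (x n) \<le> x n powr \<alpha> * ((EO (x n) + (tail_prob 1 (x n))\<^sup>2) / 2)"
        using x(2)[of n] by (intro mult_left_mono EG2_le) auto
      also have "\<dots> = (x n powr \<alpha> * EO (x n) + (x n powr \<alpha> * tail_prob 1 (x n)) * tail_prob 1 (x n)) / 2"
        by (simp add: power2_eq_square field_simps)
      finally show "x n powr \<alpha> * EG2 (x n) \<le> (x n powr \<alpha> * EO (x n) + (x n powr \<alpha> * tail_prob 1 (x n)) * tail_prob 1 (x n)) / 2" .
    qed
    show "(\<lambda>n. x n powr \<alpha> * EOh (x n) - x n powr \<alpha> * tail_prob 1 (x n) / 4) \<longlonglongrightarrow> c / 4"
      using tendsto_diff[OF EOh_seq_lim tendsto_divide[OF t1 tendsto_const[of 4]]] by simp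
    show "(\<lambda>n. (x n powr \<alpha> * EO (x n) + (x n powr \<alpha> * tail_prob 1 (x n)) * tail_prob 1 (x n)) / 2) \<longlonglongrightarrow> c / 4"
      using tendsto_divide[OF tendsto_add[OF EO_seq_lim tendsto_mult[OF t1 t0]] tendsto_const[of 2]] by simp
  qed
  from tendsto_diff[OF EO2_seq_lim this] show ?thesis
    by (simp add: V_decomp right_diff_distrib)
qed

end

theorem V_tail:
  assumes "\<alpha> \<le> 2" and tail: "((\<lambda>x. x powr \<alpha> * tail_prob 1 x) \<longlongrightarrow> c) at_top"
  shows "((\<lambda>x. x powr \<alpha> * V 1 x) \<longlongrightarrow> c / 12) at_top"
  by (rule tendsto_at_top_pos_sequences) (rule V_seq_lim[OF assms])

end

subsection \<open>Logarithmic asymptotics\<close>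

text \<open>Beyond some N the increments of a - L b are at most e / 2 times those of b, and both
  sides telescope.\<close>

lemma stolz_cesaro:
  fixes a b :: "nat \<Rightarrow> real"
  assumes mono: "\<And>n. b n < b (Suc n)" and b: "filterlim b at_top sequentially"
    and lim: "(\<lambda>n. (a (Suc n) - a n) / (b (Suc n) - b n)) \<longlonglongrightarrow> L"
  shows "(\<lambda>n. a n / b n) \<longlonglongrightarrow> L"
proof (rule LIMSEQ_I)
  fix e :: real assume e: "0 < e"
  obtain N where N: "\<And>n. N \<le> n \<Longrightarrow> \<bar>(a (Suc n) - a n) / (b (Suc n) - b n) - L\<bar> < e / 2"
    using LIMSEQ_D[OF lim, of "e / 2"] e by auto
  have step: "\<bar>(a n - L * b n) - (a N - L * b N)\<bar> \<le> e / 2 * (b n - b N)" if "N \<le> n" for n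
    using that
  proof (induction n rule: dec_induct)
    case (step n)
    have d: "0 < b (Suc n) - b n" using mono[of n] by simp
    have "\<bar>(a (Suc n) - a n) - L * (b (Suc n) - b n)\<bar> = \<bar>(a (Suc n) - a n) / (b (Suc n) - b n) - L\<bar> * (b (Suc n) - b n)"
      using d by (simp add: abs_mult_pos' field_simps flip: abs_mult_pos)
    also have "\<dots> \<le> e / 2 * (b (Suc n) - b n)"
      using N[OF step.hyps(1)] d by (intro mult_right_mono) auto
    finally have s1: "\<bar>(a (Suc n) - a n) - L * (b (Suc n) - b n)\<bar> \<le> e / 2 * (b (Suc n) - b n)" .
    have "(a (Suc n) - L * b (Suc n)) - (a N - L * b N)
      = ((a (Suc n) - a n) - L * (b (Suc n) - b n)) + ((a n - L * b n) - (a N - L * b N))"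
      by (simp add: algebra_simps)
    then have "\<bar>(a (Suc n) - L * b (Suc n)) - (a N - L * b N)\<bar> \<le> e / 2 * (b (Suc n) - b n) + e / 2 * (b n - b N)"
      using abs_triangle_ineq[of "(a (Suc n) - a n) - L * (b (Suc n) - b n)" "(a n - L * b n) - (a N - L * b N)"] s1 step.IH
      by linarith
    also have "\<dots> = e / 2 * (b (Suc n) - b N)" by (simp add: field_simps)
    finally show ?case .
  qed simp
  \<comment> \<open>Collects the terms that stay fixed as n grows; once b n exceeds 2 c / e they are
    below half of e times b n.\<close>
  define c where "c = \<bar>a N - L * b N\<bar> + e / 2 * \<bar>b N\<bar>"
  have "eventually (\<lambda>n. b n > max 1 (2 * c / e) \<and> N \<le> n) sequentially"
    using filterlim_at_top_dense[THEN iffD1, OF b, rule_format, of "max 1 (2 * c / e)"] eventually_ge_at_top[of N]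
    by (rule eventually_conj)
  then obtain M where M: "\<And>n. M \<le> n \<Longrightarrow> b n > max 1 (2 * c / e) \<and> N \<le> n"
    by (auto simp: eventually_sequentially)
  show "\<exists>no. \<forall>n\<ge>no. norm (a n / b n - L) < e"
  proof (intro exI allI impI)
    fix n assume "M \<le> n"
    then have n: "1 < b n" "2 * c / e < b n" "N \<le> n" using M[of n] by auto
    have "\<bar>a n - L * b n\<bar> \<le> c + e / 2 * b n"
    proof -
      have "e / 2 * (b n - b N) \<le> e / 2 * (b n + \<bar>b N\<bar>)" using e by (intro mult_left_mono) auto
      also have "\<dots> = e / 2 * b n + e / 2 * \<bar>b N\<bar>" by (rule distrib_left)
      finally show ?thesis unfolding c_def using step[OF n(3)] by linarith
    qed
    also have "\<dots> < e * b n" using n(2) e by (simp add: divide_less_eq mult.commute)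
    finally have "\<bar>a n - L * b n\<bar> < e * b n" .
    moreover have "norm (a n / b n - L) = \<bar>a n - L * b n\<bar> / b n"
    proof -
      have "a n / b n - L = (a n - L * b n) / b n" using n(1) by (simp add: field_simps)
      then show ?thesis using n(1) by (simp add: abs_divide)
    qed
    ultimately show "norm (a n / b n - L) < e" using n(1) by (simp add: divide_less_eq)
  qed
qed

text \<open>The increments of ln n are asymptotic to 1 / n.\<close>

lemma sum_over_ln:
  fixes w :: "nat \<Rightarrow> real"
  assumes "(\<lambda>n. real n * w n) \<longlonglongrightarrow> A"
  shows "(\<lambda>n. (\<Sum>k<n. w k) / ln (real n)) \<longlonglongrightarrow> A"
proof -
  have "(\<lambda>n. (\<Sum>k<Suc n. w k) / ln (real (Suc n))) \<longlonglongrightarrow> A"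
  proof (rule stolz_cesaro)
    show "ln (real (Suc n)) < ln (real (Suc (Suc n)))" for n by simp
    show "filterlim (\<lambda>n. ln (real (Suc n))) at_top sequentially" by real_asymp
    have "(\<lambda>n. real (Suc n) * w (Suc n)) \<longlonglongrightarrow> A" by (rule LIMSEQ_Suc[OF assms])
    moreover have "(\<lambda>n. 1 / (real (Suc n) * (ln (real (Suc (Suc n))) - ln (real (Suc n))))) \<longlonglongrightarrow> 1" by real_asymp
    ultimately have "(\<lambda>n. (real (Suc n) * w (Suc n)) * (1 / (real (Suc n) * (ln (real (Suc (Suc n))) - ln (real (Suc n)))))) \<longlonglongrightarrow> A * 1"
      by (rule tendsto_mult)
    then show "(\<lambda>n. ((\<Sum>k<Suc (Suc n). w k) - (\<Sum>k<Suc n. w k)) / (ln (real (Suc (Suc n))) - ln (real (Suc n)))) \<longlonglongrightarrow> A"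
      by (simp del: of_nat_Suc)
  qed
  then show ?thesis by (rule LIMSEQ_imp_Suc)
qed

text \<open>The increments of the squared logarithm are asymptotic to 2 (ln n) / n, which explains
  the factor 1/2.\<close>

lemma sum_over_ln_sq:
  fixes w :: "nat \<Rightarrow> real"
  assumes "(\<lambda>n. real n * w n / ln (real n)) \<longlonglongrightarrow> A"
  shows "(\<lambda>n. (\<Sum>k<n. w k) / (ln (real n))\<^sup>2) \<longlonglongrightarrow> A / 2"
proof -
  have "(\<lambda>n. (\<Sum>k<Suc n. w k) / (ln (real (Suc n)))\<^sup>2) \<longlonglongrightarrow> A / 2"
  proof (rule stolz_cesaro)
    show "(ln (real (Suc n)))\<^sup>2 < (ln (real (Suc (Suc n))))\<^sup>2" for n by (intro power_strict_mono) auto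
    show "filterlim (\<lambda>n. (ln (real (Suc n)))\<^sup>2) at_top sequentially" by real_asymp
    have "(\<lambda>n. real (Suc n) * w (Suc n) / ln (real (Suc n))) \<longlonglongrightarrow> A" by (rule LIMSEQ_Suc[OF assms])
    moreover have "(\<lambda>n. ln (real (Suc n)) / (real (Suc n) * ((ln (real (Suc (Suc n))))\<^sup>2 - (ln (real (Suc n)))\<^sup>2))) \<longlonglongrightarrow> 1 / 2" by real_asymp
    ultimately have "(\<lambda>n. (real (Suc n) * w (Suc n) / ln (real (Suc n))) * (ln (real (Suc n)) / (real (Suc n) * ((ln (real (Suc (Suc n))))\<^sup>2 - (ln (real (Suc n)))\<^sup>2)))) \<longlonglongrightarrow> A * (1 / 2)"
      by (rule tendsto_mult)
    moreover have "eventually (\<lambda>n. (real (Suc n) * w (Suc n) / ln (real (Suc n))) * (ln (real (Suc n)) / (real (Suc n) * ((ln (real (Suc (Suc n))))\<^sup>2 - (ln (real (Suc n)))\<^sup>2)))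
      = ((\<Sum>k<Suc (Suc n). w k) - (\<Sum>k<Suc n. w k)) / ((ln (real (Suc (Suc n))))\<^sup>2 - (ln (real (Suc n)))\<^sup>2)) sequentially"
    proof -
      show ?thesis
        \<comment> \<open>At n = 0 the logarithm to be cancelled is ln 1 = 0, so the rewriting
          starts at n = 1.\<close>
        using eventually_ge_at_top[of 1]
      proof eventually_elim
        case (elim n)
        have "ln (real (Suc n)) \<noteq> 0" using elim ln_gt_zero[of "real (Suc n)"] by force
        then show ?case by (simp del: of_nat_Suc)
      qed
    qed
    ultimately have "(\<lambda>n. ((\<Sum>k<Suc (Suc n). w k) - (\<Sum>k<Suc n. w k)) / ((ln (real (Suc (Suc n))))\<^sup>2 - (ln (real (Suc n)))\<^sup>2)) \<longlonglongrightarrow> A * (1 / 2)"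
      by (rule Lim_transform_eventually)
    then show "(\<lambda>n. ((\<Sum>k<Suc (Suc n). w k) - (\<Sum>k<Suc n. w k)) / ((ln (real (Suc (Suc n))))\<^sup>2 - (ln (real (Suc n)))\<^sup>2)) \<longlonglongrightarrow> A / 2"
      by simp
  qed
  then show ?thesis by (rule LIMSEQ_imp_Suc)
qed

section \<open>The error at level 0 in units of the mesh\<close>

context stable_process
begin

definition wk :: "nat \<Rightarrow> real" where "wk k = (\<integral>\<omega>. V 1 (X (real k) \<omega>) \<partial>M)"

text \<open>The level 0 is fixed by scaling, so the mesh factors out exactly, and the remaining
  summands depend neither on T nor on n.\<close>

lemma approx_err_0_eq:
  assumes T: "0 < T" and n: "0 < n"
  shows "(T / real n) powr (-2) * approx_err M X T 0 n = (\<Sum>k<n. wk k)"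
proof -
  define D where "D = T / real n"
  have D: "0 < D" using T n by (simp add: D_def)
  have TD: "T = real n * D" using n by (simp add: D_def)
  have "(\<integral>\<omega>. V D (0 - X (real k * D) \<omega>) \<partial>M) = D\<^sup>2 * wk k" for k
  proof -
    have "(\<integral>\<omega>. V D (0 - X (real k * D) \<omega>) \<partial>M) = D\<^sup>2 * (\<integral>\<omega>. V 1 (D powr (- 1 / \<alpha>) * X (D * real k) \<omega>) \<partial>M)"
      using D by (simp add: V_minus V_scale[OF D, of "X _ _"] mult.commute[of D])
    also have "(\<integral>\<omega>. V 1 (D powr (- 1 / \<alpha>) * X (D * real k) \<omega>) \<partial>M) = wk k"
    proof (cases "k = 0")
      case True
      show ?thesis unfolding wk_def True by (intro Bochner_Integration.integral_cong) (auto simp: X_0)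
    next
      case False
      then show ?thesis unfolding wk_def
        using expectation_one_law[OF scaled_process[OF D], of "real k" "V 1"] by simp
    qed
    finally show ?thesis .
  qed
  then have "approx_err M X T 0 n = D\<^sup>2 * (\<Sum>k<n. wk k)"
    using approx_err_eq[OF D n TD, of 0] by (simp add: sum_distrib_left)
  moreover have "D powr (-2) * D\<^sup>2 = 1" using D by (simp add: powr_minus)
  ultimately show ?thesis by (simp add: D_def[symmetric] mult.assoc[symmetric])
qed

lemma X_neq_0: "0 < t \<Longrightarrow> AE \<omega> in M. X t \<omega> \<noteq> 0"
  by (rule AE_X) (auto intro: eventually_mono[OF AE_lborel_singleton[of 0]])

lemma V_abs: "V 1 \<bar>x\<bar> = V 1 x"
  using V_minus[of 1 x] by (simp add: abs_if)

lemma V_bound_powr: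
  assumes "\<alpha> \<le> 2" "0 < x"
  shows "\<bar>x powr \<alpha> * V 1 x\<bar> \<le> tail_sup"
proof -
  have "x powr \<alpha> * V 1 x \<le> x powr \<alpha> * tail_prob 1 x" using assms by (intro mult_left_mono V_le_tail_prob) auto
  then show ?thesis using tail_prob_bound[OF assms] V_nonneg[of 1 x] by simp
qed

text \<open>Near 0 the density is bounded and |r|^(-\<alpha>) is integrable because \<alpha> < 1;
  away from 0 the power is at most 1.\<close>

lemma integrable_neg_moment:
  assumes \<alpha>1: "\<alpha> < 1"
  shows "integrable M (\<lambda>\<omega>. \<bar>X 1 \<omega>\<bar> powr (- \<alpha>))"
proof -
  have [measurable]: "X 1 \<in> borel_measurable M" by auto
  define g where "g r = indicator {0<..<1} r * r powr (- \<alpha>)" for r :: real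
  have ig: "integrable lborel g"
    using integrable_timed_powr[OF \<alpha>1, of 1] by (simp add: timed_integrable_iff g_def[abs_def])
  have ig2: "integrable lborel (\<lambda>r. g (0 + (-1) * r))"
    using ig by (subst lborel_integrable_real_affine_iff) auto
  have "integrable lborel (\<lambda>r. K * (g r + g (- r)) + p 1 r)"
    using ig ig2 integrable_p[of 1] by simp
  then have "integrable lborel (\<lambda>r. p 1 r * \<bar>r\<bar> powr (- \<alpha>))"
  proof (rule Bochner_Integration.integrable_bound)
    show "AE r in lborel. norm (p 1 r * \<bar>r\<bar> powr (- \<alpha>)) \<le> norm (K * (g r + g (- r)) + p 1 r)"
    proof (rule AE_I2)
      fix r :: real
      have pn: "0 \<le> p 1 r" by (rule p_nonneg) simp
      have pl: "p 1 r \<le> K" using p_le[of 1 r] by simp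
      have g0: "0 \<le> g u" for u by (simp add: g_def)
      have "p 1 r * \<bar>r\<bar> powr (- \<alpha>) \<le> K * (g r + g (- r)) + p 1 r"
      proof (cases "\<bar>r\<bar> < 1 \<and> r \<noteq> 0")
        case True
        then have e: "\<bar>r\<bar> powr (- \<alpha>) = g r + g (- r)" by (auto simp: g_def indicator_def abs_if)
        have "p 1 r * \<bar>r\<bar> powr (- \<alpha>) \<le> K * \<bar>r\<bar> powr (- \<alpha>)" by (intro mult_right_mono pl) simp
        also have "\<dots> = K * (g r + g (- r))" by (simp only: e)
        finally show ?thesis using pn by linarith
      next
        case False
        have "\<bar>r\<bar> powr (- \<alpha>) \<le> 1"
        proof (cases "r = 0")
          case f: False
          then have "1 \<le> \<bar>r\<bar>" using False by auto
          then show ?thesis using \<alpha>_pos powr_mono2'[of "- \<alpha>" 1 "\<bar>r\<bar>"] by simp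
        qed simp
        then have "p 1 r * \<bar>r\<bar> powr (- \<alpha>) \<le> p 1 r" using pn by (simp add: mult_left_le)
        moreover have "0 \<le> K * (g r + g (- r))" using g0 K_nonneg by simp
        ultimately show ?thesis by linarith
      qed
      then show "norm (p 1 r * \<bar>r\<bar> powr (- \<alpha>)) \<le> norm (K * (g r + g (- r)) + p 1 r)"
        using pn by simp
    qed
    have "(\<lambda>r. p 1 r * \<bar>r\<bar> powr (- \<alpha>)) \<in> borel_measurable borel" by measurable
    then show "(\<lambda>r. p 1 r * \<bar>r\<bar> powr (- \<alpha>)) \<in> borel_measurable lborel" by simp
  qed
  then show ?thesis
    using distributed_integrable[OF distributed_X[of 1], of "\<lambda>r. \<bar>r\<bar> powr (- \<alpha>)"] p_nonneg by simp
qed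

text \<open>With h(u) = u^\<alpha> V(1, u), scaling gives n w_n = E[|X_1|^(-\<alpha>)
  h(n^(1/\<alpha>) |X_1|)]. Since h is bounded with limit c / 12 and the moment is finite, dominated
  convergence applies.\<close>

lemma wk_lim_lt1:
  assumes \<alpha>1: "\<alpha> < 1" and tail: "((\<lambda>x. x powr \<alpha> * tail_prob 1 x) \<longlongrightarrow> c) at_top"
  shows "(\<lambda>n. real n * wk n) \<longlonglongrightarrow> c / 12 * (\<integral>\<omega>. \<bar>X 1 \<omega>\<bar> powr (- \<alpha>) \<partial>M)"
proof -
  have [measurable]: "X 1 \<in> borel_measurable M" by auto
  have [measurable]: "V 1 \<in> borel_measurable borel" by simp
  have \<alpha>2: "\<alpha> \<le> 2" using \<alpha>1 by simp
  define h where "h u = u powr \<alpha> * V 1 u" for u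
  have hm[measurable]: "h \<in> borel_measurable borel" unfolding h_def by measurable
  have hl: "(h \<longlongrightarrow> c / 12) at_top" unfolding h_def by (rule V_tail[OF \<alpha>2 tail])
  have hb: "\<bar>h u\<bar> \<le> tail_sup" if "0 < u" for u unfolding h_def by (rule V_bound_powr[OF \<alpha>2 that])
  have eq: "real n * wk n = (\<integral>\<omega>. \<bar>X 1 \<omega>\<bar> powr (- \<alpha>) * h (real n powr (1 / \<alpha>) * \<bar>X 1 \<omega>\<bar>) \<partial>M)" if n: "0 < n" for n
  proof -
    define k where "k = real n powr (1 / \<alpha>)"
    have k: "0 < k" "k powr \<alpha> = real n" "real n powr (- 1 / \<alpha>) * k = 1"
      using n \<alpha>_pos by (auto simp: k_def powr_powr powr_minus)
    have [measurable]: "X (real n) \<in> borel_measurable M" by simp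
    have "wk n = (\<integral>\<omega>. (\<lambda>u. V 1 (k * u)) (real n powr (- 1 / \<alpha>) * X (real n * 1) \<omega>) \<partial>M)"
      using k(3) by (simp add: wk_def mult.assoc[symmetric] mult.commute[of k])
    also have "\<dots> = (\<integral>\<omega>. (\<lambda>u. V 1 (k * u)) (X 1 \<omega>) \<partial>M)"
      using n by (intro expectation_one_law[OF scaled_process]) auto
    finally have "real n * wk n = (\<integral>\<omega>. real n * V 1 (k * X 1 \<omega>) \<partial>M)" by simp
    also have "\<dots> = (\<integral>\<omega>. \<bar>X 1 \<omega>\<bar> powr (- \<alpha>) * h (k * \<bar>X 1 \<omega>\<bar>) \<partial>M)"
    proof (rule integral_cong_AE)
      show "AE \<omega> in M. real n * V 1 (k * X 1 \<omega>) = \<bar>X 1 \<omega>\<bar> powr (- \<alpha>) * h (k * \<bar>X 1 \<omega>\<bar>)"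
        using X_neq_0[of 1, OF zero_less_one]
      proof eventually_elim
        case (elim \<omega>)
        have "V 1 (k * \<bar>X 1 \<omega>\<bar>) = V 1 (k * X 1 \<omega>)" using V_abs[of "k * X 1 \<omega>"] k by (simp add: abs_mult)
        moreover have "\<bar>X 1 \<omega>\<bar> powr (- \<alpha>) * (k * \<bar>X 1 \<omega>\<bar>) powr \<alpha> = real n"
          using elim k by (simp add: powr_mult powr_minus)
        ultimately show ?case by (simp add: h_def mult.assoc[symmetric])
      qed
    qed measurable
    finally show ?thesis by (simp add: k_def)
  qed
  have "(\<lambda>n. \<integral>\<omega>. \<bar>X 1 \<omega>\<bar> powr (- \<alpha>) * h (real n powr (1 / \<alpha>) * \<bar>X 1 \<omega>\<bar>) \<partial>M) \<longlonglongrightarrow> (\<integral>\<omega>. \<bar>X 1 \<omega>\<bar> powr (- \<alpha>) * (c / 12) \<partial>M)"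
  \<comment> \<open>\<open>tail_sup\<close> bounds \<open>h\<close> at positive arguments;
    \<open>\<bar>h 0\<bar>\<close> covers the argument 0, which occurs for n = 0.\<close>
  proof (rule integral_dominated_convergence[where w="\<lambda>\<omega>. \<bar>X 1 \<omega>\<bar> powr (- \<alpha>) * (tail_sup + \<bar>h 0\<bar>)"])
    show "integrable M (\<lambda>\<omega>. \<bar>X 1 \<omega>\<bar> powr (- \<alpha>) * (tail_sup + \<bar>h 0\<bar>))"
      using integrable_neg_moment[OF \<alpha>1] by (rule integrable_mult_left)
    show "AE \<omega> in M. (\<lambda>n. \<bar>X 1 \<omega>\<bar> powr (- \<alpha>) * h (real n powr (1 / \<alpha>) * \<bar>X 1 \<omega>\<bar>)) \<longlonglongrightarrow> \<bar>X 1 \<omega>\<bar> powr (- \<alpha>) * (c / 12)"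
      using X_neq_0[of 1, OF zero_less_one]
    proof eventually_elim
      case (elim \<omega>)
      have "filterlim (\<lambda>n. real n powr (1 / \<alpha>)) at_top sequentially"
        by (rule filterlim_compose[OF real_powr_at_top filterlim_real_sequentially]) (simp add: \<alpha>_pos)
      then have "filterlim (\<lambda>n. real n powr (1 / \<alpha>) * \<bar>X 1 \<omega>\<bar>) at_top sequentially"
        using elim by (intro filterlim_at_top_mult_tendsto_pos[OF tendsto_const]) auto
      then show ?case by (intro tendsto_mult tendsto_const filterlim_compose[OF hl])
    qed
    show "AE \<omega> in M. norm (\<bar>X 1 \<omega>\<bar> powr (- \<alpha>) * h (real n powr (1 / \<alpha>) * \<bar>X 1 \<omega>\<bar>)) \<le> \<bar>X 1 \<omega>\<bar> powr (- \<alpha>) * (tail_sup + \<bar>h 0\<bar>)" for n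
    proof (rule AE_I2)
      fix \<omega>
      let ?u = "real n powr (1 / \<alpha>) * \<bar>X 1 \<omega>\<bar>"
      have C0: "0 \<le> tail_sup" using hb[of 1] by linarith
      have "\<bar>h u\<bar> \<le> tail_sup + \<bar>h 0\<bar>" if "0 \<le> u" for u
      proof (cases "u = 0")
        case False
        then show ?thesis using hb[of u] that by linarith
      qed (use C0 in simp)
      then have "\<bar>h ?u\<bar> \<le> tail_sup + \<bar>h 0\<bar>" by simp
      then have "\<bar>X 1 \<omega>\<bar> powr (- \<alpha>) * \<bar>h ?u\<bar> \<le> \<bar>X 1 \<omega>\<bar> powr (- \<alpha>) * (tail_sup + \<bar>h 0\<bar>)"
        by (rule mult_left_mono) simp
      then show "norm (\<bar>X 1 \<omega>\<bar> powr (- \<alpha>) * h ?u) \<le> \<bar>X 1 \<omega>\<bar> powr (- \<alpha>) * (tail_sup + \<bar>h 0\<bar>)"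
        by (simp add: abs_mult)
    qed
  qed measurable
  then have "(\<lambda>n. \<integral>\<omega>. \<bar>X 1 \<omega>\<bar> powr (- \<alpha>) * h (real n powr (1 / \<alpha>) * \<bar>X 1 \<omega>\<bar>) \<partial>M) \<longlonglongrightarrow> c / 12 * (\<integral>\<omega>. \<bar>X 1 \<omega>\<bar> powr (- \<alpha>) \<partial>M)"
    by (simp add: mult.commute)
  moreover have "eventually (\<lambda>n. (\<integral>\<omega>. \<bar>X 1 \<omega>\<bar> powr (- \<alpha>) * h (real n powr (1 / \<alpha>) * \<bar>X 1 \<omega>\<bar>) \<partial>M) = real n * wk n) sequentially"
    using eventually_gt_at_top[of 0] by eventually_elim (simp add: eq)
  ultimately show ?thesis by (rule Lim_transform_eventually)
qed

theorem approx_err_limit_lt1: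
  assumes \<alpha>1: "\<alpha> < 1" and T: "0 < T" and tail: "((\<lambda>x. x powr \<alpha> * tail_prob 1 x) \<longlongrightarrow> c) at_top"
  shows "(\<lambda>n. (T / real n) powr (-2) * inverse (ln (real n)) * approx_err M X T 0 n) \<longlonglongrightarrow> c / 12 * (\<integral>\<omega>. \<bar>X 1 \<omega>\<bar> powr (- \<alpha>) \<partial>M)"
proof -
  have "(\<lambda>n. (\<Sum>k<n. wk k) / ln (real n)) \<longlonglongrightarrow> c / 12 * (\<integral>\<omega>. \<bar>X 1 \<omega>\<bar> powr (- \<alpha>) \<partial>M)"
    by (rule sum_over_ln[OF wk_lim_lt1[OF \<alpha>1 tail]])
  moreover have "eventually (\<lambda>n. (\<Sum>k<n. wk k) / ln (real n) = (T / real n) powr (-2) * inverse (ln (real n)) * approx_err M X T 0 n) sequentially"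
    using eventually_gt_at_top[of 0]
    by eventually_elim (simp add: approx_err_0_eq[OF T, symmetric] field_simps)
  ultimately show ?thesis by (rule Lim_transform_eventually)
qed

end

subsection \<open>The Cauchy process\<close>

lemma has_bochner_integral_FTC_atLeast:
  fixes f F :: "real \<Rightarrow> real"
  assumes f[measurable]: "f \<in> borel_measurable borel"
    and F: "\<And>x. a \<le> x \<Longrightarrow> (F has_real_derivative f x) (at x)" and nn: "\<And>x. a \<le> x \<Longrightarrow> 0 \<le> f x"
    and lim: "(F \<longlongrightarrow> T) at_top"
  shows "has_bochner_integral lborel (\<lambda>x. indicator {a..} x * f x) (T - F a)"
proof -
  have nni: "(\<integral>\<^sup>+x. ennreal (f x) * indicator {a..} x \<partial>lborel) = ennreal (T - F a)"
    by (rule nn_integral_FTC_atLeast[OF f F nn lim])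
  have "F a \<le> F x" if "a \<le> x" for x
    using DERIV_nonneg_imp_nondecreasing[OF that, of F] F nn by fastforce
  then have "F a \<le> T"
    by (intro tendsto_lowerbound[OF lim]) (auto simp: eventually_at_top_linorder)
  moreover have "(\<integral>\<^sup>+x. ennreal (indicator {a..} x * f x) \<partial>lborel) = ennreal (T - F a)"
    unfolding nni[symmetric] by (intro nn_integral_cong) (auto simp: indicator_def)
  ultimately show ?thesis
    by (intro has_bochner_integral_nn_integral) (auto simp: nn indicator_def)
qed

text \<open>The Cauchy density. Evenness reduces the transform to the half-line, where exp(-u) cos(u
  x) has an elementary antiderivative.\<close>

lemma inv_dens_exp_abs: "inv_dens (\<lambda>u. exp (- \<bar>u\<bar>)) x = 1 / (pi * (1 + x\<^sup>2))"
proof -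
  have i0: "integrable lborel (\<lambda>u::real. exp (- \<bar>u\<bar>))"
    using integrable_exp_neg_powr[of 1 1] by simp
  have i: "integrable lborel (\<lambda>u. cos (u * x) * exp (- \<bar>u\<bar>))" by (rule inv_dens_integrable[OF i0])
  have pos: "1 + x\<^sup>2 \<noteq> 0" using zero_le_power2[of x] by linarith
  define F where "F u = exp (- u) * (x * sin (u * x) - cos (u * x)) / (1 + x\<^sup>2)" for u
  have D: "(F has_real_derivative exp (- u) * cos (u * x)) (at u)" for u
  proof -
    have "(F has_real_derivative (exp (- u) * (-1) * (x * sin (u * x) - cos (u * x)) + exp (- u) * (x * (cos (u * x) * x) + sin (u * x) * x)) / (1 + x\<^sup>2)) (at u)"
      unfolding F_def by (auto intro!: derivative_eq_intros simp: pos)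
    moreover have "(exp (- u) * (-1) * (x * sin (u * x) - cos (u * x)) + exp (- u) * (x * (cos (u * x) * x) + sin (u * x) * x)) / (1 + x\<^sup>2) = exp (- u) * cos (u * x)"
      using pos by (simp add: field_simps power2_eq_square)
    ultimately show ?thesis by simp
  qed
  have "(LBINT u=0..\<infinity>. exp (- u) * cos (u * x)) = 0 - F 0"
  proof (rule interval_integral_FTC_integrable)
    show "(F has_vector_derivative exp (- u) * cos (u * x)) (at u)" for u
      using D by (simp add: has_real_derivative_iff_has_vector_derivative)
    show "set_integrable lborel (einterval 0 \<infinity>) (\<lambda>u. exp (- u) * cos (u * x))"
    proof -
      have "set_integrable lborel (einterval 0 \<infinity>) (\<lambda>u. cos (u * x) * exp (- \<bar>u\<bar>))"
        unfolding set_integrable_def using i by (intro integrable_mult_indicator) auto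
      then show ?thesis
        by (rule set_integrable_cong[THEN iffD1, rotated -1]) (auto simp: einterval_def zero_ereal_def)
    qed
    show "((F \<circ> real_of_ereal) \<longlongrightarrow> F 0) (at_right 0)"
      unfolding zero_ereal_def ereal_tendsto_simps using D[of 0, THEN DERIV_isCont]
      by (auto simp: isCont_def intro: tendsto_mono[OF at_le])
    have "(F \<longlongrightarrow> 0) at_top"
    proof (rule tendsto_0_le[where K="(\<bar>x\<bar> + 1) / (1 + x\<^sup>2)"])
      show "((\<lambda>u::real. exp (- u)) \<longlongrightarrow> 0) at_top" by real_asymp
      show "\<forall>\<^sub>F u in at_top. norm (F u) \<le> norm (exp (- u)) * ((\<bar>x\<bar> + 1) / (1 + x\<^sup>2))"
      proof (intro always_eventually allI)
        fix u
        have "\<bar>x * sin (u * x) - cos (u * x)\<bar> \<le> \<bar>x\<bar> * 1 + 1"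
          by (rule order_trans[OF abs_triangle_ineq4]) (intro add_mono, auto simp: abs_mult intro!: mult_left_le)
        then have "exp (- u) * (\<bar>x * sin (u * x) - cos (u * x)\<bar> / (1 + x\<^sup>2)) \<le> exp (- u) * ((\<bar>x\<bar> + 1) / (1 + x\<^sup>2))"
          by (intro mult_left_mono divide_right_mono) auto
        then show "norm (F u) \<le> norm (exp (- u)) * ((\<bar>x\<bar> + 1) / (1 + x\<^sup>2))"
          by (simp add: F_def abs_mult abs_divide)
      qed
    qed
    then show "((F \<circ> real_of_ereal) \<longlongrightarrow> 0) (at_left \<infinity>)"
      unfolding ereal_tendsto_simps .
  qed auto
  then have half: "(LBINT u=0..\<infinity>. exp (- u) * cos (u * x)) = 1 / (1 + x\<^sup>2)"
    by (simp add: F_def)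
  have "(LINT u|lborel. cos (u * x) * exp (- \<bar>u\<bar>)) = 2 * (LINT u:{0..}|lborel. cos (u * x) * exp (- \<bar>u\<bar>))"
    by (rule integral_even[OF i]) simp
  also have "(LINT u:{0..}|lborel. cos (u * x) * exp (- \<bar>u\<bar>)) = (LBINT u=0..\<infinity>. exp (- u) * cos (u * x))"
    unfolding interval_lebesgue_integral_def set_lebesgue_integral_def
    by (simp add: einterval_def zero_ereal_def)
       (intro integral_cong_AE eventually_mono[OF AE_lborel_singleton[of 0]], auto simp: indicator_def)
  finally show ?thesis unfolding inv_dens_def half by simp
qed

context stable_process
begin

context
  assumes \<alpha>1: "\<alpha> = 1"
begin

lemma cauchy_dens: "0 < t \<Longrightarrow> p t x = t / (pi * (t\<^sup>2 + x\<^sup>2))"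
proof -
  assume t: "0 < t"
  have "p t x = inverse t * (1 / (pi * (1 + (x * inverse t)\<^sup>2)))"
    unfolding stable_dens_def \<alpha>1 using t by (simp add: inv_dens_exp_abs powr_minus)
  also have "\<dots> = t / (pi * (t\<^sup>2 + x\<^sup>2))"
  proof -
    have "t\<^sup>2 + x\<^sup>2 > 0" using t by (simp add: add_pos_nonneg)
    then have "1 + (x * inverse t)\<^sup>2 = (t\<^sup>2 + x\<^sup>2) / t\<^sup>2" using t by (simp add: field_simps power2_eq_square)
    then show ?thesis using t by (simp add: field_simps power2_eq_square)
  qed
  finally show ?thesis .
qed

lemma cauchy_tail_prob: "tail_prob 1 x = (pi / 2 - arctan x) / pi"
proof -
  have "tail_prob 1 x = (LINT u|lborel. p 1 u * hv x u)"
    unfolding tail_prob_def by (rule expectation_X) auto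
  also have "\<dots> = (LINT u|lborel. indicator {x..} u * (1 / (pi * (1 + u\<^sup>2))))"
    by (intro Bochner_Integration.integral_cong) (auto simp: cauchy_dens hv_def indicator_def)
  also have "\<dots> = (pi / 2) / pi - arctan x / pi"
  proof (rule has_bochner_integral_integral_eq, rule has_bochner_integral_FTC_atLeast)
    show "((\<lambda>u. arctan u / pi) has_real_derivative 1 / (pi * (1 + u\<^sup>2))) (at u)" for u
      using DERIV_cdivide[OF DERIV_arctan, of pi u] by (simp add: inverse_eq_divide mult.commute)
    show "((\<lambda>u. arctan u / pi) \<longlongrightarrow> pi / 2 / pi) at_top"
      by (intro tendsto_divide tendsto_arctan_at_top tendsto_const) simp
    show "0 \<le> 1 / (pi * (1 + u\<^sup>2))" for u :: real by simp
  qed measurable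
  finally show ?thesis by (simp add: diff_divide_distrib)
qed

text \<open>pi / 2 - arctan x is asymptotic to 1 / x.\<close>

lemma cauchy_tail: "((\<lambda>x. x powr \<alpha> * tail_prob 1 x) \<longlongrightarrow> 1 / pi) at_top"
proof -
  have "((\<lambda>x::real. x * ((pi / 2 - arctan x) / pi)) \<longlongrightarrow> inverse pi) at_top" by real_asymp
  moreover have "eventually (\<lambda>x. x * ((pi / 2 - arctan x) / pi) = x powr \<alpha> * tail_prob 1 x) at_top"
    using eventually_gt_at_top[of 0] by eventually_elim (simp add: \<alpha>1 cauchy_tail_prob)
  ultimately show ?thesis unfolding inverse_eq_divide[of pi] by (rule Lim_transform_eventually)
qed

text \<open>The profile 1 / z, which \<open>V 1\<close> follows at infinity up to a constant, is cut
  off at the scale n of X at time n. The mass ln n that it collects between 1 and n is the source of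
  the second logarithm.\<close>

lemma harmonic_kernel:
  assumes n: "0 < (n::real)"
  shows "has_bochner_integral lborel (\<lambda>z. indicator {1..} z * (n\<^sup>2 / (z * (n\<^sup>2 + z\<^sup>2)))) (ln n + ln (1 + 1 / n\<^sup>2) / 2)"
proof -
  \<comment> \<open>For positive z this is ln z + ln n - ln(n^2 + z^2) / 2, in a form that shows the
    limit ln n at infinity.\<close>
  define F where "F z = - ln (1 / z\<^sup>2 + 1 / n\<^sup>2) / 2" for z
  have "has_bochner_integral lborel (\<lambda>z. indicator {1..} z * (n\<^sup>2 / (z * (n\<^sup>2 + z\<^sup>2)))) (ln n - F 1)"
  proof (rule has_bochner_integral_FTC_atLeast)
    fix z :: real assume z: "1 \<le> z"
    have pos: "0 < 1 / z\<^sup>2 + 1 / n\<^sup>2" using z n by (simp add: add_pos_pos)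
    have "(F has_real_derivative (- (1 / (1 / z\<^sup>2 + 1 / n\<^sup>2) * (- (2 * z) / (z\<^sup>2)\<^sup>2)) / 2)) (at z)"
      unfolding F_def using z n pos by (auto intro!: derivative_eq_intros simp: power2_eq_square)
    moreover have "- (1 / (1 / z\<^sup>2 + 1 / n\<^sup>2) * (- (2 * z) / (z\<^sup>2)\<^sup>2)) / 2 = n\<^sup>2 / (z * (n\<^sup>2 + z\<^sup>2))"
    proof -
      have "1 / z\<^sup>2 + 1 / n\<^sup>2 = (n\<^sup>2 + z\<^sup>2) / (z\<^sup>2 * n\<^sup>2)" using z n by (simp add: field_simps)
      moreover have "n\<^sup>2 + z\<^sup>2 > 0" using n by (simp add: add_pos_nonneg)
      ultimately show ?thesis using z n by (simp add: power2_eq_square)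
    qed
    ultimately show "(F has_real_derivative n\<^sup>2 / (z * (n\<^sup>2 + z\<^sup>2))) (at z)" by simp
    show "0 \<le> n\<^sup>2 / (z * (n\<^sup>2 + z\<^sup>2))" using z by simp
  next
    have "((\<lambda>z::real. - ln (1 / z\<^sup>2 + 1 / n\<^sup>2) / 2) \<longlongrightarrow> - ln (0 + 1 / n\<^sup>2) / 2) at_top"
      using n by (intro tendsto_divide tendsto_minus tendsto_ln tendsto_add tendsto_const) (real_asymp | simp)+
    then show "(F \<longlongrightarrow> ln n) at_top" using n by (simp add: F_def[abs_def] ln_div ln_realpow)
  qed measurable
  then show ?thesis by (simp add: F_def)
qed

text \<open>1 / |X_1| is not integrable under the Cauchy law, so domination as for \<alpha> < 1
  fails. With the explicit density, n w_n is the integral of r_n V / pi, where r_n = n^2 / (n^2 +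
  z^2). Replacing V by A / |z| for |z| >= 1 gives 2 A J_n, with J_n asymptotic to ln n, and the
  error of the replacement is of smaller order.\<close>

lemma wk_lim_1: "(\<lambda>n. real n * wk n / ln (real n)) \<longlonglongrightarrow> 1 / (6 * pi\<^sup>2)"
proof -
  \<comment> \<open>The limit c / 12 of z V(1, z) for the Cauchy tail constant c = 1 / pi.\<close>
  define A where "A = 1 / (12 * pi)"
  define r where "r n z = (real n)\<^sup>2 / ((real n)\<^sup>2 + z\<^sup>2)" for n z
  define J where "J n = ln (real n) + ln (1 + 1 / (real n)\<^sup>2) / 2" for n
  define k where "k n z = indicator {1..} z * ((real n)\<^sup>2 / (z * ((real n)\<^sup>2 + z\<^sup>2)))" for n z
  have A0: "0 \<le> A" by (simp add: A_def)
  have \<alpha>2: "\<alpha> \<le> 2" by (simp add: \<alpha>1)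
  have rr: "0 \<le> r n z" "r n z \<le> 1" if "0 < n" for n z
    using that by (auto simp: r_def divide_le_eq_1 add_pos_nonneg)
  have kk: "integrable lborel (k n)" "(LINT z|lborel. k n z) = J n" if "0 < n" for n
    using harmonic_kernel[of "real n"] that by (auto simp: k_def[abs_def] J_def has_bochner_integral_iff)
  have km: "integrable lborel (\<lambda>z. k n (- z))" "(LINT z|lborel. k n (- z)) = J n" if "0 < n" for n
  proof -
    have "integrable lborel (\<lambda>z. k n (0 + (-1) * z))"
      using kk(1)[OF that] by (subst lborel_integrable_real_affine_iff) auto
    then show "integrable lborel (\<lambda>z. k n (- z))" by simp
    have "(LINT z|lborel. k n z) = \<bar>-1\<bar> *\<^sub>R (LINT z|lborel. k n (0 + (-1) * z))"
      by (rule lborel_integral_real_affine) simp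
    then show "(LINT z|lborel. k n (- z)) = J n" using kk(2)[OF that] by simp
  qed
  have wk_eq: "real n * wk n = (LINT z|lborel. r n z * V 1 z) / pi" if n: "0 < n" for n
  proof -
    have "wk n = (LINT z|lborel. p (real n) z * V 1 z)"
      unfolding wk_def using n by (intro expectation_X) auto
    also have "real n * \<dots> = (LINT z|lborel. real n * (p (real n) z * V 1 z))" by simp
    also have "\<dots> = (LINT z|lborel. (r n z * V 1 z) / pi)"
      using n by (intro Bochner_Integration.integral_cong) (auto simp: cauchy_dens r_def power2_eq_square field_simps)
    finally show ?thesis by simp
  qed
  have iV: "integrable lborel (\<lambda>z. r n z * V 1 z)" if n: "0 < n" for n
  proof (rule Bochner_Integration.integrable_bound)
    show "integrable lborel (\<lambda>z. real n * pi * p (real n) z)" using n by (intro integrable_mult_right integrable_p) simp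
    show "AE z in lborel. norm (r n z * V 1 z) \<le> norm (real n * pi * p (real n) z)"
    proof (rule AE_I2)
      fix z
      have "real n * pi * p (real n) z = r n z" using n by (simp add: cauchy_dens r_def power2_eq_square)
      moreover have "r n z * V 1 z \<le> r n z" using V_bound[of 1 z] rr[OF n, of z] by (intro mult_left_le) auto
      ultimately show "norm (r n z * V 1 z) \<le> norm (real n * pi * p (real n) z)"
        using rr[OF n, of z] V_nonneg[of 1 z] by simp
    qed
  qed (use V_measurable[of 1] in \<open>simp add: r_def\<close>)
  have est: "\<exists>B. \<forall>n>0. \<bar>(LINT z|lborel. r n z * V 1 z) - 2 * A * J n\<bar> \<le> B + 2 * e * J n" if e: "0 < e" for e
  proof -
    have "((\<lambda>x. x powr \<alpha> * V 1 x) \<longlongrightarrow> A) at_top"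
      using V_tail[OF \<alpha>2 cauchy_tail] by (simp add: A_def mult.commute)
    then have "eventually (\<lambda>x. dist (x powr \<alpha> * V 1 x) A < e) at_top" using e by (rule tendstoD)
    then obtain R0 where R0: "\<And>x. R0 \<le> x \<Longrightarrow> dist (x powr \<alpha> * V 1 x) A < e"
      by (auto simp: eventually_at_top_linorder)
    define R where "R = max 1 R0"
    have R: "\<bar>V 1 z - A / z\<bar> \<le> e / z" if "R \<le> z" for z
    proof -
      have z: "1 \<le> z" "R0 \<le> z" using that by (auto simp: R_def)
      have "\<bar>z * V 1 z - A\<bar> < e" using R0[OF z(2)] z by (simp add: \<alpha>1 dist_real_def)
      moreover have "z * V 1 z - A = z * (V 1 z - A / z)" using z by (simp add: right_diff_distrib)
      ultimately have "z * \<bar>V 1 z - A / z\<bar> < e" using z by (simp add: abs_mult)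
      then show ?thesis using z by (simp add: field_simps)
    qed
    have R1: "1 \<le> R" by (simp add: R_def)
    show ?thesis
    proof (intro exI allI impI)
      fix n :: nat assume n: "0 < n"
      let ?g = "\<lambda>z. r n z * V 1 z - A * (k n z + k n (- z))"
      \<comment> \<open>On [-R, R] the two terms are at most 1 and A; outside, \<open>V 1\<close>
        differs from A / |z| by at most e / |z|. Only the second part grows with n, and it carries
        the small factor e.\<close>
      let ?b = "\<lambda>z. (1 + A) * indicator {-R..R} z + e * (k n z + k n (- z))"
      have iI: "integrable lborel (indicat_real {-R..R})"
        by (intro integrable_real_indicator) (auto simp: emeasure_lborel_Icc_eq)
      have ib: "integrable lborel ?b"
        using kk(1)[OF n] km(1)[OF n] iI by (intro Bochner_Integration.integrable_add integrable_mult_right)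
      have ig: "integrable lborel ?g"
        using iV[OF n] kk(1)[OF n] km(1)[OF n] by simp
      have pt: "\<bar>?g z\<bar> \<le> ?b z" if z: "0 \<le> z" for z
      proof -
        have km0: "k n (- z) = 0" using z by (simp add: k_def)
        have kr: "k n z = r n z / z" if "1 \<le> z" using that by (simp add: k_def r_def)
        have V1: "\<bar>V 1 z\<bar> \<le> 1" using V_bound[of 1 z] by simp
        consider "z < 1" | "1 \<le> z" "z < R" | "R \<le> z" by linarith
        then show ?thesis
        proof cases
          case 1
          have "\<bar>r n z * V 1 z\<bar> \<le> 1 * 1" unfolding abs_mult using rr[OF n, of z] V1 by (intro mult_mono) auto
          then show ?thesis using 1 z R1 A0 by (simp add: km0 k_def)
        next
          case 2
          have "\<bar>r n z * V 1 z\<bar> \<le> 1 * 1" unfolding abs_mult using rr[OF n, of z] V1 by (intro mult_mono) auto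
          moreover have "r n z / z \<le> 1" using rr[OF n, of z] 2 by (simp add: divide_le_eq)
          then have "A * (r n z / z) \<le> A * 1" using A0 by (intro mult_left_mono)
          moreover have "0 \<le> A * (r n z / z)" "0 \<le> e * (r n z / z)" using A0 e 2 rr[OF n, of z] by auto
          ultimately show ?thesis using 2 R1 by (simp add: km0 kr abs_le_iff)
        next
          case 3
          then have z1: "1 \<le> z" using R1 by simp
          have "?g z = r n z * (V 1 z - A / z)" by (simp add: km0 kr[OF z1] algebra_simps)
          then have "\<bar>?g z\<bar> = r n z * \<bar>V 1 z - A / z\<bar>" using rr[OF n, of z] by (simp add: abs_mult)
          also have "\<dots> \<le> r n z * (e / z)" using rr(1)[OF n, of z] by (rule mult_left_mono[OF R[OF 3]])
          also have "\<dots> = e * k n z" by (simp add: kr[OF z1])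
          also have "\<dots> \<le> ?b z" using A0 by (simp add: km0)
          finally show ?thesis .
        qed
      qed
      have pt': "\<bar>?g z\<bar> \<le> ?b z" for z
      proof (cases "0 \<le> z")
        case False
        have "r n (- z) = r n z" "V 1 (- z) = V 1 z" "indicator {-R..R} (- z) = (indicator {-R..R} z :: real)"
          by (auto simp: r_def V_minus indicator_def)
        then show ?thesis using pt[of "- z"] False by (simp add: add.commute)
      qed (rule pt)
      have "(LINT z|lborel. r n z * V 1 z) - 2 * A * J n = (LINT z|lborel. ?g z)"
        using iV[OF n] kk[OF n] km[OF n] by simp
      then have "\<bar>(LINT z|lborel. r n z * V 1 z) - 2 * A * J n\<bar> = \<bar>LINT z|lborel. ?g z\<bar>" by (rule arg_cong)
      also have "\<dots> \<le> (LINT z|lborel. ?b z)"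
        by (rule integral_abs_bound_integral[OF ig ib pt'])
      also have "\<dots> = (1 + A) * (2 * R) + 2 * e * J n"
      proof -
        have "(LINT z|lborel. ?b z) = (LINT z|lborel. (1 + A) * indicat_real {-R..R} z) + (LINT z|lborel. e * (k n z + k n (- z)))"
          using iI kk(1)[OF n] km(1)[OF n]
          by (intro Bochner_Integration.integral_add integrable_mult_right Bochner_Integration.integrable_add)
        also have "(LINT z|lborel. (1 + A) * indicat_real {-R..R} z) = (1 + A) * (2 * R)" using R1 by simp
        also have "(LINT z|lborel. e * (k n z + k n (- z))) = e * (J n + J n)"
          by (simp only: integral_mult_right_zero Bochner_Integration.integral_add[OF kk(1)[OF n] km(1)[OF n]] kk(2)[OF n] km(2)[OF n])
        finally show ?thesis by (simp add: algebra_simps)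
      qed
      finally show "\<bar>(LINT z|lborel. r n z * V 1 z) - 2 * A * J n\<bar> \<le> (1 + A) * (2 * R) + 2 * e * J n" .
    qed
  qed
  have Jl: "(\<lambda>n. J n / ln (real n)) \<longlonglongrightarrow> 1" unfolding J_def by real_asymp
  have Il: "(\<lambda>n. ((LINT z|lborel. r n z * V 1 z) - 2 * A * J n) / ln (real n)) \<longlonglongrightarrow> 0"
  proof (rule tendstoI)
    fix e :: real assume e: "0 < e"
    obtain B where B: "\<And>n. 0 < n \<Longrightarrow> \<bar>(LINT z|lborel. r n z * V 1 z) - 2 * A * J n\<bar> \<le> B + 2 * (e / 4) * J n"
      using est[of "e / 4"] e by auto
    have "(\<lambda>n. B / ln (real n) + 2 * (e / 4) * (J n / ln (real n))) \<longlonglongrightarrow> 0 + 2 * (e / 4) * 1"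
      by (intro tendsto_add tendsto_mult tendsto_const Jl) real_asymp
    then have "eventually (\<lambda>n. B / ln (real n) + 2 * (e / 4) * (J n / ln (real n)) < e) sequentially"
      by (rule order_tendstoD(2)) (use e in simp)
    then show "eventually (\<lambda>n. dist (((LINT z|lborel. r n z * V 1 z) - 2 * A * J n) / ln (real n)) 0 < e) sequentially"
      using eventually_gt_at_top[of 1]
    proof eventually_elim
      case (elim n)
      have ln0: "0 < ln (real n)" using elim by simp
      have "\<bar>(LINT z|lborel. r n z * V 1 z) - 2 * A * J n\<bar> / ln (real n) \<le> (B + 2 * (e / 4) * J n) / ln (real n)"
        using B[of n] elim ln0 by (intro divide_right_mono) auto
      also have "\<dots> = B / ln (real n) + 2 * (e / 4) * (J n / ln (real n))" by (simp add: add_divide_distrib)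
      finally show ?case using elim ln0 by (simp add: dist_real_def)
    qed
  qed
  have l1: "(\<lambda>n. (((LINT z|lborel. r n z * V 1 z) - 2 * A * J n) / ln (real n) + 2 * A * (J n / ln (real n))) / pi) \<longlonglongrightarrow> (0 + 2 * A * 1) / pi"
    by (intro tendsto_divide tendsto_add tendsto_mult tendsto_const Il Jl) simp
  have l2: "(0 + 2 * A * 1) / pi = 1 / (6 * pi\<^sup>2)" by (simp add: A_def power2_eq_square)
  have l3: "eventually (\<lambda>n. (((LINT z|lborel. r n z * V 1 z) - 2 * A * J n) / ln (real n) + 2 * A * (J n / ln (real n))) / pi = real n * wk n / ln (real n)) sequentially"
    using eventually_gt_at_top[of 0]
  proof eventually_elim
    case (elim n)
    show ?case by (simp add: wk_eq[OF elim] diff_divide_distrib)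
  qed
  show ?thesis using Lim_transform_eventually[OF l1 l3] unfolding l2 .
qed

theorem approx_err_limit_1:
  assumes T: "0 < T"
  shows "(\<lambda>n. (T / real n) powr (-2) * inverse ((ln (real n))\<^sup>2) * approx_err M X T 0 n) \<longlonglongrightarrow> 1 / (12 * pi\<^sup>2)"
proof -
  have "(\<lambda>n. (\<Sum>k<n. wk k) / (ln (real n))\<^sup>2) \<longlonglongrightarrow> 1 / (6 * pi\<^sup>2) / 2"
    by (rule sum_over_ln_sq[OF wk_lim_1])
  moreover have "eventually (\<lambda>n. (\<Sum>k<n. wk k) / (ln (real n))\<^sup>2 = (T / real n) powr (-2) * inverse ((ln (real n))\<^sup>2) * approx_err M X T 0 n) sequentially"
    using eventually_gt_at_top[of 0]
    by eventually_elim (simp add: approx_err_0_eq[OF T, symmetric] field_simps)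
  ultimately have "(\<lambda>n. (T / real n) powr (-2) * inverse ((ln (real n))\<^sup>2) * approx_err M X T 0 n) \<longlonglongrightarrow> 1 / (6 * pi\<^sup>2) / 2"
    by (rule Lim_transform_eventually)
  then show ?thesis by simp
qed

end

end

subsection \<open>The tail of the stable law\<close>

lemma nn_integral_powr_exp:
  fixes s z :: real
  assumes "0 < s" "0 < z"
  shows "(\<integral>\<^sup>+t. ennreal (indicator {0..} t * (t powr (s - 1) * exp (- t * z))) \<partial>lborel) = ennreal (Gamma s * z powr (- s))"
proof -
  let ?I = "\<integral>\<^sup>+t. ennreal (indicator {0..} t * (t powr (s - 1) * exp (- t * z))) \<partial>lborel"
  have "ennreal (Gamma s) = ennreal \<bar>z\<bar> * (\<integral>\<^sup>+t. ennreal (indicator {0..} (0 + z * t) * (0 + z * t) powr (s - 1) / exp (0 + z * t)) \<partial>lborel)"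
    unfolding Gamma_conv_nn_integral_real[OF assms(1)]
    by (rule nn_integral_real_affine) (use assms in auto)
  also have "(\<integral>\<^sup>+t. ennreal (indicator {0..} (0 + z * t) * (0 + z * t) powr (s - 1) / exp (0 + z * t)) \<partial>lborel)
      = (\<integral>\<^sup>+t. ennreal (z powr (s - 1)) * ennreal (indicator {0..} t * (t powr (s - 1) * exp (- t * z))) \<partial>lborel)"
    using assms by (intro nn_integral_cong)
      (auto simp: indicator_def ennreal_mult'[symmetric] powr_mult exp_minus field_simps zero_le_mult_iff)
  also have "\<dots> = ennreal (z powr (s - 1)) * ?I" by (rule nn_integral_cmult) simp
  finally have "ennreal (Gamma s) = ennreal (z powr s) * ?I"
    using assms by (simp add: mult.assoc[symmetric] ennreal_mult'[symmetric] powr_mult_base)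
  then have "ennreal (z powr (- s)) * ennreal (Gamma s) = ennreal (z powr (- s)) * (ennreal (z powr s) * ?I)" by simp
  also have "\<dots> = ?I"
    using assms by (simp add: mult.assoc[symmetric] ennreal_mult'[symmetric] powr_add[symmetric])
  finally show ?thesis using assms Gamma_real_pos[of s] by (simp add: ennreal_mult'[symmetric] mult.commute)
qed

lemma Beta_reflection:
  fixes a :: real
  shows "Beta a (1 - a) = pi / sin (pi * a)"
proof -
  have "complex_of_real (Gamma a * Gamma (1 - a)) = complex_of_real (pi / sin (pi * a))"
    using Gamma_reflection_complex[of "of_real a"]
    by (simp add: Gamma_complex_of_real[symmetric] sin_of_real[symmetric])
  then show ?thesis by (simp only: of_real_eq_iff Beta_def) simp
qed

text \<open>The substitution u = t^2 / (1 + t^2) turns this into half a Beta integral with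
  parameters a and 1 - a, and the reflection formula supplies the sine.\<close>

lemma nn_integral_powr_over_one_plus_square:
  fixes a :: real
  assumes a: "0 < a" "a < 1"
  shows "(\<integral>\<^sup>+t. ennreal (indicator {0<..} t * (t powr (2 * a - 1) / (1 + t\<^sup>2))) \<partial>lborel) = ennreal (pi / (2 * sin (pi * a)))"
proof -
  define g :: "real \<Rightarrow> real" where "g t = t\<^sup>2 / (1 + t\<^sup>2)" for t
  define f :: "real \<Rightarrow> real" where "f u = u powr (a - 1) * (1 - u) powr ((1 - a) - 1)" for u
  define g' :: "real \<Rightarrow> real" where "g' t = 2 * t / (1 + t\<^sup>2)\<^sup>2" for t
  have p: "1 + t\<^sup>2 \<noteq> 0" "0 < 1 + t\<^sup>2" for t :: real using zero_le_power2[of t] by linarith+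
  have der: "(g has_field_derivative g' t) (at t within {0<..})" for t
    unfolding g_def g'_def using p[of t]
    by (auto intro!: derivative_eq_intros simp: field_simps power2_eq_square)
  have inj: "inj_on g {0<..}"
  proof (rule inj_onI)
    fix x y :: real assume "x \<in> {0<..}" "y \<in> {0<..}" "g x = g y"
    then have "x\<^sup>2 = y\<^sup>2" using p[of x] p[of y] by (simp add: g_def field_simps)
    with \<open>x \<in> _\<close> \<open>y \<in> _\<close> show "x = y" by (simp add: power2_eq_iff)
  qed
  have img: "g ` {0<..} = {0<..<1}"
  proof (intro equalityI subsetI)
    fix u assume "u \<in> g ` {0<..}"
    then show "u \<in> {0<..<1}" using p by (auto simp: g_def zero_less_divide_iff divide_less_eq)
  next
    fix u :: real assume u: "u \<in> {0<..<1}"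
    then have "u = g (sqrt (u / (1 - u)))" by (simp add: g_def field_simps)
    with u show "u \<in> g ` {0<..}" by (intro image_eqI[of _ _ "sqrt (u / (1 - u))"]) auto
  qed
  have hi: "(f has_integral Beta a (1 - a)) {0<..<1}"
    using has_integral_Beta_real[of a "1 - a"] a by (simp add: has_integral_Icc_iff_Ioo f_def[abs_def])
  have "f absolutely_integrable_on g ` {0<..} \<and> integral (g ` {0<..}) f = Beta a (1 - a)"
    unfolding img using hi by (auto intro!: nonnegative_absolutely_integrable_1 simp: integrable_on_def f_def integral_unique)
  then have "(\<lambda>x. \<bar>g' x\<bar> * f (g x)) absolutely_integrable_on {0<..} \<and> integral {0<..} (\<lambda>x. \<bar>g' x\<bar> * f (g x)) = Beta a (1 - a)"
    using has_absolute_integral_change_of_variables_1'[of "{0<..}" g g' f] der inj by (simp add: lborelD)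
  then have "((\<lambda>x. \<bar>g' x\<bar> * f (g x)) has_integral Beta a (1 - a)) {0<..}"
    using set_lebesgue_integral_eq_integral(1) integrable_integral by metis
  then have "((\<lambda>x. 1 / 2 * (\<bar>g' x\<bar> * f (g x))) has_integral 1 / 2 * Beta a (1 - a)) {0<..}"
    by (rule has_integral_mult_right)
  moreover have "1 / 2 * (\<bar>g' x\<bar> * f (g x)) = x powr (2 * a - 1) / (1 + x\<^sup>2)" if "x \<in> {0<..}" for x
  proof -
    have x: "0 < x" using that by simp
    have 1: "1 - g x = (1 + x\<^sup>2) powr (- 1)" "g x = x powr 2 * (1 + x\<^sup>2) powr (- 1)"
      using p[of x] x by (simp_all add: g_def powr_minus field_simps powr_numeral)
    have "f (g x) = (x powr 2 * (1 + x\<^sup>2) powr (- 1)) powr (a - 1) * ((1 + x\<^sup>2) powr (- 1)) powr (- a)"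
      using 1 by (simp add: f_def)
    also have "\<dots> = x powr (2 * (a - 1)) * ((1 + x\<^sup>2) powr (- 1 * (a - 1)) * (1 + x\<^sup>2) powr (- 1 * (- a)))"
      by (simp only: powr_mult powr_powr mult.assoc powr_ge_zero)
    also have "\<dots> = x powr (2 * (a - 1)) * (1 + x\<^sup>2) powr (- 1 * (a - 1) + - 1 * (- a))"
      by (simp only: powr_add)
    also have "\<dots> = x powr (2 * (a - 1)) * (1 + x\<^sup>2)" using p[of x] by simp
    finally have f: "f (g x) = x powr (2 * a - 2) * (1 + x\<^sup>2)" by (simp add: algebra_simps)
    have "x powr (2 * a - 1) = x * x powr (2 * a - 2)" using x by (simp add: powr_mult_base)
    with f show ?thesis using p[of x] x by (simp add: g'_def power2_eq_square)
  qed
  ultimately have "((\<lambda>x. x powr (2 * a - 1) / (1 + x\<^sup>2)) has_integral 1 / 2 * Beta a (1 - a)) {0<..}"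
    by (subst (asm) has_integral_cong) auto
  from nn_integral_has_integral_lebesgue[OF _ this] show ?thesis
    by (simp add: Beta_reflection)
qed

text \<open>The Laplace transform of 1 - cos, namely 1 / t - t / (1 + t^2).\<close>

lemma nn_integral_one_minus_cos_exp:
  fixes t :: real
  assumes t: "0 < t"
  shows "(\<integral>\<^sup>+z. ennreal ((1 - cos z) * exp (- t * z)) * indicator {0..} z \<partial>lborel) = ennreal (1 / (t * (1 + t\<^sup>2)))"
proof -
  define F where "F z = - exp (- t * z) / t - exp (- t * z) * (sin z - t * cos z) / (1 + t\<^sup>2)" for z
  have p: "1 + t\<^sup>2 \<noteq> 0" "0 < 1 + t\<^sup>2" using zero_le_power2[of t] by linarith+
  have der: "DERIV F z :> (1 - cos z) * exp (- t * z)" for z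
  proof -
    define k where "k = 1 / (1 + t\<^sup>2)"
    have F: "F = (\<lambda>z. - (1 / t) * exp (- t * z) - k * (exp (- t * z) * (sin z - t * cos z)))"
      by (simp add: F_def k_def fun_eq_iff)
    have "DERIV F z :> exp (- t * z) - k * (exp (- t * z) * (cos z + t * sin z) - t * exp (- t * z) * (sin z - t * cos z))"
      unfolding F using t by (auto intro!: derivative_eq_intros)
    also have "exp (- t * z) - k * (exp (- t * z) * (cos z + t * sin z) - t * exp (- t * z) * (sin z - t * cos z))
       = exp (- t * z) - (k * (1 + t\<^sup>2)) * (exp (- t * z) * cos z)"
      by (simp add: algebra_simps power2_eq_square)
    also have "k * (1 + t\<^sup>2) = 1" using p by (simp add: k_def)
    finally show ?thesis by (simp add: algebra_simps)
  qed
  have e: "((\<lambda>z. exp (- t * z)) \<longlongrightarrow> 0) at_top"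
    using t by real_asymp
  have "((\<lambda>z. exp (- t * z) * ((sin z - t * cos z) / (1 + t\<^sup>2))) \<longlongrightarrow> 0) at_top"
  proof (rule Lim_null_comparison)
    show "((\<lambda>z. exp (- t * z) * ((1 + t) / (1 + t\<^sup>2))) \<longlongrightarrow> 0) at_top"
      by (rule tendsto_mult_left_zero[OF e])
    have "\<bar>sin z - t * cos z\<bar> \<le> 1 + t" for z
    proof -
      have "\<bar>t * cos z\<bar> \<le> t" using t by (simp add: abs_mult mult_left_le)
      moreover have "\<bar>sin z\<bar> \<le> 1" by simp
      ultimately show ?thesis by linarith
    qed
    then show "\<forall>\<^sub>F z in at_top. norm (exp (- t * z) * ((sin z - t * cos z) / (1 + t\<^sup>2))) \<le> exp (- t * z) * ((1 + t) / (1 + t\<^sup>2))"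
      using p by (intro always_eventually allI) (simp add: abs_mult divide_right_mono)
  qed
  then have "((\<lambda>z. - exp (- t * z) / t - exp (- t * z) * ((sin z - t * cos z) / (1 + t\<^sup>2))) \<longlongrightarrow> - 0 / t - 0) at_top"
    using e t by (intro tendsto_intros) auto
  then have lim: "(F \<longlongrightarrow> 0) at_top" by (simp add: F_def[abs_def])
  have "(\<integral>\<^sup>+z. ennreal ((1 - cos z) * exp (- t * z)) * indicator {0..} z \<partial>lborel) = ennreal (0 - F 0)"
    by (rule nn_integral_FTC_atLeast[OF _ der _ lim]) auto
  also have "0 - F 0 = 1 / (t * (1 + t\<^sup>2))"
    using p t by (simp add: F_def divide_simps) (simp add: power2_eq_square algebra_simps)
  finally show ?thesis .
qed

text \<open>Gamma(1 + a) z^(-1-a) is the Laplace transform of t^a at z. Exchanging the integrals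
  leaves the Laplace transform of 1 - cos integrated against t^a, which is the preceding integral
  over t with parameter a / 2.\<close>

lemma nn_integral_one_minus_cos_powr:
  fixes a :: real
  assumes a: "0 < a" "a < 2"
  shows "(\<integral>\<^sup>+z. ennreal (indicator {0<..} z * ((1 - cos z) * z powr (- 1 - a))) \<partial>lborel)
     = ennreal (pi / (2 * Gamma (1 + a) * sin (pi * a / 2)))"
proof -
  let ?I = "\<integral>\<^sup>+z. ennreal (indicator {0<..} z * ((1 - cos z) * z powr (- 1 - a))) \<partial>lborel"
  have G: "0 < Gamma (1 + a)" using a by (intro Gamma_real_pos) auto
  have sn: "0 < sin (pi * a / 2)" using a by (intro sin_gt_zero) auto
  have "ennreal (Gamma (1 + a)) * ?I
     = (\<integral>\<^sup>+z. ennreal (Gamma (1 + a)) * ennreal (indicator {0<..} z * ((1 - cos z) * z powr (- 1 - a))) \<partial>lborel)"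
    by (rule nn_integral_cmult[symmetric]) simp
  also have "\<dots> = (\<integral>\<^sup>+z. (\<integral>\<^sup>+t. ennreal (indicator {0<..} z * (1 - cos z)) * ennreal (indicator {0..} t * (t powr a * exp (- t * z))) \<partial>lborel) \<partial>lborel)"
  proof (rule nn_integral_cong)
    fix z :: real
    show "ennreal (Gamma (1 + a)) * ennreal (indicator {0<..} z * ((1 - cos z) * z powr (- 1 - a)))
      = (\<integral>\<^sup>+t. ennreal (indicator {0<..} z * (1 - cos z)) * ennreal (indicator {0..} t * (t powr a * exp (- t * z))) \<partial>lborel)"
    proof (cases "0 < z")
      case True
      have "(\<integral>\<^sup>+t. ennreal (indicator {0..} t * (t powr a * exp (- t * z))) \<partial>lborel) = ennreal (Gamma (1 + a) * z powr (- (1 + a)))"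
        using nn_integral_powr_exp[of "1 + a" z] a True by simp
      then show ?thesis using True G a
        by (subst nn_integral_cmult) (auto simp: ennreal_mult'[symmetric] mult_ac)
    qed simp
  qed
  also have "\<dots> = (\<integral>\<^sup>+t. (\<integral>\<^sup>+z. ennreal (indicator {0<..} z * (1 - cos z)) * ennreal (indicator {0..} t * (t powr a * exp (- t * z))) \<partial>lborel) \<partial>lborel)"
    by (rule lborel_pair.Fubini') simp
  also have "\<dots> = (\<integral>\<^sup>+t. ennreal (indicator {0<..} t * (t powr (2 * (a / 2) - 1) / (1 + t\<^sup>2))) \<partial>lborel)"
  proof (rule nn_integral_cong)
    fix t :: real
    show "(\<integral>\<^sup>+z. ennreal (indicator {0<..} z * (1 - cos z)) * ennreal (indicator {0..} t * (t powr a * exp (- t * z))) \<partial>lborel)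
       = ennreal (indicator {0<..} t * (t powr (2 * (a / 2) - 1) / (1 + t\<^sup>2)))"
    proof (cases "0 < t")
      case True
      have "(\<integral>\<^sup>+z. ennreal (indicator {0<..} z * (1 - cos z)) * ennreal (indicator {0..} t * (t powr a * exp (- t * z))) \<partial>lborel)
        = (\<integral>\<^sup>+z. ennreal (t powr a) * (ennreal ((1 - cos z) * exp (- t * z)) * indicator {0..} z) \<partial>lborel)"
        using True by (intro nn_integral_cong) (auto simp: indicator_def ennreal_mult'[symmetric] mult_ac)
      also have "\<dots> = ennreal (t powr a) * ennreal (1 / (t * (1 + t\<^sup>2)))"
        by (subst nn_integral_cmult) (use nn_integral_one_minus_cos_exp[OF True] in auto)
      also have "\<dots> = ennreal (t powr (a - 1) / (1 + t\<^sup>2))"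
        using True by (simp add: ennreal_mult'[symmetric] powr_diff)
      finally show ?thesis using True by simp
    qed (cases "t = 0", use a in auto)
  qed
  also have "\<dots> = ennreal (pi / (2 * sin (pi * a / 2)))"
    using nn_integral_powr_over_one_plus_square[of "a / 2"] a by simp
  finally have "ennreal (1 / Gamma (1 + a)) * (ennreal (Gamma (1 + a)) * ?I) = ennreal (1 / Gamma (1 + a)) * ennreal (pi / (2 * sin (pi * a / 2)))"
    by simp
  moreover have "ennreal (1 / Gamma (1 + a)) * (ennreal (Gamma (1 + a)) * ?I) = ?I"
    using G by (simp add: mult.assoc[symmetric] ennreal_mult'[symmetric])
  ultimately show ?thesis using G sn by (simp add: ennreal_mult'[symmetric] field_simps)
qed

abbreviation gaussian :: "real measure" where "gaussian \<equiv> std_normal_distribution"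

text \<open>The constant is the one for which \<open>1 - cos (u z)\<close> integrates to \<open>\<bar>u\<bar> powr a\<close>.\<close>

definition levy_dens :: "real \<Rightarrow> real \<Rightarrow> real" where
  "levy_dens a z = Gamma (1 + a) * sin (pi * a / 2) / pi * \<bar>z\<bar> powr (- 1 - a)"

lemma levy_dens_measurable[measurable]: "levy_dens a \<in> borel_measurable borel"
  unfolding levy_dens_def[abs_def] by measurable

lemma levy_dens_nonneg: "0 < a \<Longrightarrow> a < 2 \<Longrightarrow> 0 \<le> levy_dens a z"
  unfolding levy_dens_def by (intro mult_nonneg_nonneg divide_nonneg_pos Gamma_real_nonneg sin_ge_zero) auto

lemma levy_dens_minus[simp]: "levy_dens a (- z) = levy_dens a z"
  by (simp add: levy_dens_def)

text \<open>For u = 1 each half-line contributes 1/2, by the choice of the constant; the general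
  case follows from the substitution z -> u z and the homogeneity of the density.\<close>

lemma nn_integral_levy_dens:
  fixes a u :: real
  assumes a: "0 < a" "a < 2"
  shows "(\<integral>\<^sup>+z. ennreal (levy_dens a z * (1 - cos (u * z))) \<partial>lborel) = ennreal (\<bar>u\<bar> powr a)"
proof (cases "u = 0")
  case False
  define C where "C = Gamma (1 + a) * sin (pi * a / 2) / pi"
  have G: "0 < Gamma (1 + a)" using a by (intro Gamma_real_pos) auto
  have sn: "0 < sin (pi * a / 2)" using a by (intro sin_gt_zero) auto
  have C: "0 < C" using G sn by (simp add: C_def)
  let ?h = "\<lambda>z. ennreal (indicator {0<..} z * ((1 - cos z) * z powr (- 1 - a)))"
  have h: "(\<integral>\<^sup>+z. ?h z \<partial>lborel) = ennreal (1 / (2 * C))"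
    using nn_integral_one_minus_cos_powr[OF a] by (simp add: C_def field_simps)
  have "(\<integral>\<^sup>+z. ?h z \<partial>lborel) = ennreal \<bar>-1\<bar> * (\<integral>\<^sup>+z. ?h (0 + (-1) * z) \<partial>lborel)"
    by (rule nn_integral_real_affine) auto
  then have h2: "(\<integral>\<^sup>+z. ?h (- z) \<partial>lborel) = ennreal (1 / (2 * C))" using h by simp
  let ?f = "\<lambda>z. ennreal (levy_dens a z * (1 - cos z))"
  have "(\<integral>\<^sup>+z. ?f z \<partial>lborel) = (\<integral>\<^sup>+z. ennreal C * (?h z + ?h (- z)) \<partial>lborel)"
  proof (rule nn_integral_cong)
    fix z :: real
    show "?f z = ennreal C * (?h z + ?h (- z))"
      using C by (cases z "0::real" rule: linorder_cases)
        (auto simp: levy_dens_def C_def[symmetric] ennreal_mult'[symmetric] mult_ac)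
  qed
  also have "\<dots> = ennreal C * (ennreal (1 / (2 * C)) + ennreal (1 / (2 * C)))"
    by (subst nn_integral_cmult, simp, subst nn_integral_add, simp, simp) (simp only: h h2)
  also have "\<dots> = 1" using C by (simp add: ennreal_plus[symmetric] ennreal_mult'[symmetric] del: ennreal_plus)
  finally have f: "(\<integral>\<^sup>+z. ?f z \<partial>lborel) = 1" .
  have "1 = ennreal \<bar>u\<bar> * (\<integral>\<^sup>+z. ?f (0 + u * z) \<partial>lborel)"
    unfolding f[symmetric] by (rule nn_integral_real_affine) (use False in auto)
  also have "(\<integral>\<^sup>+z. ?f (0 + u * z) \<partial>lborel) = (\<integral>\<^sup>+z. ennreal (\<bar>u\<bar> powr (- 1 - a)) * ennreal (levy_dens a z * (1 - cos (u * z))) \<partial>lborel)"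
    by (intro nn_integral_cong) (simp add: levy_dens_def ennreal_mult'[symmetric] abs_mult powr_mult mult_ac)
  also have "\<dots> = ennreal (\<bar>u\<bar> powr (- 1 - a)) * (\<integral>\<^sup>+z. ennreal (levy_dens a z * (1 - cos (u * z))) \<partial>lborel)"
    by (rule nn_integral_cmult) simp
  finally have "ennreal (\<bar>u\<bar> powr a) = ennreal (\<bar>u\<bar> powr a) * (ennreal \<bar>u\<bar> * (ennreal (\<bar>u\<bar> powr (- 1 - a)) * (\<integral>\<^sup>+z. ennreal (levy_dens a z * (1 - cos (u * z))) \<partial>lborel)))"
    by simp
  also have "\<dots> = ennreal (\<bar>u\<bar> powr a * (\<bar>u\<bar> * \<bar>u\<bar> powr (- 1 - a))) * (\<integral>\<^sup>+z. ennreal (levy_dens a z * (1 - cos (u * z))) \<partial>lborel)"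
    by (simp add: ennreal_mult' mult.assoc)
  also have "\<bar>u\<bar> powr a * (\<bar>u\<bar> * \<bar>u\<bar> powr (- 1 - a)) = 1"
    using False by (simp add: powr_mult_base powr_add[symmetric])
  finally show ?thesis by simp
qed simp

lemma has_bochner_integral_levy_dens:
  assumes "0 < a" "a < 2"
  shows "has_bochner_integral lborel (\<lambda>z. levy_dens a z * (1 - cos (u * z))) (\<bar>u\<bar> powr a)"
  by (rule has_bochner_integral_nn_integral) (use levy_dens_nonneg nn_integral_levy_dens assms in auto)

lemma integral_cos_gaussian:
  "(LINT r|gaussian. 1 - cos ((u + r) * z)) = 1 - cos (u * z) * exp (- z\<^sup>2 / 2)"
proof -
  interpret N: real_distribution gaussian by (rule real_dist_normal_dist)
  have i: "integrable gaussian (\<lambda>r. cos ((u + r) * z))" by (rule N.integrable_const_bound[where B=1]) auto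
  have "(CLINT r|gaussian. iexp ((u + r) * z)) = (CLINT r|gaussian. iexp (u * z) * iexp (z * r))"
    by (intro Bochner_Integration.integral_cong refl) (simp add: exp_add[symmetric] algebra_simps)
  also have "\<dots> = iexp (u * z) * char gaussian z" by (simp add: char_def N.integrable_iexp)
  finally have "Re (CLINT r|gaussian. iexp ((u + r) * z)) = cos (u * z) * exp (- z\<^sup>2 / 2)"
    by (simp add: char_std_normal_distribution Re_exp)
  moreover have "Re (CLINT r|gaussian. iexp ((u + r) * z)) = (LINT r|gaussian. Re (iexp ((u + r) * z)))"
    by (subst integral_Re) (auto intro!: N.integrable_const_bound[where B=1])
  ultimately show ?thesis using i N.prob_space by (simp add: Re_exp)
qed

lemma integrable_shifted_powr_gaussian:
  fixes a :: real
  assumes "0 < a" "a \<le> 2"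
  shows "integrable gaussian (\<lambda>r. \<bar>u + r\<bar> powr a)"
proof (rule Bochner_Integration.integrable_bound)
  interpret N: real_distribution gaussian by (rule real_dist_normal_dist)
  show "integrable gaussian (\<lambda>r. 1 + (u\<^sup>2 + 2 * u * r ^ 1 + r\<^sup>2))"
    by (intro Bochner_Integration.integrable_add integrable_mult_right integrable_std_normal_distribution_moment) auto
  show "AE r in gaussian. norm (\<bar>u + r\<bar> powr a) \<le> norm (1 + (u\<^sup>2 + 2 * u * r ^ 1 + r\<^sup>2))"
  proof (intro AE_I2)
    fix r
    have "u\<^sup>2 + 2 * u * r ^ 1 + r\<^sup>2 = (u + r)\<^sup>2" by (simp add: power2_sum)
    then show "norm (\<bar>u + r\<bar> powr a) \<le> norm (1 + (u\<^sup>2 + 2 * u * r ^ 1 + r\<^sup>2))"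
      using powr_le_one_plus_square[OF assms, of "u + r"] by (simp add: abs_of_nonneg)
  qed
qed simp

text \<open>The preceding identity averaged over a Gaussian shift of u, which by
  \<open>integral_cos_gaussian\<close> damps the cosine by exp(-z^2/2).\<close>

lemma has_bochner_integral_levy_dens_gaussian:
  assumes a: "0 < a" "a < 2"
  shows "has_bochner_integral lborel (\<lambda>z. levy_dens a z * (1 - cos (u * z) * exp (- z\<^sup>2 / 2)))
    (LINT r|gaussian. \<bar>u + r\<bar> powr a)"
proof (rule has_bochner_integral_nn_integral)
  interpret N: real_distribution gaussian by (rule real_dist_normal_dist)
  interpret P: pair_sigma_finite lborel gaussian ..
  have le: "cos (u * z) * exp (- z\<^sup>2 / 2) \<le> 1" for z
    using mult_mono[of "cos (u * z)" 1 "exp (- z\<^sup>2 / 2)" 1] by simp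
  show "AE z in lborel. 0 \<le> levy_dens a z * (1 - cos (u * z) * exp (- z\<^sup>2 / 2))"
    using levy_dens_nonneg[OF a] le by (intro AE_I2 mult_nonneg_nonneg) auto
  have "(\<integral>\<^sup>+z. ennreal (levy_dens a z * (1 - cos (u * z) * exp (- z\<^sup>2 / 2))) \<partial>lborel)
     = (\<integral>\<^sup>+z. (\<integral>\<^sup>+r. ennreal (levy_dens a z * (1 - cos ((u + r) * z))) \<partial>gaussian) \<partial>lborel)"
  proof (rule nn_integral_cong)
    fix z
    have i: "integrable gaussian (\<lambda>r. 1 - cos ((u + r) * z))"
      by (rule N.integrable_const_bound[where B=2]) (auto simp: abs_le_iff intro: order_trans[OF cos_le_one])
    show "ennreal (levy_dens a z * (1 - cos (u * z) * exp (- z\<^sup>2 / 2))) = (\<integral>\<^sup>+r. ennreal (levy_dens a z * (1 - cos ((u + r) * z))) \<partial>gaussian)"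
      using i levy_dens_nonneg[OF a, of z]
      by (subst nn_integral_eq_integral) (auto simp: integral_cos_gaussian)
  qed
  also have "\<dots> = (\<integral>\<^sup>+r. (\<integral>\<^sup>+z. ennreal (levy_dens a z * (1 - cos ((u + r) * z))) \<partial>lborel) \<partial>gaussian)"
    by (rule P.Fubini'[symmetric]) simp
  also have "\<dots> = ennreal (LINT r|gaussian. \<bar>u + r\<bar> powr a)"
    unfolding nn_integral_levy_dens[OF a] using a
    by (intro nn_integral_eq_integral integrable_shifted_powr_gaussian) auto
  finally show "(\<integral>\<^sup>+z. ennreal (levy_dens a z * (1 - cos (u * z) * exp (- z\<^sup>2 / 2))) \<partial>lborel) = ennreal (LINT r|gaussian. \<bar>u + r\<bar> powr a)" .
qed (auto intro: integral_nonneg_AE)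

lemma integral_gaussian_pos:
  fixes f :: "real \<Rightarrow> real"
  assumes f: "integrable gaussian f" "\<And>r. 0 \<le> f r" "\<And>r. r \<noteq> 0 \<Longrightarrow> 0 < f r"
  shows "0 < (LINT r|gaussian. f r)"
proof -
  have "(LINT r|gaussian. f r) \<noteq> 0"
  proof
    assume "(LINT r|gaussian. f r) = 0"
    then have "AE r in gaussian. f r = 0" using f by (subst (asm) integral_nonneg_eq_0_iff_AE) auto
    then have "AE r in lborel. f r = 0"
      using normal_density_pos by (subst (asm) AE_density) auto
    moreover have "AE r in lborel. r \<noteq> (0::real)" by (rule AE_lborel_singleton)
    ultimately have "AE r::real in lborel. False"
      by eventually_elim (use f(3) in fastforce)
    then show False
      by (auto simp: eventually_ae_filter top.extremum_unique dest!: null_setsD1)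
  qed
  moreover have "0 \<le> (LINT r|gaussian. f r)" by (rule integral_nonneg_AE) (use f in auto)
  ultimately show ?thesis by linarith
qed

lemma real_distribution_density:
  fixes f :: "real \<Rightarrow> real"
  assumes M: "sets M = sets borel" and f: "has_bochner_integral M f Z" "\<And>z. 0 \<le> f z" "f \<in> borel_measurable borel" and Z: "0 < Z"
  shows "real_distribution (density M (\<lambda>z. f z / Z))"
proof (intro real_distribution.intro real_distribution_axioms.intro)
  have [measurable]: "f \<in> borel_measurable M" using f(3) measurable_cong_sets[OF M refl] by blast
  have "(\<integral>\<^sup>+z. ennreal (f z / Z) \<partial>M) = ennreal (Z / Z)"
  proof (subst nn_integral_eq_integral)
    show "integrable M (\<lambda>z. f z / Z)" using f(1) by (auto simp: has_bochner_integral_iff)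
    show "ennreal (LINT z|M. f z / Z) = ennreal (Z / Z)" using f(1) by (simp add: has_bochner_integral_iff)
  qed (use f Z in auto)
  then show "prob_space (density M (\<lambda>z. f z / Z))"
    using Z by (intro prob_spaceI) (simp add: emeasure_density)
qed (use M sets_eq_imp_space_eq[OF M] in auto)

text \<open>The tilt removes the mass near \<open>0\<close>, so that the tilted laws of \<open>X\<^sub>1 / x\<close> converge weakly as \<open>x \<rightarrow> \<infinity>\<close>, to \<open>jump_law\<close>.\<close>

definition gauss_tilt :: "real measure \<Rightarrow> real \<Rightarrow> real measure" where
  "gauss_tilt \<mu> Z = density \<mu> (\<lambda>z. (1 - exp (- z\<^sup>2 / 2)) / Z)"

text \<open>The tilt subtracts the law weighted by exp(-z^2/2), whose transform is the Gaussian
  average of \<open>f\<close>. Thus the limit of tilted laws can be read off from \<open>f\<close>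
  alone; the case u = 0 of the weighted transform yields the normalising constant.\<close>

lemma char_gauss_tilt:
  assumes \<mu>: "real_distribution \<mu>" and ch: "\<And>r. char \<mu> r = complex_of_real (f r)" and Z: "0 < (LINT r|gaussian. 1 - f r)"
  defines "Z \<equiv> (LINT r|gaussian. 1 - f r)"
  shows "real_distribution (gauss_tilt \<mu> Z)"
    and "char (gauss_tilt \<mu> Z) u = complex_of_real ((f u - (LINT r|gaussian. f (u + r))) / Z)"
proof -
  interpret \<mu>: real_distribution \<mu> by fact
  have [measurable_cong]: "sets \<mu> = sets borel" by simp
  have i: "integrable \<mu> (\<lambda>z. 1 - exp (- z\<^sup>2 / 2))"
    by (rule \<mu>.integrable_const_bound[where B=1]) auto
  have "has_bochner_integral \<mu> (\<lambda>z. 1 - exp (- z\<^sup>2 / 2)) Z"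
    using i integral_one_minus_gauss[OF \<mu> ch] by (simp add: has_bochner_integral_iff Z_def)
  then show "real_distribution (gauss_tilt \<mu> Z)"
    unfolding gauss_tilt_def using Z by (intro real_distribution_density) (auto simp: Z_def)
  have "char (gauss_tilt \<mu> Z) u = (CLINT z|\<mu>. ((1 - exp (- z\<^sup>2 / 2)) / Z) *\<^sub>R iexp (u * z))"
    unfolding char_def gauss_tilt_def using Z by (subst integral_density) (auto simp: Z_def)
  also have "\<dots> = (CLINT z|\<mu>. (iexp (u * z) - iexp (u * z) * exp (- z\<^sup>2 / 2)) / Z)"
    by (intro Bochner_Integration.integral_cong refl) (simp add: scaleR_conv_of_real algebra_simps)
  also have "\<dots> = ((CLINT z|\<mu>. iexp (u * z)) - (CLINT z|\<mu>. iexp (u * z) * exp (- z\<^sup>2 / 2))) / Z"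
  proof -
    have "integrable \<mu> (\<lambda>z. iexp (u * z) * exp (- z\<^sup>2 / 2))"
      by (rule \<mu>.integrable_const_bound[where B=1]) (auto simp: norm_mult)
    then show ?thesis by (simp add: \<mu>.integrable_iexp)
  qed
  also have "(CLINT z|\<mu>. iexp (u * z) * exp (- z\<^sup>2 / 2)) = (LINT r|gaussian. f (u + r))"
    unfolding integral_iexp_gauss[OF \<mu>] ch by simp
  also have "(CLINT z|\<mu>. iexp (u * z)) = f u" using ch by (simp add: char_def)
  finally show "char (gauss_tilt \<mu> Z) u = complex_of_real ((f u - (LINT r|gaussian. f (u + r))) / Z)" by simp
qed

section \<open>The limiting jump law\<close>

lemma integral_odd:
  fixes f :: "real \<Rightarrow> real"
  assumes "\<And>x. f (- x) = - f x"
  shows "(LINT x|lborel. f x) = 0"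
  using lborel_integral_real_affine[of "-1" f 0] assms by simp

text \<open>The Levy density under the same tilt. The normalising constant is the Gaussian moment of
  order a, by \<open>has_bochner_integral_levy_dens_tilt\<close> at u = 0.\<close>

definition jump_law :: "real \<Rightarrow> real measure" where
  "jump_law a = density lborel (\<lambda>z. levy_dens a z * (1 - exp (- z\<^sup>2 / 2)) / (LINT r|gaussian. \<bar>r\<bar> powr a))"

context
  fixes a :: real
  assumes a: "0 < a" "a < 2"
begin

lemma powr_gaussian_pos: "0 < (LINT r|gaussian. \<bar>r\<bar> powr a)"
  using a by (intro integral_gaussian_pos integrable_powr_normal) auto

text \<open>Subtracting the undamped identity from the damped one leaves the cosine with the factor
  1 - exp(-z^2/2).\<close>

lemma has_bochner_integral_levy_dens_tilt:
  "has_bochner_integral lborel (\<lambda>z. levy_dens a z * (1 - exp (- z\<^sup>2 / 2)) * cos (u * z))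
    ((LINT r|gaussian. \<bar>u + r\<bar> powr a) - \<bar>u\<bar> powr a)"
  using has_bochner_integral_diff[OF has_bochner_integral_levy_dens_gaussian[OF a, of u] has_bochner_integral_levy_dens[OF a, of u]]
  by (simp add: algebra_simps)

lemma real_distribution_jump_law: "real_distribution (jump_law a)"
  unfolding jump_law_def
  using has_bochner_integral_levy_dens_tilt[of 0] powr_gaussian_pos levy_dens_nonneg[OF a] a
  by (intro real_distribution_density) auto

lemma char_jump_law:
  "char (jump_law a) u = complex_of_real (((LINT r|gaussian. \<bar>u + r\<bar> powr a) - \<bar>u\<bar> powr a) / (LINT r|gaussian. \<bar>r\<bar> powr a))"
proof -
  define Z where "Z = (LINT r|gaussian. \<bar>r\<bar> powr a)"
  define \<rho> where "\<rho> z = levy_dens a z * (1 - exp (- z\<^sup>2 / 2))" for z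
  have [measurable]: "\<rho> \<in> borel_measurable borel" unfolding \<rho>_def[abs_def] by measurable
  have \<rho>0: "0 \<le> \<rho> z" for z using levy_dens_nonneg[OF a, of z] by (simp add: \<rho>_def)
  have Z: "0 < Z" unfolding Z_def by (rule powr_gaussian_pos)
  have i\<rho>: "integrable lborel \<rho>"
    using has_bochner_integral_levy_dens_tilt[of 0] by (simp add: has_bochner_integral_iff \<rho>_def[abs_def])
  have ic: "integrable lborel (\<lambda>z. \<rho> z * cos (u * z))" "integrable lborel (\<lambda>z. \<rho> z * sin (u * z))"
    using \<rho>0 by (auto intro!: Bochner_Integration.integrable_bound[OF i\<rho>] simp: abs_mult mult_left_le)
  have c: "(LINT z|lborel. \<rho> z * cos (u * z)) = (LINT r|gaussian. \<bar>u + r\<bar> powr a) - \<bar>u\<bar> powr a"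
    using has_bochner_integral_levy_dens_tilt[of u] by (simp add: has_bochner_integral_iff \<rho>_def)
  have s: "(LINT z|lborel. \<rho> z * sin (u * z)) = 0" by (rule integral_odd) (simp add: \<rho>_def)
  have "char (jump_law a) u = (CLINT z|lborel. (\<rho> z / Z) *\<^sub>R iexp (u * z))"
    unfolding char_def jump_law_def Z_def[symmetric] \<rho>_def[symmetric] using Z \<rho>0
    by (subst integral_density) auto
  also have "\<dots> = (CLINT z|lborel. (complex_of_real (\<rho> z * cos (u * z)) + \<i> * complex_of_real (\<rho> z * sin (u * z))) / complex_of_real Z)"
    by (intro Bochner_Integration.integral_cong refl) (simp add: complex_eq_iff Re_exp Im_exp)
  also have "\<dots> = (complex_of_real (LINT z|lborel. \<rho> z * cos (u * z)) + \<i> * complex_of_real (LINT z|lborel. \<rho> z * sin (u * z))) / complex_of_real Z"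
    using ic by (simp del: of_real_mult)
  finally show ?thesis by (simp add: c s Z_def)
qed

text \<open>The quotient undoes the tilt beyond 1, so what remains is the Levy mass of the half-line
  from 1 on, up to normalisation; Gamma(1 + a) / a = Gamma(a) simplifies it.\<close>

lemma integral_jump_law_ge_1:
  "(LINT z|jump_law a. (if 1 \<le> z then 1 / (1 - exp (- z\<^sup>2 / 2)) else 0)) = Gamma a * sin (pi * a / 2) / pi / (LINT r|gaussian. \<bar>r\<bar> powr a)"
proof -
  define Z where "Z = (LINT r|gaussian. \<bar>r\<bar> powr a)"
  have Z: "0 < Z" unfolding Z_def by (rule powr_gaussian_pos)
  define C where "C = Gamma (1 + a) * sin (pi * a / 2) / pi"
  have C: "C / a = Gamma a * sin (pi * a / 2) / pi"
  proof -
    have "a \<notin> \<int>\<^sub>\<le>\<^sub>0" using a(1) by (auto elim!: nonpos_Ints_cases)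
    then show ?thesis using a Gamma_plus1[of a] by (simp add: C_def add.commute)
  qed
  have "((\<lambda>z. z powr (- 1 - a)) has_integral 1 / a) {1..}"
    using has_integral_powr_to_inf[of "- 1 - a" 1] a by (simp add: algebra_simps)
  from has_integral_mult_right[OF this, of "C / Z"]
  have "((\<lambda>z. C / Z * z powr (- 1 - a)) has_integral C / Z * (1 / a)) {1..}" .
  moreover have "set_integrable lborel {1..} (\<lambda>z. C / Z * z powr (- 1 - a))"
    using integrable_powr_to_inf[of "1 + a"] a by (intro set_integrable_mult_right) (simp add: algebra_simps)
  ultimately have "(LINT z:{1..}|lborel. C / Z * z powr (- 1 - a)) = C / Z * (1 / a)"
    using set_borel_integral_eq_integral(2) integral_unique by metis
  moreover have "(LINT z|jump_law a. (if 1 \<le> z then 1 / (1 - exp (- z\<^sup>2 / 2)) else 0))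
    = (LINT z|lborel. (levy_dens a z * (1 - exp (- z\<^sup>2 / 2)) / Z) *\<^sub>R (if 1 \<le> z then 1 / (1 - exp (- z\<^sup>2 / 2)) else 0))"
    unfolding jump_law_def Z_def[symmetric] using Z levy_dens_nonneg[OF a] by (subst integral_density) auto
  moreover have "\<dots> = (LINT z:{1..}|lborel. C / Z * z powr (- 1 - a))"
    unfolding set_lebesgue_integral_def
    by (intro Bochner_Integration.integral_cong refl) (auto simp: indicator_def levy_dens_def C_def)
  ultimately show ?thesis unfolding C[symmetric] Z_def[symmetric] by simp
qed

end

context stable_process
begin

text \<open>The tilted law of X_1 / x_n, with normalising constant Z_n, converges weakly to
  \<open>jump_law\<close>, and x_n^\<alpha> Z_n converges to the Gaussian moment. Integrating the
  inverse of the tilt over the half-line from 1 on returns the tail probability divided by Z_n, and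
  in the product of the two limits the Gaussian moment cancels.\<close>

lemma tail_prob_seq_tail:
  assumes \<alpha>2: "\<alpha> < 2" and x: "filterlim x at_top sequentially" "\<And>n. 0 < x n"
  shows "(\<lambda>n. x n powr \<alpha> * tail_prob 1 (x n)) \<longlonglongrightarrow> Gamma \<alpha> * sin (pi * \<alpha> / 2) / pi"
proof -
  interpret N: real_distribution gaussian by (rule real_dist_normal_dist)
  have a: "0 < \<alpha>" "\<alpha> < 2" using \<alpha>_pos \<alpha>2 by auto
  define \<mu> where "\<mu> n = distr M borel (\<lambda>\<omega>. (1 / x n) * X 1 \<omega>)" for n
  define f where "f n r = exp (- (\<bar>r * (1 / x n)\<bar> powr \<alpha>))" for n r
  define Z where "Z n = (LINT r|gaussian. 1 - f n r)" for n
  define \<nu> where "\<nu> n = gauss_tilt (\<mu> n) (Z n)" for n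
  have [measurable]: "f n \<in> borel_measurable borel" for n unfolding f_def[abs_def] by measurable
  have f01: "0 \<le> f n r" "f n r \<le> 1" for n r by (auto simp: f_def)
  have \<mu>: "real_distribution (\<mu> n)" for n unfolding \<mu>_def by (rule real_distribution_X) simp
  have ch: "char (\<mu> n) r = complex_of_real (f n r)" for n r
    unfolding \<mu>_def f_def by (rule char_scaled_X1)
  have i: "integrable gaussian (\<lambda>r. f n (u + r))" for n u
    using f01 by (intro N.integrable_const_bound[where B=1]) auto
  have Zpos: "0 < Z n" for n
    unfolding Z_def using i[of n 0] f01 x(2)[of n] \<alpha>_pos
    by (intro integral_gaussian_pos) (auto simp: f_def)
  note \<nu> = char_gauss_tilt[OF \<mu> ch Zpos[unfolded Z_def], folded Z_def, folded \<nu>_def]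
  have k_le: "x n powr \<alpha> * (1 - f n r) \<le> \<bar>r\<bar> powr \<alpha>" for n r
  proof -
    have "1 - f n r \<le> \<bar>r * (1 / x n)\<bar> powr \<alpha>"
      using exp_ge_add_one_self[of "- (\<bar>r * (1 / x n)\<bar> powr \<alpha>)"] unfolding f_def by linarith
    then have "x n powr \<alpha> * (1 - f n r) \<le> x n powr \<alpha> * \<bar>r * (1 / x n)\<bar> powr \<alpha>"
      by (intro mult_left_mono) auto
    also have "\<dots> = \<bar>r\<bar> powr \<alpha>" using x(2)[of n] by (simp add: abs_mult powr_divide)
    finally show ?thesis .
  qed
  have k_lim: "(\<lambda>n. x n powr \<alpha> * (1 - f n r)) \<longlonglongrightarrow> \<bar>r\<bar> powr \<alpha>" for r
  proof -
    have "((\<lambda>y. y * (1 - exp (- (\<bar>r\<bar> powr \<alpha> / y)))) \<longlongrightarrow> \<bar>r\<bar> powr \<alpha>) at_top"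
      by real_asymp
    moreover have "filterlim (\<lambda>n. x n powr \<alpha>) at_top sequentially"
      by (rule filterlim_compose[OF real_powr_at_top[OF \<alpha>_pos] x(1)])
    ultimately have "(\<lambda>n. x n powr \<alpha> * (1 - exp (- (\<bar>r\<bar> powr \<alpha> / x n powr \<alpha>)))) \<longlonglongrightarrow> \<bar>r\<bar> powr \<alpha>"
      by (rule filterlim_compose)
    moreover have "exp (- (\<bar>r\<bar> powr \<alpha> / x n powr \<alpha>)) = f n r" for n
      using x(2)[of n] by (simp add: f_def abs_mult powr_divide)
    ultimately show ?thesis by simp
  qed
  have int_lim: "(\<lambda>n. x n powr \<alpha> * (1 - (LINT r|gaussian. f n (u + r)))) \<longlonglongrightarrow> (LINT r|gaussian. \<bar>u + r\<bar> powr \<alpha>)" for u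
  proof -
    have "(\<lambda>n. LINT r|gaussian. x n powr \<alpha> * (1 - f n (u + r))) \<longlonglongrightarrow> (LINT r|gaussian. \<bar>u + r\<bar> powr \<alpha>)"
    proof (rule integral_dominated_convergence[where w="\<lambda>r. \<bar>u + r\<bar> powr \<alpha>"])
      show "integrable gaussian (\<lambda>r. \<bar>u + r\<bar> powr \<alpha>)" using a by (intro integrable_shifted_powr_gaussian) auto
    qed (use k_lim k_le f01 in \<open>auto simp: abs_mult\<close>)
    then show ?thesis using i[of _ u] N.prob_space by simp
  qed
  have Zlim: "(\<lambda>n. x n powr \<alpha> * Z n) \<longlonglongrightarrow> (LINT r|gaussian. \<bar>r\<bar> powr \<alpha>)"
    using int_lim[of 0] i[of _ 0] N.prob_space by (simp add: Z_def)
  have "weak_conv_m \<nu> (jump_law \<alpha>)"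
  \<comment> \<open>Numerator and denominator of the tilted characteristic function are both
    multiplied by x_n^\<alpha>, so that each of them has a limit of its own.\<close>
  proof (rule levy_continuity)
    fix u
    have "(\<lambda>n. (x n powr \<alpha> * (1 - (LINT r|gaussian. f n (u + r))) - x n powr \<alpha> * (1 - f n u)) / (x n powr \<alpha> * Z n))
      \<longlonglongrightarrow> ((LINT r|gaussian. \<bar>u + r\<bar> powr \<alpha>) - \<bar>u\<bar> powr \<alpha>) / (LINT r|gaussian. \<bar>r\<bar> powr \<alpha>)"
      by (intro tendsto_intros int_lim k_lim Zlim) (use powr_gaussian_pos[OF a] in simp)
    moreover have "(x n powr \<alpha> * (1 - (LINT r|gaussian. f n (u + r))) - x n powr \<alpha> * (1 - f n u)) / (x n powr \<alpha> * Z n)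
      = (f n u - (LINT r|gaussian. f n (u + r))) / Z n" for n
    proof -
      have "x n powr \<alpha> * (1 - (LINT r|gaussian. f n (u + r))) - x n powr \<alpha> * (1 - f n u)
         = x n powr \<alpha> * (f n u - (LINT r|gaussian. f n (u + r)))" by (simp add: algebra_simps)
      then show ?thesis using x(2)[of n] by simp
    qed
    ultimately show "(\<lambda>n. char (\<nu> n) u) \<longlonglongrightarrow> char (jump_law \<alpha>) u"
      unfolding \<nu>(2) char_jump_law[OF a] by (intro tendsto_of_real) simp
  qed (fact \<nu>(1) real_distribution_jump_law[OF a])+
  \<comment> \<open>Bounded, because the tilt is at least 1 - exp(-1/2) beyond 1, and discontinuous
    at most at 1, which is a null set of the limit law; hence weak convergence passes to its
    integral.\<close>
  define h :: "real \<Rightarrow> real" where "h z = (if 1 \<le> z then 1 / (1 - exp (- z\<^sup>2 / 2)) else 0)" for z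
  have [measurable]: "h \<in> borel_measurable borel" unfolding h_def[abs_def] by measurable
  have h_bd: "norm (h z) \<le> 1 / (1 - exp (- 1 / 2))" for z
  proof (cases "1 \<le> z")
    case True
    then have "exp (- z\<^sup>2 / 2) \<le> exp (- 1 / 2)" by (simp add: one_le_power)
    then show ?thesis using True by (auto simp: h_def intro!: divide_left_mono)
  qed (auto simp: h_def)
  have cont: "isCont h z" if "z \<noteq> 1" for z
  proof (cases "1 < z")
    case True
    have "isCont (\<lambda>z. 1 / (1 - exp (- z\<^sup>2 / 2))) z" using True by (intro continuous_intros) auto
    moreover have "eventually (\<lambda>y. h y = 1 / (1 - exp (- y\<^sup>2 / 2))) (nhds z)"
      using eventually_nhds_in_open[of "{1<..}" z] True by (auto simp: h_def elim: eventually_mono)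
    ultimately show ?thesis using isCont_cong[of h "\<lambda>z. 1 / (1 - exp (- z\<^sup>2 / 2))" z] by simp
  next
    case False
    then have "eventually (\<lambda>y. h y = 0) (nhds z)"
      using eventually_nhds_in_open[of "{..<1}" z] that by (auto simp: h_def elim: eventually_mono)
    then show ?thesis using isCont_cong[of h "\<lambda>_. 0" z] by simp
  qed
  have "emeasure (jump_law \<alpha>) {z. \<not> isCont h z} = 0"
  proof -
    have "{z. \<not> isCont h z} \<subseteq> {1}" using cont by auto
    moreover have "AE z in lborel. z \<noteq> (1::real)" by (rule AE_lborel_singleton)
    then have "AE z in jump_law \<alpha>. z \<noteq> 1"
      unfolding jump_law_def by (subst AE_density) (auto elim: eventually_mono)
    then have "emeasure (jump_law \<alpha>) {1} = 0"
      by (subst (asm) AE_iff_measurable[of "{1}"]) (auto simp: jump_law_def)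
    ultimately show ?thesis using emeasure_mono[of "{z. \<not> isCont h z}" "{1}" "jump_law \<alpha>"]
      by (simp add: jump_law_def)
  qed
  from weak_conv_imp_bdd_ae_continuous_conv[OF \<nu>(1) real_distribution_jump_law[OF a] \<open>weak_conv_m \<nu> (jump_law \<alpha>)\<close> this h_bd]
  have hl: "(\<lambda>n. LINT z|\<nu> n. h z) \<longlonglongrightarrow> (LINT z|jump_law \<alpha>. h z)" by simp
  have "(LINT z|\<nu> n. h z) = tail_prob 1 (x n) / Z n" for n
  proof -
    have "(LINT z|\<nu> n. h z) = (LINT z|\<mu> n. ((1 - exp (- z\<^sup>2 / 2)) / Z n) *\<^sub>R h z)"
      unfolding \<nu>_def gauss_tilt_def using Zpos[of n]
      by (subst integral_density) (auto simp: \<mu>_def)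
    also have "\<dots> = (LINT z|\<mu> n. hv 1 z / Z n)"
      by (intro Bochner_Integration.integral_cong refl) (auto simp: h_def hv_def)
    also have "\<dots> = (\<integral>\<omega>. hv 1 ((1 / x n) * X 1 \<omega>) / Z n \<partial>M)"
      unfolding \<mu>_def by (subst integral_distr) (auto simp: hv_def)
    also have "\<dots> = (\<integral>\<omega>. hv (x n) (X 1 \<omega>) / Z n \<partial>M)"
      using x(2)[of n] by (intro Bochner_Integration.integral_cong refl) (auto simp: hv_def field_simps)
    finally show ?thesis by (simp add: tail_prob_def)
  qed
  with tendsto_mult[OF Zlim hl]
  have "(\<lambda>n. x n powr \<alpha> * Z n * (tail_prob 1 (x n) / Z n)) \<longlonglongrightarrow> (LINT r|gaussian. \<bar>r\<bar> powr \<alpha>) * (LINT z|jump_law \<alpha>. h z)"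
    by simp
  moreover have "x n powr \<alpha> * Z n * (tail_prob 1 (x n) / Z n) = x n powr \<alpha> * tail_prob 1 (x n)" for n
    using Zpos[of n] by simp
  moreover have "(LINT r|gaussian. \<bar>r\<bar> powr \<alpha>) * (LINT z|jump_law \<alpha>. h z) = Gamma \<alpha> * sin (pi * \<alpha> / 2) / pi"
    unfolding h_def integral_jump_law_ge_1[OF a] using powr_gaussian_pos[OF a] by simp
  ultimately show ?thesis by simp
qed

theorem tail_prob_tail:
  assumes "\<alpha> < 2"
  shows "((\<lambda>x. x powr \<alpha> * tail_prob 1 x) \<longlongrightarrow> Gamma \<alpha> * sin (pi * \<alpha> / 2) / pi) at_top"
  by (rule tendsto_at_top_pos_sequences) (rule tail_prob_seq_tail[OF assms])

end

theorem theorem5: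
  fixes M :: "'a measure" and X :: "real \<Rightarrow> 'a \<Rightarrow> real" and \<alpha> T :: real
  assumes "prob_space M"
    and "sym_stable_levy M \<alpha> X"
    and "0 < \<alpha>" and "\<alpha> \<le> 2"
    and "0 < T"
  shows
    "(1 < \<alpha> \<longrightarrow> (\<forall>y L. is_local_time M X T L \<longrightarrow>
        (\<lambda>n. (T / real n) powr (-1 - 1 / \<alpha>) * approx_err M X T y n)
          \<longlonglongrightarrow> 2 * integral\<^sup>L M (L y) *
              set_lebesgue_integral lborel {0..}
                (\<lambda>x. integral\<^sup>L M (cond_var M (gen_sigma M {X 1}) (occ X 1 x))))) \<and>
     (\<alpha> < 1 \<longrightarrow>
        (\<lambda>n. (T / real n) powr (-2) * inverse (ln (real n)) * approx_err M X T 0 n)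
          \<longlonglongrightarrow> Gamma \<alpha> * sin (pi * \<alpha> / 2) / (12 * pi) *
              integral\<^sup>L M (\<lambda>\<omega>. \<bar>X 1 \<omega>\<bar> powr (- \<alpha>))) \<and>
     (\<alpha> = 1 \<longrightarrow>
        (\<lambda>n. (T / real n) powr (-2) * inverse ((ln (real n))\<^sup>2) * approx_err M X T 0 n)
          \<longlonglongrightarrow> 1 / (12 * pi\<^sup>2))"
proof -
  interpret prob_space M by fact
  interpret stable_process M \<alpha> X
    by unfold_locales (fact assms)+
  \<comment> \<open>The tail constant of \<open>tail_prob_tail\<close> divided by the 12 of
    \<open>V_tail\<close>.\<close>
  have const: "Gamma \<alpha> * sin (pi * \<alpha> / 2) / pi / 12 = Gamma \<alpha> * sin (pi * \<alpha> / 2) / (12 * pi)" by simp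
  show ?thesis
    using approx_err_limit_local_time[OF _ \<open>\<alpha> \<le> 2\<close> \<open>0 < T\<close>] approx_err_limit_1[OF _ \<open>0 < T\<close>]
      approx_err_limit_lt1[OF _ \<open>0 < T\<close> tail_prob_tail, unfolded const]
    by auto
qed

end
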